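(* Let $S=\{s_1,\dots,s_n\}$ be a set of $n$ copies of the SBW-square, let $\varphi\colon V_+(S)\to V_-(S)$ be a bijection, where $V_\pm(S)$ are the sets of positive and negative vertices of the SBW-squares in $S$, and let $\Phi=\Phi_B\sqcup\Phi_W$ be the bijection from $E(S)=E_B(S)\sqcup E_W(S)$ to itself determined by $\varphi$. Then the SBW cubed-complex $\mathcal{C}^3(S,\varphi)$ determined by $\varphi$ is isomorphic to the Aitchison complex $\mathcal{A}(\Gamma)$ of a connected alternating diagram $\Gamma\subset S^2$ if and only if the bijection $\Phi$ satisfies $$|E(S)/\langle\Phi\rangle| = |S|+2,$$ where $E(S)/\langle\Phi\rangle$ denotes the quotient space of the cyclic group action on $E(S)$ induced by $\Phi$, and $|\cdot|$ denotes the cardinality of a set.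
   Context: **SBW-squares.** A signed BW square (SBW-square) is the square $[0,1]^2$ with the following data: the vertices $(0,0)$ and $(1,1)$ have sign $-$, the vertices $(0,1)$ and $(1,0)$ have sign $+$; the horizontal edges $[0,1]\times\{0\}$, $[0,1]\times\{1\}$ are coloured $B$ (black) and the vertical edges $\{0\}\times[0,1]$, $\{1\}\times[0,1]$ are coloured $W$ (white). Every edge is oriented from its negative vertex (initial point) to its positive vertex (terminal point). Each vertex lies on exactly one black and exactly one white edge of its square. **The bijection $\Phi$.** For a set $S=\{s_1,\dots,s_n\}$ of $n$ (disjoint) copies of the SBW-square, $V_+(S)$ and $V_-(S)$ denote the sets of all positive and all negative vertices of the squares, $E_B(S)$ and $E_W(S)$ the sets of all black and all white edges of the squares, and $E(S)=E_B(S)\sqcup E_W(S)$. A bijection $\varphi\colon V_+(S)\to V_-(S)$ induces a bijection $\Phi_B\colon E_B(S)\to E_B(S)$: for a black edge $e$ with terminal vertex $v$, $\Phi_B(e)$ is the unique black edge whose initial vertex is $\varphi(v)$. Similarly $\Phi_W\colon E_W(S)\to E_W(S)$ sends a white edge with terminal vertex $v$ to the unique white edge with initial vertex $\varphi(v)$. Put $\Phi=\Phi_B\sqcup\Phi_W$. For $e\in E(S)$ let $f_e\colon e\to\Phi(e)$ be the unique orientation-preserving linear homeomorphism. **The SBW cubed-complex.** $\mathcal{C}^3(S,\varphi)$ is the three-dimensional cubed complex obtained from the upper cubes $s_i\times[0,1]$ and lower cubes $s_i\times[-1,0]$ ($1\le i\le n$), where $s_i\times[0,1]$ and $s_i\times[-1,0]$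 meet along $s_i\times\{0\}$, by gluing, for each $e\in E(S)$, the lower side-face $e\times[-1,0]$ to the upper side-face $\Phi(e)\times[0,1]$ by $\hat f_e(x,t)=(f_e(x),-t)$. **The Aitchison complex.** Let $\Gamma\subset S^2$ be a connected alternating link diagram with crossings $x_1,\dots,x_n$, regarded as a 4-valent graph in $S^2$ with over/under information. For each $i$ let $s_i\subset S^2$ be a square which is a relative regular neighbourhood of $x_i$ in $(S^2,\Gamma)$, with its four vertices on the four germs of edges of $\Gamma$ at $x_i$; so each side of $s_i$ lies in a region of $\Gamma$. Let $x_i^+$ and $x_i^-$ be the points of the link above and below $x_i$ (on the over- and understrand), and let $\Delta_i^\pm=x_i^\pm * s_i$ be the pyramids with base $s_i$ and apex $x_i^\pm$, with $\Delta_i^+\cap\Delta_i^-=s_i$. Faces of these pyramids are paired as follows. Let $e$ be an edge of the graph $\Gamma$; since $\Gamma$ is alternating, $e$ joins a crossing $x_j$ at which it is an overpass to a crossing $x_k$ at which it is an underpass (possibly $j=k$). Let $a_j$ and $a_k$ be the vertices of $s_j$ and $s_k$ lying on $e$ near its overpass end and its underpass end, respectively. For each of the two regions $R$ of $\Gamma$ adjacent to $e$, let $b_j$ (resp. $b_k$) be the vertex of $s_j$ (resp. $s_k$) such that the side $a_jb_j$ (resp. $a_kb_k$) lies in $R$ along $e$. Glue the face $x_j^+a_jb_j$ of $\Delta_j^+$ to the face $x_k^-b_ka_k$ of $\Delta_k^-$ by the homeomorphism with $x_j^+\mapsto x_k^-$, $a_j\mapsto b_k$, $b_j\mapsto a_k$.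 Let $O_i^\pm$ be the cube obtained from $\Delta_i^\pm$ by chopping off a small regular neighbourhood of the apex $x_i^\pm$ (so $O_i^+\cap O_i^-=s_i$). The Aitchison complex $\mathcal{A}(\Gamma)$ is the three-dimensional cubed complex obtained from the cubes $O_i^\pm$ ($1\le i\le n$) by the restrictions of these face gluings.
   Formalization: The right-hand side also requires the complex C^3(S,φ) to be connected; without this the "if" direction fails, e.g. for three squares forming a sphere-type and a torus-type component with 3+2=5=|S|+2 orbits. Diagrams have at least one crossing. *)

theory Defs
  imports "HOL-Analysis.Analysis"
begin

section \<open>Cubed complexes\<close>

type_synonym plane = "real \<times> real"
type_synonym space = "plane \<times> real"

text \<open>
  A three-dimensional cubed complex is presented as a family of disjoint unit cubes, indexed by
  \<open>cells\<close>, together with identifications between points of these cubes.  Its underlying space is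
  the quotient of \<open>cube_points\<close> by the equivalence relation \<open>identified\<close>.
\<close>

record 'c cubed_complex =
  cells :: "'c set"
  cube :: "'c \<Rightarrow> space set"
  glue :: "(('c \<times> space) \<times> ('c \<times> space)) set"

definition cube_points :: "'c cubed_complex \<Rightarrow> ('c \<times> space) set" where
  "cube_points K = Sigma (cells K) (cube K)"

definition identified :: "'c cubed_complex \<Rightarrow> (('c \<times> space) \<times> ('c \<times> space)) set" where
  "identified K = (glue K \<union> (glue K)\<inverse>)\<^sup>* \<inter> (cube_points K \<times> cube_points K)"

text \<open>
  An isomorphism is a homeomorphism of the quotient spaces mapping each cube onto a cube by an
  isomorphism of cubes.  Isomorphisms of unit cubes are the same as surjective isometries, and
  maps \<open>g c\<close> on the individual cubes define an injective map of the quotients exactly when they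
  preserve and reflect the identifications.
\<close>

definition complex_iso :: "'c cubed_complex \<Rightarrow> 'd cubed_complex \<Rightarrow> bool" where
  "complex_iso K L \<longleftrightarrow> (\<exists>\<sigma> g. bij_betw \<sigma> (cells K) (cells L) \<and>
     (\<forall>c\<in>cells K. g c ` cube K c = cube L (\<sigma> c) \<and>
        (\<forall>x\<in>cube K c. \<forall>y\<in>cube K c. dist (g c x) (g c y) = dist x y)) \<and>
     (\<forall>(c, x)\<in>cube_points K. \<forall>(d, y)\<in>cube_points K.
        ((c, x), (d, y)) \<in> identified K \<longleftrightarrow>
        ((\<sigma> c, g c x), (\<sigma> d, g d y)) \<in> identified L))"

text \<open>
  Since every cube is connected, the quotient space of a finite complex is connected iff any two
  cubes are joined by a chain of cubes in which consecutive ones share a point.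
\<close>

definition complex_connected :: "'c cubed_complex \<Rightarrow> bool" where
  "complex_connected K \<longleftrightarrow>
     (\<forall>c\<in>cells K. \<forall>d\<in>cells K. (c, d) \<in> {(c, d). \<exists>x y. ((c, x), (d, y)) \<in> identified K}\<^sup>*)"


section \<open>SBW-squares and the bijection \<open>\<Phi>\<close>\<close>

definition unit_square :: "plane set" where
  "unit_square = {0..1} \<times> {0..1}"

definition positive_corners :: "plane set" where
  "positive_corners = {(0, 1), (1, 0)}"

definition negative_corners :: "plane set" where
  "negative_corners = {(0, 0), (1, 1)}"

definition V_pos :: "'a set \<Rightarrow> ('a \<times> plane) set" where
  "V_pos S = S \<times> positive_corners"

definition V_neg :: "'a set \<Rightarrow> ('a \<times> plane) set" where
  "V_neg S = S \<times> negative_corners"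

text \<open>
  The triple \<open>(s, p, q)\<close> is the edge of the copy \<open>s\<close> of the SBW-square with negative (initial)
  vertex \<open>p\<close> and positive (terminal) vertex \<open>q\<close>.
\<close>

type_synonym 'a edge = "'a \<times> plane \<times> plane"

definition E_B :: "'a set \<Rightarrow> 'a edge set" where
  "E_B S = {(s, p, q). s \<in> S \<and> p \<in> negative_corners \<and> q \<in> positive_corners \<and> snd p = snd q}"

definition E_W :: "'a set \<Rightarrow> 'a edge set" where
  "E_W S = {(s, p, q). s \<in> S \<and> p \<in> negative_corners \<and> q \<in> positive_corners \<and> fst p = fst q}"

definition E_all :: "'a set \<Rightarrow> 'a edge set" where
  "E_all S = E_B S \<union> E_W S"

fun initial :: "'a edge \<Rightarrow> 'a \<times> plane" where
  "initial (s, p, q) = (s, p)"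

fun terminal :: "'a edge \<Rightarrow> 'a \<times> plane" where
  "terminal (s, p, q) = (s, q)"

definition Phi_B :: "'a set \<Rightarrow> ('a \<times> plane \<Rightarrow> 'a \<times> plane) \<Rightarrow> 'a edge \<Rightarrow> 'a edge" where
  "Phi_B S \<phi> e = (THE e'. e' \<in> E_B S \<and> initial e' = \<phi> (terminal e))"

definition Phi_W :: "'a set \<Rightarrow> ('a \<times> plane \<Rightarrow> 'a \<times> plane) \<Rightarrow> 'a edge \<Rightarrow> 'a edge" where
  "Phi_W S \<phi> e = (THE e'. e' \<in> E_W S \<and> initial e' = \<phi> (terminal e))"

definition Phi :: "'a set \<Rightarrow> ('a \<times> plane \<Rightarrow> 'a \<times> plane) \<Rightarrow> 'a edge \<Rightarrow> 'a edge" where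
  "Phi S \<phi> e = (if e \<in> E_B S then Phi_B S \<phi> e else Phi_W S \<phi> e)"

text \<open>
  The orbit relation of the cyclic group generated by a permutation \<open>f\<close> of \<open>A\<close>; the second
  disjunct accounts for the negative powers of \<open>f\<close>.
\<close>

definition cyclic_orbit_rel :: "('b \<Rightarrow> 'b) \<Rightarrow> 'b set \<Rightarrow> ('b \<times> 'b) set" where
  "cyclic_orbit_rel f A =
     {(x, y). x \<in> A \<and> y \<in> A \<and> (\<exists>k::nat. (f ^^ k) x = y \<or> (f ^^ k) y = x)}"

definition edge_orbits :: "'a set \<Rightarrow> ('a \<times> plane \<Rightarrow> 'a \<times> plane) \<Rightarrow> 'a edge set set" where
  "edge_orbits S \<phi> = E_all S // cyclic_orbit_rel (Phi S \<phi>) (E_all S)"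


section \<open>The SBW cubed-complex\<close>

datatype 'i half = Upper 'i | Lower 'i

fun half_cube :: "'i half \<Rightarrow> space set" where
  "half_cube (Upper i) = unit_square \<times> {0..1}"
| "half_cube (Lower i) = unit_square \<times> {-1..0}"

definition half_cells :: "'i set \<Rightarrow> 'i half set" where
  "half_cells I = Upper ` I \<union> Lower ` I"

definition base_glue :: "'i set \<Rightarrow> (('i half \<times> space) \<times> ('i half \<times> space)) set" where
  "base_glue I = {((Upper i, (p, 0)), (Lower i, (p, 0))) | i p. i \<in> I \<and> p \<in> unit_square}"

text \<open>
  The point of an edge with parameter \<open>r\<close> measured from its initial vertex; the
  orientation-preserving linear homeomorphism \<open>e \<rightarrow> \<Phi>(e)\<close> preserves this parameter.
\<close>

fun edge_point :: "'a edge \<Rightarrow> real \<Rightarrow> plane" where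
  "edge_point (s, p, q) r = (1 - r) *\<^sub>R p + r *\<^sub>R q"

definition C3 :: "'a set \<Rightarrow> ('a \<times> plane \<Rightarrow> 'a \<times> plane) \<Rightarrow> 'a half cubed_complex" where
  "C3 S \<phi> = \<lparr>cells = half_cells S, cube = half_cube,
     glue = base_glue S \<union>
       {((Lower (fst e), (edge_point e r, t)),
         (Upper (fst (Phi S \<phi> e)), (edge_point (Phi S \<phi> e) r, - t))) | e r t.
         e \<in> E_all S \<and> r \<in> {0..1} \<and> t \<in> {-1..0}}\<rparr>"


section \<open>Link diagrams in the 2-sphere\<close>

abbreviation S2 :: "(real ^ 3) set" where
  "S2 \<equiv> sphere 0 1"

abbreviation square_centre :: plane where
  "square_centre \<equiv> (1/2, 1/2)"

definition diagonals :: "plane set" where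
  "diagonals = closed_segment (0, 0) (1, 1) \<union> closed_segment (0, 1) (1, 0)"

definition corners :: "plane set" where
  "corners = positive_corners \<union> negative_corners"

definition side :: "plane \<Rightarrow> plane \<Rightarrow> bool" where
  "side a b \<longleftrightarrow> a \<in> corners \<and> b \<in> corners \<and> dist a b = 1"

text \<open>
  A diagram with at least one crossing, as a 4-valent graph in the sphere with over/under
  information.  Each edge is given by one of its two parametrisations.  For a crossing \<open>x\<close>, the map
  \<open>chart x\<close> from the unit square to the sphere parametrises the square around \<open>x\<close>, whose diagonals
  are the two strands through \<open>x\<close>; \<open>over x\<close> consists of the two opposite corners lying on the
  overstrand.  Thus \<open>chart\<close> records the local crossing structure and at the same time the choice of
  the squares from which the Aitchison complex is built.  No orientation is imposed on the charts.
\<close>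

record diagram =
  crossings :: "(real ^ 3) set"
  edges :: "(real \<Rightarrow> real ^ 3) set"
  chart :: "real ^ 3 \<Rightarrow> plane \<Rightarrow> real ^ 3"
  over :: "real ^ 3 \<Rightarrow> plane set"

definition graph :: "diagram \<Rightarrow> (real ^ 3) set" where
  "graph \<Gamma> = crossings \<Gamma> \<union> (\<Union>g\<in>edges \<Gamma>. path_image g)"

definition link_diagram :: "diagram \<Rightarrow> bool" where
  "link_diagram \<Gamma> \<longleftrightarrow>
     finite (crossings \<Gamma>) \<and> crossings \<Gamma> \<noteq> {} \<and> crossings \<Gamma> \<subseteq> S2 \<and> finite (edges \<Gamma>) \<and>
     (\<forall>g\<in>edges \<Gamma>. simple_path g \<and> path_image g \<subseteq> S2 \<and>
        pathstart g \<in> crossings \<Gamma> \<and> pathfinish g \<in> crossings \<Gamma> \<and>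
        g ` {0<..<1} \<inter> crossings \<Gamma> = {}) \<and>
     (\<forall>g\<in>edges \<Gamma>. \<forall>g'\<in>edges \<Gamma>. g \<noteq> g' \<longrightarrow> g ` {0<..<1} \<inter> g' ` {0<..<1} = {}) \<and>
     (\<forall>x\<in>crossings \<Gamma>.
        continuous_on unit_square (chart \<Gamma> x) \<and> inj_on (chart \<Gamma> x) unit_square \<and>
        chart \<Gamma> x ` unit_square \<subseteq> S2 \<and> chart \<Gamma> x square_centre = x \<and>
        {p \<in> unit_square. chart \<Gamma> x p \<in> graph \<Gamma>} = diagonals \<and>
        over \<Gamma> x \<in> {positive_corners, negative_corners}) \<and>
     (\<forall>x\<in>crossings \<Gamma>. \<forall>y\<in>crossings \<Gamma>. x \<noteq> y \<longrightarrow>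
        chart \<Gamma> x ` unit_square \<inter> chart \<Gamma> y ` unit_square = {})"

text \<open>
  The path \<open>g\<close> starts at the crossing \<open>x\<close> along the half-diagonal with corner \<open>v\<close>, i.e. \<open>v\<close> is the
  vertex of the square around \<open>x\<close> that lies on \<open>g\<close> near its initial end.
\<close>

definition leaves_at :: "diagram \<Rightarrow> (real \<Rightarrow> real ^ 3) \<Rightarrow> real ^ 3 \<Rightarrow> plane \<Rightarrow> bool" where
  "leaves_at \<Gamma> g x v \<longleftrightarrow> x \<in> crossings \<Gamma> \<and> pathstart g = x \<and> v \<in> corners \<and>
     (\<exists>t\<in>{0<..<1}. g ` {0..t} = chart \<Gamma> x ` closed_segment square_centre v)"

text \<open>
  \<open>joins_over_under \<Gamma> g j a k a'\<close>: \<open>g\<close> runs from the crossing \<open>j\<close>, where it is on the overstrand,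
  to the crossing \<open>k\<close>, where it is on the understrand; \<open>a\<close> and \<open>a'\<close> are the vertices of the squares
  around \<open>j\<close> and \<open>k\<close> near the two ends.
\<close>

definition joins_over_under ::
    "diagram \<Rightarrow> (real \<Rightarrow> real ^ 3) \<Rightarrow> real ^ 3 \<Rightarrow> plane \<Rightarrow> real ^ 3 \<Rightarrow> plane \<Rightarrow> bool" where
  "joins_over_under \<Gamma> g j a k a' \<longleftrightarrow>
     leaves_at \<Gamma> g j a \<and> a \<in> over \<Gamma> j \<and> leaves_at \<Gamma> (reversepath g) k a' \<and> a' \<notin> over \<Gamma> k"

definition oriented_edges :: "diagram \<Rightarrow> (real \<Rightarrow> real ^ 3) set" where
  "oriented_edges \<Gamma> = edges \<Gamma> \<union> reversepath ` edges \<Gamma>"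

definition alternating :: "diagram \<Rightarrow> bool" where
  "alternating \<Gamma> \<longleftrightarrow> (\<forall>g\<in>edges \<Gamma>. \<exists>j a k a'.
     joins_over_under \<Gamma> g j a k a' \<or> joins_over_under \<Gamma> (reversepath g) j a k a')"

definition connected_diagram :: "diagram \<Rightarrow> bool" where
  "connected_diagram \<Gamma> \<longleftrightarrow> connected (graph \<Gamma>)"

definition regions :: "diagram \<Rightarrow> (real ^ 3) set set" where
  "regions \<Gamma> = components (S2 - graph \<Gamma>)"


section \<open>The Aitchison complex\<close>

text \<open>
  The pyramids over the squares are modelled in coordinates: base \<open>unit_square \<times> {0}\<close>, apex
  above or below its centre.  The points of a pyramid at distance at most 1/2 from the base plane
  form the chopped pyramid, and \<open>chopped\<close> identifies the unit cubes \<open>unit_square \<times> {0..1}\<close> and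
  \<open>unit_square \<times> {-1..0}\<close> with the chopped upper and lower pyramids, along the segments to the apex.
\<close>

definition apex_above :: space where
  "apex_above = (square_centre, 1)"

definition apex_below :: space where
  "apex_below = (square_centre, -1)"

fun chopped :: "space \<Rightarrow> space" where
  "chopped (p, t) = ((1 - \<bar>t\<bar> / 2) *\<^sub>R p + (\<bar>t\<bar> / 2) *\<^sub>R square_centre, t / 2)"

text \<open>
  For an edge \<open>g\<close> from \<open>j\<close> (over) to \<open>k\<close> (under) and a region \<open>R\<close>, the upper face with vertices
  apex, \<open>a\<close>, \<open>b\<close> is glued to the lower face with vertices apex, \<open>b'\<close>, \<open>a'\<close> by the map preserving
  barycentric coordinates with respect to these orders of the vertices.  The condition on \<open>R\<close>
  determines the sides \<open>a b\<close> and \<open>a' b'\<close>: the regions on the two sides of an edge of a 4-valent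
  graph in the sphere are distinct, so the two sides of a square that meet in a corner lie in
  distinct regions.
\<close>

definition aitchison_glue ::
    "diagram \<Rightarrow> ((real ^ 3) half \<times> space) rel" where
  "aitchison_glue \<Gamma> =
     {((Upper j, x), (Lower k, y)) | j k x y. x \<in> half_cube (Upper j) \<and> y \<in> half_cube (Lower k) \<and>
        (\<exists>g\<in>oriented_edges \<Gamma>. \<exists>R\<in>regions \<Gamma>. \<exists>a b a' b'.
           joins_over_under \<Gamma> g j a k a' \<and> side a b \<and> side a' b' \<and>
           chart \<Gamma> j ` open_segment a b \<subseteq> R \<and> chart \<Gamma> k ` open_segment a' b' \<subseteq> R \<and>
           (\<exists>\<alpha> \<beta> \<gamma>. 0 \<le> \<alpha> \<and> 0 \<le> \<beta> \<and> 0 \<le> \<gamma> \<and> \<alpha> + \<beta> + \<gamma> = 1 \<and>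
              chopped x = \<alpha> *\<^sub>R apex_above + \<beta> *\<^sub>R (a, 0) + \<gamma> *\<^sub>R (b, 0) \<and>
              chopped y = \<alpha> *\<^sub>R apex_below + \<beta> *\<^sub>R (b', 0) + \<gamma> *\<^sub>R (a', 0)))}"

definition Aitchison :: "diagram \<Rightarrow> (real ^ 3) half cubed_complex" where
  "Aitchison \<Gamma> = \<lparr>cells = half_cells (crossings \<Gamma>), cube = half_cube,
     glue = base_glue (crossings \<Gamma>) \<union> aitchison_glue \<Gamma>\<rparr>"

end

theory Submission
  imports Defs "HOL-Combinatorics.Transposition"
begin

text \<open>
  On the terminal vertices of the edges, \<open>\<Phi>\<close> is a permutation \<open>\<beta>\<close> of \<open>V_pos S\<close> for the black edges,
  and for the white edges it is \<open>\<beta>\<close> followed by the exchange of opposite vertices in all squares.  If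
  the complex is connected, \<open>\<beta>\<close> and this exchange act transitively, and then the two permutations
  together have at most \<open>card S + 2\<close> cycles.

  An isomorphism to an Aitchison complex preserves the midpoints of the base edges, and glued sides
  lie in the same region, so the orbits of \<open>\<Phi>\<close> map onto the regions of the diagram.  By the Jordan
  curve theorem and Janiszewski's theorem there are at least \<open>card S + 2\<close> regions.

  Conversely, exchanging the vertices only in a suitable set \<open>T\<close> of squares turns \<open>\<beta>\<close> into a single
  cycle.  Arrange \<open>V_pos S\<close> on a circle along this cycle.  If the number of orbits is \<open>card S + 2\<close>, then
  the chords joining opposite vertices of the squares in \<open>T\<close> are pairwise disjoint, and so are those
  of the squares outside \<open>T\<close>.  With the circle as the equator of the sphere, the two families are drawn
  in the two hemispheres, and replacing each chord by two crossing strands gives an alternating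
  diagram.  The checkerboard colouring of its complement determines which sides are glued.
\<close>

section \<open>Orbits of permutations\<close>

text \<open>The equation is Euler's formula. A connected 4-valent graph with n crossings in the
  sphere has n + 2 regions; here the squares are the crossings, the 2 * \<open>card S\<close> points
  of \<open>V_pos S\<close> play the part of the edges, and the cycles of \<beta> and of its full
  twist are the black and the white regions. In general a connected gluing has \<open>card S\<close>
  + 2 - 2g orbits, where g is the genus of the surface carrying the permutations. This is why
  connectedness accompanies the count in the criterion: a piece of genus 0 beside a piece of genus 1
  has the same total. The converse must produce a diagram in the round sphere. Gluing abstract
  polygons would require recognising the result as a sphere. Instead T is the edge set of a spanning
  tree in the graph whose vertices are the cycles of \<beta> and whose edges are the squares. The
  boundary of a neighbourhood of the tree is the single cycle; with this as equator, everything else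
  consists of explicit segments lifted to the hemispheres, and planarity becomes the statement that
  chords do not interleave.\<close>

definition eqcl :: "'b set \<Rightarrow> ('b \<times> 'b) set \<Rightarrow> ('b \<times> 'b) set" where
  "eqcl A r = (r \<union> r\<inverse>)\<^sup>* \<inter> A \<times> A"

lemma equiv_eqcl: "equiv A (eqcl A r)"
proof (rule equivI)
  have "sym ((r \<union> r\<inverse>)\<^sup>*)"
    by (rule sym_rtrancl) (auto simp: sym_def)
  then show "sym (eqcl A r)"
    by (auto simp: eqcl_def sym_def)
  show "trans (eqcl A r)"
    unfolding eqcl_def trans_def by (blast intro: rtrancl_trans)
qed (auto simp: eqcl_def refl_on_def)

lemma eqcl_subset: "eqcl A r \<subseteq> A \<times> A"
  by (auto simp: eqcl_def)

lemma eqcl_refl: "x \<in> A \<Longrightarrow> (x, x) \<in> eqcl A r"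
  by (simp add: eqcl_def)

lemma eqcl_sym: "(x, y) \<in> eqcl A r \<Longrightarrow> (y, x) \<in> eqcl A r"
  using equiv_eqcl[of A r] by (auto elim!: equivE dest: symD)

lemma eqcl_trans: "(x, y) \<in> eqcl A r \<Longrightarrow> (y, z) \<in> eqcl A r \<Longrightarrow> (x, z) \<in> eqcl A r"
  using equiv_eqcl[of A r] by (auto elim!: equivE dest: transD)

lemma eqcl_incl: "r \<subseteq> A \<times> A \<Longrightarrow> r \<subseteq> eqcl A r"
  by (auto simp: eqcl_def)

lemma eqcl_least:
  assumes "equiv A E" "r \<subseteq> E"
  shows "eqcl A r \<subseteq> E"
proof clarify
  fix x y assume "(x, y) \<in> eqcl A r"
  then have xy: "(x, y) \<in> (r \<union> r\<inverse>)\<^sup>*" and "x \<in> A" by (auto simp: eqcl_def)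
  have E: "sym E" "trans E" "refl_on A E" using assms(1) by (auto elim: equivE)
  from xy show "(x, y) \<in> E"
  proof (induction rule: rtrancl_induct)
    case base
    then show ?case using E \<open>x \<in> A\<close> by (auto simp: refl_on_def)
  next
    case (step y z)
    then have "(y, z) \<in> E" using assms(2) E(1) by (auto dest: symD)
    then show ?case using step E(2) by (blast dest: transD)
  qed
qed

lemma eqcl_mono:
  assumes "r \<subseteq> eqcl A r'"
  shows "eqcl A r \<subseteq> eqcl A r'"
  by (rule eqcl_least[OF equiv_eqcl assms])

lemma equiv_pullback:
  assumes "equiv B E" "h ` A \<subseteq> B"
  shows "equiv A {(x, y). x \<in> A \<and> y \<in> A \<and> (h x, h y) \<in> E}"
proof -
  have E: "sym E" "trans E" "refl_on B E" using assms(1) by (auto elim: equivE)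
  show ?thesis
  proof (rule equivI)
    show "refl_on A {(x, y). x \<in> A \<and> y \<in> A \<and> (h x, h y) \<in> E}"
      using E(3) assms(2) by (auto simp: refl_on_def)
    show "sym {(x, y). x \<in> A \<and> y \<in> A \<and> (h x, h y) \<in> E}"
      using E(1) by (auto simp: sym_def)
    show "trans {(x, y). x \<in> A \<and> y \<in> A \<and> (h x, h y) \<in> E}"
      using E(2) unfolding trans_def by blast
  qed auto
qed

text \<open>Sending a class of R to the class of S containing it is onto; were it also injective, S
  would be contained in R.\<close>

lemma strict_refines_card_less:
  assumes "finite (A // R)" "R \<subset> S" "equiv A R" "equiv A S"
  shows "card (A // S) < card (A // R)"
proof -
  let ?f = "\<lambda>X. S `` X"
  have im: "?f ` (A // R) = A // S"
    using refines_equiv_image_eq[of R S A] assms by auto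
  have "\<not> inj_on ?f (A // R)"
  proof
    assume inj: "inj_on ?f (A // R)"
    have "S \<subseteq> R"
    proof clarify
      fix x y assume xy: "(x, y) \<in> S"
      then have A: "x \<in> A" "y \<in> A" using assms(4) by (auto elim!: equivE)
      have "?f (R `` {x}) = ?f (R `` {y})"
        using xy assms refines_equiv_class_eq2[of R S A] equiv_class_eq[of A S x y] by auto
      then have "R `` {x} = R `` {y}"
        using inj A by (auto simp: inj_on_def quotientI)
      then show "(x, y) \<in> R" using A assms(3) by (simp add: eq_equiv_class_iff)
    qed
    then show False using assms by auto
  qed
  then have "card (?f ` (A // R)) \<noteq> card (A // R)"
    using eq_card_imp_inj_on assms(1) by blast
  then show ?thesis
    using card_image_le[OF assms(1), of ?f] im by auto
qed

text \<open>Adjoining one pair changes nothing outside the classes of its two ends, which merge into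
  \<open>C\<close>. Both the orbits of permutations and the components of graphs are counted through
  this unit step.\<close>

lemma card_eqcl_insert:
  assumes "finite A" "r \<subseteq> A \<times> A" "a \<in> A" "b \<in> A" "(a, b) \<notin> eqcl A r"
  shows "card (A // eqcl A r) = Suc (card (A // eqcl A (insert (a, b) r)))"
proof -
  let ?E = "eqcl A r" and ?E' = "eqcl A (insert (a, b) r)"
  define C where "C = ?E `` {a} \<union> ?E `` {b}"
  have clsD: "(x, y) \<in> ?E \<Longrightarrow> x \<in> C \<longleftrightarrow> y \<in> C" for x y
    unfolding C_def using eqcl_trans[of _ x A r y] eqcl_trans[of _ y A r x] eqcl_sym[of x y A r] by auto
  have ab: "a \<in> C" "b \<in> C" using assms eqcl_refl by (auto simp: C_def)
  have CA: "C \<subseteq> A" using eqcl_subset by (auto simp: C_def)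
  have E': "?E' = ?E \<union> C \<times> C"
  proof
    have "equiv A (?E \<union> C \<times> C)"
    proof (rule equivI)
      show "?E \<union> C \<times> C \<subseteq> A \<times> A" using eqcl_subset CA by blast
      show "refl_on A (?E \<union> C \<times> C)" using eqcl_refl by (auto simp: refl_on_def)
      show "sym (?E \<union> C \<times> C)" unfolding sym_def using eqcl_sym[of _ _ A r] by blast
      show "trans (?E \<union> C \<times> C)"
        unfolding trans_def using eqcl_trans[of _ _ A r] clsD by auto
    qed
    moreover have "insert (a, b) r \<subseteq> ?E \<union> C \<times> C"
      using ab eqcl_incl[OF assms(2)] by auto
    ultimately show "?E' \<subseteq> ?E \<union> C \<times> C" by (rule eqcl_least)
    have sub: "insert (a, b) r \<subseteq> ?E'" by (rule eqcl_incl) (use assms in auto)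
    then have 1: "?E \<subseteq> ?E'" by (intro eqcl_mono) auto
    have "(a, x) \<in> ?E'" if "x \<in> C" for x
      using that 1 sub eqcl_trans[of a b A "insert (a,b) r" x] by (auto simp: C_def)
    then have "(x, y) \<in> ?E'" if "x \<in> C" "y \<in> C" for x y
      using that eqcl_sym eqcl_trans[of x a] by metis
    then have "C \<times> C \<subseteq> ?E'" by blast
    with 1 show "?E \<union> C \<times> C \<subseteq> ?E'" by blast
  qed
  have Ein: "?E `` {x} = ?E `` {a} \<or> ?E `` {x} = ?E `` {b}" if "x \<in> C" for x
    using that equiv_class_eq[OF equiv_eqcl, of a x A r] equiv_class_eq[OF equiv_eqcl, of b x A r]
    unfolding C_def by blast
  have neq: "?E `` {a} \<noteq> ?E `` {b}"
    using assms equiv_eqcl by (metis eq_equiv_class)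
  have 1: "A // ?E' = insert C (A // ?E - {?E `` {a}, ?E `` {b}})"
  proof
    show "A // ?E' \<subseteq> insert C (A // ?E - {?E `` {a}, ?E `` {b}})"
    proof
      fix X assume "X \<in> A // ?E'"
      then obtain x where x: "x \<in> A" "X = ?E' `` {x}" by (auto elim: quotientE)
      show "X \<in> insert C (A // ?E - {?E `` {a}, ?E `` {b}})"
      proof (cases "x \<in> C")
        case True
        then have "X = C" using x E' clsD by auto
        then show ?thesis by simp
      next
        case False
        then have "X = ?E `` {x}" using x E' by auto
        moreover have "x \<in> ?E `` {x}" using x eqcl_refl by auto
        ultimately show ?thesis using x False by (auto simp: C_def quotientI)
      qed
    qed
    show "insert C (A // ?E - {?E `` {a}, ?E `` {b}}) \<subseteq> A // ?E'"
    proof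
      fix X assume "X \<in> insert C (A // ?E - {?E `` {a}, ?E `` {b}})"
      then consider "X = C" | x where "x \<in> A" "X = ?E `` {x}" "X \<noteq> ?E `` {a}" "X \<noteq> ?E `` {b}"
        by (auto elim!: quotientE)
      then show "X \<in> A // ?E'"
      proof cases
        case 1
        then have "X = ?E' `` {a}" using ab E' clsD by auto
        then show ?thesis using assms by (simp add: quotientI)
      next
        case 2
        then have "x \<notin> C" using Ein by blast
        then have "X = ?E' `` {x}" using 2 E' by auto
        then show ?thesis using 2 by (simp add: quotientI)
      qed
    qed
  qed
  have Cn: "C \<notin> A // ?E - {?E `` {a}, ?E `` {b}}"
  proof
    assume *: "C \<in> A // ?E - {?E `` {a}, ?E `` {b}}"
    then obtain x where "C = ?E `` {x}" by (auto elim: quotientE)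
    then have "(x, a) \<in> ?E" using ab by auto
    then show False using * \<open>C = ?E `` {x}\<close> equiv_class_eq[OF equiv_eqcl] by fastforce
  qed
  have fin: "finite (A // ?E)"
    using assms(1) by (simp add: eqcl_subset finite_quotient)
  have in2: "{?E `` {a}, ?E `` {b}} \<subseteq> A // ?E"
    using assms by (auto intro: quotientI)
  have "card (A // ?E - {?E `` {a}, ?E `` {b}}) = card (A // ?E) - 2"
    using neq in2 by (subst card_Diff_subset) auto
  moreover have "2 \<le> card (A // ?E)"
    using card_mono[OF fin in2] neq by auto
  ultimately show ?thesis
    using 1 Cn fin by simp
qed

lemma card_eqcl_insert_le:
  assumes "finite A" "r \<subseteq> A \<times> A" "a \<in> A" "b \<in> A"
  shows "card (A // eqcl A r) \<le> Suc (card (A // eqcl A (insert (a, b) r)))"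
proof (cases "(a, b) \<in> eqcl A r")
  case True
  then have "eqcl A (insert (a, b) r) \<subseteq> eqcl A r"
    using eqcl_incl[OF assms(2)] by (intro eqcl_mono) auto
  moreover have "eqcl A r \<subseteq> eqcl A (insert (a, b) r)"
    using eqcl_incl[of "insert (a, b) r" A] assms by (intro eqcl_mono) auto
  ultimately show ?thesis by simp
next
  case False
  then show ?thesis using card_eqcl_insert[OF assms(1-4)] by simp
qed

section \<open>Counting the orbits of a permutation\<close>

definition fgraph :: "('b \<Rightarrow> 'b) \<Rightarrow> 'b set \<Rightarrow> ('b \<times> 'b) set" where
  "fgraph f A = (\<lambda>x. (x, f x)) ` A"

definition norb :: "('b \<Rightarrow> 'b) \<Rightarrow> 'b set \<Rightarrow> nat" where
  "norb f A = card (A // eqcl A (fgraph f A))"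

lemma fgraph_subset: "f ` A \<subseteq> A \<Longrightarrow> fgraph f A \<subseteq> A \<times> A"
  by (auto simp: fgraph_def)

lemma funpow_closed: "f ` A \<subseteq> A \<Longrightarrow> x \<in> A \<Longrightarrow> (f ^^ k) x \<in> A"
  by (induction k) auto

lemma eqcl_fgraph_funpow:
  assumes "f ` A \<subseteq> A" "x \<in> A"
  shows "(x, (f ^^ k) x) \<in> eqcl A (fgraph f A)"
proof (induction k)
  case 0
  then show ?case using assms by (simp add: eqcl_refl)
next
  case (Suc k)
  have "((f ^^ k) x, f ((f ^^ k) x)) \<in> eqcl A (fgraph f A)"
    using eqcl_incl[OF fgraph_subset[OF assms(1)]] funpow_closed[OF assms, of k]
    by (auto simp: fgraph_def)
  from eqcl_trans[OF Suc this] show ?case by simp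
qed

lemma inj_on_funpow_closed:
  assumes "f ` A \<subseteq> A" "inj_on f A"
  shows "inj_on (f ^^ k) A"
proof (induction k)
  case (Suc k)
  have "inj_on (f \<circ> (f ^^ k)) A"
    using Suc assms funpow_closed[OF assms(1)] by (intro comp_inj_on inj_on_subset[OF assms(2)]) auto
  then show ?case by (simp add: comp_def)
qed auto

lemma funpow_diff_cancel:
  assumes "f ` A \<subseteq> A" "inj_on f A" "x \<in> A" "y \<in> A" "(f ^^ k) x = (f ^^ l) y" "k \<le> l"
  shows "x = (f ^^ (l - k)) y"
proof -
  have "(f ^^ k) x = (f ^^ k) ((f ^^ (l - k)) y)"
    using assms(5,6) by (metis funpow_add le_add_diff_inverse o_apply)
  then show ?thesis
    using inj_on_funpow_closed[OF assms(1,2), of k] assms funpow_closed[OF assms(1)]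
    by (auto dest: inj_onD)
qed

text \<open>The definition only asks that one point lies on the forward orbit of the other.
  Injectivity allows a common power to be cancelled, so points whose forward orbits meet are
  related; this yields transitivity.\<close>

lemma cyclic_orbit_rel_eq_eqcl:
  assumes "f ` A \<subseteq> A" "inj_on f A"
  shows "cyclic_orbit_rel f A = eqcl A (fgraph f A)"
proof
  show "cyclic_orbit_rel f A \<subseteq> eqcl A (fgraph f A)"
    unfolding cyclic_orbit_rel_def by (auto intro: eqcl_fgraph_funpow[OF assms(1)] eqcl_sym)
  have "equiv A (cyclic_orbit_rel f A)"
  proof (rule equivI)
    show "cyclic_orbit_rel f A \<subseteq> A \<times> A" by (auto simp: cyclic_orbit_rel_def)
    show "refl_on A (cyclic_orbit_rel f A)"
      by (auto simp: refl_on_def cyclic_orbit_rel_def intro: exI[of _ 0])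
    show "sym (cyclic_orbit_rel f A)" by (auto simp: sym_def cyclic_orbit_rel_def)
    show "trans (cyclic_orbit_rel f A)"
    proof (rule transI)
      fix x y z assume xy: "(x, y) \<in> cyclic_orbit_rel f A" and yz: "(y, z) \<in> cyclic_orbit_rel f A"
      then have A: "x \<in> A" "y \<in> A" "z \<in> A" by (auto simp: cyclic_orbit_rel_def)
      have same: "(u, v) \<in> cyclic_orbit_rel f A" if "(f ^^ k) u = (f ^^ l) v" "u \<in> A" "v \<in> A" for k l u v
      proof (cases "k \<le> l")
        case True
        then have "u = (f ^^ (l - k)) v" using funpow_diff_cancel[OF assms] that by blast
        then show ?thesis using that by (auto simp: cyclic_orbit_rel_def)
      next
        case False
        then have "v = (f ^^ (k - l)) u" using funpow_diff_cancel[OF assms, of v u l k] that by auto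
        then show ?thesis using that by (auto simp: cyclic_orbit_rel_def)
      qed
      obtain k l where kl: "(f ^^ k) x = y \<or> (f ^^ k) y = x" "(f ^^ l) y = z \<or> (f ^^ l) z = y"
        using xy yz by (auto simp: cyclic_orbit_rel_def)
      have add: "(f ^^ m) ((f ^^ m') u) = (f ^^ (m + m')) u" for m m' u by (simp add: funpow_add)
      from kl show "(x, z) \<in> cyclic_orbit_rel f A"
      proof (elim disjE)
        assume "(f ^^ k) x = y" "(f ^^ l) y = z"
        then show ?thesis using same[of "l + k" x 0 z] A add by auto
      next
        assume "(f ^^ k) x = y" "(f ^^ l) z = y"
        then show ?thesis using same[of k x l z] A by auto
      next
        assume *: "(f ^^ k) y = x" "(f ^^ l) y = z"
        then have "(f ^^ l) x = (f ^^ k) z" by (metis add add.commute)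
        then show ?thesis using same A by blast
      next
        assume "(f ^^ k) y = x" "(f ^^ l) z = y"
        then show ?thesis using same[of 0 x "k + l" z] A add by auto
      qed
    qed
  qed
  moreover have "fgraph f A \<subseteq> cyclic_orbit_rel f A"
    using assms(1) by (auto simp: fgraph_def cyclic_orbit_rel_def intro: exI[of _ "Suc 0"])
  ultimately show "eqcl A (fgraph f A) \<subseteq> cyclic_orbit_rel f A" by (rule eqcl_least)
qed

text \<open>Once a and b are identified, exchanging them in the values of f is invisible. The
  converse inclusion is the same argument, since the exchange is an involution.\<close>

lemma eqcl_transpose:
  assumes "f ` A \<subseteq> A" "a \<in> A" "b \<in> A"
  shows "eqcl A (insert (a, b) (fgraph (Transposition.transpose a b \<circ> f) A))
       = eqcl A (insert (a, b) (fgraph f A))"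
proof -
  have *: "eqcl A (insert (a, b) (fgraph g A)) \<subseteq> eqcl A (insert (a, b) (fgraph f A))"
    if "f ` A \<subseteq> A" and g: "\<And>x. g x = Transposition.transpose a b (f x)" for f g
  proof (rule eqcl_mono)
    let ?E = "eqcl A (insert (a, b) (fgraph f A))"
    have inc: "insert (a, b) (fgraph f A) \<subseteq> ?E"
      using assms fgraph_subset[OF that(1)] by (intro eqcl_incl) auto
    have "(x, g x) \<in> ?E" if "x \<in> A" for x
    proof -
      have 1: "(x, f x) \<in> ?E" using inc that by (auto simp: fgraph_def)
      have ab: "(a, b) \<in> ?E" "(b, a) \<in> ?E" using inc eqcl_sym by auto
      show ?thesis
        using 1 eqcl_trans[OF 1, of b] eqcl_trans[OF 1, of a] ab
        unfolding g Transposition.transpose_def by presburger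
    qed
    then show "insert (a, b) (fgraph g A) \<subseteq> ?E" using inc by (auto simp: fgraph_def)
  qed
  have im: "(Transposition.transpose a b \<circ> f) ` A \<subseteq> A" using assms by (auto simp: Transposition.transpose_def)
  show ?thesis
  proof
    show "eqcl A (insert (a, b) (fgraph (Transposition.transpose a b \<circ> f) A))
        \<subseteq> eqcl A (insert (a, b) (fgraph f A))"
      by (rule *[OF assms(1)]) simp
    show "eqcl A (insert (a, b) (fgraph f A))
        \<subseteq> eqcl A (insert (a, b) (fgraph (Transposition.transpose a b \<circ> f) A))"
      by (rule *[OF im]) simp
  qed
qed

text \<open>Compare both permutations with their common coarsening that identifies a and b: passing
  to it from the transposed one costs at most one class, and it has at most as many classes as
  f.\<close>

lemma norb_transpose_le:
  assumes "finite A" "f ` A \<subseteq> A" "a \<in> A" "b \<in> A"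
  shows "norb (Transposition.transpose a b \<circ> f) A \<le> Suc (norb f A)"
proof -
  let ?f' = "Transposition.transpose a b \<circ> f"
  have im: "?f' ` A \<subseteq> A" using assms by (auto simp: Transposition.transpose_def)
  have "norb ?f' A \<le> Suc (card (A // eqcl A (insert (a, b) (fgraph ?f' A))))"
    unfolding norb_def by (intro card_eqcl_insert_le assms fgraph_subset im)
  also have "card (A // eqcl A (insert (a, b) (fgraph ?f' A))) \<le> norb f A"
    unfolding norb_def eqcl_transpose[OF assms(2-4)]
    using assms eqcl_incl[of "insert (a, b) (fgraph f A)" A] fgraph_subset[OF assms(2)]
    by (intro finite_refines_card_le equiv_eqcl eqcl_mono finite_quotient) (auto simp: eqcl_subset)
  finally show ?thesis by simp
qed

text \<open>The new orbit of a follows the old one up to the step that would first return to a; this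
  step now leads to b, which was not met before. So the two cycles become one.\<close>

lemma eqcl_transpose_merge:
  assumes "finite A" "f ` A = A" "a \<in> A" "b \<in> A" "(a, b) \<notin> eqcl A (fgraph f A)"
  shows "eqcl A (fgraph (Transposition.transpose a b \<circ> f) A) = eqcl A (insert (a, b) (fgraph f A))"
proof -
  let ?f' = "Transposition.transpose a b \<circ> f"
  have fA: "f ` A \<subseteq> A" using assms by simp
  have im: "?f' ` A \<subseteq> A" using assms by (auto simp: Transposition.transpose_def)
  have inj: "inj_on f A" using assms by (simp add: eq_card_imp_inj_on)
  have ex: "\<exists>k>0. (f ^^ k) a = a"
  proof -
    have "\<not> inj_on (\<lambda>k. (f ^^ k) a) UNIV"
      using range_inj_infinite[of "\<lambda>k. (f ^^ k) a"] funpow_closed[OF fA assms(3)] assms(1)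
      by (metis finite_subset image_subsetI)
    then obtain k l where "k < l" "(f ^^ k) a = (f ^^ l) a"
      unfolding inj_on_def by (metis linorder_neqE_nat)
    then show ?thesis
      using funpow_diff_cancel[OF fA inj assms(3) assms(3), of k l]
      by (intro exI[of _ "l - k"]) auto
  qed
  define k where "k = (LEAST k. k > 0 \<and> (f ^^ k) a = a)"
  have k: "k > 0" "(f ^^ k) a = a"
    using LeastI_ex[OF ex] by (auto simp: k_def)
  have kmin: "(f ^^ i) a \<noteq> a" if "0 < i" "i < k" for i
    using that not_less_Least[of i "\<lambda>k. k > 0 \<and> (f ^^ k) a = a"] by (auto simp: k_def)
  have nb: "(f ^^ i) a \<noteq> b" for i
    using eqcl_fgraph_funpow[OF fA assms(3), of i] assms(5) by auto
  have pow: "(?f' ^^ i) a = (f ^^ i) a" if "i < k" for i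
    using that
  proof (induction i)
    case (Suc i)
    then show ?case using kmin[of "Suc i"] nb[of "Suc i"] by (simp add: Transposition.transpose_def)
  qed auto
  have "(?f' ^^ k) a = b"
    using k pow[of "k - 1"] by (cases k) (auto simp: Transposition.transpose_def)
  then have "(a, b) \<in> eqcl A (fgraph ?f' A)"
    using eqcl_fgraph_funpow[OF im assms(3), of k] by simp
  then have "eqcl A (insert (a, b) (fgraph ?f' A)) \<subseteq> eqcl A (fgraph ?f' A)"
    using eqcl_incl[OF fgraph_subset[OF im]] by (intro eqcl_mono) auto
  moreover have "eqcl A (fgraph ?f' A) \<subseteq> eqcl A (insert (a, b) (fgraph ?f' A))"
    using eqcl_incl[of "insert (a, b) (fgraph ?f' A)" A] fgraph_subset[OF im] assms
    by (intro eqcl_mono) auto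
  ultimately show ?thesis using eqcl_transpose[OF fA assms(3,4)] by simp
qed

lemma norb_transpose_merge:
  assumes "finite A" "f ` A = A" "a \<in> A" "b \<in> A" "(a, b) \<notin> eqcl A (fgraph f A)"
  shows "norb f A = Suc (norb (Transposition.transpose a b \<circ> f) A)"
  unfolding norb_def eqcl_transpose_merge[OF assms]
  using assms by (intro card_eqcl_insert fgraph_subset) auto

lemma norb_conj:
  assumes "bij_betw h A B" "f ` A \<subseteq> A" "\<And>x. x \<in> A \<Longrightarrow> h (f x) = g (h x)"
  shows "norb f A = norb g B"
proof -
  let ?F = "eqcl A (fgraph f A)" and ?G = "eqcl B (fgraph g B)"
  have B: "B = h ` A" and inj: "inj_on h A" using assms by (auto simp: bij_betw_def)
  have gB: "g ` B \<subseteq> B"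
  proof
    fix y assume "y \<in> g ` B"
    then obtain x where x: "x \<in> A" "y = g (h x)" using B by auto
    then show "y \<in> B" using assms(2) assms(3)[OF x(1), symmetric] B by auto
  qed
  define k where "k = the_inv_into A h"
  have k: "k (h x) = x" if "x \<in> A" for x using that inj by (simp add: k_def the_inv_into_f_f)
  have iff: "(x, y) \<in> ?F \<longleftrightarrow> (h x, h y) \<in> ?G" if "x \<in> A" "y \<in> A" for x y
  proof
    define P where "P = {(x, y). x \<in> A \<and> y \<in> A \<and> (h x, h y) \<in> ?G}"
    have "equiv A P"
      unfolding P_def by (rule equiv_pullback[OF equiv_eqcl]) (simp add: B)
    moreover have "fgraph f A \<subseteq> P"
      using eqcl_incl[OF fgraph_subset[OF gB]] assms B by (auto simp: fgraph_def P_def)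
    ultimately have "?F \<subseteq> P" by (rule eqcl_least)
    then show "(x, y) \<in> ?F \<Longrightarrow> (h x, h y) \<in> ?G" by (auto simp: P_def)
  next
    define P where "P = {(x, y). x \<in> B \<and> y \<in> B \<and> (k x, k y) \<in> ?F}"
    have "equiv B P"
      unfolding P_def by (rule equiv_pullback[OF equiv_eqcl]) (auto simp: B k)
    moreover have "fgraph g B \<subseteq> P"
    proof
      fix p assume "p \<in> fgraph g B"
      then obtain x where x: "x \<in> A" and p: "p = (h x, g (h x))" by (auto simp: fgraph_def B)
      have fx: "f x \<in> A" using x assms by auto
      have "(x, f x) \<in> ?F"
        using eqcl_incl[OF fgraph_subset[OF assms(2)]] x by (auto simp: fgraph_def)
      then show "p \<in> P"
        using assms(3)[OF x, symmetric] k x fx by (auto simp: P_def B p)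
    qed
    ultimately have "?G \<subseteq> P" by (rule eqcl_least)
    then show "(h x, h y) \<in> ?G \<Longrightarrow> (x, y) \<in> ?F" using k that by (auto simp: P_def)
  qed
  have cls: "h ` (?F `` {x}) = ?G `` {h x}" if "x \<in> A" for x
  proof
    show "h ` (?F `` {x}) \<subseteq> ?G `` {h x}"
    proof clarify
      fix y assume "(x, y) \<in> ?F"
      moreover from this have "y \<in> A" by (simp add: eqcl_def)
      ultimately show "(h x, h y) \<in> ?G" using iff[OF that] by simp
    qed
    show "?G `` {h x} \<subseteq> h ` (?F `` {x})"
    proof clarify
      fix y assume y: "(h x, y) \<in> ?G"
      then have "y \<in> B" by (simp add: eqcl_def)
      then obtain z where "z \<in> A" "y = h z" using B by auto
      then show "y \<in> h ` (?F `` {x})" using iff[OF that] y by blast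
    qed
  qed
  have "(\<lambda>X. h ` X) ` (A // ?F) = B // ?G"
    using cls unfolding quotient_def image_UN by (simp add: B)
  moreover have "inj_on (\<lambda>X. h ` X) (A // ?F)"
  proof (rule inj_on_subset[OF inj_on_image])
    show "inj_on h (\<Union>(Pow A))" using inj by simp
    show "A // ?F \<subseteq> Pow A" by (auto simp: quotient_def eqcl_def)
  qed
  ultimately show ?thesis unfolding norb_def by (metis card_image)
qed

lemma norb_Un_disjoint:
  assumes "finite A" "finite B" "A \<inter> B = {}" "f ` A \<subseteq> A" "f ` B \<subseteq> B"
  shows "norb f (A \<union> B) = norb f A + norb f B"
proof -
  let ?EA = "eqcl A (fgraph f A)" and ?EB = "eqcl B (fgraph f B)"
  let ?E = "eqcl (A \<union> B) (fgraph f (A \<union> B))"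
  have E: "?E = ?EA \<union> ?EB"
  proof
    have "equiv (A \<union> B) (?EA \<union> ?EB)"
    proof (rule equivI)
      show "?EA \<union> ?EB \<subseteq> (A \<union> B) \<times> (A \<union> B)" using eqcl_subset by blast
      show "refl_on (A \<union> B) (?EA \<union> ?EB)"
        using eqcl_refl[of _ A] eqcl_refl[of _ B] unfolding refl_on_def by blast
      show "sym (?EA \<union> ?EB)"
        using equiv_eqcl[of A] equiv_eqcl[of B] by (auto elim!: equivE intro!: sym_Un)
      show "trans (?EA \<union> ?EB)"
      proof (rule transI)
        fix x y z assume xyz: "(x, y) \<in> ?EA \<union> ?EB" "(y, z) \<in> ?EA \<union> ?EB"
        have "y \<in> A \<and> y \<notin> B \<or> y \<in> B \<and> y \<notin> A"
          using xyz eqcl_subset[of A] eqcl_subset[of B] assms(3) by blast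
        then show "(x, z) \<in> ?EA \<union> ?EB"
          using xyz eqcl_subset[of A] eqcl_subset[of B]
            eqcl_trans[of x y A _ z] eqcl_trans[of x y B _ z] by blast
      qed
    qed
    moreover have "fgraph f (A \<union> B) \<subseteq> ?EA \<union> ?EB"
      using eqcl_incl[OF fgraph_subset[OF assms(4)]] eqcl_incl[OF fgraph_subset[OF assms(5)]]
      by (auto simp: fgraph_def)
    ultimately show "?E \<subseteq> ?EA \<union> ?EB" by (rule eqcl_least)
    have "fgraph f A \<union> fgraph f B \<subseteq> fgraph f (A \<union> B)" by (auto simp: fgraph_def)
    then have "((fgraph f A \<union> (fgraph f A)\<inverse>)\<^sup>* \<union> (fgraph f B \<union> (fgraph f B)\<inverse>)\<^sup>*)
        \<subseteq> (fgraph f (A \<union> B) \<union> (fgraph f (A \<union> B))\<inverse>)\<^sup>*"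
      by (intro Un_least rtrancl_mono) auto
    then show "?EA \<union> ?EB \<subseteq> ?E" unfolding eqcl_def by blast
  qed
  have "(A \<union> B) // ?E = A // ?EA \<union> B // ?EB"
  proof -
    have "(?EA \<union> ?EB) `` {x} = ?EA `` {x}" if "x \<in> A" for x
      using that eqcl_subset[of B] assms(3) by blast
    moreover have "(?EA \<union> ?EB) `` {x} = ?EB `` {x}" if "x \<in> B" for x
      using that eqcl_subset[of A] assms(3) by blast
    ultimately show ?thesis unfolding E quotient_def by simp
  qed
  moreover have "A // ?EA \<inter> B // ?EB = {}"
  proof -
    have False if "X \<in> A // ?EA" "X \<in> B // ?EB" for X
      using in_quotient_imp_non_empty[OF equiv_eqcl that(1)]
        in_quotient_imp_subset[OF equiv_eqcl that(1)] in_quotient_imp_subset[OF equiv_eqcl that(2)]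
        assms(3) by blast
    then show ?thesis by blast
  qed
  moreover have "finite (A // ?EA)" "finite (B // ?EB)"
    using assms by (auto simp: finite_quotient eqcl_subset)
  ultimately show ?thesis by (simp add: norb_def card_Un_disjoint)
qed

lemma norb_cong: "(\<And>x. x \<in> A \<Longrightarrow> f x = g x) \<Longrightarrow> norb f A = norb g A"
  unfolding norb_def fgraph_def by (metis (no_types, lifting) image_cong)

lemma fgraph_cong: "(\<And>x. x \<in> A \<Longrightarrow> f x = g x) \<Longrightarrow> fgraph f A = fgraph g A"
  unfolding fgraph_def by (intro image_cong) auto

section \<open>Planar permutation triples\<close>

text \<open>A combinatorial map: the darts in A are paired by the involution \<tau>, whose orbits
  are labelled by \<open>sq\<close>, and a permutation f of A supplies the cyclic data. For a
  gluing, the darts are the positive vertices and the labels are the squares.\<close>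

locale paired_darts =
  fixes A :: "'b set" and \<tau> :: "'b \<Rightarrow> 'b" and sq :: "'b \<Rightarrow> 's"
  assumes finite_darts: "finite A"
    and \<tau>_in: "x \<in> A \<Longrightarrow> \<tau> x \<in> A"
    and \<tau>_\<tau>: "x \<in> A \<Longrightarrow> \<tau> (\<tau> x) = x"
    and \<tau>_neq: "x \<in> A \<Longrightarrow> \<tau> x \<noteq> x"
    and sq_eq_iff: "x \<in> A \<Longrightarrow> y \<in> A \<Longrightarrow> sq x = sq y \<longleftrightarrow> y = x \<or> y = \<tau> x"
begin

text \<open>Interpolates between f, for T empty, and \<tau> composed with f, for T all labels.
  Adding one label composes with a transposition, so it raises the number of orbits by at most
  one.\<close>

definition tw :: "('b \<Rightarrow> 'b) \<Rightarrow> 's set \<Rightarrow> 'b \<Rightarrow> 'b" where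
  "tw f T x = (if sq (f x) \<in> T then \<tau> (f x) else f x)"

lemma sq_\<tau>: "x \<in> A \<Longrightarrow> sq (\<tau> x) = sq x"
  using sq_eq_iff[of x "\<tau> x"] \<tau>_in by auto

lemma tw_empty [simp]: "tw f {} = f"
  by (auto simp: tw_def)

lemma tw_in: "f ` A \<subseteq> A \<Longrightarrow> x \<in> A \<Longrightarrow> tw f T x \<in> A"
  using \<tau>_in by (auto simp: tw_def)

lemma tw_tw:
  assumes "f ` A \<subseteq> A" "x \<in> A"
  shows "tw (tw f T) U x = tw f (T - U \<union> (U - T)) x"
  using assms sq_\<tau>[of "f x"] \<tau>_\<tau>[of "f x"] by (auto simp: tw_def)

lemma tw_image:
  assumes "f ` A = A"
  shows "tw f T ` A = A"
proof
  show "tw f T ` A \<subseteq> A" using tw_in[of f] assms by auto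
  have "inj_on f A" using assms finite_darts by (simp add: eq_card_imp_inj_on)
  have "inj_on (tw f T) A"
  proof (rule inj_on_inverseI[where g = "\<lambda>y. the_inv_into A f (if sq y \<in> T then \<tau> y else y)"])
    fix x assume "x \<in> A"
    then have "f x \<in> A" using assms by auto
    then have "(if sq (tw f T x) \<in> T then \<tau> (tw f T x) else tw f T x) = f x"
      by (auto simp: tw_def sq_\<tau> \<tau>_\<tau>)
    then show "the_inv_into A f (if sq (tw f T x) \<in> T then \<tau> (tw f T x) else tw f T x) = x"
      using \<open>inj_on f A\<close> \<open>x \<in> A\<close> by (simp add: the_inv_into_f_f)
  qed
  then show "A \<subseteq> tw f T ` A"
    using \<open>tw f T ` A \<subseteq> A\<close> endo_inj_surj[OF finite_darts] by blast
qed

lemma tw_insert: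
  assumes "f ` A \<subseteq> A" "x \<in> A" "a \<in> A" "sq a \<notin> T"
  shows "tw f (insert (sq a) T) x = (Transposition.transpose a (\<tau> a) \<circ> tw f T) x"
proof -
  have fx: "f x \<in> A" using assms by auto
  consider "f x = a" | "f x = \<tau> a" | "f x \<noteq> a" "f x \<noteq> \<tau> a" by auto
  then show ?thesis
  proof cases
    case 1
    then show ?thesis using assms(4) by (simp add: tw_def)
  next
    case 2
    then show ?thesis
      using assms(4) sq_\<tau>[OF assms(3)] \<tau>_\<tau>[OF assms(3)] by (simp add: tw_def)
  next
    case 3
    then have "sq (f x) \<noteq> sq a"
      using sq_eq_iff[OF assms(3) fx] by auto
    moreover have "\<tau> (f x) \<noteq> a" "\<tau> (f x) \<noteq> \<tau> a"
      using 3 \<tau>_\<tau>[OF fx] \<tau>_\<tau>[OF assms(3)] by metis+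
    ultimately show ?thesis
      using 3 by (simp add: tw_def Transposition.transpose_def)
  qed
qed

lemma norb_tw_le:
  assumes "f ` A = A" "finite U" "U \<subseteq> sq ` A" "T \<inter> U = {}"
  shows "norb (tw f (T \<union> U)) A \<le> norb (tw f T) A + card U"
  using assms(2-4)
proof (induction U)
  case (insert s U)
  then obtain a where a: "a \<in> A" "s = sq a" by auto
  have "norb (tw f (T \<union> insert s U)) A = norb (Transposition.transpose a (\<tau> a) \<circ> tw f (T \<union> U)) A"
    using insert a assms(1) tw_insert[of f _ a "T \<union> U"] by (intro norb_cong) auto
  also have "\<dots> \<le> Suc (norb (tw f (T \<union> U)) A)"
    using tw_image[OF assms(1), of "T \<union> U"] finite_darts a \<tau>_in by (intro norb_transpose_le) auto
  finally show ?case using insert by auto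
qed auto

text \<open>The orbits of f are the vertices and the labels the edges of a graph, connected by
  hypothesis; T is a spanning tree. Each new label joins two orbits into one, until a single orbit
  remains.\<close>

lemma spanning_twist:
  assumes f: "f ` A = A" and "A \<noteq> {}"
    and conn: "\<And>Y. Y \<subseteq> A \<Longrightarrow> Y \<noteq> {} \<Longrightarrow> f ` Y \<subseteq> Y \<Longrightarrow> \<tau> ` Y \<subseteq> Y \<Longrightarrow> Y = A"
  shows "\<exists>T \<subseteq> sq ` A. norb (tw f T) A = 1 \<and> Suc (card T) = norb f A"
proof -
  have pos: "norb g A > 0" for g
    unfolding norb_def using \<open>A \<noteq> {}\<close> finite_darts
    by (auto simp: card_gt_0_iff finite_quotient eqcl_subset quotient_def)
  let ?E = "\<lambda>T. eqcl A (fgraph (tw f T) A)"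
  \<comment> \<open>The last clause ensures that a label whose two darts lie in different orbits is
    not yet in T, so it can be added.\<close>
  have step: "\<exists>T \<subseteq> sq ` A. card T = k \<and> norb (tw f T) A + k = norb f A \<and>
      (\<forall>a\<in>A. sq a \<in> T \<longrightarrow> (a, \<tau> a) \<in> ?E T)" if "k < norb f A" for k
    using that
  proof (induction k)
    case 0
    then show ?case by (intro exI[of _ "{}"]) simp
  next
    case (Suc k)
    then obtain T where T: "T \<subseteq> sq ` A" "card T = k" "norb (tw f T) A + k = norb f A"
      "\<And>a. a \<in> A \<Longrightarrow> sq a \<in> T \<Longrightarrow> (a, \<tau> a) \<in> ?E T" by auto
    have im: "tw f T ` A = A" using tw_image[OF f] .
    \<comment> \<open>Otherwise every orbit of the twist is closed under \<tau> and then also under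
      f, hence is all of A; a single orbit contradicts \<open>Suc k < norb f A\<close>.\<close>
    have "\<exists>a\<in>A. (a, \<tau> a) \<notin> ?E T"
    proof (rule ccontr)
      assume "\<not> (\<exists>a\<in>A. (a, \<tau> a) \<notin> ?E T)"
      then have all: "(a, \<tau> a) \<in> ?E T" if "a \<in> A" for a using that by blast
      have cls: "?E T `` {x} = A" if "x \<in> A" for x
      proof (rule conn)
        show "?E T `` {x} \<subseteq> A" using eqcl_subset by blast
        show "?E T `` {x} \<noteq> {}" using eqcl_refl[OF that] by blast
        show "\<tau> ` (?E T `` {x}) \<subseteq> ?E T `` {x}"
        proof clarify
          fix y assume y: "(x, y) \<in> ?E T"
          then have "y \<in> A" by (simp add: eqcl_def)
          then show "(x, \<tau> y) \<in> ?E T" using eqcl_trans[OF y all] by simp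
        qed
        show "f ` (?E T `` {x}) \<subseteq> ?E T `` {x}"
        proof clarify
          fix y assume y: "(x, y) \<in> ?E T"
          then have yA: "y \<in> A" by (simp add: eqcl_def)
          have fy: "f y \<in> A" using f yA by auto
          have 1: "(y, tw f T y) \<in> ?E T"
            using eqcl_incl[OF fgraph_subset[of "tw f T" A]] im yA by (auto simp: fgraph_def)
          have "(tw f T y, f y) \<in> ?E T"
            using all[OF fy] eqcl_sym[OF all[OF fy]] eqcl_refl[OF fy] by (auto simp: tw_def)
          then show "(x, f y) \<in> ?E T" using eqcl_trans[OF y eqcl_trans[OF 1]] by simp
        qed
      qed
      have "A // ?E T = {A}"
        using cls \<open>A \<noteq> {}\<close> by (auto simp: quotient_def)
      then have "norb (tw f T) A = 1" by (simp add: norb_def)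
      then show False using T(3) Suc.prems by simp
    qed
    then obtain a where a: "a \<in> A" "(a, \<tau> a) \<notin> ?E T" by auto
    then have sa: "sq a \<notin> T" using T(4) by auto
    let ?T' = "insert (sq a) T"
    have eq: "tw f ?T' x = (Transposition.transpose a (\<tau> a) \<circ> tw f T) x" if "x \<in> A" for x
      using tw_insert[of f x a T] f that a sa by auto
    have E': "?E ?T' = eqcl A (insert (a, \<tau> a) (fgraph (tw f T) A))"
      using eqcl_transpose_merge[OF finite_darts im a(1) \<tau>_in[OF a(1)] a(2)]
      by (simp only: fgraph_cong[of A "tw f ?T'" "Transposition.transpose a (\<tau> a) \<circ> tw f T", OF eq])
    have "norb (tw f T) A = Suc (norb (Transposition.transpose a (\<tau> a) \<circ> tw f T) A)"
      using norb_transpose_merge[OF finite_darts im a(1) \<tau>_in[OF a(1)] a(2)] .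
    moreover have "norb (Transposition.transpose a (\<tau> a) \<circ> tw f T) A = norb (tw f ?T') A"
      using eq by (intro norb_cong) auto
    moreover have "finite T" using T(1) finite_darts by (auto intro: finite_subset)
    moreover have "(b, \<tau> b) \<in> ?E ?T'" if b: "b \<in> A" "sq b \<in> ?T'" for b
    proof -
      have sub: "insert (a, \<tau> a) (fgraph (tw f T) A) \<subseteq> ?E ?T'"
        unfolding E' using a \<tau>_in fgraph_subset[of "tw f T" A] im by (intro eqcl_incl) auto
      then have sub2: "?E T \<subseteq> ?E ?T'" by (intro eqcl_mono) auto
      show ?thesis
      proof (cases "sq b \<in> T")
        case True
        then show ?thesis using T(4) b sub2 by auto
      next
        case False
        then have "b = a \<or> b = \<tau> a" using b sq_eq_iff[OF a(1) b(1)] by auto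
        moreover have "(a, \<tau> a) \<in> ?E ?T'" using sub by auto
        ultimately show ?thesis using eqcl_sym[of a "\<tau> a"] \<tau>_\<tau>[OF a(1)] by auto
      qed
    qed
    ultimately show ?case
      using T sa a by (intro exI[of _ ?T']) auto
  qed
  obtain T where "T \<subseteq> sq ` A" "card T = norb f A - 1" "norb (tw f T) A + (norb f A - 1) = norb f A"
    using step[of "norb f A - 1"] pos[of f] by auto
  then show ?thesis using pos[of f] by (intro exI[of _ T]) auto
qed

section \<open>Cyclic arrangement and interleaving pairs\<close>

lemma single_orbit_enum:
  assumes g: "g ` A = A" and "norb g A = 1"
  shows "\<exists>e. bij_betw e {..<card A} A \<and> (\<forall>i<card A. g (e i) = e (Suc i mod card A))"
proof -
  have inj: "inj_on g A" using g finite_darts by (simp add: eq_card_imp_inj_on)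
  have gA: "g ` A \<subseteq> A" using g by simp
  have rel: "eqcl A (fgraph g A) = cyclic_orbit_rel g A"
    using cyclic_orbit_rel_eq_eqcl[OF gA inj] by simp
  obtain X where X: "A // eqcl A (fgraph g A) = {X}"
    using assms(2) unfolding norb_def by (auto simp: card_1_singleton_iff)
  then have "A \<noteq> {}" by (auto simp: quotient_def)
  then obtain x0 where x0: "x0 \<in> A" by auto
  have rel_all: "(x, y) \<in> cyclic_orbit_rel g A" if "x \<in> A" "y \<in> A" for x y
  proof -
    have "eqcl A (fgraph g A) `` {x} = eqcl A (fgraph g A) `` {y}"
      using X that by (metis quotientI singletonD)
    then show ?thesis using that equiv_eqcl rel by (metis eq_equiv_class)
  qed
  define e where "e i = (g ^^ i) x0" for i
  have eA: "e i \<in> A" for i using funpow_closed[OF gA x0] by (simp add: e_def)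
  have ex: "\<exists>p>0. e p = x0"
  proof -
    have "\<not> inj_on e UNIV"
      using range_inj_infinite[of e] finite_darts eA by (metis finite_subset image_subsetI)
    then obtain k l where "k < l" "e k = e l"
      unfolding inj_on_def by (metis linorder_neqE_nat)
    then show ?thesis
      using funpow_diff_cancel[OF gA inj x0 x0, of k l] unfolding e_def
      by (intro exI[of _ "l - k"]) auto
  qed
  define p where "p = (LEAST p. p > 0 \<and> e p = x0)"
  have p: "p > 0" "e p = x0" using LeastI_ex[OF ex] by (auto simp: p_def)
  have pmin: "e i \<noteq> x0" if "0 < i" "i < p" for i
    using that not_less_Least[of i "\<lambda>p. p > 0 \<and> e p = x0"] by (auto simp: p_def)
  have add: "e (i + j) = (g ^^ i) (e j)" for i j by (simp add: e_def funpow_add)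
  have e0: "e 0 = x0" by (simp add: e_def)
  have per: "e (i + p * m) = e i" for i m
  proof (induction m)
    case (Suc m)
    have "e (i + p * Suc m) = (g ^^ (i + p * m)) (e p)"
      using add[of "i + p * m" p] by (simp add: algebra_simps)
    then show ?case using Suc p by (simp add: e_def)
  qed simp
  have emod: "e i = e (i mod p)" for i
    using per[of "i mod p" "i div p"] by simp
  have inj_e: "inj_on e {..<p}"
  proof (rule linorder_inj_onI)
    fix i j assume "i < j" "i \<in> {..<p}" "j \<in> {..<p}"
    then show "e i \<noteq> e j"
      using funpow_diff_cancel[OF gA inj x0 x0, of i j] pmin[of "j - i"] unfolding e_def by fastforce
  qed auto
  have surj: "y \<in> e ` {..<p}" if y: "y \<in> A" for y
  proof -
    obtain k where "e k = y \<or> (g ^^ k) y = x0"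
      using rel_all[OF x0 y] by (auto simp: cyclic_orbit_rel_def e_def)
    then have "\<exists>k. e k = y"
    proof
      assume *: "(g ^^ k) y = x0"
      \<comment> \<open>A point of the backward orbit becomes one of the forward orbit after adding
        k full periods to the exponent.\<close>
      have "k \<le> p * k" using p by simp
      moreover have "(g ^^ k) y = (g ^^ (p * k)) x0" using * per[of 0 k] e0 by (simp add: e_def)
      ultimately have "y = (g ^^ (p * k - k)) x0"
        by (rule funpow_diff_cancel[OF gA inj y x0, rotated])
      then show ?thesis unfolding e_def by metis
    qed auto
    then obtain k where "e k = y" by auto
    then have "y = e (k mod p)" using emod by simp
    then show ?thesis using p by auto
  qed
  have bij: "bij_betw e {..<p} A"
    using inj_e surj eA by (auto simp: bij_betw_def)
  then have "card A = p" using bij_betw_same_card by fastforce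
  moreover have "g (e i) = e (Suc i mod p)" for i
    using emod[of "Suc i"] by (simp add: e_def)
  ultimately show ?thesis using bij by auto
qed

text \<open>Twisting at the first chord cuts the single cycle into the arc from i up to j and its
  complement. The second chord has one end in each, so twisting there joins them again: two
  interleaved chords leave one cycle instead of three.\<close>

lemma crossing_norb:
  assumes g: "g ` A = A" and one: "norb g A = 1"
    and e: "bij_betw e {..<card A} A" "\<And>i. i < card A \<Longrightarrow> g (e i) = e (Suc i mod card A)"
    and ij: "e j = \<tau> (e i)" "e l = \<tau> (e k)" "i < k" "k < j" "j < l" "l < card A"
  shows "norb (tw g {sq (e i), sq (e k)}) A \<le> 1"
proof -
  have inj: "e m = e m' \<longleftrightarrow> m = m'" if "m < card A" "m' < card A" for m m'
    using e(1) that by (auto simp: bij_betw_def inj_on_eq_iff)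
  have eA: "e m \<in> A" if "m < card A" for m using e(1) that by (auto simp: bij_betw_def)
  have A4: "e i \<in> A" "e j \<in> A" "e k \<in> A" "e l \<in> A" using ij(3-6) by (auto intro!: eA)
  have ne: "sq (e k) \<notin> {sq (e i)}"
  proof -
    have "e k \<noteq> e i" "e k \<noteq> e j" using inj[of k i] inj[of k j] ij by simp_all
    then show ?thesis using sq_eq_iff[OF A4(1,3)] unfolding ij(1) by auto
  qed
  let ?g = "tw g {sq (e i)}"
  have im: "?g ` A = A" using tw_image[OF g] .
  have le2: "norb ?g A \<le> 2"
    using norb_tw_le[OF g, of "{sq (e i)}" "{}"] one A4 by auto
  \<comment> \<open>The predecessor of \<open>e j\<close> is now sent to
    \<open>\<tau> (e j)\<close>, which is \<open>e i\<close>, so this half-open arc is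
    invariant.\<close>
  define Y where "Y = e ` {i..<j}"
  have YA: "Y \<subseteq> A" using eA ij by (auto simp: Y_def)
  have inv: "?g y \<in> Y" if y: "y \<in> Y" for y
  proof -
    obtain m where m: "i \<le> m" "m < j" "y = e m" using y by (auto simp: Y_def)
    then have gy: "g y = e (Suc m)" using e(2)[of m] ij by auto
    show ?thesis
    proof (cases "Suc m = j")
      case True
      then have "?g y = e i"
        using gy ij A4 \<tau>_\<tau>[OF A4(1)] sq_\<tau>[OF A4(1)] by (simp add: tw_def)
      then show ?thesis using m by (auto simp: Y_def)
    next
      case False
      then have "Suc m < j" using m by simp
      moreover from this have "sq (g y) \<noteq> sq (e i)"
        using gy sq_eq_iff[OF A4(1) eA[of "Suc m"]] inj[of "Suc m" i] inj[of "Suc m" j] ij m by auto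
      ultimately show ?thesis using gy m by (auto simp: tw_def Y_def)
    qed
  qed
  have "(y \<in> Y) = (z \<in> Y)" if "(y, z) \<in> eqcl A (fgraph ?g A)" for y z
  proof -
    have YY: "?g ` Y = Y"
    proof -
      have "inj_on ?g A" using im finite_darts by (simp add: eq_card_imp_inj_on)
      then show ?thesis
        using inv YA finite_subset[OF YA finite_darts]
        by (intro endo_inj_surj) (auto intro: inj_on_subset)
    qed
    have inj_g: "inj_on ?g A" using im finite_darts by (simp add: eq_card_imp_inj_on)
    have iff: "x \<in> Y \<longleftrightarrow> ?g x \<in> Y" if "x \<in> A" for x
    proof
      assume "?g x \<in> Y"
      then obtain x' where "x' \<in> Y" "?g x' = ?g x" using YY by (metis imageE)
      then show "x \<in> Y" using inj_g that YA by (metis inj_onD subsetD)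
    qed (rule inv)
    have "equiv A {(x, y). x \<in> A \<and> y \<in> A \<and> (x \<in> Y) = (y \<in> Y)}"
      by (rule equivI) (auto simp: refl_on_def sym_def trans_def)
    moreover have "fgraph ?g A \<subseteq> {(x, y). x \<in> A \<and> y \<in> A \<and> (x \<in> Y) = (y \<in> Y)}"
      using iff im by (auto simp: fgraph_def)
    ultimately show ?thesis using that eqcl_least by blast
  qed
  moreover have "e k \<in> Y" using ij by (auto simp: Y_def)
  moreover have "e l \<notin> Y" using ij inj by (auto simp: Y_def)
  ultimately have "(e k, \<tau> (e k)) \<notin> eqcl A (fgraph ?g A)"
    using ij(2) by metis
  then have "norb ?g A = Suc (norb (Transposition.transpose (e k) (\<tau> (e k)) \<circ> ?g) A)"
    by (intro norb_transpose_merge finite_darts im A4 \<tau>_in)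
  moreover have "norb (Transposition.transpose (e k) (\<tau> (e k)) \<circ> ?g) A
      = norb (tw g (insert (sq (e k)) {sq (e i)})) A"
    using tw_insert[of g _ "e k" "{sq (e i)}"] g A4 ne by (intro norb_cong) auto
  ultimately show ?thesis using le2 by (simp add: insert_commute)
qed

text \<open>The twist by U reaches the maximum \<open>Suc (card U)\<close> only if every label adds
  an orbit. An interleaved pair adds none, which leaves at most
  \<open>1 + (card U - 2)\<close>.\<close>

lemma noncrossing:
  assumes g: "g ` A = A" and one: "norb g A = 1"
    and e: "bij_betw e {..<card A} A" "\<And>i. i < card A \<Longrightarrow> g (e i) = e (Suc i mod card A)"
    and U: "U \<subseteq> sq ` A" "norb (tw g U) A = Suc (card U)"
    and ij: "e j = \<tau> (e i)" "e l = \<tau> (e k)" "sq (e i) \<in> U" "sq (e k) \<in> U" "l < card A"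
  shows "\<not> (i < k \<and> k < j \<and> j < l)"
proof
  assume *: "i < k \<and> k < j \<and> j < l"
  let ?V = "{sq (e i), sq (e k)}"
  have A2: "e i \<in> A" "e k \<in> A" using * ij e(1) by (auto simp: bij_betw_def)
  have "inj_on e {..<card A}" using e(1) by (simp add: bij_betw_def)
  then have "e k \<noteq> e i" "e k \<noteq> e j"
    using * ij(5) inj_on_eq_iff[of e "{..<card A}" k] by simp_all
  then have ne: "sq (e i) \<noteq> sq (e k)"
    using sq_eq_iff[OF A2] ij(1) by metis
  have "finite U" using U(1) finite_darts by (auto intro: finite_subset)
  then have "norb (tw g (?V \<union> (U - ?V))) A \<le> norb (tw g ?V) A + card (U - ?V)"
    using U by (intro norb_tw_le g) auto
  moreover have "?V \<union> (U - ?V) = U" using ij by auto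
  moreover have "norb (tw g ?V) A \<le> 1"
    using crossing_norb[OF g one e ij(1,2)] * ij by auto
  moreover have "card (U - ?V) = card U - 2"
    using ij ne \<open>finite U\<close> by (subst card_Diff_subset) auto
  moreover have "card U \<ge> 2"
    using card_mono[OF \<open>finite U\<close>, of ?V] ij ne by auto
  ultimately show False using U(2) by simp
qed

context
  fixes f
  assumes f: "f ` A = A" and ne: "A \<noteq> {}"
    and conn: "\<And>Y. Y \<subseteq> A \<Longrightarrow> Y \<noteq> {} \<Longrightarrow> f ` Y \<subseteq> Y \<Longrightarrow> \<tau> ` Y \<subseteq> Y \<Longrightarrow> Y = A"
begin

text \<open>The genus is nonnegative: starting from the single cycle given by a spanning T, each
  label outside T adds at most one orbit.\<close>

lemma norb_add_le: "norb f A + norb (tw f (sq ` A)) A \<le> card (sq ` A) + 2"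
proof -
  obtain T where T: "T \<subseteq> sq ` A" "norb (tw f T) A = 1" "Suc (card T) = norb f A"
    using spanning_twist[OF f ne conn] by auto
  have fin: "finite (sq ` A)" using finite_darts by simp
  have "norb (tw f (T \<union> (sq ` A - T))) A \<le> norb (tw f T) A + card (sq ` A - T)"
    by (rule norb_tw_le[OF f]) (use fin in auto)
  moreover have "T \<union> (sq ` A - T) = sq ` A" using T(1) by auto
  moreover have "card (sq ` A - T) = card (sq ` A) - card T"
    using T(1) fin by (meson card_Diff_subset finite_subset)
  moreover have "card T \<le> card (sq ` A)" using T(1) fin by (simp add: card_mono)
  ultimately show ?thesis using T by simp
qed

text \<open>Equality leaves no slack: twisting the single cycle again by T gives back f, twisting it
  by the complement gives the full twist, and both attain the maximum. \<open>noncrossing\<close>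
  then applies to each of the two families.\<close>

lemma planar_arrangement:
  assumes "norb f A + norb (tw f (sq ` A)) A = card (sq ` A) + 2"
  obtains T e where "T \<subseteq> sq ` A" "bij_betw e {..<card A} A"
    "\<And>i. i < card A \<Longrightarrow> tw f T (e i) = e (Suc i mod card A)"
    "\<And>i j k l. e j = \<tau> (e i) \<Longrightarrow> e l = \<tau> (e k) \<Longrightarrow> (sq (e i) \<in> T \<longleftrightarrow> sq (e k) \<in> T) \<Longrightarrow>
       i < k \<Longrightarrow> k < j \<Longrightarrow> j < l \<Longrightarrow> l < card A \<Longrightarrow> False"
proof -
  obtain T where T: "T \<subseteq> sq ` A" "norb (tw f T) A = 1" "Suc (card T) = norb f A"
    using spanning_twist[OF f ne conn] by auto
  let ?g = "tw f T"
  have g: "?g ` A = A" by (rule tw_image[OF f])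
  obtain e where e: "bij_betw e {..<card A} A" "\<forall>i<card A. ?g (e i) = e (Suc i mod card A)"
    using single_orbit_enum[OF g T(2)] by auto
  have fin: "finite (sq ` A)" using finite_darts by simp
  have "norb (tw ?g T) A = norb f A"
    using f tw_tw[of f _ T T] by (intro norb_cong) auto
  then have nT: "norb (tw ?g T) A = Suc (card T)" using T by simp
  have "norb (tw ?g (sq ` A - T)) A = norb (tw f (sq ` A)) A"
    using f tw_tw[of f _ T "sq ` A - T"] T(1) by (intro norb_cong) (auto simp: Diff_Diff_Int Un_absorb1 Un_Diff double_diff Int_absorb1)
  moreover have "card (sq ` A - T) = card (sq ` A) - card T"
    using T(1) fin by (meson card_Diff_subset finite_subset)
  moreover have "card T \<le> card (sq ` A)" using T(1) fin by (simp add: card_mono)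
  ultimately have nU: "norb (tw ?g (sq ` A - T)) A = Suc (card (sq ` A - T))"
    using assms T(3) by simp
  show thesis
  proof (rule that[OF T(1) e(1)])
    show "\<And>i. i < card A \<Longrightarrow> ?g (e i) = e (Suc i mod card A)" using e by auto
    fix i j k l
    assume *: "e j = \<tau> (e i)" "e l = \<tau> (e k)" "sq (e i) \<in> T \<longleftrightarrow> sq (e k) \<in> T"
      "i < k" "k < j" "j < l" "l < card A"
    have "e i \<in> A" "e k \<in> A" using * e(1) by (auto simp: bij_betw_def)
    then show False
      using noncrossing[OF g T(2) e(1) _ T(1) nT *(1,2)]
        noncrossing[OF g T(2) e(1) _ Diff_subset nU *(1,2)] e(2) * by auto
  qed
qed

end

end

section \<open>The permutation triple of an SBW-gluing\<close>

fun flipB :: "'a \<times> plane \<Rightarrow> 'a \<times> plane" where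
  "flipB (s, x, y) = (s, 1 - x, y)"

fun flipW :: "'a \<times> plane \<Rightarrow> 'a \<times> plane" where
  "flipW (s, x, y) = (s, x, 1 - y)"

fun opposite :: "'a \<times> plane \<Rightarrow> 'a \<times> plane" where
  "opposite (s, x, y) = (s, 1 - x, 1 - y)"

text \<open>An edge of given colour is determined by its terminal vertex, so the orbits of
  \<open>Phi\<close> on each colour can be counted on \<open>V_pos S\<close>.\<close>

definition edgeB :: "'a \<times> plane \<Rightarrow> 'a edge" where
  "edgeB v = (fst v, snd (flipB v), snd v)"

definition edgeW :: "'a \<times> plane \<Rightarrow> 'a edge" where
  "edgeW v = (fst v, snd (flipW v), snd v)"

lemma fst_flip [simp]: "fst (flipB v) = fst v" "fst (flipW v) = fst v" "fst (opposite v) = fst v"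
  by (cases v; auto)+

lemma flip_flip [simp]: "flipB (flipB v) = v" "flipW (flipW v) = v" "opposite (opposite v) = v"
  by (cases v; auto)+

lemma flipW_eq: "flipW v = opposite (flipB v)"
  by (cases v) auto

lemma V_pos_iff: "v \<in> V_pos S \<longleftrightarrow> fst v \<in> S \<and> (snd v = (0, 1) \<or> snd v = (1, 0))"
  by (cases v) (auto simp: V_pos_def positive_corners_def)

lemma V_neg_iff: "v \<in> V_neg S \<longleftrightarrow> fst v \<in> S \<and> (snd v = (0, 0) \<or> snd v = (1, 1))"
  by (cases v) (auto simp: V_neg_def negative_corners_def)

lemma flip_neg: "v \<in> V_neg S \<Longrightarrow> flipB v \<in> V_pos S" "v \<in> V_neg S \<Longrightarrow> flipW v \<in> V_pos S"
  by (cases v; auto simp: V_pos_iff V_neg_iff)+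

lemma flip_pos: "v \<in> V_pos S \<Longrightarrow> flipB v \<in> V_neg S" "v \<in> V_pos S \<Longrightarrow> flipW v \<in> V_neg S"
  "v \<in> V_pos S \<Longrightarrow> opposite v \<in> V_pos S"
  by (cases v; auto simp: V_pos_iff V_neg_iff)+

lemma E_B_eq: "E_B S = edgeB ` V_pos S"
proof
  show "edgeB ` V_pos S \<subseteq> E_B S"
    by (auto simp: E_B_def edgeB_def V_pos_iff positive_corners_def negative_corners_def)
  show "E_B S \<subseteq> edgeB ` V_pos S"
  proof
    fix e assume "e \<in> E_B S"
    then obtain s p q where e: "e = (s, p, q)" "s \<in> S" "p \<in> negative_corners"
      "q \<in> positive_corners" "snd p = snd q"
      by (auto simp: E_B_def)
    then have "e = edgeB (s, q)" "(s, q) \<in> V_pos S"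
      by (auto simp: edgeB_def V_pos_def negative_corners_def positive_corners_def)
    then show "e \<in> edgeB ` V_pos S" by blast
  qed
qed

lemma E_W_eq: "E_W S = edgeW ` V_pos S"
proof
  show "edgeW ` V_pos S \<subseteq> E_W S"
    by (auto simp: E_W_def edgeW_def V_pos_iff positive_corners_def negative_corners_def)
  show "E_W S \<subseteq> edgeW ` V_pos S"
  proof
    fix e assume "e \<in> E_W S"
    then obtain s p q where e: "e = (s, p, q)" "s \<in> S" "p \<in> negative_corners"
      "q \<in> positive_corners" "fst p = fst q"
      by (auto simp: E_W_def)
    then have "e = edgeW (s, q)" "(s, q) \<in> V_pos S"
      by (auto simp: edgeW_def V_pos_def negative_corners_def positive_corners_def)
    then show "e \<in> edgeW ` V_pos S" by blast
  qed
qed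

lemma inj_edgeB: "inj edgeB" and inj_edgeW: "inj edgeW"
  by (rule injI, simp add: edgeB_def edgeW_def prod_eq_iff)+

lemma edge_ends [simp]:
  "initial (edgeB v) = flipB v" "terminal (edgeB v) = v" "fst (edgeB v) = fst v"
  "initial (edgeW v) = flipW v" "terminal (edgeW v) = v" "fst (edgeW v) = fst v"
  by (cases v; auto simp: edgeB_def edgeW_def)+

lemma E_B_E_W_disjoint: "E_B S \<inter> E_W S = {}"
proof -
  have False if "p \<in> negative_corners" "p \<in> positive_corners" for p
    using that by (auto simp: positive_corners_def negative_corners_def)
  then show ?thesis unfolding E_B_def E_W_def by (auto dest: prod_eqI)
qed

locale sbw =
  fixes S :: "'a set" and \<phi> :: "'a \<times> plane \<Rightarrow> 'a \<times> plane"
  assumes finite_S: "finite S" and bij_\<phi>: "bij_betw \<phi> (V_pos S) (V_neg S)"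
begin

definition \<beta> :: "'a \<times> plane \<Rightarrow> 'a \<times> plane" where "\<beta> v = flipB (\<phi> v)"

definition \<omega> :: "'a \<times> plane \<Rightarrow> 'a \<times> plane" where "\<omega> v = flipW (\<phi> v)"

lemma \<phi>_in: "v \<in> V_pos S \<Longrightarrow> \<phi> v \<in> V_neg S"
  using bij_\<phi> by (auto simp: bij_betw_def)

lemma finite_V_pos: "finite (V_pos S)"
  using finite_S by (simp add: V_pos_def positive_corners_def)

sublocale paired_darts "V_pos S" opposite fst
proof
  show "finite (V_pos S)" by (rule finite_V_pos)
  show "opposite v \<in> V_pos S" if "v \<in> V_pos S" for v using that by (rule flip_pos)
  show "opposite (opposite v) = v" for v :: "'a \<times> plane" by simp
  show "opposite v \<noteq> v" if "v \<in> V_pos S" for v using that by (cases v) (auto simp: V_pos_iff)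
  show "fst v = fst w \<longleftrightarrow> w = v \<or> w = opposite v" if "v \<in> V_pos S" "w \<in> V_pos S" for v w
    using that by (cases v; cases w) (auto simp: V_pos_iff)
qed

lemma fst_V_pos: "fst ` V_pos S = S"
  by (force simp: V_pos_def positive_corners_def)

lemma card_V_pos: "card (V_pos S) = 2 * card S"
  by (simp add: V_pos_def positive_corners_def card_cartesian_product)

lemma \<beta>_in: "v \<in> V_pos S \<Longrightarrow> \<beta> v \<in> V_pos S"
  and \<omega>_in: "v \<in> V_pos S \<Longrightarrow> \<omega> v \<in> V_pos S"
  unfolding \<beta>_def \<omega>_def using \<phi>_in by (blast intro: flip_neg)+

lemma inj_\<beta>: "inj_on \<beta> (V_pos S)" and inj_\<omega>: "inj_on \<omega> (V_pos S)"
  using bij_\<phi> unfolding bij_betw_def \<beta>_def \<omega>_def inj_on_def by (metis flip_flip)+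

lemma \<beta>_image: "\<beta> ` V_pos S = V_pos S"
  using endo_inj_surj[OF finite_V_pos _ inj_\<beta>] \<beta>_in by blast

lemma \<omega>_eq_tw: "v \<in> V_pos S \<Longrightarrow> \<omega> v = tw \<beta> S v"
  using \<phi>_in[of v] by (simp add: tw_def \<omega>_def \<beta>_def flipW_eq V_neg_iff)

lemma Phi_edgeB:
  assumes "v \<in> V_pos S"
  shows "Phi S \<phi> (edgeB v) = edgeB (\<beta> v)"
proof -
  have "(THE e'. e' \<in> E_B S \<and> initial e' = \<phi> v) = edgeB (\<beta> v)"
  proof (rule the_equality)
    show "edgeB (\<beta> v) \<in> E_B S \<and> initial (edgeB (\<beta> v)) = \<phi> v"
      using \<beta>_in[OF assms] by (simp add: E_B_eq) (simp add: \<beta>_def)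
    fix e' assume *: "e' \<in> E_B S \<and> initial e' = \<phi> v"
    then obtain w where "e' = edgeB w" by (auto simp: E_B_eq)
    then have "flipB w = \<phi> v" using * by simp
    then have "w = \<beta> v" unfolding \<beta>_def by (metis flip_flip(1))
    then show "e' = edgeB (\<beta> v)" using \<open>e' = edgeB w\<close> by simp
  qed
  then show ?thesis using assms by (simp add: Phi_def Phi_B_def E_B_eq)
qed

lemma Phi_edgeW:
  assumes "v \<in> V_pos S"
  shows "Phi S \<phi> (edgeW v) = edgeW (\<omega> v)"
proof -
  have "(THE e'. e' \<in> E_W S \<and> initial e' = \<phi> v) = edgeW (\<omega> v)"
  proof (rule the_equality)
    show "edgeW (\<omega> v) \<in> E_W S \<and> initial (edgeW (\<omega> v)) = \<phi> v"
      using \<omega>_in[OF assms] by (simp add: E_W_eq) (simp add: \<omega>_def)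
    fix e' assume *: "e' \<in> E_W S \<and> initial e' = \<phi> v"
    then obtain w where "e' = edgeW w" by (auto simp: E_W_eq)
    then have "flipW w = \<phi> v" using * by simp
    then have "w = \<omega> v" unfolding \<omega>_def by (metis flip_flip(2))
    then show "e' = edgeW (\<omega> v)" using \<open>e' = edgeW w\<close> by simp
  qed
  moreover have "edgeW v \<notin> E_B S"
    using assms E_B_E_W_disjoint by (auto simp: E_W_eq)
  ultimately show ?thesis by (simp add: Phi_def Phi_W_def)
qed

lemma E_all_cases:
  assumes "e \<in> E_all S"
  obtains v where "v \<in> V_pos S" "e = edgeB v" "Phi S \<phi> e = edgeB (\<beta> v)"
  | v where "v \<in> V_pos S" "e = edgeW v" "Phi S \<phi> e = edgeW (\<omega> v)"
  using assms Phi_edgeB Phi_edgeW by (auto simp: E_all_def E_B_eq E_W_eq)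

lemma edge_in_E_all: "v \<in> V_pos S \<Longrightarrow> edgeB v \<in> E_all S" "v \<in> V_pos S \<Longrightarrow> edgeW v \<in> E_all S"
  by (auto simp: E_all_def E_B_eq E_W_eq)

lemma Phi_in: "e \<in> E_all S \<Longrightarrow> Phi S \<phi> e \<in> E_all S"
  by (erule E_all_cases) (simp_all add: edge_in_E_all \<beta>_in \<omega>_in)

lemma inj_Phi: "inj_on (Phi S \<phi>) (E_all S)"
proof (rule inj_onI)
  fix e e' assume "e \<in> E_all S" "e' \<in> E_all S" and eq: "Phi S \<phi> e = Phi S \<phi> e'"
  have ne: "edgeB v \<noteq> edgeW w" if "v \<in> V_pos S" "w \<in> V_pos S" for v w
    using E_B_E_W_disjoint that by (metis E_B_eq E_W_eq disjoint_iff image_eqI)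
  from \<open>e \<in> E_all S\<close> \<open>e' \<in> E_all S\<close> eq show "e = e'"
    by (elim E_all_cases)
      (auto dest!: injD[OF inj_edgeB] injD[OF inj_edgeW] inj_onD[OF inj_\<beta>] inj_onD[OF inj_\<omega>]
        simp: ne[OF \<beta>_in \<omega>_in] ne[OF \<beta>_in \<omega>_in, symmetric])
qed

lemma finite_E_all: "finite (E_all S)"
  using finite_V_pos by (simp add: E_all_def E_B_eq E_W_eq)

lemma card_edge_orbits: "card (edge_orbits S \<phi>) = norb (Phi S \<phi>) (E_all S)"
proof -
  have "cyclic_orbit_rel (Phi S \<phi>) (E_all S) = eqcl (E_all S) (fgraph (Phi S \<phi>) (E_all S))"
    by (rule cyclic_orbit_rel_eq_eqcl) (auto simp: Phi_in inj_Phi)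
  then show ?thesis by (simp add: edge_orbits_def norb_def)
qed

lemma norb_Phi: "norb (Phi S \<phi>) (E_all S) = norb \<beta> (V_pos S) + norb \<omega> (V_pos S)"
proof -
  have "norb \<beta> (V_pos S) = norb (Phi S \<phi>) (E_B S)"
    by (rule norb_conj[where h = edgeB])
      (auto simp: E_B_eq bij_betw_def Phi_edgeB \<beta>_in intro: inj_on_subset[OF inj_edgeB])
  moreover have "norb \<omega> (V_pos S) = norb (Phi S \<phi>) (E_W S)"
    by (rule norb_conj[where h = edgeW])
      (auto simp: E_W_eq bij_betw_def Phi_edgeW \<omega>_in intro: inj_on_subset[OF inj_edgeW])
  moreover have "norb (Phi S \<phi>) (E_B S \<union> E_W S) = norb (Phi S \<phi>) (E_B S) + norb (Phi S \<phi>) (E_W S)"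
    by (intro norb_Un_disjoint E_B_E_W_disjoint)
      (auto simp: E_B_eq E_W_eq finite_V_pos Phi_edgeB Phi_edgeW \<beta>_in \<omega>_in)
  ultimately show ?thesis by (simp add: E_all_def)
qed

lemma norb_\<omega>: "norb \<omega> (V_pos S) = norb (tw \<beta> (fst ` V_pos S)) (V_pos S)"
  unfolding fst_V_pos by (rule norb_cong) (rule \<omega>_eq_tw)

end

section \<open>Transitivity from connectedness of the complex\<close>

fun half_index :: "'i half \<Rightarrow> 'i" where
  "half_index (Upper i) = i"
| "half_index (Lower i) = i"

lemma identified_eq_eqcl: "identified K = eqcl (cube_points K) (glue K)"
  by (simp add: identified_def eqcl_def)

lemma rtrancl_invariant:
  assumes "(x, y) \<in> (r \<union> r\<inverse>)\<^sup>*" "\<And>u v. (u, v) \<in> r \<Longrightarrow> P u \<longleftrightarrow> P v"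
  shows "P x \<longleftrightarrow> P y"
  using assms(1) by (induction rule: rtrancl_induct) (use assms(2) in blast)+

context sbw
begin

text \<open>Each gluing either stays in one square or passes between the squares of \<open>v\<close>
  and \<open>\<phi> v\<close>. So no identification leaves the set of squares with a vertex in Y;
  connectedness makes it all of S, and closure under \<open>opposite\<close> returns the
  vertices.\<close>

lemma \<beta>_\<tau>_transitive:
  assumes con: "complex_connected (C3 S \<phi>)"
    and Y: "Y \<subseteq> V_pos S" "Y \<noteq> {}" "\<beta> ` Y \<subseteq> Y" "opposite ` Y \<subseteq> Y"
  shows "Y = V_pos S"
proof -
  have mem: "v \<in> Y \<longleftrightarrow> fst v \<in> fst ` Y" if v: "v \<in> V_pos S" for v
  proof
    assume "fst v \<in> fst ` Y"
    then obtain w where w: "w \<in> Y" "fst w = fst v" by auto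
    then have "v = w \<or> v = opposite w" using sq_eq_iff[of w v] v Y(1) by auto
    then show "v \<in> Y" using w Y(4) by auto
  qed auto
  \<comment> \<open>Finiteness turns invariance into equality, so membership in Y can also be pulled
    back along \<beta>.\<close>
  have \<beta>_Y: "\<beta> ` Y = Y"
    using Y finite_subset[OF Y(1) finite_V_pos] inj_on_subset[OF inj_\<beta> Y(1)]
    by (intro endo_inj_surj) auto
  have \<beta>_iff: "v \<in> Y \<longleftrightarrow> \<beta> v \<in> Y" if "v \<in> V_pos S" for v
  proof
    assume "\<beta> v \<in> Y"
    then obtain w where "w \<in> Y" "\<beta> w = \<beta> v" using \<beta>_Y by (metis imageE)
    then show "v \<in> Y" using inj_onD[OF inj_\<beta>, of w v] Y(1) that by blast
  qed (use Y(3) in blast)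
  have \<phi>_iff: "fst v \<in> fst ` Y \<longleftrightarrow> fst (\<phi> v) \<in> fst ` Y" if v: "v \<in> V_pos S" for v
    using mem[OF v] mem[OF \<beta>_in[OF v]] \<beta>_iff[OF v] by (simp add: \<beta>_def)
  have glue_iff: "half_index (fst x) \<in> fst ` Y \<longleftrightarrow> half_index (fst y) \<in> fst ` Y"
    if "(x, y) \<in> glue (C3 S \<phi>)" for x y
    using that
  proof -
    consider "half_index (fst x) = half_index (fst y)"
      | e where "e \<in> E_all S" "half_index (fst x) = fst e" "half_index (fst y) = fst (Phi S \<phi> e)"
      using \<open>(x, y) \<in> glue (C3 S \<phi>)\<close> by (auto simp: C3_def base_glue_def)
    then show ?thesis
    proof cases
      case 2
      then show ?thesis
        by (elim E_all_cases) (simp_all add: \<phi>_iff \<beta>_def \<omega>_def)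
    qed simp
  qed
  have step: "half_index c \<in> fst ` Y \<longleftrightarrow> half_index d \<in> fst ` Y"
    if cd: "(c, d) \<in> {(c, d). \<exists>x y. ((c, x), (d, y)) \<in> identified (C3 S \<phi>)}" for c d
  proof -
    obtain x y where "((c, x), (d, y)) \<in> (glue (C3 S \<phi>) \<union> (glue (C3 S \<phi>))\<inverse>)\<^sup>*"
      using cd by (auto simp: identified_def)
    from rtrancl_invariant[OF this, of "\<lambda>p. half_index (fst p) \<in> fst ` Y"] glue_iff
    show ?thesis by simp
  qed
  obtain w where w: "w \<in> Y" using Y(2) by auto
  have "v \<in> Y" if v: "v \<in> V_pos S" for v
  proof -
    have "Upper (fst w) \<in> cells (C3 S \<phi>)" "Upper (fst v) \<in> cells (C3 S \<phi>)"
      using w v Y(1) by (auto simp: C3_def half_cells_def V_pos_iff)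
    then have "(Upper (fst w), Upper (fst v))
        \<in> {(c, d). \<exists>x y. ((c, x), (d, y)) \<in> identified (C3 S \<phi>)}\<^sup>*"
      using con unfolding complex_connected_def by blast
    then have "half_index (Upper (fst w)) \<in> fst ` Y \<longleftrightarrow> half_index (Upper (fst v)) \<in> fst ` Y"
      by (induction rule: rtrancl_induct) (use step in blast)+
    then show ?thesis using mem[OF v] w by simp
  qed
  then show ?thesis using Y(1) by auto
qed

lemma card_edge_orbits_le:
  assumes "complex_connected (C3 S \<phi>)" "S \<noteq> {}"
  shows "card (edge_orbits S \<phi>) \<le> card S + 2"
  unfolding card_edge_orbits norb_Phi norb_\<omega>
  using norb_add_le[OF \<beta>_image _ \<beta>_\<tau>_transitive[OF assms(1)]] assms(2) fst_V_pos by auto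

end

section \<open>Midpoints of base edges\<close>

text \<open>This and the next two notions mention only distances, so surjective isometries preserve
  them. In a unit cube \<open>sqrt 3\<close> is the diameter and is attained only by opposite
  vertices; a point at half the distance from both ends of an edge or of a face diagonal is its
  midpoint.\<close>

definition cube_vertex :: "'m::metric_space set \<Rightarrow> 'm \<Rightarrow> bool" where
  "cube_vertex X x \<longleftrightarrow> x \<in> X \<and> (\<exists>y\<in>X. dist x y = sqrt 3)"

definition edge_mid :: "'m::metric_space set \<Rightarrow> 'm \<Rightarrow> bool" where
  "edge_mid X x \<longleftrightarrow> x \<in> X \<and> (\<exists>v\<in>X. \<exists>w\<in>X. cube_vertex X v \<and> cube_vertex X w \<and>
     dist v w = 1 \<and> dist x v = 1 / 2 \<and> dist x w = 1 / 2)"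

definition face_centre :: "'m::metric_space set \<Rightarrow> 'm \<Rightarrow> bool" where
  "face_centre X x \<longleftrightarrow> x \<in> X \<and> (\<exists>v\<in>X. \<exists>w\<in>X. cube_vertex X v \<and> cube_vertex X w \<and>
     dist v w = sqrt 2 \<and> dist x v = sqrt 2 / 2 \<and> dist x w = sqrt 2 / 2)"

text \<open>In the complexes at hand the only unglued faces are the top faces of the upper cubes and the
  bottom faces of the lower ones, so that these are preserved by every isomorphism.\<close>

definition free_centre :: "'c cubed_complex \<Rightarrow> 'c \<Rightarrow> space \<Rightarrow> bool" where
  "free_centre K c x \<longleftrightarrow> face_centre (cube K c) x \<and> (\<forall>p. ((c, x), p) \<in> identified K \<longrightarrow> p = (c, x))"

text \<open>From the centre of the outer face, the midpoint of an edge is at distance 1/2 on that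
  face, \<open>sqrt (3/4)\<close> for an upright edge and \<open>sqrt (5/4)\<close> for a base edge;
  the last value singles out the base.\<close>

definition base_mid :: "'c cubed_complex \<Rightarrow> 'c \<Rightarrow> space \<Rightarrow> bool" where
  "base_mid K c x \<longleftrightarrow> edge_mid (cube K c) x \<and>
     (\<exists>z\<in>cube K c. free_centre K c z \<and> dist x z = sqrt 5 / 2)"

locale surj_isometry =
  fixes X Y :: "'m::metric_space set" and g :: "'m \<Rightarrow> 'm"
  assumes img: "g ` X = Y"
    and iso: "x \<in> X \<Longrightarrow> y \<in> X \<Longrightarrow> dist (g x) (g y) = dist x y"
begin

lemma cube_vertex_iff: "x \<in> X \<Longrightarrow> cube_vertex Y (g x) \<longleftrightarrow> cube_vertex X x"
  unfolding cube_vertex_def img[symmetric] by (auto simp: iso)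

lemma edge_mid_iff: "x \<in> X \<Longrightarrow> edge_mid Y (g x) \<longleftrightarrow> edge_mid X x"
  unfolding edge_mid_def using cube_vertex_iff by (auto simp: iso img[symmetric])

lemma face_centre_iff: "x \<in> X \<Longrightarrow> face_centre Y (g x) \<longleftrightarrow> face_centre X x"
  unfolding face_centre_def using cube_vertex_iff by (auto simp: iso img[symmetric])

end

locale complex_isomorphism =
  fixes K :: "'c cubed_complex" and L :: "'d cubed_complex" and \<sigma> g
  assumes bij_\<sigma>: "bij_betw \<sigma> (cells K) (cells L)"
    and g_img: "c \<in> cells K \<Longrightarrow> g c ` cube K c = cube L (\<sigma> c)"
    and g_iso: "c \<in> cells K \<Longrightarrow> x \<in> cube K c \<Longrightarrow> y \<in> cube K c \<Longrightarrow> dist (g c x) (g c y) = dist x y"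
    and g_ident: "c \<in> cells K \<Longrightarrow> d \<in> cells K \<Longrightarrow> x \<in> cube K c \<Longrightarrow> y \<in> cube K d \<Longrightarrow>
      ((c, x), (d, y)) \<in> identified K \<longleftrightarrow> ((\<sigma> c, g c x), (\<sigma> d, g d y)) \<in> identified L"
begin

lemma cube_iso: "c \<in> cells K \<Longrightarrow> surj_isometry (cube K c) (cube L (\<sigma> c)) (g c)"
  by unfold_locales (auto simp: g_img g_iso)

lemma \<sigma>_in: "c \<in> cells K \<Longrightarrow> \<sigma> c \<in> cells L"
  using bij_\<sigma> by (auto simp: bij_betw_def)

lemma g_inj: "c \<in> cells K \<Longrightarrow> x \<in> cube K c \<Longrightarrow> y \<in> cube K c \<Longrightarrow> g c x = g c y \<longleftrightarrow> x = y"
  using g_iso[of c x y] by (metis dist_eq_0_iff)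

lemma free_centre_iff:
  assumes c: "c \<in> cells K" "x \<in> cube K c"
  shows "free_centre L (\<sigma> c) (g c x) \<longleftrightarrow> free_centre K c x"
proof -
  have "(\<forall>p. ((\<sigma> c, g c x), p) \<in> identified L \<longrightarrow> p = (\<sigma> c, g c x)) \<longleftrightarrow>
      (\<forall>p. ((c, x), p) \<in> identified K \<longrightarrow> p = (c, x))" (is "?l \<longleftrightarrow> ?r")
  proof
    assume l: ?l
    show ?r
    proof (intro allI impI)
      fix p assume p: "((c, x), p) \<in> identified K"
      obtain d y where dy: "p = (d, y)" by (cases p)
      have d: "d \<in> cells K" "y \<in> cube K d"
        using p by (auto simp: identified_def cube_points_def dy)
      have "((\<sigma> c, g c x), (\<sigma> d, g d y)) \<in> identified L"
        using p g_ident[OF c(1) d(1) c(2) d(2)] dy by blast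
      then have "(\<sigma> d, g d y) = (\<sigma> c, g c x)" using l by blast
      then have "\<sigma> d = \<sigma> c \<and> g d y = g c x" by simp
      moreover from this have "d = c" using bij_\<sigma> c d by (auto simp: bij_betw_def inj_on_eq_iff)
      ultimately show "p = (c, x)" using g_inj[OF c(1), of y x] c d dy by auto
    qed
  next
    assume r: ?r
    show ?l
    proof (intro allI impI)
      fix p assume p: "((\<sigma> c, g c x), p) \<in> identified L"
      obtain d' y' where dy: "p = (d', y')" by (cases p)
      have d': "d' \<in> cells L" "y' \<in> cube L d'"
        using p by (auto simp: identified_def cube_points_def dy)
      then obtain d where d: "d \<in> cells K" "d' = \<sigma> d" using bij_\<sigma> by (auto simp: bij_betw_def)
      then obtain y where y: "y \<in> cube K d" "y' = g d y" using d' g_img[OF d(1)] by blast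
      then have "((c, x), (d, y)) \<in> identified K" using p g_ident[OF c(1) d(1) c(2) y(1)] d dy by blast
      then have "(d, y) = (c, x)" using r by blast
      then show "p = (\<sigma> c, g c x)" using dy d y by simp
    qed
  qed
  then show ?thesis
    unfolding free_centre_def using surj_isometry.face_centre_iff[OF cube_iso[OF c(1)] c(2)] by blast
qed

lemma base_mid_iff:
  assumes c: "c \<in> cells K" "x \<in> cube K c"
  shows "base_mid L (\<sigma> c) (g c x) \<longleftrightarrow> base_mid K c x"
proof -
  have "(\<exists>z\<in>cube L (\<sigma> c). free_centre L (\<sigma> c) z \<and> dist (g c x) z = sqrt 5 / 2) \<longleftrightarrow>
      (\<exists>z\<in>cube K c. free_centre K c z \<and> dist x z = sqrt 5 / 2)"
    unfolding g_img[OF c(1), symmetric]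
    by (simp add: free_centre_iff[OF c(1)] g_iso[OF c] cong: bex_cong)
  then show ?thesis
    unfolding base_mid_def surj_isometry.edge_mid_iff[OF cube_iso[OF c(1)] c(2)] by simp
qed

end

lemma complex_isoE:
  assumes "complex_iso K L"
  obtains \<sigma> g where "complex_isomorphism K L \<sigma> g"
proof -
  obtain \<sigma> g where *: "bij_betw \<sigma> (cells K) (cells L)"
     "\<forall>c\<in>cells K. g c ` cube K c = cube L (\<sigma> c) \<and>
        (\<forall>x\<in>cube K c. \<forall>y\<in>cube K c. dist (g c x) (g c y) = dist x y)"
     "\<forall>(c, x)\<in>cube_points K. \<forall>(d, y)\<in>cube_points K.
        ((c, x), (d, y)) \<in> identified K \<longleftrightarrow>
        ((\<sigma> c, g c x), (\<sigma> d, g d y)) \<in> identified L"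
    using assms unfolding complex_iso_def by blast
  have "complex_isomorphism K L \<sigma> g"
  proof
    fix c d x y assume "c \<in> cells K" "d \<in> cells K" "x \<in> cube K c" "y \<in> cube K d"
    then have "(c, x) \<in> cube_points K" "(d, y) \<in> cube_points K" by (auto simp: cube_points_def)
    then show "((c, x), (d, y)) \<in> identified K \<longleftrightarrow> ((\<sigma> c, g c x), (\<sigma> d, g d y)) \<in> identified L"
      using *(3) by fastforce
  qed (use * in auto)
  then show thesis by (rule that)
qed

section \<open>Vertices, edge midpoints and face centres of the half cubes\<close>

fun height :: "'i half \<Rightarrow> real" where
  "height (Upper i) = 1"
| "height (Lower i) = -1"

definition mids :: "plane set" where
  "mids = {(1/2, 0), (1/2, 1), (0, 1/2), (1, 1/2)}"

lemma dist_space: "dist ((a, b), t) ((a', b'), t') = sqrt ((a - a')\<^sup>2 + (b - b')\<^sup>2 + (t - t')\<^sup>2)"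
  for a b t a' b' t' :: real
  by (simp add: dist_Pair_Pair dist_real_def)

lemma mem_half_cube:
  "((a, b), t) \<in> half_cube c \<longleftrightarrow> 0 \<le> a \<and> a \<le> 1 \<and> 0 \<le> b \<and> b \<le> 1 \<and>
     0 \<le> t * height c \<and> t * height c \<le> 1"
  by (cases c) (auto simp: unit_square_def)

lemma height_cases: "height c = 1 \<or> height c = -1"
  by (cases c) auto

text \<open>Equality in the triangle inequality makes \<open>x - v\<close> and \<open>w - x\<close>
  point in the same direction, and they have the same length.\<close>

lemma eq_midpoint_of_dist:
  fixes x v w :: "'e::real_inner"
  assumes "dist x v = dist v w / 2" "dist x w = dist v w / 2"
  shows "x = midpoint v w"
proof -
  have "norm ((x - v) + (w - x)) = norm (x - v) + norm (w - x)"
    using assms by (simp add: dist_norm norm_minus_commute)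
  then have "norm (x - v) *\<^sub>R (w - x) = norm (w - x) *\<^sub>R (x - v)"
    by (rule norm_triangle_eq[THEN iffD1])
  moreover have "norm (x - v) = norm (w - x)"
    using assms by (simp add: dist_norm norm_minus_commute)
  ultimately have "x - v = w - x \<or> norm (x - v) = 0" by auto
  then have "x - v = w - x"
    using \<open>norm (x - v) = norm (w - x)\<close> by auto
  then have "2 *\<^sub>R x = v + w" by (simp add: scaleR_2 algebra_simps)
  then have "(1/2) *\<^sub>R (2 *\<^sub>R x) = (1/2) *\<^sub>R (v + w)" by simp
  then show ?thesis by (simp add: midpoint_def)
qed

text \<open>Each coordinate difference is at most 1 in absolute value, so squares adding up to 3
  force all of them to be extreme.\<close>

lemma cube_vertex_half_cube:
  "cube_vertex (half_cube c) ((a, b), t) \<longleftrightarrow> a \<in> {0, 1} \<and> b \<in> {0, 1} \<and> t \<in> {0, height c}"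
proof
  assume "cube_vertex (half_cube c) ((a, b), t)"
  then obtain a' b' t' where y: "((a, b), t) \<in> half_cube c" "((a', b'), t') \<in> half_cube c"
    "dist ((a, b), t) ((a', b'), t') = sqrt 3"
    by (auto simp: cube_vertex_def)
  have s: "(a - a')\<^sup>2 + (b - b')\<^sup>2 + (t - t')\<^sup>2 = 3"
    using y(3) unfolding dist_space by simp
  have 1: "u\<^sup>2 \<le> 1" if "\<bar>u\<bar> \<le> 1" for u :: real using that by (simp add: abs_square_le_1)
  have le: "(a - a')\<^sup>2 \<le> 1" "(b - b')\<^sup>2 \<le> 1" "(t - t')\<^sup>2 \<le> 1"
    using y(1,2) height_cases[of c] unfolding mem_half_cube by (auto intro!: 1)
  have "\<bar>a - a'\<bar> = 1" "\<bar>b - b'\<bar> = 1" "\<bar>t - t'\<bar> = 1"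
    using s le by (auto simp: abs_square_eq_1[symmetric])
  then show "a \<in> {0, 1} \<and> b \<in> {0, 1} \<and> t \<in> {0, height c}"
    using y(1,2) height_cases[of c] unfolding mem_half_cube by auto
next
  assume r: "a \<in> {0, 1} \<and> b \<in> {0, 1} \<and> t \<in> {0, height c}"
  have "dist ((a, b), t) ((1 - a, 1 - b), height c - t) = sqrt 3"
    unfolding dist_space using r height_cases[of c] by (auto simp: power2_eq_square)
  moreover have "((a, b), t) \<in> half_cube c" "((1 - a, 1 - b), height c - t) \<in> half_cube c"
    using r height_cases[of c] unfolding mem_half_cube by auto
  ultimately show "cube_vertex (half_cube c) ((a, b), t)" unfolding cube_vertex_def by blast
qed

text \<open>Either the two values agree and their mean is 0 or h, or they differ and the mean is
  \<open>h / 2\<close>. The identity covers both cases, so the distance of two vertices determines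
  how far their midpoint is from the centre of the cube.\<close>

lemma half_sum_cases:
  fixes a a' h :: real
  assumes "a \<in> {0, h}" "a' \<in> {0, h}"
  shows "(a + a') / 2 \<in> {0, h / 2, h}" "(a - a')\<^sup>2 + 4 * ((a + a') / 2 - h / 2)\<^sup>2 = h\<^sup>2"
  using assms by (auto simp: power2_eq_square)

lemma edge_mid_dist_iff:
  "edge_mid (half_cube c) x \<and> dist x (square_centre, height c) = sqrt 5 / 2 \<longleftrightarrow>
     snd x = 0 \<and> fst x \<in> mids"
proof
  assume *: "edge_mid (half_cube c) x \<and> dist x (square_centre, height c) = sqrt 5 / 2"
  then obtain a b t a' b' t' where v: "cube_vertex (half_cube c) ((a, b), t)"
    "cube_vertex (half_cube c) ((a', b'), t')" "dist ((a, b), t) ((a', b'), t') = 1"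
    "dist x ((a, b), t) = 1 / 2" "dist x ((a', b'), t') = 1 / 2"
    by (auto simp: edge_mid_def)
  have x: "x = midpoint ((a, b), t) ((a', b'), t')"
    using v by (intro eq_midpoint_of_dist) auto
  then have x': "x = (((a + a') / 2, (b + b') / 2), (t + t') / 2)"
    by (simp add: midpoint_def)
  have bits: "a \<in> {0, 1}" "b \<in> {0, 1}" "t \<in> {0, height c}"
      "a' \<in> {0, 1}" "b' \<in> {0, 1}" "t' \<in> {0, height c}"
    using v(1,2) unfolding cube_vertex_half_cube by blast+
  have h2: "(height c)\<^sup>2 = 1" using height_cases[of c] by auto
  have hs: "(a + a') / 2 \<in> {0, 1 / 2, 1}" "(a - a')\<^sup>2 + 4 * ((a + a') / 2 - 1 / 2)\<^sup>2 = 1"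
    "(b + b') / 2 \<in> {0, 1 / 2, 1}" "(b - b')\<^sup>2 + 4 * ((b + b') / 2 - 1 / 2)\<^sup>2 = 1"
    "(t + t') / 2 \<in> {0, height c / 2, height c}"
    "(t - t')\<^sup>2 + 4 * ((t + t') / 2 - height c / 2)\<^sup>2 = 1"
    using half_sum_cases[OF bits(1,4)] half_sum_cases[OF bits(2,5)] half_sum_cases[OF bits(3,6)] h2
    unfolding power_one h2 by blast+
  have "sqrt 5 / 2 = sqrt (5 / 4)" by (simp add: real_sqrt_divide)
  then have "((a + a') / 2 - 1/2)\<^sup>2 + ((b + b') / 2 - 1/2)\<^sup>2 + ((t + t') / 2 - height c)\<^sup>2 = 5 / 4"
    using * unfolding x' dist_space by simp
  note far = this
  have "(a - a')\<^sup>2 + (b - b')\<^sup>2 + (t - t')\<^sup>2 = 1"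
    using v(3) unfolding dist_space by simp
  then have near: "4 * ((a + a') / 2 - 1 / 2)\<^sup>2 + 4 * ((b + b') / 2 - 1 / 2)\<^sup>2 +
      4 * ((t + t') / 2 - height c / 2)\<^sup>2 = 2"
    using hs(2,4,6) by simp
  \<comment> \<open>\<open>far\<close> minus a quarter of \<open>near\<close> cancels the horizontal
    coordinates: 5/4 - 1/2 = 3/4.\<close>
  have "((t + t') / 2 - height c)\<^sup>2 - ((t + t') / 2 - height c / 2)\<^sup>2 = 3 / 4"
    using far near by linarith
  then have t0: "(t + t') / 2 = 0"
    using height_cases[of c] by (auto simp: power2_eq_square field_simps)
  moreover have "((a + a') / 2, (b + b') / 2) \<in> mids"
    using far hs(1,3) t0 height_cases[of c] unfolding mids_def
    by (elim insertE emptyE disjE) (simp_all add: power2_eq_square)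
  ultimately show "snd x = 0 \<and> fst x \<in> mids"
    unfolding x' by simp
next
  assume r: "snd x = 0 \<and> fst x \<in> mids"
  have "\<exists>v w. cube_vertex (half_cube c) v \<and> cube_vertex (half_cube c) w \<and> dist v w = 1 \<and> x = midpoint v w"
  proof -
    define m where "m = fst x"
    have x: "x = (m, 0)" using r by (simp add: m_def prod_eq_iff)
    have "m = (1/2, 0) \<or> m = (1/2, 1) \<or> m = (0, 1/2) \<or> m = (1, 1/2)" using r by (auto simp: mids_def m_def)
    then show ?thesis
    proof (elim disjE)
      assume "m = (1/2, 0)"
      then show ?thesis
        by (intro exI[of _ "((0, 0), 0)"] exI[of _ "((1, 0), 0)"])
          (simp add: x cube_vertex_half_cube dist_space midpoint_def)
    next
      assume "m = (1/2, 1)"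
      then show ?thesis
        by (intro exI[of _ "((0, 1), 0)"] exI[of _ "((1, 1), 0)"])
          (simp add: x cube_vertex_half_cube dist_space midpoint_def)
    next
      assume "m = (0, 1/2)"
      then show ?thesis
        by (intro exI[of _ "((0, 0), 0)"] exI[of _ "((0, 1), 0)"])
          (simp add: x cube_vertex_half_cube dist_space midpoint_def)
    next
      assume "m = (1, 1/2)"
      then show ?thesis
        by (intro exI[of _ "((1, 0), 0)"] exI[of _ "((1, 1), 0)"])
          (simp add: x cube_vertex_half_cube dist_space midpoint_def)
    qed
  qed
  then obtain v w where vw: "cube_vertex (half_cube c) v" "cube_vertex (half_cube c) w" "dist v w = 1"
    "x = midpoint v w" by auto
  have "dist x v = 1 / 2" "dist x w = 1 / 2"
    using vw(3) dist_midpoint[of v w] unfolding vw(4) by auto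
  moreover have "x \<in> half_cube c"
    using r height_cases[of c] by (cases x; cases "fst x") (auto simp: mem_half_cube mids_def)
  moreover have "v \<in> half_cube c" "w \<in> half_cube c" using vw by (auto simp: cube_vertex_def)
  ultimately have "edge_mid (half_cube c) x" using vw unfolding edge_mid_def by blast
  moreover have "dist x (square_centre, height c) = sqrt 5 / 2"
  proof -
    have "sqrt 5 / 2 = sqrt (5 / 4)" by (simp add: real_sqrt_divide)
    moreover have "(u - 1/2)\<^sup>2 + (w - 1/2)\<^sup>2 = 1/4" if "(u, w) \<in> mids" for u w
      using that by (auto simp: mids_def power2_eq_square)
    ultimately show ?thesis
      using r height_cases[of c] by (cases x; cases "fst x") (auto simp: dist_space)
  qed
  ultimately show "edge_mid (half_cube c) x \<and> dist x (square_centre, height c) = sqrt 5 / 2" by blast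
qed

lemma face_centre_half_cube:
  assumes "face_centre (half_cube c) x"
  shows "x = (square_centre, height c) \<or> x = (square_centre, 0) \<or> fst x \<in> mids \<and> snd x = height c / 2"
proof -
  obtain a b t a' b' t' where v: "cube_vertex (half_cube c) ((a, b), t)"
    "cube_vertex (half_cube c) ((a', b'), t')" "dist ((a, b), t) ((a', b'), t') = sqrt 2"
    "dist x ((a, b), t) = sqrt 2 / 2" "dist x ((a', b'), t') = sqrt 2 / 2"
    using assms by (auto simp: face_centre_def)
  have x: "x = midpoint ((a, b), t) ((a', b'), t')"
    using v by (intro eq_midpoint_of_dist) auto
  then have x': "x = (((a + a') / 2, (b + b') / 2), (t + t') / 2)"
    by (simp add: midpoint_def)
  have bits: "a \<in> {0, 1}" "b \<in> {0, 1}" "t \<in> {0, height c}"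
      "a' \<in> {0, 1}" "b' \<in> {0, 1}" "t' \<in> {0, height c}"
    using v(1,2) unfolding cube_vertex_half_cube by blast+
  have h2: "(height c)\<^sup>2 = 1" using height_cases[of c] by auto
  have hs: "(a + a') / 2 \<in> {0, 1 / 2, 1}" "(a - a')\<^sup>2 + 4 * ((a + a') / 2 - 1 / 2)\<^sup>2 = 1"
    "(b + b') / 2 \<in> {0, 1 / 2, 1}" "(b - b')\<^sup>2 + 4 * ((b + b') / 2 - 1 / 2)\<^sup>2 = 1"
    "(t + t') / 2 \<in> {0, height c / 2, height c}"
    "(t - t')\<^sup>2 + 4 * ((t + t') / 2 - height c / 2)\<^sup>2 = 1"
    using half_sum_cases[OF bits(1,4)] half_sum_cases[OF bits(2,5)] half_sum_cases[OF bits(3,6)] h2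
    unfolding power_one h2 by blast+
  have "(a - a')\<^sup>2 + (b - b')\<^sup>2 + (t - t')\<^sup>2 = 2"
    using v(3) unfolding dist_space by simp
  then have "4 * ((a + a') / 2 - 1 / 2)\<^sup>2 + 4 * ((b + b') / 2 - 1 / 2)\<^sup>2 +
      4 * ((t + t') / 2 - height c / 2)\<^sup>2 = 1"
    using hs(2,4,6) by simp
  then show ?thesis
    using hs(1,3,5) height_cases[of c] unfolding x' mids_def
    by (elim insertE emptyE disjE) (simp_all add: power2_eq_square)
qed

lemma face_centre_top: "face_centre (half_cube c) (square_centre, height c)"
proof -
  let ?v = "((0 :: real, 0 :: real), height c)" and ?w = "((1 :: real, 1 :: real), height c)"
  have "(square_centre, height c) = midpoint ?v ?w" by (simp add: midpoint_def)
  moreover have d: "dist ?v ?w = sqrt 2" unfolding dist_space by simp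
  ultimately have "dist (square_centre, height c) ?v = sqrt 2 / 2" "dist (square_centre, height c) ?w = sqrt 2 / 2"
    using dist_midpoint[of ?v ?w] by auto
  moreover have "cube_vertex (half_cube c) ?v" "cube_vertex (half_cube c) ?w"
    by (simp_all add: cube_vertex_half_cube)
  moreover have "(square_centre, height c) \<in> half_cube c"
    using height_cases[of c] by (auto simp: mem_half_cube)
  ultimately show ?thesis unfolding face_centre_def using d by (auto simp: cube_vertex_def)
qed

lemma base_mid_iff_mids:
  assumes "cube K = half_cube" and "\<And>z. free_centre K c z \<longleftrightarrow> z = (square_centre, height c)"
  shows "base_mid K c x \<longleftrightarrow> snd x = 0 \<and> fst x \<in> mids"
proof -
  have "(square_centre, height c) \<in> half_cube c"
    using height_cases[of c] by (auto simp: mem_half_cube)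
  then show ?thesis
    unfolding base_mid_def assms edge_mid_dist_iff[of c x, symmetric] by auto
qed

lemma identified_isolated:
  assumes "\<And>q. (p, q) \<notin> glue K" "\<And>q. (q, p) \<notin> glue K" "(p, q) \<in> identified K"
  shows "q = p"
proof -
  have "(p, q) \<in> (glue K \<union> (glue K)\<inverse>)\<^sup>*" using assms(3) by (simp add: identified_def)
  then show ?thesis by (cases rule: converse_rtranclE) (use assms in auto)
qed

lemma identified_sym: "(p, q) \<in> identified K \<Longrightarrow> (q, p) \<in> identified K"
  unfolding identified_eq_eqcl by (rule eqcl_sym)

lemma glue_identified:
  assumes "(p, q) \<in> glue K" "p \<in> cube_points K" "q \<in> cube_points K"
  shows "(p, q) \<in> identified K" "(q, p) \<in> identified K"
  using assms by (auto simp: identified_def)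

section \<open>Base midpoints of the SBW complex\<close>

context sbw
begin

lemma cells_C3 [simp]: "cells (C3 S \<phi>) = half_cells S" and cube_C3 [simp]: "cube (C3 S \<phi>) = half_cube"
  by (simp_all add: C3_def)

lemma edge_point_edgeB: "edge_point (edgeB (s, x, y)) r = ((1 - r) * (1 - x) + r * x, y)"
  and edge_point_edgeW: "edge_point (edgeW (s, x, y)) r = (x, (1 - r) * (1 - y) + r * y)"
  by (auto simp: edgeB_def edgeW_def algebra_simps)

lemma edge_point_half: "e \<in> E_all S \<Longrightarrow> edge_point e (1/2) \<in> mids"
proof (elim E_all_cases)
  fix v assume v: "v \<in> V_pos S" "e = edgeB v"
  obtain s x y where "v = (s, x, y)" by (cases v) auto
  then show ?thesis using v by (auto simp: edge_point_edgeB V_pos_iff mids_def field_simps)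
next
  fix v assume v: "v \<in> V_pos S" "e = edgeW v"
  obtain s x y where "v = (s, x, y)" by (cases v) auto
  then show ?thesis using v by (auto simp: edge_point_edgeW V_pos_iff mids_def field_simps)
qed

lemma mids_edge_point:
  assumes "s \<in> S" "m \<in> mids"
  obtains e where "e \<in> E_all S" "fst e = s" "edge_point e (1/2) = m"
proof -
  have in_pos: "(s, 0, 1) \<in> V_pos S" "(s, 1, 0) \<in> V_pos S" using assms(1) by (auto simp: V_pos_iff)
  have "m = (1/2, 0) \<or> m = (1/2, 1) \<or> m = (0, 1/2) \<or> m = (1, 1/2)" using assms(2) by (auto simp: mids_def)
  then show thesis
  proof (elim disjE)
    assume "m = (1/2, 0)"
    then show ?thesis
      using that[of "edgeB (s, 1, 0)"] in_pos edge_in_E_all by (simp add: edge_point_edgeB)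
  next
    assume "m = (1/2, 1)"
    then show ?thesis
      using that[of "edgeB (s, 0, 1)"] in_pos edge_in_E_all by (simp add: edge_point_edgeB)
  next
    assume "m = (0, 1/2)"
    then show ?thesis
      using that[of "edgeW (s, 0, 1)"] in_pos edge_in_E_all by (simp add: edge_point_edgeW)
  next
    assume "m = (1, 1/2)"
    then show ?thesis
      using that[of "edgeW (s, 1, 0)"] in_pos edge_in_E_all by (simp add: edge_point_edgeW)
  qed
qed

lemma edge_point_boundary:
  assumes "e \<in> E_all S"
  shows "edge_point e r \<noteq> square_centre"
  using assms
proof (elim E_all_cases)
  fix v assume v: "v \<in> V_pos S" "e = edgeB v"
  obtain s x y where "v = (s, x, y)" by (cases v) auto
  then show ?thesis using v by (auto simp: edge_point_edgeB V_pos_iff)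
next
  fix v assume v: "v \<in> V_pos S" "e = edgeW v"
  obtain s x y where "v = (s, x, y)" by (cases v) auto
  then show ?thesis using v by (auto simp: edge_point_edgeW V_pos_iff)
qed

lemma C3_glueE:
  assumes "(p, q) \<in> glue (C3 S \<phi>)"
  obtains (base) s x where "s \<in> S" "x \<in> unit_square" "p = (Upper s, (x, 0))" "q = (Lower s, (x, 0))"
  | (side) e r t where "e \<in> E_all S" "r \<in> {0..1}" "t \<in> {-1..0}"
      "p = (Lower (fst e), (edge_point e r, t))"
      "q = (Upper (fst (Phi S \<phi> e)), (edge_point (Phi S \<phi> e) r, - t))"
  using assms unfolding C3_def base_glue_def cubed_complex.simps Un_iff mem_Collect_eq prod.inject
  by blast

lemma fst_in_S: "e \<in> E_all S \<Longrightarrow> fst e \<in> S"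
  by (auto simp: E_all_def E_B_def E_W_def)

lemma mids_unit_square: "m \<in> mids \<Longrightarrow> m \<in> unit_square"
  by (auto simp: mids_def unit_square_def)

lemma base_identified:
  assumes "s \<in> S" "p \<in> unit_square"
  shows "((Upper s, (p, 0)), (Lower s, (p, 0))) \<in> identified (C3 S \<phi>)"
proof (rule glue_identified)
  show "((Upper s, (p, 0)), (Lower s, (p, 0))) \<in> glue (C3 S \<phi>)"
    using assms unfolding C3_def base_glue_def by (cases p) simp
qed (use assms in \<open>auto simp: cube_points_def half_cells_def\<close>)

lemma side_identified:
  assumes "e \<in> E_all S" "t \<in> {-1..0}"
  shows "((Lower (fst e), (edge_point e (1/2), t)),
      (Upper (fst (Phi S \<phi> e)), (edge_point (Phi S \<phi> e) (1/2), - t))) \<in> identified (C3 S \<phi>)"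
proof (rule glue_identified)
  show "((Lower (fst e), (edge_point e (1/2), t)),
      (Upper (fst (Phi S \<phi> e)), (edge_point (Phi S \<phi> e) (1/2), - t))) \<in> glue (C3 S \<phi>)"
    unfolding C3_def cubed_complex.simps
    by (rule UnI2, rule CollectI, intro exI[of _ e] exI[of _ "1/2"] exI[of _ t]) (use assms in simp)
qed (use assms fst_in_S Phi_in edge_point_half mids_unit_square in
    \<open>auto simp: C3_def cube_points_def half_cells_def\<close>)

text \<open>The base centre is glued to the opposite half cube, and each side centre to a side
  centre because \<Phi> permutes the edges. The outer centre is neither at height 0 nor over the
  boundary of the square, where all gluings take place.\<close>

lemma free_centre_C3:
  assumes c: "c \<in> half_cells S"
  shows "free_centre (C3 S \<phi>) c z \<longleftrightarrow> z = (square_centre, height c)"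
proof
  assume fc: "free_centre (C3 S \<phi>) c z"
  have single: "p = (c, z)" if "((c, z), p) \<in> identified (C3 S \<phi>)" for p
    using fc that unfolding free_centre_def by blast
  have "face_centre (half_cube c) z" using fc by (simp add: free_centre_def)
  then consider "z = (square_centre, height c)" | "z = (square_centre, 0)"
    | "fst z \<in> mids" "snd z = height c / 2"
    using face_centre_half_cube by blast
  then show "z = (square_centre, height c)"
  proof cases
    case 2
    have sc: "square_centre \<in> unit_square" by (auto simp: unit_square_def)
    obtain s where s: "s \<in> S" "c = Upper s \<or> c = Lower s" using c by (auto simp: half_cells_def)
    have "(Upper s, z) = (c, z) \<longrightarrow> (Lower s, z) = (c, z)" "(Lower s, z) = (c, z) \<longrightarrow> (Upper s, z) = (c, z)"
      using single base_identified[OF s(1) sc] identified_sym[OF base_identified[OF s(1) sc]]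
      unfolding 2 by blast+
    then show ?thesis using s(2) by auto
  next
    case 3
    from c consider s where "s \<in> S" "c = Upper s" | s where "s \<in> S" "c = Lower s"
      by (auto simp: half_cells_def)
    then show ?thesis
    proof cases
      case (1 s)
      obtain e where e: "e \<in> E_all S" "fst e = s" "edge_point e (1/2) = fst z"
        using mids_edge_point[OF 1(1) 3(1)] .
      \<comment> \<open>Side faces of upper cubes occur as targets of the gluing, so here \<Phi> has
        to be onto.\<close>
      have "Phi S \<phi> ` E_all S = E_all S"
        by (rule endo_inj_surj[OF finite_E_all _ inj_Phi]) (use Phi_in in auto)
      then obtain e' where e': "e' \<in> E_all S" "Phi S \<phi> e' = e" using e(1) by (metis imageE)
      have "z = (edge_point e (1/2), 1/2)"
        using 3 e 1 by (simp add: prod_eq_iff)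
      then have "((Lower (fst e'), (edge_point e' (1/2), -1/2)), (c, z)) \<in> identified (C3 S \<phi>)"
        using side_identified[OF e'(1), of "-1/2"] e(2) e'(2) 1 by simp
      then have "Lower (fst e') = c" using single identified_sym by blast
      then show ?thesis using 1 by simp
    next
      case (2 s)
      obtain e where e: "e \<in> E_all S" "fst e = s" "edge_point e (1/2) = fst z"
        using mids_edge_point[OF 2(1) 3(1)] .
      have "z = (edge_point e (1/2), - 1/2)"
        using 3 e 2 by (simp add: prod_eq_iff)
      then have "((c, z), (Upper (fst (Phi S \<phi> e)), (edge_point (Phi S \<phi> e) (1/2), - (- 1/2))))
          \<in> identified (C3 S \<phi>)"
        using side_identified[OF e(1), of "-1/2"] e(2) 2 by simp
      then have "Upper (fst (Phi S \<phi> e)) = c" using single by blast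
      then show ?thesis using 2 by simp
    qed
  qed
next
  assume z: "z = (square_centre, height c)"
  have "free_centre (C3 S \<phi>) c (square_centre, height c)"
    unfolding free_centre_def
  proof (intro conjI allI impI)
    show "face_centre (cube (C3 S \<phi>) c) (square_centre, height c)" by (simp add: face_centre_top)
    fix p assume p: "((c, (square_centre, height c)), p) \<in> identified (C3 S \<phi>)"
    show "p = (c, (square_centre, height c))"
    proof (rule identified_isolated[OF _ _ p])
      fix q
      show "((c, (square_centre, height c)), q) \<notin> glue (C3 S \<phi>)"
      proof
        assume "((c, (square_centre, height c)), q) \<in> glue (C3 S \<phi>)"
        then show False
          by (cases rule: C3_glueE) (use edge_point_boundary height_cases[of c] in fastforce)+
      qed
      show "(q, (c, (square_centre, height c))) \<notin> glue (C3 S \<phi>)"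
      proof
        assume "(q, (c, (square_centre, height c))) \<in> glue (C3 S \<phi>)"
        then show False
          by (cases rule: C3_glueE) (use edge_point_boundary[OF Phi_in] height_cases[of c] in fastforce)+
      qed
    qed
  qed
  then show "free_centre (C3 S \<phi>) c z" using z by simp
qed

lemma base_mid_C3: "c \<in> half_cells S \<Longrightarrow> base_mid (C3 S \<phi>) c x \<longleftrightarrow> snd x = 0 \<and> fst x \<in> mids"
  by (rule base_mid_iff_mids) (auto simp: free_centre_C3)

end

section \<open>Separation in the sphere\<close>

text \<open>Stereographic projection. It carries invariance of domain, the Jordan curve theorem and
  Janiszewski's theorem from the plane to the sphere.\<close>

lemma punctured_S2_homeomorphism:
  assumes "x0 \<in> S2"
  obtains h k where "homeomorphism (S2 - {x0}) (UNIV :: complex set) h k"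
proof -
  define c :: "real ^ 3" where "c = axis 1 1"
  have c: "c \<noteq> 0" by (simp add: c_def axis_eq_0_iff)
  have "(S2 - {x0}) homeomorphic {x. c \<bullet> x = 0}"
    by (rule homeomorphic_punctured_sphere_hyperplane) (use assms c in auto)
  also have "{x. c \<bullet> x = 0} homeomorphic (UNIV :: complex set)"
    by (rule homeomorphic_affine_sets) (use c in \<open>auto simp: affine_hyperplane\<close>)
  finally show thesis using that by (auto simp: homeomorphic_def)
qed

text \<open>Removing \<open>f q\<close> from the sphere leaves a plane, where invariance of domain
  applies to \<open>U - {q}\<close>; two different choices of q together cover U.\<close>

lemma openin_S2_image:
  fixes f :: "real \<times> real \<Rightarrow> real ^ 3"
  assumes "open U" "continuous_on U f" "inj_on f U" "f ` U \<subseteq> S2"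
  shows "openin (top_of_set S2) (f ` U)"
proof -
  have punct: "openin (top_of_set S2) (f ` (U - {q}))" if "q \<in> U" for q
  proof -
    have "f q \<in> S2" using that assms(4) by auto
    then obtain h k where hk: "homeomorphism (S2 - {f q}) (UNIV :: complex set) h k"
      by (rule punctured_S2_homeomorphism)
    have sub: "f ` (U - {q}) \<subseteq> S2 - {f q}"
      using assms(3,4) that by (auto simp: inj_on_def)
    have inj_h: "inj_on h (S2 - {f q})"
      using homeomorphism_apply1[OF hk] by (rule inj_on_inverseI)
    have "open ((h \<circ> f) ` (U - {q}))"
    proof (rule invariance_of_domain_gen)
      show "open (U - {q})" using assms(1) by auto
      show "continuous_on (U - {q}) (h \<circ> f)"
        using assms(2) sub homeomorphism_cont1[OF hk]
        by (intro continuous_on_compose) (auto intro: continuous_on_subset)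
      show "inj_on (h \<circ> f) (U - {q})"
        using sub inj_h assms(3) by (intro comp_inj_on) (auto intro: inj_on_subset)
    qed simp
    then have "openin (top_of_set (S2 - {f q})) ((S2 - {f q}) \<inter> h -` ((h \<circ> f) ` (U - {q})))"
      using continuous_openin_preimage_gen homeomorphism_cont1[OF hk] by blast
    moreover have "(S2 - {f q}) \<inter> h -` ((h \<circ> f) ` (U - {q})) = f ` (U - {q})"
      using sub inj_h by (auto simp: inj_on_def image_iff)
    ultimately have "openin (top_of_set (S2 - {f q})) (f ` (U - {q}))" by simp
    moreover have "openin (top_of_set S2) (S2 - {f q})" by (simp add: openin_delete)
    ultimately show ?thesis by (rule openin_trans)
  qed
  show ?thesis
  proof (cases "U = {}")
    case False
    then obtain q where q: "q \<in> U" by auto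
    then have "U \<noteq> {q}" using assms(1) not_open_singleton by metis
    then obtain q' where q': "q' \<in> U" "q' \<noteq> q" using q by auto
    then have "f ` U = f ` (U - {q}) \<union> f ` (U - {q'})" by auto
    then show ?thesis using punct[OF q] punct[OF q'(1)] by (metis openin_Un)
  qed simp
qed

text \<open>\<open>I\<close> is the side that is bounded in the plane obtained by removing
  \<open>x0\<close>. It is open and closed in the complement of the curve, so connected sets cannot
  leave it; each point of the curve is on the frontier of both sides and is approached from
  both.\<close>

lemma Jordan_S2:
  assumes q: "simple_path q" "pathfinish q = pathstart q" "path_image q \<subseteq> S2"
    and x0: "x0 \<in> S2" "x0 \<notin> path_image q"
  obtains I where "I \<subseteq> S2 - path_image q"
    "\<And>C. connected C \<Longrightarrow> C \<subseteq> S2 - path_image q \<Longrightarrow> C \<inter> I \<noteq> {} \<Longrightarrow> C \<subseteq> I"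
    "\<And>p D. p \<in> path_image q \<Longrightarrow> openin (top_of_set S2) D \<Longrightarrow> p \<in> D \<Longrightarrow>
       D \<inter> I \<noteq> {} \<and> D \<inter> (S2 - path_image q - I) \<noteq> {}"
proof -
  obtain h k where hk: "homeomorphism (S2 - {x0}) (UNIV :: complex set) h k"
    using punctured_S2_homeomorphism[OF x0(1)] .
  have kh: "k (h x) = x" if "x \<in> S2 - {x0}" for x using hk that by (rule homeomorphism_apply1)
  have hk': "h (k y) = y" for y using homeomorphism_apply2[OF hk] by simp
  have k_in: "k y \<in> S2 - {x0}" for y using homeomorphism_image2[OF hk] by blast
  have J: "path_image q \<subseteq> S2 - {x0}" using q x0 by auto
  have cont_h: "continuous_on (S2 - {x0}) h" and cont_k: "continuous_on UNIV k"
    using hk by (auto simp: homeomorphism_def)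
  have inj_h: "inj_on h (S2 - {x0})" using kh by (rule inj_on_inverseI)
  have sp: "simple_path (h \<circ> q)"
    by (rule simple_path_continuous_image[OF q(1)])
      (use J cont_h inj_h in \<open>auto intro: continuous_on_subset inj_on_subset\<close>)
  have loop: "pathfinish (h \<circ> q) = pathstart (h \<circ> q)"
    using q(2) by (simp add: pathstart_def pathfinish_def)
  obtain inner outer where io: "open inner" "open outer" "bounded inner" "inner \<inter> outer = {}"
    "inner \<union> outer = - path_image (h \<circ> q)" "frontier inner = path_image (h \<circ> q)"
    "frontier outer = path_image (h \<circ> q)"
    using Jordan_curve[OF sp loop] by metis
  have im: "path_image (h \<circ> q) = h ` path_image q" by (simp add: path_image_def image_comp)
  define I where "I = k ` inner"
  have memI: "x \<in> I \<longleftrightarrow> x \<in> S2 - {x0} \<and> h x \<in> inner" for x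
  proof
    assume "x \<in> I"
    then show "x \<in> S2 - {x0} \<and> h x \<in> inner" using k_in hk' unfolding I_def by fastforce
  next
    assume "x \<in> S2 - {x0} \<and> h x \<in> inner"
    then show "x \<in> I" using kh[of x] unfolding I_def by (metis imageI)
  qed
  have memJ: "x \<in> path_image q \<longleftrightarrow> x \<in> S2 - {x0} \<and> h x \<in> path_image (h \<circ> q)" for x
    using J inj_on_image_mem_iff[OF inj_h _ J, of x] unfolding im by blast
  have clos: "closure inner = inner \<union> path_image (h \<circ> q)"
    using io(1,6) by (metis closure_Un_frontier)
  have IJ: "k ` closure inner = I \<union> path_image q"
  proof -
    have "(k \<circ> h) x = x" if "x \<in> path_image q" for x
      using kh[OF subsetD[OF J that]] by simp
    then have "k ` (h ` path_image q) = path_image q" unfolding image_comp by simp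
    then show ?thesis by (simp add: clos I_def im image_Un)
  qed
  \<comment> \<open>Boundedness makes the closure compact, so its image is closed in the whole
    sphere, also near the removed point.\<close>
  have "compact (k ` closure inner)"
    using io(3) cont_k by (intro compact_continuous_image) (auto intro: continuous_on_subset)
  then have closed: "closed (I \<union> path_image q)" by (simp add: IJ compact_imp_closed)
  have openI: "openin (top_of_set S2) I"
  proof -
    have "openin (top_of_set (S2 - {x0})) ((S2 - {x0}) \<inter> h -` inner)"
      by (rule continuous_openin_preimage_gen[OF cont_h io(1)])
    moreover have "(S2 - {x0}) \<inter> h -` inner = I" unfolding set_eq_iff memI by blast
    ultimately have "openin (top_of_set (S2 - {x0})) I" by simp
    moreover have "openin (top_of_set S2) (S2 - {x0})" by (simp add: openin_delete)
    ultimately show ?thesis by (rule openin_trans)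
  qed
  show thesis
  proof (rule that[of I])
    show "I \<subseteq> S2 - path_image q" using memI memJ io(5) by blast
    show "C \<subseteq> I" if C: "connected C" "C \<subseteq> S2 - path_image q" "C \<inter> I \<noteq> {}" for C
    proof -
      have "openin (top_of_set C) (C \<inter> I)"
      proof -
        obtain T where "open T" "I = S2 \<inter> T" using openI by (auto simp: openin_open)
        then have "C \<inter> I = C \<inter> T" using C(2) by auto
        then show ?thesis using \<open>open T\<close> by (simp add: openin_open_Int)
      qed
      moreover have "closedin (top_of_set C) (C \<inter> I)"
      proof -
        have "C \<inter> I = C \<inter> (I \<union> path_image q)" using C(2) by auto
        then show ?thesis using closed by (simp add: closedin_closed_Int)
      qed
      ultimately have "C \<inter> I = {} \<or> C \<inter> I = C" using C(1) connected_clopen by blast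
      then show ?thesis using C(3) by auto
    qed
    show "D \<inter> I \<noteq> {} \<and> D \<inter> (S2 - path_image q - I) \<noteq> {}"
      if p: "p \<in> path_image q" "openin (top_of_set S2) D" "p \<in> D" for p D
    proof -
      obtain T where T: "open T" "D = S2 \<inter> T" using p(2) by (auto simp: openin_open)
      have ok: "open (k -` T)" using T(1) cont_k by (simp add: open_vimage)
      have "k (h p) = p" by (rule kh[OF subsetD[OF J p(1)]])
      then have "h p \<in> k -` T" using p(3) T(2) by simp
      then have near: "\<exists>y\<in>B. k y \<in> T" if "h p \<in> closure B" for B
        using that open_Int_closure_eq_empty[OF ok, of B] by blast
      have "h p \<in> frontier inner" "h p \<in> frontier outer"
        unfolding io(6,7) im using p(1) by simp_all
      then obtain y z where y: "y \<in> inner" "k y \<in> T" and z: "z \<in> outer" "k z \<in> T"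
        using near[of inner] near[of outer] unfolding frontier_def by blast
      have "k y \<in> D \<inter> I" using y T k_in[of y] by (auto simp: I_def)
      moreover have "k z \<in> D \<inter> (S2 - path_image q - I)"
        using z T k_in[of z] io(4,5) memI[of "k z"] memJ[of "k z"] hk' by auto
      ultimately show ?thesis by blast
    qed
  qed
qed

text \<open>An arc does not separate the plane, and K does not separate u from v, as C shows; since
  the arc meets K in a connected set, the union does not separate them either. Removing
  \<open>x0\<close>, which is off K, the arc and C, makes the sphere a plane.\<close>

lemma Janiszewski_arc_S2:
  assumes x0: "x0 \<in> S2" and K: "closed K" "K \<subseteq> S2 - {x0}"
    and \<gamma>: "arc \<gamma>" "path_image \<gamma> \<subseteq> S2 - {x0}" and conn: "connected (path_image \<gamma> \<inter> K)"
    and C: "connected C" "C \<subseteq> S2 - {x0} - K" "u \<in> C" "v \<in> C" "u \<notin> path_image \<gamma>" "v \<notin> path_image \<gamma>"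
  obtains D where "connected D" "D \<subseteq> S2 - (K \<union> path_image \<gamma>)" "u \<in> D" "v \<in> D"
proof -
  obtain h k where hk: "homeomorphism (S2 - {x0}) (UNIV :: complex set) h k"
    using punctured_S2_homeomorphism[OF x0] .
  have kh: "k (h x) = x" if "x \<in> S2 - {x0}" for x using hk that by (rule homeomorphism_apply1)
  have hk': "h (k y) = y" for y using homeomorphism_apply2[OF hk] by simp
  have k_in: "k y \<in> S2 - {x0}" for y using homeomorphism_image2[OF hk] by blast
  have cont_h: "continuous_on (S2 - {x0}) h" and cont_k: "continuous_on UNIV k"
    using hk by (auto simp: homeomorphism_def)
  have inj_h: "inj_on h (S2 - {x0})" using kh by (rule inj_on_inverseI)
  have "compact K"
    using K bounded_subset[OF bounded_sphere[of 0 1], of K] by (auto simp: compact_eq_bounded_closed)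
  then have cK: "compact (h ` K)"
    using K cont_h by (intro compact_continuous_image) (auto intro: continuous_on_subset)
  have arc: "arc (h \<circ> \<gamma>)"
    using \<gamma> cont_h inj_h unfolding arc_def
    by (auto intro!: path_continuous_image comp_inj_on intro: continuous_on_subset inj_on_subset
        simp: path_image_def)
  have im: "path_image (h \<circ> \<gamma>) = h ` path_image \<gamma>" by (simp add: path_image_def image_comp)
  have "connected_component (- (path_image (h \<circ> \<gamma>) \<union> h ` K)) (h u) (h v)"
  proof (rule Janiszewski)
    show "compact (path_image (h \<circ> \<gamma>))" using arc by (simp add: compact_arc_image)
    show "closed (h ` K)" using cK by (rule compact_imp_closed)
    have "path_image (h \<circ> \<gamma>) \<inter> h ` K = h ` (path_image \<gamma> \<inter> K)"
      unfolding im using \<gamma>(2) K(2) inj_on_image_Int[OF inj_h] by simp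
    then show "connected (path_image (h \<circ> \<gamma>) \<inter> h ` K)"
      using conn K cont_h by (metis connected_continuous_image continuous_on_subset inf_le2 order_trans)
    have out: "h x \<notin> path_image (h \<circ> \<gamma>)" if "x \<in> C" "x \<notin> path_image \<gamma>" for x
      using that C(2) \<gamma>(2) inj_on_image_mem_iff[OF inj_h, of x "path_image \<gamma>"] unfolding im by blast
    show "connected_component (- path_image (h \<circ> \<gamma>)) (h u) (h v)"
      using connected_arc_complement[OF arc] out C
      by (intro connected_componentI[where T = "- path_image (h \<circ> \<gamma>)"]) auto
    have "h ` C \<subseteq> - h ` K"
    proof
      fix y assume "y \<in> h ` C"
      then obtain x where x: "x \<in> C" "y = h x" by blast
      then have "x \<in> S2 - {x0}" "x \<notin> K" using C(2) by blast+
      then show "y \<in> - h ` K" using inj_on_image_mem_iff[OF inj_h _ K(2), of x] x by simp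
    qed
    moreover have "connected (h ` C)"
      using C cont_h by (intro connected_continuous_image) (auto intro: continuous_on_subset)
    ultimately show "connected_component (- h ` K) (h u) (h v)"
      using C by (intro connected_componentI[where T = "h ` C"]) auto
  qed
  then obtain T where T: "connected T" "T \<subseteq> - (path_image (h \<circ> \<gamma>) \<union> h ` K)" "h u \<in> T" "h v \<in> T"
    by (auto simp: connected_component_def)
  show thesis
  proof (rule that[of "k ` T"])
    show "connected (k ` T)" using T cont_k by (intro connected_continuous_image) (auto intro: continuous_on_subset)
    have "k y \<notin> K \<union> path_image \<gamma>" if "y \<in> T" for y
      using T(2) that hk'[of y] unfolding im by (metis ComplD UnCI UnE imageI subsetD)
    then show "k ` T \<subseteq> S2 - (K \<union> path_image \<gamma>)" using k_in by blast
    show "u \<in> k ` T" "v \<in> k ` T" using T C kh by (metis DiffD1 image_eqI subsetD)+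
  qed
qed

section \<open>Sectors of the unit square\<close>

text \<open>Scalar product and, in the next function, determinant of the vectors from
  \<open>square_centre\<close>, with coordinates doubled so that those of the corners are 1 and
  -1.\<close>

fun dotc :: "plane \<Rightarrow> plane \<Rightarrow> real" where
  "dotc (x, y) (a, b) = (2 * x - 1) * (2 * a - 1) + (2 * y - 1) * (2 * b - 1)"

fun crossc :: "plane \<Rightarrow> plane \<Rightarrow> real" where
  "crossc (x, y) (a, b) = (2 * x - 1) * (2 * b - 1) - (2 * y - 1) * (2 * a - 1)"

definition open_square :: "plane set" where
  "open_square = {0<..<1} \<times> {0<..<1}"

text \<open>For a midpoint m of a side, one of the four triangles cut out by the diagonals, with the
  open side but without the diagonals. The \<open>wedge\<close> below is the open half of the square
  towards a corner; of the diagonals it meets only the half leading to that corner, so it isolates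
  the strand leaving there.\<close>

definition sector :: "plane \<Rightarrow> plane set" where
  "sector m = {p \<in> unit_square. \<bar>crossc p m\<bar> < dotc p m}"

definition wedge :: "plane \<Rightarrow> plane set" where
  "wedge a = {p \<in> open_square. 0 < dotc p a}"

lemma corners_eq: "corners = {(0, 0), (0, 1), (1, 0), (1, 1)}"
  by (auto simp: corners_def positive_corners_def negative_corners_def)

lemma corners_cases:
  assumes "a \<in> corners"
  obtains "a = (0, 0)" | "a = (0, 1)" | "a = (1, 0)" | "a = (1, 1)"
  using assms by (auto simp: corners_eq)

lemma mids_cases:
  assumes "m \<in> mids"
  obtains "m = (1/2, 0)" | "m = (1/2, 1)" | "m = (0, 1/2)" | "m = (1, 1/2)"
  using assms by (auto simp: mids_def)

lemma convex_halfplane: "convex {p :: plane. u * fst p + v * snd p < w}"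
proof -
  have "{p :: plane. u * fst p + v * snd p < w} = {p. (u, v) \<bullet> p < w}"
    by (auto simp: inner_prod_def)
  then show ?thesis by (simp add: convex_halfspace_lt)
qed

lemma unit_square_iff: "(x, y) \<in> unit_square \<longleftrightarrow> 0 \<le> x \<and> x \<le> 1 \<and> 0 \<le> y \<and> y \<le> 1"
  by (auto simp: unit_square_def)

lemma convex_unit_square: "convex unit_square"
  unfolding unit_square_def by (intro convex_Times convex_real_interval)

lemma convex_sector: "convex (sector m)"
proof -
  obtain a b where m: "m = (a, b)" by (cases m)
  let ?A = "2 * a - 1" and ?B = "2 * b - 1"
  have "sector m = unit_square \<inter>
      {p. 2 * (?B - ?A) * fst p + (- 2 * (?A + ?B)) * snd p < - 2 * ?A} \<inter>
      {p. (- 2 * (?A + ?B)) * fst p + 2 * (?A - ?B) * snd p < - 2 * ?B}"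
    by (auto simp: sector_def m abs_less_iff algebra_simps)
  then show ?thesis by (simp only: convex_Int convex_halfplane convex_unit_square)
qed

lemma wedge_eq:
  "wedge (a, b) = open_square \<inter>
     {p. (- 2 * (2 * a - 1)) * fst p + (- 2 * (2 * b - 1)) * snd p < - (2 * a - 1) - (2 * b - 1)}"
  by (auto simp: wedge_def algebra_simps)

lemma open_square_open: "open open_square"
  unfolding open_square_def by (intro open_Times) auto

lemma open_square_sub: "open_square \<subseteq> unit_square"
  by (auto simp: open_square_def unit_square_def)

lemma convex_open_square: "convex open_square"
  unfolding open_square_def by (intro convex_Times convex_real_interval)

lemma convex_wedge: "convex (wedge a)"
  by (cases a) (simp only: wedge_eq convex_Int convex_halfplane convex_open_square)

lemma open_wedge: "open (wedge a)"
proof -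
  obtain x y where a: "a = (x, y)" by (cases a)
  have "open {p :: plane. (- 2 * (2 * x - 1)) * fst p + (- 2 * (2 * y - 1)) * snd p
      < - (2 * x - 1) - (2 * y - 1)}"
    by (intro open_Collect_less continuous_intros)
  then show ?thesis unfolding a wedge_eq using open_square_open by (rule open_Int[rotated])
qed

lemma wedge_sub: "wedge a \<subseteq> unit_square" "wedge a \<subseteq> open_square"
  using open_square_sub by (auto simp: wedge_def)

lemma sector_sub: "sector m \<subseteq> unit_square"
  by (auto simp: sector_def)

lemma mem_diagonals_iff:
  assumes "p \<in> unit_square"
  shows "p \<in> diagonals \<longleftrightarrow> fst p = snd p \<or> fst p + snd p = 1"
proof -
  obtain x y where p: "p = (x, y)" by (cases p)
  have "(x, y) \<in> closed_segment (0, 0) (1, 1) \<longleftrightarrow> x = y"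
    using assms unfolding p by (auto simp: in_segment unit_square_def algebra_simps intro!: exI[of _ y])
  moreover have "(x, y) \<in> closed_segment (0, 1) (1, 0) \<longleftrightarrow> x + y = 1"
    using assms unfolding p by (auto simp: in_segment unit_square_def algebra_simps intro!: exI[of _ x])
  ultimately show ?thesis by (simp add: diagonals_def p)
qed

lemma mids_sector: "m \<in> mids \<Longrightarrow> m \<in> sector m"
  by (erule mids_cases) (auto simp: sector_def unit_square_def)

lemma sector_not_diagonal: "m \<in> mids \<Longrightarrow> p \<in> sector m \<Longrightarrow> p \<notin> diagonals"
  by (cases p; erule mids_cases) (auto simp: mem_diagonals_iff sector_def abs_less_iff)

lemma half_param: "p \<in> closed_segment square_centre a \<longleftrightarrow>
    (\<exists>s\<in>{0..1}. p = (1/2 + s * (fst a - 1/2), 1/2 + s * (snd a - 1/2)))"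
proof -
  have "(1 - u) *\<^sub>R square_centre + u *\<^sub>R a = (1/2 + u * (fst a - 1/2), 1/2 + u * (snd a - 1/2))" for u
    by (cases a) (simp add: field_simps)
  then show ?thesis unfolding in_segment by auto
qed

lemma half_sub_diagonals: "a \<in> corners \<Longrightarrow> closed_segment square_centre a \<subseteq> diagonals"
proof
  fix p assume a: "a \<in> corners" and "p \<in> closed_segment square_centre a"
  then obtain s where s: "0 \<le> s" "s \<le> 1" "p = (1/2 + s * (fst a - 1/2), 1/2 + s * (snd a - 1/2))"
    by (auto simp: half_param)
  then have "p \<in> unit_square" using a by (auto simp: corners_eq unit_square_def)
  then show "p \<in> diagonals" using a s by (auto simp: mem_diagonals_iff corners_eq)
qed

lemma diagonals_sub: "diagonals \<subseteq> unit_square"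
  unfolding diagonals_def using convex_unit_square
  by (intro Un_least closed_segment_subset) (auto simp: unit_square_def)

lemma half_sub: "a \<in> corners \<Longrightarrow> closed_segment square_centre a \<subseteq> unit_square"
  using half_sub_diagonals diagonals_sub by blast

lemma half_open_wedge:
  assumes "a \<in> corners" "p \<in> closed_segment square_centre a" "p \<noteq> square_centre" "p \<in> open_square"
  shows "p \<in> wedge a"
proof -
  obtain s where s: "0 \<le> s" "s \<le> 1" "p = (1/2 + s * (fst a - 1/2), 1/2 + s * (snd a - 1/2))"
    using assms(2) by (auto simp: half_param)
  then have "s > 0" using assms(3) by (cases "s = 0") auto
  then show ?thesis using assms(1,4) s by (auto simp: wedge_def corners_eq)
qed

lemma wedge_diagonal:
  assumes "a \<in> corners" "p \<in> wedge a" "p \<in> diagonals"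
  shows "p \<in> closed_segment square_centre a" "p \<noteq> square_centre"
proof -
  obtain x y where p: "p = (x, y)" by (cases p)
  have xy: "0 < x" "x < 1" "0 < y" "y < 1" "0 < dotc (x, y) a"
    using assms(2) by (auto simp: wedge_def p open_square_def)
  have "x = y \<or> x + y = 1"
    using assms(3) mem_diagonals_iff[of p] xy by (auto simp: p unit_square_iff)
  then show "p \<in> closed_segment square_centre a"
    unfolding half_param
    using assms(1) xy
    by (intro bexI[of _ "\<bar>2 * x - 1\<bar>"]; elim corners_cases disjE) (auto simp: p abs_if field_simps)
  show "p \<noteq> square_centre"
  proof
    assume "p = square_centre"
    moreover have "dotc square_centre a = 0" by (cases a) simp
    ultimately show False using xy(5) unfolding p[symmetric] by (metis order_less_irrefl)
  qed
qed

lemma wedge_sector: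
  assumes "a \<in> corners" "p \<in> wedge a" "p \<notin> diagonals"
  obtains m where "m \<in> mids" "0 < dotc m a" "p \<in> sector m"
proof -
  obtain x y where p: "p = (x, y)" by (cases p)
  have xy: "0 < x" "x < 1" "0 < y" "y < 1" "0 < dotc (x, y) a"
    using assms(2) by (auto simp: wedge_def p open_square_def)
  have ne: "x \<noteq> y" "x + y \<noteq> 1"
    using assms(3) mem_diagonals_iff[of p] xy by (auto simp: p unit_square_iff)
  have cs: "(x, y) \<in> sector (1/2, 0) \<longleftrightarrow> y < x \<and> x + y < 1"
    "(x, y) \<in> sector (1/2, 1) \<longleftrightarrow> x < y \<and> 1 < x + y"
    "(x, y) \<in> sector (0, 1/2) \<longleftrightarrow> x < y \<and> x + y < 1"
    "(x, y) \<in> sector (1, 1/2) \<longleftrightarrow> y < x \<and> 1 < x + y"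
    using xy(1-4) by (auto simp: sector_def unit_square_def abs_less_iff)
  have "\<exists>m\<in>mids. 0 < dotc m a \<and> p \<in> sector m"
    using assms(1)
  proof (cases rule: corners_cases)
    case 1
    then show ?thesis using xy(5) ne cs unfolding p mids_def by (cases "x < y") auto
  next
    case 2
    then show ?thesis using xy(5) ne cs unfolding p mids_def by (cases "x + y < 1") auto
  next
    case 3
    then show ?thesis using xy(5) ne cs unfolding p mids_def by (cases "x + y < 1") auto
  next
    case 4
    then show ?thesis using xy(5) ne cs unfolding p mids_def by (cases "x < y") auto
  qed
  then show thesis using that by blast
qed

lemma sector_wedge_meet:
  assumes "a \<in> corners" "m \<in> mids" "0 < dotc m a"
  shows "sector m \<inter> wedge a \<noteq> {}"
proof -
  have "((1/2 + fst m) / 2, (1/2 + snd m) / 2) \<in> sector m \<inter> wedge a"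
    using assms(1,3) by (rule_tac mids_cases[OF assms(2)]; elim corners_cases)
      (auto simp: sector_def wedge_def unit_square_def open_square_def)
  then show ?thesis by blast
qed

lemma half_mid_wedge:
  assumes "a \<in> corners"
  shows "midpoint square_centre a \<in> wedge a" "midpoint square_centre a \<in> closed_segment square_centre a"
proof -
  show "midpoint square_centre a \<in> closed_segment square_centre a" by simp
  show "midpoint square_centre a \<in> wedge a"
    using assms by (auto simp: corners_eq wedge_def open_square_def midpoint_def)
qed

lemma side_cases:
  assumes "side a b"
  shows "a \<in> corners" "b \<in> corners" "midpoint a b \<in> mids" "0 < dotc (midpoint a b) a"
    "0 < dotc (midpoint a b) b" "open_segment a b \<subseteq> sector (midpoint a b)" "midpoint a b \<in> open_segment a b"
proof -
  show c: "a \<in> corners" "b \<in> corners" using assms by (auto simp: side_def)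
  have ne: "a \<noteq> b" using assms by (auto simp: side_def)
  have "dist a b = 1" using assms by (simp add: side_def)
  then have d: "(fst a - fst b)\<^sup>2 + (snd a - snd b)\<^sup>2 = 1"
    by (simp add: dist_prod_def dist_real_def)
  show m: "midpoint a b \<in> mids" "0 < dotc (midpoint a b) a" "0 < dotc (midpoint a b) b"
    using c d unfolding corners_eq by (auto simp: mids_def midpoint_def)
  show "midpoint a b \<in> open_segment a b" using ne by simp
  show "open_segment a b \<subseteq> sector (midpoint a b)"
  proof
    fix p assume "p \<in> open_segment a b"
    then obtain s where s: "0 < s" "s < 1" "p = (1 - s) *\<^sub>R a + s *\<^sub>R b" by (auto simp: in_segment)
    then show "p \<in> sector (midpoint a b)"
      using c d unfolding corners_eq
      by (auto simp: sector_def unit_square_def midpoint_def abs_less_iff)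
  qed
qed

lemma adjacent_side:
  assumes "a \<in> corners" "m \<in> mids" "0 < dotc m a"
  obtains b where "side a b" "m = midpoint a b"
proof -
  have "side a (2 * fst m - fst a, 2 * snd m - snd a) \<and> m = midpoint a (2 * fst m - fst a, 2 * snd m - snd a)"
    using assms(1,3) by (rule_tac mids_cases[OF assms(2)]; elim corners_cases)
      (auto simp: side_def corners_eq midpoint_def dist_prod_def dist_real_def)
  then show thesis using that by blast
qed

section \<open>Regions of a link diagram\<close>

lemma path_image_split: "path_image g = g ` {0<..<1} \<union> {pathstart g, pathfinish g}"
proof -
  have "{0..1::real} = {0<..<1} \<union> {0, 1}" by auto
  then show ?thesis by (simp add: path_image_def pathstart_def pathfinish_def)
qed

lemma reversepath_open: "reversepath g ` {0<..<1} = g ` {0<..<1}"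
proof -
  have "(\<lambda>t::real. 1 - t) ` {0<..<1} = {0<..<1}"
  proof
    show "{0<..<1} \<subseteq> (\<lambda>t::real. 1 - t) ` {0<..<1}"
    proof
      fix x :: real assume "x \<in> {0<..<1}"
      then have "1 - x \<in> {0<..<1}" by auto
      then show "x \<in> (\<lambda>t. 1 - t) ` {0<..<1}" by (rule rev_image_eqI) simp
    qed
  qed auto
  moreover have "reversepath g ` {0<..<1} = g ` ((\<lambda>t. 1 - t) ` {0<..<1})"
    by (simp add: image_image reversepath_def)
  ultimately show ?thesis by simp
qed

lemma simple_path_interior_ne:
  assumes "simple_path g" "0 < t" "t < 1"
  shows "g t \<noteq> g 0" "g t \<noteq> g 1"
proof -
  have *: "g x = g y \<Longrightarrow> x = y \<or> x = 0 \<and> y = 1 \<or> x = 1 \<and> y = 0" if "x \<in> {0..1}" "y \<in> {0..1}" for x y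
    using assms(1) that unfolding simple_path_def loop_free_def by blast
  show "g t \<noteq> g 0" "g t \<noteq> g 1" using *[of t 0] *[of t 1] assms(2,3) by auto
qed

lemma simple_path_interior_inj:
  assumes "simple_path g" "0 < s" "s < 1" "0 \<le> t" "t \<le> 1" "g s = g t"
  shows "s = t"
proof -
  have "s = t \<or> s = 0 \<and> t = 1 \<or> s = 1 \<and> t = 0"
    using assms unfolding simple_path_def loop_free_def by (metis atLeastAtMost_iff less_imp_le)
  then show ?thesis using assms(2,3) by auto
qed

locale ldiag =
  fixes \<Gamma> :: diagram
  assumes ld: "link_diagram \<Gamma>"
begin

abbreviation "cr \<equiv> crossings \<Gamma>"
abbreviation "ch \<equiv> chart \<Gamma>"

lemma ld_facts:
  "finite cr" "cr \<noteq> {}" "cr \<subseteq> S2" "finite (edges \<Gamma>)"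
  "\<forall>g\<in>edges \<Gamma>. simple_path g \<and> path_image g \<subseteq> S2 \<and>
     pathstart g \<in> cr \<and> pathfinish g \<in> cr \<and> g ` {0<..<1} \<inter> cr = {}"
  "\<forall>g\<in>edges \<Gamma>. \<forall>g'\<in>edges \<Gamma>. g \<noteq> g' \<longrightarrow> g ` {0<..<1} \<inter> g' ` {0<..<1} = {}"
  "\<forall>x\<in>cr. continuous_on unit_square (ch x) \<and> inj_on (ch x) unit_square \<and>
     ch x ` unit_square \<subseteq> S2 \<and> ch x square_centre = x \<and>
     {p \<in> unit_square. ch x p \<in> graph \<Gamma>} = diagonals \<and>
     over \<Gamma> x \<in> {positive_corners, negative_corners}"
  "\<forall>x\<in>cr. \<forall>y\<in>cr. x \<noteq> y \<longrightarrow> ch x ` unit_square \<inter> ch y ` unit_square = {}"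
  by (insert ld, unfold link_diagram_def, elim conjE, assumption)+

lemmas finite_cr = ld_facts(1) and cr_ne = ld_facts(2) and cr_S2 = ld_facts(3) and finite_edges = ld_facts(4)

lemma edge_props:
  assumes "g \<in> edges \<Gamma>"
  shows "simple_path g" "path_image g \<subseteq> S2" "pathstart g \<in> cr" "pathfinish g \<in> cr" "g ` {0<..<1} \<inter> cr = {}"
  by (insert bspec[OF ld_facts(5) assms], elim conjE, assumption)+

lemma edges_disjoint:
  "g \<in> edges \<Gamma> \<Longrightarrow> g' \<in> edges \<Gamma> \<Longrightarrow> g \<noteq> g' \<Longrightarrow> g ` {0<..<1} \<inter> g' ` {0<..<1} = {}"
  using ld_facts(6) by blast

lemma ch_props:
  assumes "x \<in> cr"
  shows "continuous_on unit_square (ch x)" "inj_on (ch x) unit_square" "ch x ` unit_square \<subseteq> S2"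
    "ch x square_centre = x" "{p \<in> unit_square. ch x p \<in> graph \<Gamma>} = diagonals"
    "over \<Gamma> x \<in> {positive_corners, negative_corners}"
  by (insert bspec[OF ld_facts(7) assms], elim conjE, assumption)+

lemma ch_graph: "x \<in> cr \<Longrightarrow> p \<in> unit_square \<Longrightarrow> ch x p \<in> graph \<Gamma> \<longleftrightarrow> p \<in> diagonals"
  using ch_props(5) by blast

lemma ch_eq:
  assumes "x \<in> cr" "y \<in> cr" "p \<in> unit_square" "q \<in> unit_square" "ch x p = ch y q"
  shows "x = y \<and> p = q"
proof -
  have "x = y"
    using ld_facts(8) assms by blast
  then show ?thesis using ch_props(2)[OF assms(1)] assms by (auto dest: inj_onD)
qed

lemma oedgeE:
  assumes "g \<in> oriented_edges \<Gamma>"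
  obtains h where "h \<in> edges \<Gamma>" "g = h \<or> g = reversepath h"
  using assms by (auto simp: oriented_edges_def)

lemma oedge_rev: "g \<in> oriented_edges \<Gamma> \<Longrightarrow> reversepath g \<in> oriented_edges \<Gamma>"
  by (auto simp: oriented_edges_def)

lemma oedge_props:
  assumes "g \<in> oriented_edges \<Gamma>"
  shows "simple_path g" "path_image g \<subseteq> S2" "pathstart g \<in> cr" "pathfinish g \<in> cr" "g ` {0<..<1} \<inter> cr = {}"
    "path_image g \<subseteq> graph \<Gamma>"
proof -
  obtain h where h: "h \<in> edges \<Gamma>" "g = h \<or> g = reversepath h" using assms by (rule oedgeE)
  show "simple_path g" using edge_props(1)[OF h(1)] h(2) simple_path_reversepath by auto
  have "path_image g = path_image h" using h(2) by auto
  then show "path_image g \<subseteq> S2" "path_image g \<subseteq> graph \<Gamma>"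
    using edge_props(2)[OF h(1)] h(1) by (auto simp: graph_def)
  show "pathstart g \<in> cr" "pathfinish g \<in> cr" using edge_props(3,4)[OF h(1)] h(2) by auto
  have "g ` {0<..<1} = h ` {0<..<1}" using h(2) reversepath_open by auto
  then show "g ` {0<..<1} \<inter> cr = {}" using edge_props(5)[OF h(1)] by simp
qed

lemma closed_graph: "closed (graph \<Gamma>)"
  unfolding graph_def
  by (intro closed_Un closed_UN finite_imp_closed finite_cr finite_edges)
    (auto intro: closed_path_image simple_path_imp_path edge_props)

lemma graph_S2: "graph \<Gamma> \<subseteq> S2"
  using cr_S2 edge_props(2) by (auto simp: graph_def)

text \<open>Both parametrisations of the edge are discarded, since \<open>g\<close> may be the
  reverse of the listed one. In this form the rest of the graph is seen to be closed.\<close>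

lemma graph_minus_edge:
  assumes "g \<in> oriented_edges \<Gamma>"
  shows "graph \<Gamma> - g ` {0<..<1} = cr \<union> (\<Union>g'\<in>edges \<Gamma> - {g, reversepath g}. path_image g')"
proof -
  obtain h where h: "h \<in> edges \<Gamma>" "g = h \<or> g = reversepath h" using assms by (rule oedgeE)
  then have sub: "edges \<Gamma> - {g, reversepath g} \<subseteq> edges \<Gamma> - {h}" by auto
  have op: "g ` {0<..<1} = h ` {0<..<1}" using h(2) reversepath_open by auto
  have hg: "path_image h = g ` {0<..<1} \<union> {pathstart h, pathfinish h}"
    using path_image_split[of h] op by simp
  have disj: "path_image g' \<inter> g ` {0<..<1} = {}" if "g' \<in> edges \<Gamma>" "g' \<noteq> h" for g'
    using that edges_disjoint[OF that(1) h(1)] edge_props(3,4)[OF that(1)] edge_props(5)[OF h(1)]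
    unfolding path_image_split[of g'] op by blast
  have "g' = h" if "g' \<in> edges \<Gamma>" "g' = g \<or> g' = reversepath g" for g'
  proof (rule ccontr)
    assume "g' \<noteq> h"
    have "g' ` {0<..<1} = h ` {0<..<1}" using that(2) op reversepath_open[of g] by auto
    moreover have "h (1/2) \<in> h ` {0<..<1}" by auto
    ultimately show False using edges_disjoint[OF that(1) h(1) \<open>g' \<noteq> h\<close>] by auto
  qed
  moreover have "h = g \<or> h = reversepath g" using h(2) reversepath_reversepath[of h] by metis
  ultimately have eq: "edges \<Gamma> - {g, reversepath g} = edges \<Gamma> - {h}" using h(1) by blast
  show ?thesis
    unfolding eq
  proof
    show "graph \<Gamma> - g ` {0<..<1} \<subseteq> cr \<union> (\<Union>g'\<in>edges \<Gamma> - {h}. path_image g')"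
    proof
      fix z assume z: "z \<in> graph \<Gamma> - g ` {0<..<1}"
      then consider "z \<in> cr" | g' where "g' \<in> edges \<Gamma>" "z \<in> path_image g'"
        unfolding graph_def by blast
      then show "z \<in> cr \<union> (\<Union>g'\<in>edges \<Gamma> - {h}. path_image g')"
      proof cases
        case 2
        show ?thesis
        proof (cases "g' = h")
          case True
          then have "z \<in> g ` {0<..<1} \<union> {pathstart h, pathfinish h}"
            using 2(2) hg by simp
          then have "z = pathstart h \<or> z = pathfinish h" using DiffD2[OF z] by blast
          then have "z \<in> cr" using edge_props(3,4)[OF h(1)] by metis
          then show ?thesis by (rule UnI1)
        qed (use 2 in blast)
      qed simp
    qed
    show "cr \<union> (\<Union>g'\<in>edges \<Gamma> - {h}. path_image g') \<subseteq> graph \<Gamma> - g ` {0<..<1}"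
    proof -
      have "cr \<inter> g ` {0<..<1} = {}" 
        using edge_props(5)[OF h(1)] unfolding op by (simp add: Int_commute)
      moreover have "z \<notin> g ` {0<..<1}" if "z \<in> (\<Union>g'\<in>edges \<Gamma> - {h}. path_image g')" for z
      proof -
        obtain g' where "g' \<in> edges \<Gamma>" "g' \<noteq> h" "z \<in> path_image g'"
          using \<open>z \<in> _\<close> by blast
        then show ?thesis using disj[of g'] by blast
      qed
      ultimately show ?thesis unfolding graph_def by blast
    qed
  qed
qed

lemma closed_graph_minus_edge:
  assumes "g \<in> oriented_edges \<Gamma>"
  shows "closed (graph \<Gamma> - g ` {0<..<1})"
  unfolding graph_minus_edge[OF assms]
  by (intro closed_Un closed_UN finite_imp_closed finite_cr finite_Diff finite_edges)
    (auto intro: closed_path_image simple_path_imp_path edge_props)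

lemma ch_openin:
  assumes "x \<in> cr" "open U" "U \<subseteq> unit_square"
  shows "openin (top_of_set S2) (ch x ` U)"
proof (rule openin_S2_image[OF assms(2)])
  show "continuous_on U (ch x)" "inj_on (ch x) U" "ch x ` U \<subseteq> S2"
    using ch_props(1-3)[OF assms(1)] assms(3) by (auto intro: continuous_on_subset inj_on_subset)
qed

lemma ch_connected:
  assumes "x \<in> cr" "U \<subseteq> unit_square" "connected U"
  shows "connected (ch x ` U)"
  using ch_props(1)[OF assms(1)] assms by (intro connected_continuous_image) (auto intro: continuous_on_subset)

lemma ch_in_S2: "x \<in> cr \<Longrightarrow> p \<in> unit_square \<Longrightarrow> ch x p \<in> S2"
  using ch_props(3) by blast

definition reg :: "real ^ 3 \<Rightarrow> plane \<Rightarrow> (real ^ 3) set" where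
  "reg x m = connected_component_set (S2 - graph \<Gamma>) (ch x m)"

lemma mids_off_graph: "x \<in> cr \<Longrightarrow> m \<in> mids \<Longrightarrow> ch x m \<in> S2 - graph \<Gamma>"
  using mids_sector[of m] sector_not_diagonal[of m m] sector_sub[of m] ch_graph ch_in_S2 by blast

lemma reg_in_regions: "x \<in> cr \<Longrightarrow> m \<in> mids \<Longrightarrow> reg x m \<in> regions \<Gamma>"
  using mids_off_graph by (auto simp: reg_def regions_def components_def)

lemma sector_off_graph:
  assumes "x \<in> cr" "m \<in> mids"
  shows "ch x ` sector m \<subseteq> S2 - graph \<Gamma>"
  using sector_not_diagonal[OF assms(2)] sector_sub[of m] ch_graph[OF assms(1)] ch_in_S2[OF assms(1)] by blast

lemma sector_connected: "x \<in> cr \<Longrightarrow> connected (ch x ` sector m)"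
  by (intro ch_connected sector_sub convex_connected convex_sector)

lemma sector_reg:
  assumes "x \<in> cr" "m \<in> mids"
  shows "ch x ` sector m \<subseteq> reg x m"
  unfolding reg_def
  using sector_connected[OF assms(1)] sector_off_graph[OF assms] mids_sector[OF assms(2)]
  by (intro connected_component_maximal) auto

lemma reg_eq_if_meet:
  assumes "x \<in> cr" "m \<in> mids" "R \<in> regions \<Gamma>" "ch x ` sector m \<inter> R \<noteq> {}"
  shows "R = reg x m"
  using assms(3,4) sector_reg[OF assms(1,2)] reg_in_regions[OF assms(1,2)] components_nonoverlap
  unfolding regions_def by blast

lemma regions_openin:
  assumes "R \<in> regions \<Gamma>"
  shows "openin (top_of_set S2) R"
proof -
  have op: "openin (top_of_set S2) (S2 - graph \<Gamma>)"
    by (intro openin_diff) (auto simp: closedin_closed_eq closed_graph graph_S2)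
  have "locally connected (S2 - graph \<Gamma>)"
    by (rule locally_open_subset[OF locally_connected_sphere op])
  then have "openin (top_of_set (S2 - graph \<Gamma>)) R"
    using assms unfolding regions_def by (rule openin_components_locally_connected)
  then show ?thesis using op by (rule openin_trans)
qed

lemma regions_closure:
  assumes "R \<in> regions \<Gamma>" "z \<in> closure R" "z \<in> S2 - graph \<Gamma>"
  shows "z \<in> R"
proof -
  have "closedin (top_of_set (S2 - graph \<Gamma>)) R"
    using assms(1) unfolding regions_def by (rule closedin_component)
  then show ?thesis using assms by (auto simp: closedin_closed) (metis Int_iff closure_minimal inf_le2 subsetD)
qed

lemma regions_sub: "R \<in> regions \<Gamma> \<Longrightarrow> R \<subseteq> S2 - graph \<Gamma>"
  unfolding regions_def by (rule in_components_subset)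

lemma leaves_half_open:
  assumes g: "g \<in> oriented_edges \<Gamma>" and l: "leaves_at \<Gamma> g x a"
  shows "ch x ` (closed_segment square_centre a - {square_centre}) \<subseteq> g ` {0<..<1}"
proof -
  obtain t where t: "0 < t" "t < 1" "g ` {0..t} = ch x ` closed_segment square_centre a"
    and x: "x \<in> cr" "pathstart g = x" "a \<in> corners"
    using l by (auto simp: leaves_at_def)
  show ?thesis
  proof (rule image_subsetI)
    fix p assume "p \<in> closed_segment square_centre a - {square_centre}"
    then have p: "p \<in> closed_segment square_centre a" "p \<noteq> square_centre" by auto
    then have "ch x p \<in> g ` {0..t}" using t(3) by blast
    then obtain s where s: "0 \<le> s" "s \<le> t" "ch x p = g s" by auto
    have "p \<in> unit_square" using p half_sub[OF x(3)] by auto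
    then have "ch x p \<noteq> ch x square_centre"
      using ch_eq[OF x(1) x(1), of p square_centre] p(2) by (auto simp: unit_square_def)
    then have "g s \<noteq> g 0" using s ch_props(4)[OF x(1)] x(2) by (auto simp: pathstart_def)
    then have "s \<noteq> 0" by auto
    then show "ch x p \<in> g ` {0<..<1}" using s t by auto
  qed
qed

text \<open>Of two initial pieces of \<open>g\<close> one contains the other, so the corner ending
  the smaller half-diagonal lies on the larger one; half-diagonals to different corners meet only in
  the centre.\<close>

lemma leaves_unique:
  assumes "leaves_at \<Gamma> g x a" "leaves_at \<Gamma> g x' a'"
  shows "x = x' \<and> a = a'"
proof -
  have aux: "a = a'" if l: "g ` {0..t} = ch x ` closed_segment square_centre a"
    "g ` {0..t'} = ch x ` closed_segment square_centre a'" "t \<le> t'" "x \<in> cr" "a \<in> corners" "a' \<in> corners"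
    for t t' a a' x
  proof -
    have "ch x ` closed_segment square_centre a \<subseteq> ch x ` closed_segment square_centre a'"
      using l(1-3) by (metis image_mono atLeastatMost_subset_iff order_refl)
    then have "ch x a \<in> ch x ` closed_segment square_centre a'" by (meson ends_in_segment(2) image_subset_iff)
    then obtain p where "p \<in> closed_segment square_centre a'" "ch x a = ch x p" by auto
    then have "a \<in> closed_segment square_centre a'"
      using ch_eq[OF l(4) l(4), of a p] half_sub[OF l(5)] half_sub[OF l(6)] by auto
    then show ?thesis using l(5,6) unfolding half_param by (auto simp: corners_eq)
  qed
  show ?thesis
    using assms aux[of _ x a _ a'] aux[of _ x a' _ a] unfolding leaves_at_def by (metis linear)
qed

end

section \<open>The regions along an edge\<close>

context ldiag
begin

lemma end_in_wedge:
  assumes g: "g \<in> oriented_edges \<Gamma>" and l: "leaves_at \<Gamma> g x a"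
  obtains s0 where "0 < s0" "s0 \<le> 1" "g ` {0<..<s0} \<subseteq> ch x ` wedge a"
proof -
  obtain t where t: "0 < t" "t < 1" "g ` {0..t} = ch x ` closed_segment square_centre a"
    and x: "x \<in> cr" "g 0 = x" "a \<in> corners"
    using l by (auto simp: leaves_at_def pathstart_def)
  have "openin (top_of_set S2) (ch x ` open_square)"
    by (rule ch_openin[OF x(1) open_square_open open_square_sub])
  then obtain T where T: "open T" "ch x ` open_square = S2 \<inter> T" by (auto simp: openin_open)
  have sc: "square_centre \<in> open_square" by (simp add: open_square_def)
  have "x \<in> T" using T(2) ch_props(4)[OF x(1)] sc by (metis IntE image_eqI)
  then obtain e where e: "e > 0" "ball x e \<subseteq> T" using T(1) openE by metis
  have "continuous_on {0..1} g"
    using oedge_props(1)[OF g] by (simp add: path_def simple_path_imp_path flip: path_def)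
  then obtain d where d: "d > 0" "\<And>s. s \<in> {0..1} \<Longrightarrow> dist s 0 < d \<Longrightarrow> dist (g s) (g 0) < e"
    using e(1) unfolding continuous_on_iff by (metis atLeastAtMost_iff order_refl zero_le_one)
  define s0 where "s0 = min t d"
  have "g s \<in> ch x ` wedge a" if s: "0 < s" "s < s0" for s
  proof -
    have s1: "s \<in> {0..t}" "s < 1" "s < d" using s t by (auto simp: s0_def)
    then have "g s \<in> ch x ` closed_segment square_centre a" using t(3) by blast
    then obtain p where p: "p \<in> closed_segment square_centre a" "g s = ch x p" by auto
    have "dist (g s) x < e" using d(2)[of s] s1 s x(2) by (auto simp: dist_real_def)
    then have "g s \<in> T" using e(2) by (auto simp: dist_commute)
    moreover have "g s \<in> path_image g" using s s1 by (auto simp: path_image_def)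
    then have "g s \<in> S2" using oedge_props(2)[OF g] by blast
    ultimately obtain p' where p': "p' \<in> open_square" "g s = ch x p'" using T(2) by blast
    have "p = p'"
      using ch_eq[OF x(1) x(1), of p p'] p p' half_sub[OF x(3)] open_square_sub by auto
    moreover have "p \<noteq> square_centre"
      using p(2) ch_props(4)[OF x(1)] x(2) simple_path_interior_ne(1)[OF oedge_props(1)[OF g], of s] s s1 by auto
    ultimately show ?thesis using half_open_wedge[OF x(3) p(1)] p' by blast
  qed
  then have "g ` {0<..<s0} \<subseteq> ch x ` wedge a" by auto
  then show thesis using that[of s0] t d by (simp add: s0_def)
qed

lemma wedge_off_regions:
  assumes x: "x \<in> cr" "a \<in> corners" and R: "R \<in> regions \<Gamma>"
    and no: "\<And>m. m \<in> mids \<Longrightarrow> 0 < dotc m a \<Longrightarrow> R \<noteq> reg x m"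
  shows "ch x ` wedge a \<inter> R = {}"
proof -
  have False if p: "p \<in> wedge a" "ch x p \<in> R" for p
  proof -
    have "p \<in> unit_square" using p wedge_sub by blast
    then have "p \<notin> diagonals" using p(2) regions_sub[OF R] ch_graph[OF x(1)] by blast
    then obtain m where m: "m \<in> mids" "0 < dotc m a" "p \<in> sector m"
      using wedge_sector[OF x(2) p(1)] by blast
    then show False using reg_eq_if_meet[OF x(1) m(1) R] no[OF m(1,2)] p by blast
  qed
  then show ?thesis by blast
qed

text \<open>The only part of the diagonals in the wedge is the half leading to \<open>a\<close>, an
  initial piece of \<open>g\<close>.\<close>

lemma wedge_graph:
  assumes g: "g \<in> oriented_edges \<Gamma>" "leaves_at \<Gamma> g x a" and p: "p \<in> wedge a" "ch x p \<in> graph \<Gamma>"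
  shows "ch x p \<in> g ` {0<..<1}"
proof -
  have x: "x \<in> cr" "a \<in> corners" using g by (auto simp: leaves_at_def)
  have "p \<in> diagonals" using p ch_graph[OF x(1), of p] wedge_sub by blast
  then show ?thesis using wedge_diagonal[OF x(2) p(1)] leaves_half_open[OF g] by blast
qed

text \<open>If the region R beside \<open>a\<close> at the start were missing from the sides at
  \<open>a'\<close>, it would avoid a whole wedge around the end of \<open>g\<close>. Cut
  \<open>g\<close> inside this wedge. The piece before the cut is an arc meeting the remaining graph
  in one point, so by Janiszewski it does not separate a point of R from a point \<open>v\<close> of
  \<open>g\<close> after the cut. On the way R meets no boundary, so it would contain
  \<open>v\<close>; but \<open>v\<close> is on the graph.\<close>

lemma edge_side:
  assumes g: "g \<in> oriented_edges \<Gamma>" and lj: "leaves_at \<Gamma> g j a" and lk: "leaves_at \<Gamma> (reversepath g) k a'"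
    and m: "m \<in> mids" "0 < dotc m a"
  shows "\<exists>m'\<in>mids. 0 < dotc m' a' \<and> reg k m' = reg j m"
proof (rule ccontr)
  assume "\<not> ?thesis"
  then have no: "\<And>m'. m' \<in> mids \<Longrightarrow> 0 < dotc m' a' \<Longrightarrow> reg j m \<noteq> reg k m'" by metis
  have j: "j \<in> cr" "a \<in> corners" "pathstart g = j" and k: "k \<in> cr" "a' \<in> corners" "pathfinish g = k"
    using lj lk by (auto simp: leaves_at_def)
  let ?G = "graph \<Gamma>" and ?K = "graph \<Gamma> - g ` {0<..<1}" and ?R = "reg j m"
  have R: "?R \<in> regions \<Gamma>" by (rule reg_in_regions[OF j(1) m(1)])
  have sp: "simple_path g" by (rule oedge_props(1)[OF g])
  have gG: "g ` {0..1} \<subseteq> ?G" using oedge_props(6)[OF g] by (simp add: path_image_def)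
  let ?D' = "ch k ` wedge a'"
  have D'R: "?D' \<inter> ?R = {}" by (rule wedge_off_regions[OF k(1,2) R no])
  have D'o: "openin (top_of_set S2) ?D'" by (rule ch_openin[OF k(1) open_wedge wedge_sub(1)])
  obtain s0 where s0: "0 < s0" "s0 \<le> 1" "reversepath g ` {0<..<s0} \<subseteq> ?D'"
    using end_in_wedge[OF oedge_rev[OF g] lk] .
  \<comment> \<open>From this parameter up to 1 the path \<open>g\<close> runs inside the wedge at
    its end. Stopping short of 1 also keeps the initial piece an arc when \<open>g\<close> is a
    loop.\<close>
  define r where "r = 1 - s0 / 2"
  have r: "0 < r" "r < 1" using s0 by (auto simp: r_def)
  have tail: "g s \<in> ?D'" if "r < s" "s < 1" for s
  proof -
    have "g s = reversepath g (1 - s)" by (simp add: reversepath_def)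
    moreover have "1 - s \<in> {0<..<s0}" using that s0 by (auto simp: r_def)
    ultimately show ?thesis using s0(3) by blast
  qed
  have sub: "subpath 0 r g = (\<lambda>t. g (r * t))" by (simp add: subpath_def)
  define \<gamma> where "\<gamma> = subpath 0 r g"
  have "g r \<noteq> g 0" using simple_path_interior_ne(1)[OF sp r] .
  then have arc: "arc \<gamma>"
    unfolding \<gamma>_def using sp r by (intro arc_simple_path_subpath) auto
  have im: "path_image \<gamma> = g ` {0..r}"
    unfolding \<gamma>_def using r by (simp add: path_image_subpath)
  have imG: "path_image \<gamma> \<subseteq> ?G" unfolding im using gG r by auto
  \<comment> \<open>The side opposite to \<open>m\<close> faces away from \<open>a\<close>, so its
    midpoint is off the graph and off the wedge and can serve as the removed point.\<close>
  define mm where "mm = (1 - fst m, 1 - snd m)"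
  have mm: "mm \<in> mids" "dotc mm a < 0"
    using m by (cases a; auto simp: mm_def mids_def; linarith)+
  define x0 where "x0 = ch j mm"
  have x0: "x0 \<in> S2" "x0 \<notin> ?G" using mids_off_graph[OF j(1) mm(1)] by (auto simp: x0_def)
  obtain q where q: "q \<in> sector m" "q \<in> wedge a" using sector_wedge_meet[OF j(2) m] by auto
  define u where "u = ch j q"
  define v where "v = g ((r + 1) / 2)"
  have uR: "u \<in> ?R" using sector_reg[OF j(1) m(1)] q by (auto simp: u_def)
  have uG: "u \<notin> ?G" using uR regions_sub[OF R] by blast
  have vG: "v \<in> g ` {0<..<1}" using r by (auto simp: v_def)
  have v\<gamma>: "v \<notin> path_image \<gamma>"
  proof
    assume "v \<in> path_image \<gamma>"
    then obtain s where "0 \<le> s" "s \<le> r" "g ((r + 1) / 2) = g s" by (auto simp: im v_def)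
    then show False using simple_path_interior_inj[OF sp, of "(r + 1) / 2" s] r by auto
  qed
  let ?C = "ch j ` wedge a \<union> g ` {0<..<1}"
  obtain D where D: "connected D" "D \<subseteq> S2 - (?K \<union> path_image \<gamma>)" "u \<in> D" "v \<in> D"
  proof (rule Janiszewski_arc_S2[OF x0(1) closed_graph_minus_edge[OF g] _ arc])
    show "?K \<subseteq> S2 - {x0}" "path_image \<gamma> \<subseteq> S2 - {x0}" using graph_S2 x0 imG by auto
    have "path_image \<gamma> \<inter> ?K = {g 0}"
    proof
      show "path_image \<gamma> \<inter> ?K \<subseteq> {g 0}"
      proof
        fix z assume z: "z \<in> path_image \<gamma> \<inter> ?K"
        then obtain s where s: "0 \<le> s" "s \<le> r" "z = g s" by (auto simp: im)
        then show "z \<in> {g 0}" using z r by (cases "s = 0") auto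
      qed
      have "g 0 \<in> cr" using j by (simp add: pathstart_def)
      then have "g 0 \<in> ?K" using graph_minus_edge[OF g] by auto
      then show "{g 0} \<subseteq> path_image \<gamma> \<inter> ?K" using r by (auto simp: im)
    qed
    then show "connected (path_image \<gamma> \<inter> ?K)" by simp
    show "connected ?C"
    proof (rule connected_Un)
      show "connected (ch j ` wedge a)"
        by (intro ch_connected[OF j(1)] wedge_sub convex_connected convex_wedge)
      have "continuous_on {0<..<1} g"
        using sp by (auto simp: simple_path_def path_def intro: continuous_on_subset)
      then show "connected (g ` {0<..<1})" by (rule connected_continuous_image) simp
      have "midpoint square_centre a \<in> diagonals"
        using half_mid_wedge(2)[OF j(2)] half_sub_diagonals[OF j(2)] by blast
      then have "midpoint square_centre a \<noteq> square_centre"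
        using wedge_diagonal(2)[OF j(2) half_mid_wedge(1)[OF j(2)]] by blast
      then have "ch j (midpoint square_centre a) \<in> g ` {0<..<1}"
        using leaves_half_open[OF g lj] half_mid_wedge(2)[OF j(2)] by blast
      then show "ch j ` wedge a \<inter> g ` {0<..<1} \<noteq> {}" using half_mid_wedge(1)[OF j(2)] by blast
    qed
    show "?C \<subseteq> S2 - {x0} - ?K"
    proof
      fix z assume "z \<in> ?C"
      then consider p where "p \<in> wedge a" "z = ch j p" | "z \<in> g ` {0<..<1}" by blast
      then show "z \<in> S2 - {x0} - ?K"
      proof cases
        case 1
        have pu: "p \<in> unit_square" using 1 wedge_sub by blast
        have "p \<noteq> mm" using 1(1) mm(2) by (auto simp: wedge_def)
        then have "z \<noteq> x0"
          using ch_eq[OF j(1) j(1) pu subsetD[OF sector_sub mids_sector[OF mm(1)]]] 1(2) by (auto simp: x0_def)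
        moreover have "z \<notin> ?K" using wedge_graph[OF g lj 1(1)] 1(2) by blast
        moreover have "z \<in> S2" using ch_in_S2[OF j(1) pu] 1(2) by simp
        ultimately show ?thesis by blast
      next
        case 2
        have "z \<in> ?G" using 2 gG by auto
        then show ?thesis using 2 graph_S2 x0 by blast
      qed
    qed
    show "u \<in> ?C" using q by (auto simp: u_def)
    show "v \<in> ?C" using vG by blast
    show "u \<notin> path_image \<gamma>" using uG imG by blast
    show "v \<notin> path_image \<gamma>" by (rule v\<gamma>)
  qed
  \<comment> \<open>Inside \<open>D\<close> the closure of R can meet the graph only on the tail of
    \<open>g\<close>, where the wedge keeps R away; hence R is open and closed in
    \<open>D\<close>.\<close>
  have close: "z \<in> ?R" if z: "z \<in> D" "z \<in> closure ?R" for z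
  proof (cases "z \<in> ?G")
    case True
    then have "z \<in> g ` {0<..<1}" "z \<notin> g ` {0..r}" using z(1) D(2) im by blast+
    then obtain s where s: "0 < s" "s < 1" "z = g s" by auto
    then have "\<not> s \<le> r" using \<open>z \<notin> g ` {0..r}\<close> by auto
    then have "z \<in> ?D'" using tail s by auto
    then obtain T where T: "open T" "z \<in> T" "S2 \<inter> T = ?D'" using D'o by (auto simp: openin_open)
    then have "T \<inter> ?R \<noteq> {}" using z(2) open_Int_closure_eq_empty[of T ?R] by blast
    then have "?D' \<inter> ?R \<noteq> {}" using T regions_sub[OF R] by blast
    then show ?thesis using D'R by blast
  next
    case False
    then show ?thesis using regions_closure[OF R z(2)] z(1) D(2) by blast
  qed
  have "openin (top_of_set D) (D \<inter> ?R)"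
  proof -
    obtain T where T: "open T" "?R = S2 \<inter> T" using regions_openin[OF R] by (auto simp: openin_open)
    then have "D \<inter> ?R = D \<inter> T" using D(2) by blast
    then show ?thesis using T(1) by (simp add: openin_open_Int)
  qed
  moreover have "closedin (top_of_set D) (D \<inter> ?R)"
  proof -
    have "D \<inter> ?R = D \<inter> closure ?R" using close closure_subset by blast
    then show ?thesis by (simp add: closedin_closed_Int)
  qed
  ultimately have "D \<inter> ?R = {} \<or> D \<inter> ?R = D" using D(1) connected_clopen by blast
  then have "v \<in> ?R" using D(3,4) uR by blast
  moreover have "v \<in> ?G" using vG gG by auto
  ultimately show False using regions_sub[OF R] by blast
qed

end

section \<open>Counting the regions of an alternating diagram\<close>

lemma half_overlap:
  assumes "v \<in> corners" "a \<in> corners" "p \<in> closed_segment square_centre v"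
    "p \<in> closed_segment square_centre a" "p \<noteq> square_centre"
  shows "v = a"
proof -
  obtain s where s: "0 \<le> s" "p = (1/2 + s * (fst v - 1/2), 1/2 + s * (snd v - 1/2))"
    using assms(3) by (auto simp: half_param)
  obtain s' where s': "0 \<le> s'" "p = (1/2 + s' * (fst a - 1/2), 1/2 + s' * (snd a - 1/2))"
    using assms(4) by (auto simp: half_param)
  have "s \<noteq> 0" using assms(5) s by auto
  moreover have "s * (fst v - 1/2) = s' * (fst a - 1/2)" "s * (snd v - 1/2) = s' * (snd a - 1/2)"
    using s(2) s'(2) by auto
  ultimately show ?thesis using s(1) s'(1) assms(1,2) by (auto simp: corners_eq)
qed

lemma card_corners: "card corners = 4"
  by (simp add: corners_eq)

lemma finite_mids: "finite mids" and finite_corners: "finite corners"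
  by (simp_all add: mids_def corners_eq)

locale alt_diagram = ldiag +
  assumes alt: "alternating \<Gamma>" and con: "connected_diagram \<Gamma>"
begin

lemma alt_ends:
  assumes "g \<in> edges \<Gamma>"
  obtains x a y b where "leaves_at \<Gamma> g x a" "leaves_at \<Gamma> (reversepath g) y b"
  using bspec[OF alt[unfolded alternating_def] assms] unfolding joins_over_under_def
  by (metis reversepath_reversepath)

text \<open>Near the crossing, the half-diagonal to \<open>v\<close> avoids the middle parts of all
  edges, so it contains a point of some initial or final piece. These pieces are half-diagonals of
  squares; squares are disjoint and half-diagonals meet only in the centre, so this piece is the one
  to \<open>v\<close>.\<close>

lemma corner_covered:
  assumes x: "x \<in> cr" "v \<in> corners"
  shows "\<exists>g\<in>oriented_edges \<Gamma>. leaves_at \<Gamma> g x v"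
proof -
  have ends: "\<exists>t t'. 0 < t \<and> 0 < t' \<and> t < 1 \<and> t' < 1 \<and>
     (\<exists>y b. leaves_at \<Gamma> g y b \<and> g ` {0..t} = ch y ` closed_segment square_centre b) \<and>
     (\<exists>y b. leaves_at \<Gamma> (reversepath g) y b \<and>
        reversepath g ` {0..t'} = ch y ` closed_segment square_centre b)" if gE: "g \<in> edges \<Gamma>" for g
  proof -
    obtain x a y b where l: "leaves_at \<Gamma> g x a" "leaves_at \<Gamma> (reversepath g) y b"
      using alt_ends[OF gE] .
    obtain t where "t \<in> {0<..<1}" "g ` {0..t} = ch x ` closed_segment square_centre a"
      using l(1) unfolding leaves_at_def by blast
    moreover obtain t' where "t' \<in> {0<..<1}" "reversepath g ` {0..t'} = ch y ` closed_segment square_centre b"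
      using l(2) unfolding leaves_at_def by blast
    ultimately show ?thesis using l by (metis greaterThanLessThan_iff)
  qed
  then obtain t t' where tt: "\<And>g. g \<in> edges \<Gamma> \<Longrightarrow> 0 < t g \<and> 0 < t' g \<and> t g < 1 \<and> t' g < 1 \<and>
     (\<exists>y b. leaves_at \<Gamma> g y b \<and> g ` {0..t g} = ch y ` closed_segment square_centre b) \<and>
     (\<exists>y b. leaves_at \<Gamma> (reversepath g) y b \<and>
        reversepath g ` {0..t' g} = ch y ` closed_segment square_centre b)" by metis
  \<comment> \<open>The edges with their two end pieces cut off: a closed set without
    crossings.\<close>
  define M where "M = (\<Union>g\<in>edges \<Gamma>. g ` {t g..1 - t' g})"
  have "closed (g ` {t g..1 - t' g})" if g: "g \<in> edges \<Gamma>" for g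
  proof -
    have "continuous_on {t g..1 - t' g} g"
      using edge_props(1)[OF g] tt[OF g] by (auto simp: simple_path_def path_def intro: continuous_on_subset)
    then show ?thesis by (intro compact_imp_closed compact_continuous_image) auto
  qed
  then have cM: "closed M" unfolding M_def using finite_edges by (intro closed_UN) auto
  have xM: "x \<notin> M"
  proof
    assume "x \<in> M"
    then obtain g s where g: "g \<in> edges \<Gamma>" "t g \<le> s" "s \<le> 1 - t' g" "x = g s" by (auto simp: M_def)
    then have "x \<in> g ` {0<..<1}" using tt[OF g(1)] by auto
    then show False using edge_props(5)[OF g(1)] x(1) by blast
  qed
  define w where "w s = (1/2 + s * (fst v - 1/2), 1/2 + s * (snd v - 1/2))" for s :: real
  have wseg: "w s \<in> closed_segment square_centre v" if "0 \<le> s" "s \<le> 1" for s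
    using that by (auto simp: half_param w_def)
  have wsq: "w s \<in> unit_square" if "0 \<le> s" "s \<le> 1" for s using wseg[OF that] half_sub[OF x(2)] by blast
  have "continuous_on {0..1} w" unfolding w_def by (intro continuous_intros)
  moreover have "w ` {0..1} \<subseteq> unit_square" using wsq by auto
  ultimately have cw: "continuous_on {0..1} (\<lambda>s. ch x (w s))"
    using continuous_on_compose2[OF ch_props(1)[OF x(1)], of "{0..1}" w] by blast
  have w0: "ch x (w 0) = x" using ch_props(4)[OF x(1)] by (simp add: w_def)
  obtain e where e: "e > 0" "ball x e \<subseteq> - M" using cM xM by (metis ComplI open_Compl openE)
  obtain d where d: "d > 0" "\<And>s. s \<in> {0..1} \<Longrightarrow> dist s 0 < d \<Longrightarrow> dist (ch x (w s)) (ch x (w 0)) < e"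
    using cw e(1) unfolding continuous_on_iff by (metis atLeastAtMost_iff order_refl zero_le_one)
  define s where "s = min 1 (d / 2)"
  have s: "0 < s" "s \<le> 1" "s < d" using d(1) by (auto simp: s_def)
  define p where "p = w s"
  have p: "p \<in> closed_segment square_centre v" "p \<in> unit_square"
    using wseg wsq s by (auto simp: p_def)
  have pc: "p \<noteq> square_centre" using x(2) s by (auto simp: p_def w_def corners_eq)
  have "dist (ch x p) x < e" using d(2)[of s] s w0 by (auto simp: p_def dist_real_def)
  then have pM: "ch x p \<notin> M" using e(2) by (auto simp: dist_commute)
  have "ch x p \<in> graph \<Gamma>" using ch_graph[OF x(1) p(2)] p(1) half_sub_diagonals[OF x(2)] by blast
  moreover have "ch x p \<notin> cr"
  proof
    assume y: "ch x p \<in> cr"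
    have "ch x p = ch (ch x p) square_centre" using ch_props(4)[OF y] by simp
    then show False using ch_eq[OF x(1) y p(2), of square_centre] pc by (auto simp: unit_square_def)
  qed
  ultimately obtain g where g: "g \<in> edges \<Gamma>" "ch x p \<in> path_image g" by (auto simp: graph_def)
  then obtain \<tau> where \<tau>: "0 \<le> \<tau>" "\<tau> \<le> 1" "ch x p = g \<tau>" by (auto simp: path_image_def)
  have hit: "leaves_at \<Gamma> h x v"
    if h: "leaves_at \<Gamma> h y b" "ch x p \<in> ch y ` closed_segment square_centre b" for h y b
  proof -
    have yb: "y \<in> cr" "b \<in> corners" using h(1) by (auto simp: leaves_at_def)
    obtain q where q: "q \<in> closed_segment square_centre b" "ch x p = ch y q" using h(2) by blast
    then have "x = y \<and> p = q" using ch_eq[OF x(1) yb(1) p(2)] half_sub[OF yb(2)] by blast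
    then have "x = y" "v = b" using half_overlap[OF x(2) yb(2) p(1)] q(1) pc by auto
    then show ?thesis using h(1) by simp
  qed
  have "\<tau> < t g \<or> 1 - t' g < \<tau>"
    using pM g(1) \<tau>(3) by (auto simp: M_def not_le[symmetric])
  then show ?thesis
  proof
    assume "\<tau> < t g"
    then have "ch x p \<in> g ` {0..t g}" using \<tau> by auto
    then have "leaves_at \<Gamma> g x v" using tt[OF g(1)] hit by metis
    then show ?thesis using g(1) by (auto simp: oriented_edges_def)
  next
    assume "1 - t' g < \<tau>"
    then have "ch x p = reversepath g (1 - \<tau>)" "1 - \<tau> \<in> {0..t' g}" using \<tau> by (auto simp: reversepath_def)
    then have "ch x p \<in> reversepath g ` {0..t' g}" by blast
    then have "leaves_at \<Gamma> (reversepath g) x v" using tt[OF g(1)] hit by metis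
    then show ?thesis using g(1) by (auto simp: oriented_edges_def)
  qed
qed

text \<open>Each of the four corners of a square is left by an oriented edge of its own, and an edge
  has two orientations.\<close>

lemma card_edges_ge: "2 * card cr \<le> card (edges \<Gamma>)"
proof -
  obtain G where G: "\<And>x v. x \<in> cr \<Longrightarrow> v \<in> corners \<Longrightarrow> G x v \<in> oriented_edges \<Gamma> \<and> leaves_at \<Gamma> (G x v) x v"
    using corner_covered by metis
  have "inj_on (\<lambda>(x, v). G x v) (cr \<times> corners)"
  proof (rule inj_onI, clarify)
    fix x v x' v' assume "x \<in> cr" "v \<in> corners" "x' \<in> cr" "v' \<in> corners" "G x v = G x' v'"
    then show "x = x' \<and> v = v'" using G leaves_unique by metis
  qed
  moreover have "(\<lambda>(x, v). G x v) ` (cr \<times> corners) \<subseteq> oriented_edges \<Gamma>" using G by auto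
  moreover have fin: "finite (oriented_edges \<Gamma>)" using finite_edges by (simp add: oriented_edges_def)
  ultimately have "card (cr \<times> corners) \<le> card (oriented_edges \<Gamma>)" by (rule card_inj_on_le)
  also have "\<dots> \<le> card (edges \<Gamma>) + card (edges \<Gamma>)"
    unfolding oriented_edges_def
    using card_Un_le[of "edges \<Gamma>" "reversepath ` edges \<Gamma>"] card_image_le[OF finite_edges, of reversepath] by linarith
  finally show ?thesis by (simp add: card_cartesian_product card_corners)
qed

section \<open>Components of partial graphs and of their complements\<close>

definition subgraph :: "(real \<Rightarrow> real ^ 3) set \<Rightarrow> (real ^ 3) set" where
  "subgraph E = cr \<union> (\<Union>g\<in>E. path_image g)"

definition linked :: "(real \<Rightarrow> real ^ 3) set \<Rightarrow> (real ^ 3) rel" where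
  "linked E = eqcl cr ((\<lambda>g. (pathstart g, pathfinish g)) ` E)"

definition sides :: "((real ^ 3) \<times> plane) set" where
  "sides = cr \<times> mids"

text \<open>The complementary components of a partial graph are counted by the side midpoints in
  them. This bounds their number from below, and the set being partitioned stays the same while
  edges are added.\<close>

definition conn :: "(real ^ 3) set \<Rightarrow> ((real ^ 3) \<times> plane) rel" where
  "conn K = {((x, m), (y, m')). (x, m) \<in> sides \<and> (y, m') \<in> sides \<and>
     connected_component (S2 - K) (ch x m) (ch y m')}"

lemma finite_sides: "finite sides"
  using finite_cr finite_mids by (simp add: sides_def)

lemma equiv_conn:
  assumes "K \<subseteq> graph \<Gamma>"
  shows "equiv sides (conn K)"
proof (rule equivI)
  show "refl_on sides (conn K)"
    using mids_off_graph assms unfolding refl_on_def conn_def sides_def by (auto intro!: connected_component_refl) 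
  show "sym (conn K)" unfolding sym_def conn_def by (auto intro: connected_component_sym)
  show "trans (conn K)" unfolding trans_def conn_def by (auto intro: connected_component_trans)
qed (auto simp: conn_def)

lemma conn_mono: "K \<subseteq> K' \<Longrightarrow> conn K' \<subseteq> conn K"
  unfolding conn_def by (auto elim!: connected_component_of_subset)

lemma subgraph_sub: "E \<subseteq> edges \<Gamma> \<Longrightarrow> subgraph E \<subseteq> graph \<Gamma>"
  by (auto simp: subgraph_def graph_def)

lemma linked_path:
  assumes E: "E \<subseteq> edges \<Gamma>" and xy: "(x, y) \<in> linked E"
  shows "path_component (subgraph E) x y"
proof -
  have x: "x \<in> cr" and chain: "(x, y) \<in> ((\<lambda>g. (pathstart g, pathfinish g)) ` E \<union>
      ((\<lambda>g. (pathstart g, pathfinish g)) ` E)\<inverse>)\<^sup>*"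
    using xy by (auto simp: linked_def eqcl_def)
  have edge: "path_component (subgraph E) (pathstart g) (pathfinish g)" if "g \<in> E" for g
    using that E edge_props(1)[of g] unfolding path_component_def subgraph_def
    by (intro exI[of _ g]) (auto intro: simple_path_imp_path)
  from chain show ?thesis
  proof (induction rule: rtrancl_induct)
    case base
    then show ?case using x by (auto intro!: path_component_refl simp: subgraph_def)
  next
    case (step y z)
    then have "path_component (subgraph E) y z" using edge path_component_sym by auto
    then show ?case using step path_component_trans by metis
  qed
qed

text \<open>Either the edge is itself closed, or an arc between its ends inside the subgraph
  completes it.\<close>

lemma edge_closes_loop:
  assumes E: "E \<subseteq> edges \<Gamma>" "g \<in> edges \<Gamma>" "g \<notin> E" and l: "(pathstart g, pathfinish g) \<in> linked E"
  obtains q where "simple_path q" "pathfinish q = pathstart q" "path_image g \<subseteq> path_image q"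
    "path_image q \<subseteq> subgraph (insert g E)"
proof (cases "pathstart g = pathfinish g")
  case True
  then show thesis using that[of g] edge_props(1)[OF E(2)] by (auto simp: subgraph_def)
next
  case False
  have "path_component (subgraph E) (pathfinish g) (pathstart g)"
    using linked_path[OF E(1) l] by (rule path_component_sym)
  then obtain p where p: "path p" "path_image p \<subseteq> subgraph E" "pathstart p = pathfinish g" "pathfinish p = pathstart g"
    by (auto simp: path_component_def)
  obtain r where r: "arc r" "path_image r \<subseteq> path_image p" "pathstart r = pathfinish g" "pathfinish r = pathstart g"
    using path_contains_arc[OF p(1,3,4)] False by metis
  have ag: "arc g" using edge_props(1)[OF E(2)] False by (simp add: arc_simple_path)
  have "g' ` {0<..<1} \<inter> g ` {0<..<1} = {}" if "g' \<in> E" for g'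
    using that E edges_disjoint[of g' g] by auto
  then have disj: "subgraph E \<inter> g ` {0<..<1} = {}"
    using edge_props(5)[OF E(2)] edge_props(3,4) E(1)
    unfolding subgraph_def path_image_split[of "_ :: real \<Rightarrow> real ^ 3"] by blast
  have "path_image g \<inter> path_image r \<subseteq> {pathstart g, pathstart r}"
    using disj r p path_image_split[of g] by auto
  then have "simple_path (g +++ r)"
    using ag r by (intro simple_path_join_loop) auto
  moreover have "path_image (g +++ r) = path_image g \<union> path_image r"
    using r by (simp add: path_image_join)
  moreover have "path_image r \<subseteq> subgraph (insert g E)" using r p by (auto simp: subgraph_def)
  ultimately show thesis
    using that[of "g +++ r"] r by (auto simp: subgraph_def)
qed

text \<open>The wedge at the corner meets both sectors, and the only part of the graph in it belongs
  to the open edge \<open>g\<close>, which K avoids.\<close>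

lemma edge_sides_connected:
  assumes g: "g \<in> edges \<Gamma>" "leaves_at \<Gamma> g x a" and K: "K \<subseteq> graph \<Gamma> - g ` {0<..<1}"
    and m: "m1 \<in> mids" "0 < dotc m1 a" "m2 \<in> mids" "0 < dotc m2 a"
  shows "((x, m1), (x, m2)) \<in> conn K"
proof -
  have x: "x \<in> cr" "a \<in> corners" using g(2) by (auto simp: leaves_at_def)
  have go: "g \<in> oriented_edges \<Gamma>" using g(1) by (simp add: oriented_edges_def)
  let ?C = "ch x ` (wedge a \<union> sector m1 \<union> sector m2)"
  have "connected (wedge a \<union> sector m1 \<union> sector m2)"
    using sector_wedge_meet[OF x(2) m(1,2)] sector_wedge_meet[OF x(2) m(3,4)]
    by (intro connected_Un convex_connected convex_wedge convex_sector) blast+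
  then have "connected ?C"
    using wedge_sub sector_sub by (intro ch_connected[OF x(1)]) auto
  moreover have "?C \<subseteq> S2 - K"
  proof
    fix z assume "z \<in> ?C"
    then consider p where "p \<in> wedge a" "z = ch x p" | p where "p \<in> sector m1 \<union> sector m2" "z = ch x p" by blast
    then show "z \<in> S2 - K"
    proof cases
      case 1
      have "z \<notin> K" using wedge_graph[OF go g(2) 1(1)] 1(2) K by blast
      moreover have "p \<in> unit_square" using 1(1) wedge_sub by blast
      then have "z \<in> S2" using ch_in_S2[OF x(1), of p] 1(2) by simp
      ultimately show ?thesis by blast
    next
      case 2
      then show ?thesis
        using sector_off_graph[OF x(1) m(1)] sector_off_graph[OF x(1) m(3)] K by blast
    qed
  qed
  moreover have "ch x m1 \<in> ?C" "ch x m2 \<in> ?C" using mids_sector m by auto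
  ultimately show ?thesis
    using x m by (auto simp: conn_def sides_def intro!: connected_componentI)
qed

text \<open>The new edge closes a Jordan curve. Near a point of \<open>g\<close> inside the wedge at
  its start both sides of the curve occur, and the points of the wedge off the curve lie in sectors
  next to that corner; so two sides that were connected across \<open>g\<close> become
  separated.\<close>

lemma conn_strict:
  assumes E: "E \<subseteq> edges \<Gamma>" "g \<in> edges \<Gamma>" "g \<notin> E" and l: "(pathstart g, pathfinish g) \<in> linked E"
  shows "conn (subgraph (insert g E)) \<subset> conn (subgraph E)"
proof -
  obtain x a where lg: "leaves_at \<Gamma> g x a" using alt_ends[OF E(2)] by metis
  then have x: "x \<in> cr" "a \<in> corners" by (auto simp: leaves_at_def)
  have go: "g \<in> oriented_edges \<Gamma>" using E(2) by (simp add: oriented_edges_def)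
  obtain q where q: "simple_path q" "pathfinish q = pathstart q" "path_image g \<subseteq> path_image q"
    "path_image q \<subseteq> subgraph (insert g E)" using edge_closes_loop[OF E l] .
  have qG: "path_image q \<subseteq> graph \<Gamma>" using q(4) subgraph_sub[of "insert g E"] E by blast
  obtain m0 where m0: "m0 \<in> mids" by (auto simp: mids_def)
  have x0: "ch x m0 \<in> S2" "ch x m0 \<notin> path_image q" using mids_off_graph[OF x(1) m0] qG by blast+
  have qS: "path_image q \<subseteq> S2" using qG graph_S2 by blast
  obtain I where I: "I \<subseteq> S2 - path_image q"
    "\<And>C. connected C \<Longrightarrow> C \<subseteq> S2 - path_image q \<Longrightarrow> C \<inter> I \<noteq> {} \<Longrightarrow> C \<subseteq> I"
    "\<And>p D. p \<in> path_image q \<Longrightarrow> openin (top_of_set S2) D \<Longrightarrow> p \<in> D \<Longrightarrow>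
       D \<inter> I \<noteq> {} \<and> D \<inter> (S2 - path_image q - I) \<noteq> {}"
    by (rule Jordan_S2[OF q(1,2) qS x0]) blast
  let ?D = "ch x ` wedge a" and ?p = "ch x (midpoint square_centre a)"
  have "midpoint square_centre a \<in> diagonals"
    using half_mid_wedge(2)[OF x(2)] half_sub_diagonals[OF x(2)] by blast
  then have "?p \<in> g ` {0<..<1}"
    using wedge_graph[OF go lg half_mid_wedge(1)[OF x(2)]] ch_graph[OF x(1)] diagonals_sub by blast
  then have pq: "?p \<in> path_image q" using q(3) path_image_split[of g] by blast
  have "openin (top_of_set S2) ?D" by (rule ch_openin[OF x(1) open_wedge wedge_sub(1)])
  then have "?D \<inter> I \<noteq> {} \<and> ?D \<inter> (S2 - path_image q - I) \<noteq> {}"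
    using I(3)[OF pq] half_mid_wedge(1)[OF x(2)] by blast
  then obtain p1 p2 where p1: "p1 \<in> wedge a" "ch x p1 \<in> I" and p2: "p2 \<in> wedge a" "ch x p2 \<notin> path_image q" "ch x p2 \<notin> I"
    by blast
  have off: "p \<notin> diagonals" if p: "p \<in> wedge a" "ch x p \<notin> path_image q" for p
  proof
    assume "p \<in> diagonals"
    then have "ch x p \<in> g ` {0<..<1}"
      using wedge_graph[OF go lg p(1)] ch_graph[OF x(1)] diagonals_sub by blast
    then show False using p(2) q(3) path_image_split[of g] by blast
  qed
  have "ch x p1 \<notin> path_image q" using p1(2) I(1) by blast
  then obtain m1 where m1: "m1 \<in> mids" "0 < dotc m1 a" "p1 \<in> sector m1"
    using wedge_sector[OF x(2) p1(1) off[OF p1(1)]] by blast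
  obtain m2 where m2: "m2 \<in> mids" "0 < dotc m2 a" "p2 \<in> sector m2"
    using wedge_sector[OF x(2) p2(1) off[OF p2(1,2)]] by blast
  have sec: "ch x ` sector m \<subseteq> I" if "m \<in> mids" "ch x ` sector m \<inter> I \<noteq> {}" for m
    using I(2)[OF sector_connected[OF x(1)] _ that(2)] sector_off_graph[OF x(1) that(1)] qG by blast
  have "ch x ` sector m1 \<subseteq> I" using sec[OF m1(1)] m1(3) p1(2) by blast
  then have m1I: "ch x m1 \<in> I" using mids_sector[OF m1(1)] by blast
  have m2I: "ch x m2 \<notin> I" using sec[OF m2(1)] m2(3) p2(3) mids_sector[OF m2(1)] by blast
  have "((x, m1), (x, m2)) \<notin> conn (subgraph (insert g E))"
  proof
    assume "((x, m1), (x, m2)) \<in> conn (subgraph (insert g E))"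
    then obtain C where C: "connected C" "C \<subseteq> S2 - subgraph (insert g E)" "ch x m1 \<in> C" "ch x m2 \<in> C"
      by (auto simp: conn_def connected_component_def)
    then have "C \<subseteq> I" using I(2)[OF C(1)] q(4) m1I by blast
    then show False using C(4) m2I by blast
  qed
  moreover have "((x, m1), (x, m2)) \<in> conn (subgraph E)"
  proof (rule edge_sides_connected[OF E(2) lg _ m1(1,2) m2(1,2)])
    have "E \<subseteq> edges \<Gamma> - {g}" using E by auto
    moreover have "reversepath g \<notin> E"
    proof
      assume r: "reversepath g \<in> E"
      then have "reversepath g \<in> edges \<Gamma>" "reversepath g \<noteq> g" using E by auto
      then have "g ` {0<..<1} \<inter> g ` {0<..<1} = {}"
        using edges_disjoint[OF _ E(2), of "reversepath g"] reversepath_open[of g] by simp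
      then show False by auto
    qed
    ultimately show "subgraph E \<subseteq> graph \<Gamma> - g ` {0<..<1}"
      unfolding graph_minus_edge[OF go] subgraph_def by blast
  qed
  moreover have "conn (subgraph (insert g E)) \<subseteq> conn (subgraph E)"
    by (rule conn_mono) (auto simp: subgraph_def)
  ultimately show ?thesis by blast
qed

text \<open>Each edge that closes a loop separates a region, each other edge joins two components.\<close>

lemma region_count_induct:
  assumes "E \<subseteq> edges \<Gamma>"
  shows "card E + card (cr // linked E) + 1 \<le> card (sides // conn (subgraph E)) + card cr"
proof -
  have "finite E" using assms finite_edges by (rule finite_subset)
  then show ?thesis using assms
  proof (induction E)
    case empty
    have "card (cr // linked {}) \<le> card cr"
      unfolding quotient_def using finite_cr
      by (metis UNION_singleton_eq_range card_image_le)
    moreover have "(1/2, 0) \<in> mids" by (simp add: mids_def)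
    then have "sides \<noteq> {}" using cr_ne by (auto simp: sides_def)
    then have "sides // conn (subgraph {}) \<noteq> {}" using quotientI by fastforce
    then have "card (sides // conn (subgraph {})) \<noteq> 0"
      using finite_sides equiv_conn[OF subgraph_sub] by (simp add: finite_quotient equiv_type)
    ultimately show ?case by simp
  next
    case (insert g E)
    have E: "E \<subseteq> edges \<Gamma>" "g \<in> edges \<Gamma>" using insert by auto
    let ?r = "(\<lambda>g. (pathstart g, pathfinish g)) ` E"
    have r: "?r \<subseteq> cr \<times> cr" using E edge_props(3,4) by auto
    have ends: "pathstart g \<in> cr" "pathfinish g \<in> cr" using E edge_props(3,4) by auto
    have li: "linked (insert g E) = eqcl cr (insert (pathstart g, pathfinish g) ?r)" by (simp add: linked_def)
    have mono: "conn (subgraph (insert g E)) \<subseteq> conn (subgraph E)"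
      by (rule conn_mono) (auto simp: subgraph_def)
    have eq: "equiv sides (conn (subgraph E))" "equiv sides (conn (subgraph (insert g E)))"
      using E by (auto intro!: equiv_conn subgraph_sub)
    have fin: "finite (sides // conn (subgraph (insert g E)))"
      using finite_sides eq by (simp add: finite_quotient equiv_type)
    show ?case
    proof (cases "(pathstart g, pathfinish g) \<in> linked E")
      case True
      have "card (sides // conn (subgraph E)) < card (sides // conn (subgraph (insert g E)))"
        using strict_refines_card_less[OF fin conn_strict[OF E insert(2) True] eq(2,1)] .
      moreover have "card (cr // linked (insert g E)) \<le> card (cr // linked E)"
      proof (rule finite_refines_card_le)
        show "finite (cr // linked E)" using finite_cr by (simp add: linked_def finite_quotient eqcl_subset)
        show "linked E \<subseteq> linked (insert g E)"
          unfolding linked_def using eqcl_incl[of "insert (pathstart g, pathfinish g) ?r" cr] r ends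
          by (intro eqcl_mono) auto
      qed (simp_all add: linked_def equiv_eqcl)
      ultimately show ?thesis using insert E by simp
    next
      case False
      have "card (cr // linked E) = Suc (card (cr // linked (insert g E)))"
        unfolding li using card_eqcl_insert[OF finite_cr r ends] False by (simp add: linked_def)
      moreover have "card (sides // conn (subgraph E)) \<le> card (sides // conn (subgraph (insert g E)))"
        by (rule finite_refines_card_le[OF fin mono eq(2,1)])
      ultimately show ?thesis using insert E by simp
    qed
  qed
qed

lemma graph_subgraph: "graph \<Gamma> = subgraph (edges \<Gamma>)"
  by (simp add: graph_def subgraph_def)

text \<open>An edge starting in one class also ends there. So a class with its edges, and the other
  crossings with theirs, would be disjoint closed sets covering the graph.\<close>

lemma all_linked:
  assumes "x \<in> cr" "y \<in> cr"
  shows "(x, y) \<in> linked (edges \<Gamma>)"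
proof (rule ccontr)
  assume not: "(x, y) \<notin> linked (edges \<Gamma>)"
  let ?L = "linked (edges \<Gamma>)"
  define X where "X = {z \<in> cr. (x, z) \<in> ?L}"
  define F where "F = {g \<in> edges \<Gamma>. pathstart g \<in> X}"
  have mem: "(pathstart g, pathfinish g) \<in> ?L" if "g \<in> edges \<Gamma>" for g
  proof -
    have "(\<lambda>g. (pathstart g, pathfinish g)) ` edges \<Gamma> \<subseteq> cr \<times> cr" using edge_props(3,4) by auto
    then show ?thesis unfolding linked_def using eqcl_incl that by blast
  qed
  have ends: "pathfinish g \<in> X \<longleftrightarrow> pathstart g \<in> X" if g: "g \<in> edges \<Gamma>" for g
  proof -
    have "(x, pathstart g) \<in> ?L \<longleftrightarrow> (x, pathfinish g) \<in> ?L"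
    proof
      assume "(x, pathstart g) \<in> ?L"
      then show "(x, pathfinish g) \<in> ?L"
        using mem[OF g] unfolding linked_def by (rule eqcl_trans)
    next
      assume "(x, pathfinish g) \<in> ?L"
      then show "(x, pathstart g) \<in> ?L"
        using eqcl_sym[OF mem[OF g, unfolded linked_def]] unfolding linked_def by (rule eqcl_trans)
    qed
    then show ?thesis using edge_props(3,4)[OF g] by (simp add: X_def)
  qed
  define G1 where "G1 = X \<union> (\<Union>g\<in>F. path_image g)"
  define G2 where "G2 = (cr - X) \<union> (\<Union>g\<in>edges \<Gamma> - F. path_image g)"
  have fin: "finite X" "finite F" using finite_cr finite_edges by (auto simp: X_def F_def)
  have "closed G1" unfolding G1_def
    using fin edge_props(1) by (intro closed_Un closed_UN finite_imp_closed)
      (auto simp: F_def intro!: closed_path_image simple_path_imp_path)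
  moreover have "closed G2" unfolding G2_def
    using finite_cr finite_edges edge_props(1) by (intro closed_Un closed_UN finite_imp_closed)
      (auto intro!: closed_path_image simple_path_imp_path)
  moreover have "graph \<Gamma> \<subseteq> G1 \<union> G2" by (auto simp: graph_def G1_def G2_def X_def)
  moreover have "x \<in> G1 \<inter> graph \<Gamma>" using assms by (auto simp: G1_def X_def graph_def linked_def eqcl_refl)
  moreover have "y \<in> G2 \<inter> graph \<Gamma>" using assms not by (auto simp: G2_def X_def graph_def)
  moreover have "G1 \<inter> G2 \<inter> graph \<Gamma> = {}"
  proof -
    have int: "g ` {0<..<1} \<inter> cr = {}" if "g \<in> edges \<Gamma>" for g using edge_props(5)[OF that] .
    have G1: "z \<in> X \<or> (\<exists>g\<in>F. z \<in> g ` {0<..<1})" if z: "z \<in> G1" for z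
    proof (cases "z \<in> X")
      case False
      then obtain g where g: "g \<in> F" "z \<in> path_image g" using z by (auto simp: G1_def)
      then have "pathstart g \<in> X" "pathfinish g \<in> X" using ends[of g] by (auto simp: F_def)
      then show ?thesis using g False path_image_split[of g] by auto
    qed simp
    have G2: "z \<in> cr - X \<or> (\<exists>g\<in>edges \<Gamma> - F. z \<in> g ` {0<..<1})" if z: "z \<in> G2" for z
    proof (cases "z \<in> cr - X")
      case False
      then obtain g where g: "g \<in> edges \<Gamma>" "g \<notin> F" "z \<in> path_image g" using z by (auto simp: G2_def)
      then have "pathstart g \<in> cr - X" "pathfinish g \<in> cr - X"
        using ends[of g] edge_props(3,4)[of g] by (auto simp: F_def)
      then show ?thesis using g False path_image_split[of g] by auto
    qed simp
    have XF: "X \<subseteq> cr" "F \<subseteq> edges \<Gamma>" by (auto simp: X_def F_def)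
    have "False" if z: "z \<in> G1" "z \<in> G2" for z
    proof -
      consider "z \<in> X" "z \<in> cr - X" | g where "z \<in> cr" "g \<in> edges \<Gamma>" "z \<in> g ` {0<..<1}"
        | g g' where "g \<in> F" "g' \<in> edges \<Gamma> - F" "z \<in> g ` {0<..<1}" "z \<in> g' ` {0<..<1}"
        using G1[OF z(1)] G2[OF z(2)] XF by blast
      then show False
      proof cases
        case 2
        then show ?thesis using int[of g] by blast
      next
        case 3
        then have "g \<noteq> g'" "g \<in> edges \<Gamma>" "g' \<in> edges \<Gamma>" using XF by auto
        then show ?thesis using edges_disjoint[of g g'] 3 by blast
      qed auto
    qed
    then show ?thesis by blast
  qed
  ultimately have "\<not> connected (graph \<Gamma>)"
    unfolding connected_closed by blast
  then show False using con by (simp add: connected_diagram_def)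
qed

text \<open>With n crossings there are at least 2n edges and at least one component, so the
  inequality gives at least 2n + 1 + 1 - n classes.\<close>

lemma region_count: "card cr + 2 \<le> card (sides // conn (graph \<Gamma>))"
proof -
  have "cr // linked (edges \<Gamma>) \<noteq> {}" using cr_ne by (auto simp: quotient_def)
  moreover have "finite (cr // linked (edges \<Gamma>))" using finite_cr by (simp add: linked_def finite_quotient eqcl_subset)
  ultimately have "1 \<le> card (cr // linked (edges \<Gamma>))" by (simp add: Suc_leI card_gt_0_iff)
  then show ?thesis
    using region_count_induct[of "edges \<Gamma>"] card_edges_ge unfolding graph_subgraph by simp
qed

end

section \<open>The Aitchison complex of an alternating diagram\<close>

text \<open>Hitting every point up to Q makes the induced map on classes onto.\<close>

lemma card_quotient_le_map:
  assumes E: "equiv A E" "finite A" and Q: "equiv B Q"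
    and map: "\<And>x. x \<in> A \<Longrightarrow> \<rho> x \<in> B" "\<And>x y. (x, y) \<in> E \<Longrightarrow> (\<rho> x, \<rho> y) \<in> Q"
    and surj: "\<And>z. z \<in> B \<Longrightarrow> \<exists>x\<in>A. (\<rho> x, z) \<in> Q"
  shows "card (B // Q) \<le> card (A // E)"
proof -
  have cls: "Q `` (\<rho> ` (E `` {x})) = Q `` {\<rho> x}" if x: "x \<in> A" for x
  proof
    have "(x, x) \<in> E" using E(1) x by (auto simp: equiv_def refl_on_def)
    then show "Q `` {\<rho> x} \<subseteq> Q `` (\<rho> ` (E `` {x}))" by blast
    show "Q `` (\<rho> ` (E `` {x})) \<subseteq> Q `` {\<rho> x}"
    proof clarify
      fix z y assume "(x, y) \<in> E" "(\<rho> y, z) \<in> Q"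
      then show "(\<rho> x, z) \<in> Q" using map(2)[of x y] Q by (auto elim!: equivE dest: transD)
    qed
  qed
  have "B // Q \<subseteq> (\<lambda>X. Q `` (\<rho> ` X)) ` (A // E)"
  proof
    fix Y assume "Y \<in> B // Q"
    then obtain z where z: "z \<in> B" "Y = Q `` {z}" by (auto elim: quotientE)
    then obtain x where x: "x \<in> A" "(\<rho> x, z) \<in> Q" using surj by blast
    have "Y = Q `` {\<rho> x}" using z(2) equiv_class_eq[OF Q x(2)] by simp
    then have "Y = Q `` (\<rho> ` (E `` {x}))" using cls[OF x(1)] by simp
    then show "Y \<in> (\<lambda>X. Q `` (\<rho> ` X)) ` (A // E)" using x(1) by (blast intro: quotientI)
  qed
  moreover have "finite (A // E)" using E by (simp add: finite_quotient equiv_type)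
  ultimately show ?thesis by (meson card_image_le card_mono finite_imageI le_trans)
qed

lemma side_sum_mids:
  assumes "side a b" "0 \<le> \<beta>" "\<beta> \<le> 1"
  shows "\<beta> *\<^sub>R a + (1 - \<beta>) *\<^sub>R b \<in> mids \<longleftrightarrow> \<beta> = 1 / 2"
proof -
  have c: "a \<in> corners" "b \<in> corners" "dist a b = 1" using assms(1) by (auto simp: side_def)
  have d: "(fst a - fst b)\<^sup>2 + (snd a - snd b)\<^sup>2 = 1"
    using c(3) by (simp add: dist_prod_def dist_real_def)
  show ?thesis
    using c(1,2) d assms(2,3) unfolding corners_eq by (auto simp: mids_def)
qed

lemma half_sum_midpoint: "(1/2) *\<^sub>R a + (1 - 1/2) *\<^sub>R b = midpoint a b" for a b :: plane
  by (simp add: midpoint_def scaleR_add_right)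

lemma side_sum_ne_centre:
  assumes "side a b" "0 \<le> \<beta>" "\<beta> \<le> 1"
  shows "\<beta> *\<^sub>R a + (1 - \<beta>) *\<^sub>R b \<noteq> square_centre"
proof -
  have c: "a \<in> corners" "b \<in> corners" "dist a b = 1" using assms(1) by (auto simp: side_def)
  have d: "(fst a - fst b)\<^sup>2 + (snd a - snd b)\<^sup>2 = 1"
    using c(3) by (simp add: dist_prod_def dist_real_def)
  show ?thesis
    using c(1,2) d assms(2,3) unfolding corners_eq by auto
qed

lemma side_sum_unit_square:
  assumes "side a b" "0 \<le> \<beta>" "\<beta> \<le> 1"
  shows "\<beta> *\<^sub>R a + (1 - \<beta>) *\<^sub>R b \<in> unit_square"
  using assms convex_unit_square by (intro convexD) (auto simp: side_def corners_eq unit_square_def)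

text \<open>The combinatorial part of \<open>aitchison_glue\<close>: which side faces are glued,
  without the coordinates on them.\<close>

definition glued_sides ::
    "diagram \<Rightarrow> real ^ 3 \<Rightarrow> plane \<Rightarrow> plane \<Rightarrow> real ^ 3 \<Rightarrow> plane \<Rightarrow> plane \<Rightarrow> bool" where
  "glued_sides \<Gamma> j a b k a' b' \<longleftrightarrow> (\<exists>g\<in>oriented_edges \<Gamma>. \<exists>R\<in>regions \<Gamma>.
     joins_over_under \<Gamma> g j a k a' \<and> side a b \<and> side a' b' \<and>
     chart \<Gamma> j ` open_segment a b \<subseteq> R \<and> chart \<Gamma> k ` open_segment a' b' \<subseteq> R)"

text \<open>The apex weight \<alpha> is half the absolute height in the cube, and dividing the other
  weights by \<open>1 - \<alpha>\<close> gives the position along the base edge. In cube coordinates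
  the barycentric gluing thus becomes a product, matching points of the sides and changing the sign
  of the height, as in \<open>C3\<close>.\<close>

lemma chopped_iff:
  fixes a b c p :: plane
  assumes \<alpha>: "0 \<le> \<alpha>" "\<alpha> < 1" and h: "h = 1 \<or> h = -1" and t: "0 \<le> t * h"
  shows "((1 - \<bar>t\<bar> / 2) *\<^sub>R p + (\<bar>t\<bar> / 2) *\<^sub>R c, t / 2) =
      \<alpha> *\<^sub>R (c, h) + ((1 - \<alpha>) * \<beta>) *\<^sub>R (a, 0) + ((1 - \<alpha>) * \<gamma>) *\<^sub>R (b, 0)
    \<longleftrightarrow> t = 2 * \<alpha> * h \<and> p = \<beta> *\<^sub>R a + \<gamma> *\<^sub>R b"
proof -
  have "(1 - \<alpha>) *\<^sub>R p + \<alpha> *\<^sub>R c = \<alpha> *\<^sub>R c + ((1 - \<alpha>) * \<beta>) *\<^sub>R a + ((1 - \<alpha>) * \<gamma>) *\<^sub>R b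
      \<longleftrightarrow> (1 - \<alpha>) *\<^sub>R p = (1 - \<alpha>) *\<^sub>R (\<beta> *\<^sub>R a + \<gamma> *\<^sub>R b)"
    by (auto simp: scaleR_add_right)
  also have "\<dots> \<longleftrightarrow> p = \<beta> *\<^sub>R a + \<gamma> *\<^sub>R b" using \<alpha> by simp
  finally have *: "(1 - \<alpha>) *\<^sub>R p + \<alpha> *\<^sub>R c = \<alpha> *\<^sub>R c + ((1 - \<alpha>) * \<beta>) *\<^sub>R a + ((1 - \<alpha>) * \<gamma>) *\<^sub>R b
      \<longleftrightarrow> p = \<beta> *\<^sub>R a + \<gamma> *\<^sub>R b" .
  have abs: "\<bar>t\<bar> / 2 = \<alpha>" if "t = 2 * \<alpha> * h" using that \<alpha> h by auto
  have "((1 - \<bar>t\<bar> / 2) *\<^sub>R p + (\<bar>t\<bar> / 2) *\<^sub>R c, t / 2) =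
      \<alpha> *\<^sub>R (c, h) + ((1 - \<alpha>) * \<beta>) *\<^sub>R (a, 0) + ((1 - \<alpha>) * \<gamma>) *\<^sub>R (b, 0)
    \<longleftrightarrow> t = 2 * \<alpha> * h \<and> (1 - \<bar>t\<bar> / 2) *\<^sub>R p + (\<bar>t\<bar> / 2) *\<^sub>R c =
      \<alpha> *\<^sub>R c + ((1 - \<alpha>) * \<beta>) *\<^sub>R a + ((1 - \<alpha>) * \<gamma>) *\<^sub>R b"
    by auto
  then show ?thesis using * abs by metis
qed

lemma chopped_eq: "chopped (p, t) = ((1 - \<bar>t\<bar> / 2) *\<^sub>R p + (\<bar>t\<bar> / 2) *\<^sub>R square_centre, t / 2)"
  by simp

lemma aitchison_glueE:
  assumes "(u, v) \<in> aitchison_glue \<Gamma>"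
  obtains j a b k a' b' \<beta> t where "glued_sides \<Gamma> j a b k a' b'" "0 \<le> t" "t \<le> 1" "0 \<le> \<beta>" "\<beta> \<le> 1"
    "u = (Upper j, (\<beta> *\<^sub>R a + (1 - \<beta>) *\<^sub>R b, t))" "v = (Lower k, (\<beta> *\<^sub>R b' + (1 - \<beta>) *\<^sub>R a', - t))"
proof -
  obtain j k x y g R a b a' b' \<alpha> \<beta> \<gamma> where *: "u = (Upper j, x)" "v = (Lower k, y)"
    "x \<in> half_cube (Upper j)" "y \<in> half_cube (Lower k)"
    "g \<in> oriented_edges \<Gamma>" "R \<in> regions \<Gamma>" "joins_over_under \<Gamma> g j a k a'" "side a b" "side a' b'"
    "chart \<Gamma> j ` open_segment a b \<subseteq> R" "chart \<Gamma> k ` open_segment a' b' \<subseteq> R"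
    "0 \<le> \<alpha>" "0 \<le> \<beta>" "0 \<le> \<gamma>" "\<alpha> + \<beta> + \<gamma> = 1"
    "chopped x = \<alpha> *\<^sub>R apex_above + \<beta> *\<^sub>R (a, 0) + \<gamma> *\<^sub>R (b, 0)"
    "chopped y = \<alpha> *\<^sub>R apex_below + \<beta> *\<^sub>R (b', 0) + \<gamma> *\<^sub>R (a', 0)"
    using assms unfolding aitchison_glue_def
    by (elim CollectE exE conjE bexE Pair_inject) (rule that; assumption)
  obtain p t p' t' where xy: "x = (p, t)" "y = (p', t')" by (cases x; cases y)
  have t: "0 \<le> t" "t \<le> 1" "t' \<le> 0"
    using *(3,4) by (auto simp: xy)
  have "snd (chopped x) = \<alpha>" unfolding *(16) apex_above_def by simp
  then have \<alpha>: "\<alpha> = t / 2" by (simp add: xy)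
  then have \<alpha>1: "\<alpha> < 1" using t by simp
  \<comment> \<open>Chopping keeps the apex weight at most 1/2, so the two weights on the base edge
    can be rescaled to sum 1.\<close>
  define \<beta>' where "\<beta>' = \<beta> / (1 - \<alpha>)"
  have \<beta>: "\<beta> = (1 - \<alpha>) * \<beta>'" using \<alpha>1 by (simp add: \<beta>'_def)
  have "\<gamma> = (1 - \<alpha>) - \<beta>" using *(15) by simp
  then have \<gamma>: "\<gamma> = (1 - \<alpha>) * (1 - \<beta>')" by (simp add: \<beta> right_diff_distrib)
  have b01: "0 \<le> \<beta>'" "\<beta>' \<le> 1" using *(13,14) \<alpha>1 unfolding \<gamma> by (simp_all add: \<beta>'_def zero_le_mult_iff)
  have up: "t = 2 * \<alpha> * 1 \<and> p = \<beta>' *\<^sub>R a + (1 - \<beta>') *\<^sub>R b"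
  proof (rule chopped_iff[THEN iffD1])
    show "((1 - \<bar>t\<bar> / 2) *\<^sub>R p + (\<bar>t\<bar> / 2) *\<^sub>R square_centre, t / 2) = \<alpha> *\<^sub>R (square_centre, 1) +
        ((1 - \<alpha>) * \<beta>') *\<^sub>R (a, 0) + ((1 - \<alpha>) * (1 - \<beta>')) *\<^sub>R (b, 0)"
      using *(16) unfolding xy chopped_eq apex_above_def \<beta> \<gamma> .
  qed (use *(12) \<alpha>1 t in auto)
  have down: "t' = 2 * \<alpha> * -1 \<and> p' = \<beta>' *\<^sub>R b' + (1 - \<beta>') *\<^sub>R a'"
  proof (rule chopped_iff[THEN iffD1])
    show "((1 - \<bar>t'\<bar> / 2) *\<^sub>R p' + (\<bar>t'\<bar> / 2) *\<^sub>R square_centre, t' / 2) = \<alpha> *\<^sub>R (square_centre, -1) +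
        ((1 - \<alpha>) * \<beta>') *\<^sub>R (b', 0) + ((1 - \<alpha>) * (1 - \<beta>')) *\<^sub>R (a', 0)"
      using *(17) unfolding xy chopped_eq apex_below_def \<beta> \<gamma> .
  qed (use *(12) \<alpha>1 t in auto)
  have "p = \<beta>' *\<^sub>R a + (1 - \<beta>') *\<^sub>R b" using up by blast
  moreover have "t' = - t \<and> p' = \<beta>' *\<^sub>R b' + (1 - \<beta>') *\<^sub>R a'" using up down by simp
  moreover have "glued_sides \<Gamma> j a b k a' b'" using *(5-11) unfolding glued_sides_def by blast
  ultimately show thesis using that[of j a b k a' b' t \<beta>'] *(1,2) xy t b01 by blast
qed

lemma aitchison_glueI:
  assumes gs: "glued_sides \<Gamma> j a b k a' b'" and t: "0 \<le> t" "t \<le> 1" and \<beta>: "0 \<le> \<beta>" "\<beta> \<le> 1"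
  shows "((Upper j, (\<beta> *\<^sub>R a + (1 - \<beta>) *\<^sub>R b, t)), (Lower k, (\<beta> *\<^sub>R b' + (1 - \<beta>) *\<^sub>R a', - t))) \<in> aitchison_glue \<Gamma>"
proof -
  obtain g R where gR: "g \<in> oriented_edges \<Gamma>" "R \<in> regions \<Gamma>" "joins_over_under \<Gamma> g j a k a'" "side a b" "side a' b'"
    "chart \<Gamma> j ` open_segment a b \<subseteq> R" "chart \<Gamma> k ` open_segment a' b' \<subseteq> R"
    using gs unfolding glued_sides_def by blast
  let ?p = "\<beta> *\<^sub>R a + (1 - \<beta>) *\<^sub>R b" and ?p' = "\<beta> *\<^sub>R b' + (1 - \<beta>) *\<^sub>R a'"
  have sym: "side b' a'" using gR(5) by (simp add: side_def dist_commute)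
  have in1: "(?p, t) \<in> half_cube (Upper j)"
    using side_sum_unit_square[OF gR(4) \<beta>] t by simp
  have in2: "(?p', - t) \<in> half_cube (Lower k)"
    using side_sum_unit_square[OF sym \<beta>] t by simp
  define \<alpha> where "\<alpha> = t / 2"
  have \<alpha>: "0 \<le> \<alpha>" "\<alpha> < 1" using t by (auto simp: \<alpha>_def)
  have "chopped (?p, t) = \<alpha> *\<^sub>R apex_above + ((1 - \<alpha>) * \<beta>) *\<^sub>R (a, 0) + ((1 - \<alpha>) * (1 - \<beta>)) *\<^sub>R (b, 0)"
    unfolding chopped_eq apex_above_def
    by (rule chopped_iff[THEN iffD2]) (use \<alpha> t in \<open>auto simp: \<alpha>_def\<close>)
  moreover have "chopped (?p', - t) = \<alpha> *\<^sub>R apex_below + ((1 - \<alpha>) * \<beta>) *\<^sub>R (b', 0) + ((1 - \<alpha>) * (1 - \<beta>)) *\<^sub>R (a', 0)"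
    unfolding chopped_eq apex_below_def
    by (rule chopped_iff[THEN iffD2]) (use \<alpha> t in \<open>auto simp: \<alpha>_def\<close>)
  moreover have "\<alpha> + (1 - \<alpha>) * \<beta> + (1 - \<alpha>) * (1 - \<beta>) = 1" by (simp add: algebra_simps)
  moreover have "0 \<le> (1 - \<alpha>) * \<beta>" "0 \<le> (1 - \<alpha>) * (1 - \<beta>)" using \<alpha> \<beta> by simp_all
  ultimately have "\<exists>\<alpha> \<beta> \<gamma>. 0 \<le> \<alpha> \<and> 0 \<le> \<beta> \<and> 0 \<le> \<gamma> \<and> \<alpha> + \<beta> + \<gamma> = 1 \<and>
      chopped (?p, t) = \<alpha> *\<^sub>R apex_above + \<beta> *\<^sub>R (a, 0) + \<gamma> *\<^sub>R (b, 0) \<and>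
      chopped (?p', - t) = \<alpha> *\<^sub>R apex_below + \<beta> *\<^sub>R (b', 0) + \<gamma> *\<^sub>R (a', 0)"
    using \<alpha>(1) by blast
  note bary = this
  show ?thesis
    unfolding aitchison_glue_def mem_Collect_eq
    by (intro exI[of _ j] exI[of _ k] exI[of _ "(?p, t)"] exI[of _ "(?p', - t)"] conjI refl in1 in2
        bexI[OF _ gR(1)] bexI[OF _ gR(2)] exI[of _ a] exI[of _ b] exI[of _ a'] exI[of _ b'] gR(3-7) bary)
qed

lemma cells_Aitchison [simp]: "cells (Aitchison \<Gamma>) = half_cells (crossings \<Gamma>)"
  and cube_Aitchison [simp]: "cube (Aitchison \<Gamma>) = half_cube"
  by (simp_all add: Aitchison_def)

lemma Aitchison_glueE:
  assumes "(u, v) \<in> glue (Aitchison \<Gamma>)"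
  obtains (base) s x where "s \<in> crossings \<Gamma>" "x \<in> unit_square" "u = (Upper s, (x, 0))" "v = (Lower s, (x, 0))"
  | (side) j a b k a' b' \<beta> t where "glued_sides \<Gamma> j a b k a' b'" "0 \<le> t" "t \<le> 1" "0 \<le> \<beta>" "\<beta> \<le> 1"
    "u = (Upper j, (\<beta> *\<^sub>R a + (1 - \<beta>) *\<^sub>R b, t))" "v = (Lower k, (\<beta> *\<^sub>R b' + (1 - \<beta>) *\<^sub>R a', - t))"
proof -
  have "(u, v) \<in> base_glue (crossings \<Gamma>) \<or> (u, v) \<in> aitchison_glue \<Gamma>"
    using assms by (auto simp: Aitchison_def)
  then show thesis
  proof
    assume "(u, v) \<in> base_glue (crossings \<Gamma>)"
    then show thesis using base unfolding base_glue_def by blast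
  next
    assume "(u, v) \<in> aitchison_glue \<Gamma>"
    then show thesis by (rule aitchison_glueE) (rule side)
  qed
qed

text \<open>All gluings take place at height 0 or over the boundary of the squares. For a complex
  isomorphic to some \<open>C3\<close>, uniqueness of the free centre is transferred from
  \<open>free_centre_C3\<close> in \<open>forward\<close>.\<close>

lemma free_centre_Aitchison: "free_centre (Aitchison \<Gamma>) d (square_centre, height d)"
  unfolding free_centre_def
proof (intro conjI allI impI)
  show "face_centre (cube (Aitchison \<Gamma>) d) (square_centre, height d)" by (simp add: face_centre_top)
  fix p assume p: "((d, (square_centre, height d)), p) \<in> identified (Aitchison \<Gamma>)"
  have no: "u \<noteq> (d, (square_centre, height d)) \<and> v \<noteq> (d, (square_centre, height d))"
    if "(u, v) \<in> glue (Aitchison \<Gamma>)" for u v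
    using that
  proof (cases rule: Aitchison_glueE)
    case (base s x)
    then show ?thesis using height_cases[of d] by auto
  next
    case (side j a b k a' b' \<beta> t)
    have s: "side a b" "side b' a'" using side(1) by (auto simp: glued_sides_def side_def dist_commute)
    show ?thesis
      using side_sum_ne_centre[OF s(1) side(4,5)] side_sum_ne_centre[OF s(2) side(4,5)] side(6,7)
      by (metis prod.inject)
  qed
  show "p = (d, (square_centre, height d))"
    by (rule identified_isolated[OF _ _ p]) (use no in blast)+
qed

lemma half_index_cells: "c \<in> half_cells I \<Longrightarrow> half_index c \<in> I"
  by (auto simp: half_cells_def)

lemma half_index_cases: "c = Upper (half_index c) \<or> c = Lower (half_index c)"
  by (cases c) auto

section \<open>Regions as an invariant of the Aitchison gluing\<close>

context ldiag
begin

lemma reg_eq_side: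
  assumes "x \<in> cr" "side a b" "R \<in> regions \<Gamma>" "ch x ` open_segment a b \<subseteq> R"
  shows "R = reg x (midpoint a b)"
proof (rule reg_eq_if_meet[OF assms(1) _ assms(3)])
  show "midpoint a b \<in> mids" using side_cases[OF assms(2)] by blast
  show "ch x ` sector (midpoint a b) \<inter> R \<noteq> {}"
    using side_cases(6,7)[OF assms(2)] assms(4) by blast
qed

lemma side_in_reg:
  assumes "x \<in> cr" "side a b"
  shows "ch x ` open_segment a b \<subseteq> reg x (midpoint a b)"
  using sector_reg[OF assms(1)] side_cases[OF assms(2)] by blast

lemma glued_sides_reg:
  assumes "glued_sides \<Gamma> j a b k a' b'"
  shows "j \<in> cr" "k \<in> cr" "side a b" "side b' a'" "reg j (midpoint a b) = reg k (midpoint b' a')"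
proof -
  obtain g R where gR: "g \<in> oriented_edges \<Gamma>" "R \<in> regions \<Gamma>" "joins_over_under \<Gamma> g j a k a'"
    "side a b" "side a' b'" "ch j ` open_segment a b \<subseteq> R" "ch k ` open_segment a' b' \<subseteq> R"
    using assms unfolding glued_sides_def by blast
  show jk: "j \<in> cr" "k \<in> cr" using gR(3) by (auto simp: joins_over_under_def leaves_at_def)
  show "side a b" "side b' a'" using gR(4,5) by (auto simp: side_def dist_commute)
  show "reg j (midpoint a b) = reg k (midpoint b' a')"
    using reg_eq_side[OF jk(1) gR(4,2,6)] reg_eq_side[OF jk(2) gR(5,2,7)] by (simp add: midpoint_sym)
qed

text \<open>An invariant of the identifications: the region at the midpoint of a base edge, and None
  at all other points, which are never glued to such a midpoint.\<close>

definition side_label :: "(real ^ 3) half \<times> space \<Rightarrow> (real ^ 3) set option" where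
  "side_label = (\<lambda>(c, p, t). if t = 0 \<and> p \<in> mids then Some (reg (half_index c) p) else None)"

lemma side_label_glue:
  assumes "(u, v) \<in> glue (Aitchison \<Gamma>)"
  shows "side_label u = side_label v"
  using assms
proof (cases rule: Aitchison_glueE)
  case (base s x)
  then show ?thesis by (simp add: side_label_def)
next
  case (side j a b k a' b' \<beta> t)
  note g = glued_sides_reg[OF side(1)]
  show ?thesis
  proof (cases "t = 0 \<and> \<beta> = 1/2")
    case True
    have h: "\<beta> = 1/2" using True by blast
    have "midpoint a b \<in> mids" "midpoint b' a' \<in> mids" using side_cases(3) g(3,4) by blast+
    then show ?thesis
      unfolding side(6,7) h half_sum_midpoint using True g(5) by (simp add: side_label_def)
  next
    case False
    then show ?thesis
      unfolding side(6,7) side_label_def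
      using side_sum_mids[OF g(3) side(4,5)] side_sum_mids[OF g(4) side(4,5)] by auto
  qed
qed

lemma identified_side_label:
  assumes "(u, v) \<in> identified (Aitchison \<Gamma>)"
  shows "side_label u = side_label v"
proof -
  have *: "(u, v) \<in> (glue (Aitchison \<Gamma>) \<union> (glue (Aitchison \<Gamma>))\<inverse>)\<^sup>*"
    using assms by (simp add: identified_def)
  have "side_label u = side_label u \<longleftrightarrow> side_label v = side_label u"
    by (rule rtrancl_invariant[OF *]) (simp add: side_label_glue)
  then show ?thesis by simp
qed

lemma identified_reg:
  assumes "((c, (m, 0)), (d, (m', 0))) \<in> identified (Aitchison \<Gamma>)" "m \<in> mids" "m' \<in> mids"
  shows "reg (half_index c) m = reg (half_index d) m'"
  using identified_side_label[OF assms(1)] assms(2,3) by (simp add: side_label_def)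

text \<open>\<open>aitchison_glue\<close> glues sides lying in a common region; that a partner
  exists for each side at the overpass end of an edge is the content of
  \<open>edge_side\<close>.\<close>

lemma reg_eq_joins:
  assumes g: "g \<in> oriented_edges \<Gamma>" and j: "joins_over_under \<Gamma> g j a k a'"
    and m: "m \<in> mids" "0 < dotc m a"
  shows "\<exists>b b'. m = midpoint a b \<and> glued_sides \<Gamma> j a b k a' b'"
proof -
  have l: "leaves_at \<Gamma> g j a" "leaves_at \<Gamma> (reversepath g) k a'"
    using j by (auto simp: joins_over_under_def)
  have c: "j \<in> cr" "k \<in> cr" "a \<in> corners" "a' \<in> corners" using l by (auto simp: leaves_at_def)
  obtain m' where m': "m' \<in> mids" "0 < dotc m' a'" "reg k m' = reg j m"
    using edge_side[OF g l m] by blast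
  obtain b where b: "side a b" "m = midpoint a b" using adjacent_side[OF c(3) m] by blast
  obtain b' where b': "side a' b'" "m' = midpoint a' b'" using adjacent_side[OF c(4) m'(1,2)] by blast
  have "ch j ` open_segment a b \<subseteq> reg j m" using side_in_reg[OF c(1) b(1)] b(2) by simp
  moreover have "ch k ` open_segment a' b' \<subseteq> reg j m" using side_in_reg[OF c(2) b'(1)] b'(2) m'(3) by simp
  moreover have "reg j m \<in> regions \<Gamma>" by (rule reg_in_regions[OF c(1) m(1)])
  ultimately have "glued_sides \<Gamma> j a b k a' b'"
    unfolding glued_sides_def using g j b(1) b'(1) by blast
  then show ?thesis using b(2) by blast
qed

end

lemma (in complex_isomorphism) connected_transfer:
  assumes "complex_connected L"
  shows "complex_connected K"
  unfolding complex_connected_def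
proof (intro ballI)
  let ?RK = "{(c, d). \<exists>x y. ((c, x), (d, y)) \<in> identified K}"
  let ?RL = "{(c, d). \<exists>x y. ((c, x), (d, y)) \<in> identified L}"
  fix c d assume cd: "c \<in> cells K" "d \<in> cells K"
  have "(\<sigma> c, \<sigma> d) \<in> ?RL\<^sup>*"
    using assms cd \<sigma>_in unfolding complex_connected_def by blast
  then have "\<exists>e\<in>cells K. \<sigma> e = \<sigma> d \<and> (c, e) \<in> ?RK\<^sup>*"
  proof (induction rule: rtrancl_induct)
    case base
    then show ?case using cd by blast
  next
    case (step d' e')
    then obtain e where e: "e \<in> cells K" "\<sigma> e = d'" "(c, e) \<in> ?RK\<^sup>*" by blast
    obtain x' y' where xy': "((d', x'), (e', y')) \<in> identified L" using step(2) by blast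
    then have in_L: "x' \<in> cube L d'" "e' \<in> cells L" "y' \<in> cube L e'"
      by (auto simp: identified_def cube_points_def)
    obtain f where f: "f \<in> cells K" "e' = \<sigma> f" using in_L(2) bij_\<sigma> by (auto simp: bij_betw_def)
    obtain x where x: "x \<in> cube K e" "x' = g e x" using in_L(1) g_img[OF e(1)] e(2) by blast
    obtain y where y: "y \<in> cube K f" "y' = g f y" using in_L(3) g_img[OF f(1)] f(2) by blast
    have "((e, x), (f, y)) \<in> identified K"
      using xy' g_ident[OF e(1) f(1) x(1) y(1)] e(2) f(2) x(2) y(2) by simp
    then have "(e, f) \<in> ?RK" by blast
    then have "(c, f) \<in> ?RK\<^sup>*" by (rule rtrancl_into_rtrancl[OF e(3)])
    then show ?case using f by blast
  qed
  then show "(c, d) \<in> ?RK\<^sup>*"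
    using bij_\<sigma> cd by (auto simp: bij_betw_def inj_on_eq_iff)
qed

context alt_diagram
begin

lemma Aitchison_connected: "complex_connected (Aitchison \<Gamma>)"
  unfolding complex_connected_def
proof (intro ballI)
  let ?R = "{(c, d). \<exists>x y. ((c, x), (d, y)) \<in> identified (Aitchison \<Gamma>)}"
  have symR: "sym ?R"
  proof (rule symI)
    fix c d assume "(c, d) \<in> ?R"
    then obtain x y where "((c, x), (d, y)) \<in> identified (Aitchison \<Gamma>)" by blast
    from identified_sym[OF this] show "(d, c) \<in> ?R" by blast
  qed
  have symR': "(c, d) \<in> ?R\<^sup>* \<Longrightarrow> (d, c) \<in> ?R\<^sup>*" for c d
    by (rule symD[OF sym_rtrancl[OF symR]])
  have base: "(Upper s, Lower s) \<in> ?R" if "s \<in> cr" for s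
  proof -
    have "((Upper s, ((0, 0), 0)), (Lower s, ((0, 0), 0))) \<in> identified (Aitchison \<Gamma>)"
      by (rule glue_identified)
        (use that in \<open>auto simp: Aitchison_def base_glue_def cube_points_def half_cells_def unit_square_def\<close>)
    then show ?thesis by blast
  qed
  have edge: "(Upper (pathstart h), Upper (pathfinish h)) \<in> ?R\<^sup>*" if h: "h \<in> edges \<Gamma>" for h
  proof -
    obtain g j a k a' where g: "g = h \<or> g = reversepath h" "joins_over_under \<Gamma> g j a k a'"
      using bspec[OF alt[unfolded alternating_def] h] by blast
    have go: "g \<in> oriented_edges \<Gamma>" using g(1) h by (auto simp: oriented_edges_def)
    have jk: "pathstart g = j" "pathfinish g = k" "j \<in> cr" "k \<in> cr" "a \<in> corners"
      using g(2) by (auto simp: joins_over_under_def leaves_at_def)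
    have "side a (fst a, 1 - snd a)"
      using jk(5) by (auto simp: corners_eq side_def dist_prod_def dist_real_def)
    then obtain b0 where "side a b0" by blast
    then obtain b b' where gs: "glued_sides \<Gamma> j a b k a' b'"
      using reg_eq_joins[OF go g(2) side_cases(3,4)] by blast
    \<comment> \<open>At parameter 0 and height 0 the vertex \<open>b\<close> is glued to
      \<open>a'\<close>; one common point suffices to link the two cubes.\<close>
    have "((Upper j, (0 *\<^sub>R a + (1 - 0) *\<^sub>R b, 0)), (Lower k, (0 *\<^sub>R b' + (1 - 0) *\<^sub>R a', - 0))) \<in> aitchison_glue \<Gamma>"
      by (rule aitchison_glueI[OF gs]) auto
    then have "((Upper j, (b, 0)), (Lower k, (a', 0))) \<in> identified (Aitchison \<Gamma>)"
    proof (intro glue_identified)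
      assume "((Upper j, (0 *\<^sub>R a + (1 - 0) *\<^sub>R b, 0)), (Lower k, (0 *\<^sub>R b' + (1 - 0) *\<^sub>R a', - 0))) \<in> aitchison_glue \<Gamma>"
      then show "((Upper j, (b, 0)), (Lower k, (a', 0))) \<in> glue (Aitchison \<Gamma>)"
        by (simp add: Aitchison_def)
      have "b \<in> corners" "a' \<in> corners" using glued_sides_reg(3,4)[OF gs] by (auto simp: side_def)
      then have "b \<in> unit_square" "a' \<in> unit_square" by (auto simp: corners_eq unit_square_def)
      then show "(Upper j, (b, 0)) \<in> cube_points (Aitchison \<Gamma>)" "(Lower k, (a', 0)) \<in> cube_points (Aitchison \<Gamma>)"
        using jk by (auto simp: cube_points_def half_cells_def)
    qed
    then have "(Upper j, Lower k) \<in> ?R" by blast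
    moreover have "(Lower k, Upper k) \<in> ?R" by (rule symD[OF symR base[OF jk(4)]])
    ultimately have "(Upper j, Upper k) \<in> ?R\<^sup>*" by (meson r_into_rtrancl rtrancl_into_rtrancl)
    then show ?thesis using g(1) jk(1,2) symR' by auto
  qed
  have upper: "(Upper x, Upper y) \<in> ?R\<^sup>*" if "x \<in> cr" "y \<in> cr" for x y
  proof -
    have "(x, y) \<in> ((\<lambda>g. (pathstart g, pathfinish g)) ` edges \<Gamma> \<union>
        ((\<lambda>g. (pathstart g, pathfinish g)) ` edges \<Gamma>)\<inverse>)\<^sup>*"
      using all_linked[OF that] by (simp add: linked_def eqcl_def)
    then show ?thesis
    proof (induction rule: rtrancl_induct)
      case (step y z)
      then have "(Upper y, Upper z) \<in> ?R\<^sup>*" using edge symR' by auto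
      then show ?case by (rule rtrancl_trans[OF step(3)])
    qed simp
  qed
  fix c d assume cd: "c \<in> cells (Aitchison \<Gamma>)" "d \<in> cells (Aitchison \<Gamma>)"
  have *: "(Upper (half_index c), c) \<in> ?R\<^sup>*" if "c \<in> half_cells cr" for c
    using half_index_cases[of c] base[OF half_index_cells[OF that]] by (metis (lifting) r_into_rtrancl rtrancl.rtrancl_refl)
  have "(c, Upper (half_index c)) \<in> ?R\<^sup>*" using *[of c] cd symR' by simp
  moreover have "(Upper (half_index c), Upper (half_index d)) \<in> ?R\<^sup>*"
    using upper[OF half_index_cells half_index_cells] cd by simp
  moreover have "(Upper (half_index d), d) \<in> ?R\<^sup>*" using *[of d] cd by simp
  ultimately show "(c, d) \<in> ?R\<^sup>*" by (meson rtrancl_trans)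
qed

end

lemma card_half_cells: "finite I \<Longrightarrow> card (half_cells I) = 2 * card I"
proof -
  assume "finite I"
  moreover have "Upper ` I \<inter> Lower ` I = {}" by auto
  moreover have "card (Upper ` I) = card I" "card (Lower ` I) = card I"
    by (auto intro!: card_image simp: inj_on_def)
  ultimately show ?thesis by (simp add: half_cells_def card_Un_disjoint)
qed

lemma (in sbw) forward:
  assumes \<Gamma>: "link_diagram \<Gamma>" "connected_diagram \<Gamma>" "alternating \<Gamma>"
    and iso: "complex_iso (C3 S \<phi>) (Aitchison \<Gamma>)"
  shows "complex_connected (C3 S \<phi>) \<and> card (edge_orbits S \<phi>) = card S + 2"
proof -
  interpret D: alt_diagram \<Gamma> by unfold_locales (use \<Gamma> in auto)
  let ?K = "C3 S \<phi>" and ?L = "Aitchison \<Gamma>"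
  obtain \<sigma> g where "complex_isomorphism ?K ?L \<sigma> g" using iso by (rule complex_isoE)
  then interpret I: complex_isomorphism ?K ?L \<sigma> g .
  have con: "complex_connected ?K" by (rule I.connected_transfer[OF D.Aitchison_connected])
  have "card (half_cells S) = card (half_cells (crossings \<Gamma>))"
    using bij_betw_same_card[OF I.bij_\<sigma>] by simp
  then have card: "card S = card (crossings \<Gamma>)" using finite_S D.finite_cr by (simp add: card_half_cells)
  then have ne: "S \<noteq> {}" using D.cr_ne D.finite_cr by auto
  \<comment> \<open>Free centres are pulled back to \<open>C3\<close>, where each cube has just one;
    so a cube of the Aitchison complex has just one as well, and its outer centre is free.\<close>
  have fcL: "z = (square_centre, height d)" if fc: "free_centre ?L d z" and d: "d \<in> half_cells (crossings \<Gamma>)" for d z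
  proof -
    obtain c where c: "c \<in> cells ?K" "d = \<sigma> c" using d I.bij_\<sigma> by (auto simp: bij_betw_def)
    have "w = (square_centre, height c)" if w: "w \<in> cube ?K c" "free_centre ?L d (g c w)" for w
      using I.free_centre_iff[OF c(1) w(1)] w(2) c free_centre_C3[of c w] by simp
    moreover have "\<exists>w\<in>cube ?K c. x = g c w" if "free_centre ?L d x" for x
      using that I.g_img[OF c(1)] c(2) unfolding free_centre_def face_centre_def by blast
    ultimately show ?thesis using fc free_centre_Aitchison[of \<Gamma> d] by metis
  qed
  have bmL: "base_mid ?L d x \<longleftrightarrow> snd x = 0 \<and> fst x \<in> mids" if d: "d \<in> half_cells (crossings \<Gamma>)" for d x
    by (rule base_mid_iff_mids) (use fcL[OF _ d] free_centre_Aitchison in auto)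
  have iso_mid: "snd (g c x) = 0 \<and> fst (g c x) \<in> mids \<longleftrightarrow> snd x = 0 \<and> fst x \<in> mids"
    if c: "c \<in> half_cells S" "x \<in> half_cube c" for c x
    using I.base_mid_iff[of c x] c bmL[of "\<sigma> c" "g c x"] base_mid_C3[OF c(1)] I.\<sigma>_in[of c] by simp
  have reg_eq: "D.reg (half_index (\<sigma> c)) (fst (g c (m, 0))) = D.reg (half_index (\<sigma> d)) (fst (g d (m', 0)))"
    if c: "c \<in> half_cells S" "d \<in> half_cells S" "m \<in> mids" "m' \<in> mids"
      and id: "((c, (m, 0)), (d, (m', 0))) \<in> identified ?K" for c d m m'
  proof -
    have cu: "(m, 0) \<in> half_cube c" "(m', 0) \<in> half_cube d"
      using c mids_unit_square by (cases c; cases d; auto)+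
    have gm: "g c (m, 0) = (fst (g c (m, 0)), 0)" "g d (m', 0) = (fst (g d (m', 0)), 0)"
      "fst (g c (m, 0)) \<in> mids" "fst (g d (m', 0)) \<in> mids"
      using iso_mid[OF c(1) cu(1)] iso_mid[OF c(2) cu(2)] c by (simp_all add: prod_eq_iff)
    have "((\<sigma> c, g c (m, 0)), (\<sigma> d, g d (m', 0))) \<in> identified ?L"
      using I.g_ident[of c d "(m, 0)" "(m', 0)"] c cu id by simp
    then have "((\<sigma> c, (fst (g c (m, 0)), 0)), (\<sigma> d, (fst (g d (m', 0)), 0))) \<in> identified ?L"
      using gm(1,2) by simp
    then show ?thesis by (rule D.identified_reg[OF _ gm(3,4)])
  qed
  \<comment> \<open>The crossing and the side to which the isomorphism carries the midpoint of an
    edge, read in the upper cube. Gluings identify these midpoints along \<Phi>, so \<rho> induces a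
    map from orbits to regions.\<close>
  define \<rho> where "\<rho> e = (half_index (\<sigma> (Upper (fst e))), fst (g (Upper (fst e)) (edge_point e (1/2), 0)))" for e
  have \<rho>_in: "\<rho> e \<in> D.sides" if e: "e \<in> E_all S" for e
  proof -
    have U: "Upper (fst e) \<in> half_cells S" using fst_in_S[OF e] by (simp add: half_cells_def)
    have m: "edge_point e (1/2) \<in> mids" by (rule edge_point_half[OF e])
    have "fst (g (Upper (fst e)) (edge_point e (1/2), 0)) \<in> mids"
      using iso_mid[OF U, of "(edge_point e (1/2), 0)"] m mids_unit_square[OF m] by simp
    moreover have "half_index (\<sigma> (Upper (fst e))) \<in> crossings \<Gamma>"
      using I.\<sigma>_in[of "Upper (fst e)"] U half_index_cells by simp
    ultimately show ?thesis by (simp add: D.sides_def \<rho>_def)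
  qed
  have conn_reg: "((x, m), (y, m')) \<in> D.conn (graph \<Gamma>)"
    if "(x, m) \<in> D.sides" "(y, m') \<in> D.sides" "D.reg x m = D.reg y m'" for x m y m'
  proof -
    have "chart \<Gamma> y m' \<in> S2 - graph \<Gamma>"
      using D.mids_off_graph that(2) unfolding D.sides_def by blast
    then have "chart \<Gamma> y m' \<in> D.reg y m'"
      unfolding D.reg_def mem_Collect_eq by (rule connected_component_refl)
    then have "chart \<Gamma> y m' \<in> D.reg x m" using that(3) by simp
    then show ?thesis using that(1,2) unfolding D.reg_def by (simp add: D.conn_def)
  qed
  have eqv: "equiv D.sides (D.conn (graph \<Gamma>))" by (rule D.equiv_conn) simp
  have "card (D.sides // D.conn (graph \<Gamma>)) \<le> card (E_all S // eqcl (E_all S) (fgraph (Phi S \<phi>) (E_all S)))"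
  proof (rule card_quotient_le_map[OF equiv_eqcl finite_E_all eqv \<rho>_in])
    fix e e' assume "(e, e') \<in> eqcl (E_all S) (fgraph (Phi S \<phi>) (E_all S))"
    moreover have "eqcl (E_all S) (fgraph (Phi S \<phi>) (E_all S))
        \<subseteq> {(x, y). x \<in> E_all S \<and> y \<in> E_all S \<and> (\<rho> x, \<rho> y) \<in> D.conn (graph \<Gamma>)}"
    proof (rule eqcl_least)
      show "equiv (E_all S) {(x, y). x \<in> E_all S \<and> y \<in> E_all S \<and> (\<rho> x, \<rho> y) \<in> D.conn (graph \<Gamma>)}"
        by (rule equiv_pullback[OF eqv]) (use \<rho>_in in blast)
      show "fgraph (Phi S \<phi>) (E_all S) \<subseteq> {(x, y). x \<in> E_all S \<and> y \<in> E_all S \<and> (\<rho> x, \<rho> y) \<in> D.conn (graph \<Gamma>)}"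
      proof
        fix p assume "p \<in> fgraph (Phi S \<phi>) (E_all S)"
        then obtain e where e: "e \<in> E_all S" and p: "p = (e, Phi S \<phi> e)" unfolding fgraph_def by blast
        let ?e = "Phi S \<phi> e"
        have U: "Upper (fst e) \<in> half_cells S" "Upper (fst ?e) \<in> half_cells S"
          using fst_in_S[OF e] fst_in_S[OF Phi_in[OF e]] by (auto simp: half_cells_def)
        have m: "edge_point e (1/2) \<in> mids" "edge_point ?e (1/2) \<in> mids"
          using edge_point_half e Phi_in by blast+
        have "((Upper (fst e), (edge_point e (1/2), 0)), (Lower (fst e), (edge_point e (1/2), 0))) \<in> identified ?K"
          by (rule base_identified[OF fst_in_S[OF e] mids_unit_square[OF m(1)]])
        moreover have "((Lower (fst e), (edge_point e (1/2), 0)), (Upper (fst ?e), (edge_point ?e (1/2), 0))) \<in> identified ?K"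
          using side_identified[OF e, of 0] by simp
        ultimately have "((Upper (fst e), (edge_point e (1/2), 0)), (Upper (fst ?e), (edge_point ?e (1/2), 0))) \<in> identified ?K"
          unfolding identified_eq_eqcl by (rule eqcl_trans)
        from reg_eq[OF U m this] have "(\<rho> e, \<rho> ?e) \<in> D.conn (graph \<Gamma>)"
          using \<rho>_in[OF e] \<rho>_in[OF Phi_in[OF e]] unfolding \<rho>_def by (intro conn_reg)
        then show "p \<in> {(x, y). x \<in> E_all S \<and> y \<in> E_all S \<and> (\<rho> x, \<rho> y) \<in> D.conn (graph \<Gamma>)}"
          using e Phi_in[OF e] p by simp
      qed
    qed
    ultimately show "(\<rho> e, \<rho> e') \<in> D.conn (graph \<Gamma>)" by blast
  next
    fix z assume z: "z \<in> D.sides"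
    obtain x m where xm: "z = (x, m)" "x \<in> crossings \<Gamma>" "m \<in> mids" using z by (auto simp: D.sides_def)
    have "Upper x \<in> cells ?L" using xm by (simp add: half_cells_def)
    then have "Upper x \<in> \<sigma> ` half_cells S" using bij_betw_imp_surj_on[OF I.bij_\<sigma>] by simp
    then obtain c where c: "c \<in> half_cells S" "\<sigma> c = Upper x" by (metis imageE)
    have "(m, 0) \<in> cube ?L (\<sigma> c)" using c(2) mids_unit_square[OF xm(3)] by simp
    then have "(m, 0) \<in> g c ` half_cube c" using I.g_img[of c] c(1) by simp
    then obtain y where y: "y \<in> half_cube c" "g c y = (m, 0)" by (metis imageE)
    then have "snd y = 0" "fst y \<in> mids" using iso_mid[OF c(1) y(1)] xm(3) by auto
    then obtain m' where m': "y = (m', 0)" "m' \<in> mids" by (metis prod.collapse)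
    let ?s = "half_index c"
    have s: "?s \<in> S" by (rule half_index_cells[OF c(1)])
    then obtain e where e: "e \<in> E_all S" "fst e = ?s" "edge_point e (1/2) = m'"
      using mids_edge_point[OF _ m'(2)] by metis
    have U: "Upper ?s \<in> half_cells S" using s by (simp add: half_cells_def)
    \<comment> \<open>The preimage of the side may lie in a lower cube; the base gluing moves it to
      the upper one, where \<rho> is defined.\<close>
    have "((Upper ?s, (m', 0)), (c, (m', 0))) \<in> identified ?K"
    proof (cases c)
      case (Upper s)
      then have "(Upper ?s, (m', 0)) \<in> cube_points ?K"
        using s mids_unit_square[OF m'(2)] by (simp add: cube_points_def half_cells_def)
      then show ?thesis using Upper by (simp add: identified_def)
    next
      case (Lower s')
      then show ?thesis using base_identified[OF s mids_unit_square[OF m'(2)]] by simp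
    qed
    from reg_eq[OF U c(1) m'(2,2) this]
    have "D.reg (fst (\<rho> e)) (snd (\<rho> e)) = D.reg x m"
      using e y m' c(2) by (simp add: \<rho>_def)
    then have "(\<rho> e, z) \<in> D.conn (graph \<Gamma>)"
      using conn_reg[of "fst (\<rho> e)" "snd (\<rho> e)" x m] \<rho>_in[OF e(1)] z xm(1) by simp
    then show "\<exists>e\<in>E_all S. (\<rho> e, z) \<in> D.conn (graph \<Gamma>)" using e(1) by blast
  qed
  then have "card S + 2 \<le> card (edge_orbits S \<phi>)"
    using D.region_count card unfolding card_edge_orbits norb_def by simp
  then show ?thesis using con card_edge_orbits_le[OF con ne] by simp
qed

section \<open>Chords of a circle\<close>

locale circle =
  fixes N :: nat
  assumes N2: "2 \<le> N"
begin

text \<open>Half the angle between consecutive positions, because \<theta> times differences of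
  positions are the angles in \<open>lf_u\<close>.\<close>

definition \<theta> :: real where "\<theta> = pi / N"

definition u :: "real \<Rightarrow> complex" where "u r = cis (2 * \<theta> * r)"

text \<open>Affine function vanishing on the line through \<open>u a\<close> and \<open>u b\<close>:
  the coordinate in the direction bisecting the two points, minus the signed distance of the line
  from the origin. For \<open>a = b\<close> the line is the tangent.\<close>

definition lf :: "real \<Rightarrow> real \<Rightarrow> complex \<Rightarrow> real" where
  "lf a b z = Re (z * cis (- \<theta> * (a + b))) - cos (\<theta> * (b - a))"

lemma \<theta>_pos: "0 < \<theta>" and \<theta>_N: "\<theta> * N = pi" and \<theta>_le: "\<theta> \<le> pi / 2"
  using N2 by (auto simp: \<theta>_def field_simps)

lemma norm_u [simp]: "norm (u r) = 1"
  by (simp add: u_def)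

lemma u_periodic: "u (r + real N) = u r"
proof -
  have "2 * \<theta> * (r + N) = 2 * \<theta> * r + 2 * pi" using \<theta>_N by (simp add: distrib_left)
  then show ?thesis by (simp add: u_def cis_mult[symmetric] cis_2pi flip: cis_mult)
qed

lemma u_periodic': "u (r - real N) = u r"
  using u_periodic[of "r - N"] by simp

lemma lf_sym: "lf a b = lf b a"
proof
  fix z
  have "cos (\<theta> * (b - a)) = cos (\<theta> * (a - b))" by (metis cos_minus minus_diff_eq mult_minus_right)
  then show "lf a b z = lf b a z" by (simp add: lf_def add.commute)
qed

lemma lf_u: "lf a b (u r) = 2 * sin (\<theta> * (r - a)) * sin (\<theta> * (b - r))"
proof -
  have "u r * cis (- \<theta> * (a + b)) = cis (2 * \<theta> * r - \<theta> * (a + b))"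
    by (simp add: u_def cis_mult)
  then have "lf a b (u r) = cos (2 * \<theta> * r - \<theta> * (a + b)) - cos (\<theta> * (b - a))"
    by (simp add: lf_def)
  also have "2 * \<theta> * r - \<theta> * (a + b) = \<theta> * (r - a) - \<theta> * (b - r)" by (simp add: algebra_simps)
  also have "\<theta> * (b - a) = \<theta> * (r - a) + \<theta> * (b - r)" by (simp add: algebra_simps)
  finally show ?thesis by (simp add: cos_add cos_diff)
qed

lemma sgn_sin: "\<bar>x\<bar> < real N \<Longrightarrow> sgn (sin (\<theta> * x)) = sgn x" for x :: real
proof -
  assume x: "\<bar>x\<bar> < real N"
  have pos: "0 < sin (\<theta> * y)" if "0 < y" "y < real N" for y :: real
  proof (rule sin_gt_zero)
    show "0 < \<theta> * y" using that \<theta>_pos by simp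
    have "\<theta> * y < \<theta> * N" using that \<theta>_pos by (intro mult_strict_left_mono) auto
    then show "\<theta> * y < pi" using \<theta>_N by simp
  qed
  consider "x = 0" | "0 < x" | "x < 0" by linarith
  then show ?thesis
  proof cases
    case 2
    then show ?thesis using pos[of x] x by simp
  next
    case 3
    then show ?thesis using pos[of "- x"] x by simp
  qed simp
qed

lemma sgn_lf_u:
  assumes "\<bar>r - a\<bar> < real N" "\<bar>b - r\<bar> < real N"
  shows "sgn (lf a b (u r)) = sgn (r - a) * sgn (b - r)"
  using sgn_sin[OF assms(1)] sgn_sin[OF assms(2)] by (simp add: lf_u sgn_mult)

lemma lf_ends: "lf a b (u a) = 0" "lf a b (u b) = 0"
  by (simp_all add: lf_u)

lemma lf_convex: "lf a b ((1 - t) *\<^sub>R z + t *\<^sub>R w) = (1 - t) * lf a b z + t * lf a b w"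
  by (simp add: lf_def algebra_simps)

lemma lf_add: "lf a b (z + t *\<^sub>R (w - w')) = lf a b z + t * (lf a b w - lf a b w')"
  by (simp add: lf_def algebra_simps)

lemma continuous_lf: "continuous_on A (lf a b)"
  unfolding lf_def by (intro continuous_intros)

lemma inj_u: "u r = u s \<Longrightarrow> \<bar>r - s\<bar> < real N \<Longrightarrow> r = s"
proof -
  assume *: "u r = u s" "\<bar>r - s\<bar> < real N"
  have "lf s (s + N / 2) (u s) = 0" by (simp add: lf_ends)
  have sN: "sin (\<theta> * (s - r)) = 0"
  proof -
    \<comment> \<open>The tangent at \<open>u s\<close> contains \<open>u r\<close> only if the sine
      vanishes.\<close>
    have "lf s s (u r) = lf s s (u s)" using *(1) by simp
    then have "2 * sin (\<theta> * (r - s)) * sin (\<theta> * (s - r)) = 0" by (simp add: lf_u)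
    moreover have "sin (\<theta> * (r - s)) = - sin (\<theta> * (s - r))" by (metis minus_diff_eq mult_minus_right sin_minus)
    ultimately show ?thesis by simp
  qed
  then have "sgn (s - r) = 0" using sgn_sin[of "s - r"] *(2) by (simp add: abs_minus_commute)
  then show "r = s" by (simp add: sgn_0_0)
qed

lemma chord_eq:
  assumes "\<bar>b - a\<bar> < real N" "norm z \<le> 1" "lf a b z = 0"
  shows "z \<in> closed_segment (u a) (u b)"
proof (cases "a = b")
  case True
  define w where "w = z * cis (- \<theta> * (a + b))"
  have "Re w = 1" using assms(3) True by (simp add: lf_def w_def)
  moreover have "norm w \<le> 1" using assms(2) by (simp add: w_def norm_mult)
  ultimately have "Im w = 0" using cmod_power2[of w] by (smt (verit) norm_ge_zero one_power2 power_mono zero_eq_power2 sum_power2_le_zero_iff)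
  then have "w = 1" using \<open>Re w = 1\<close> by (simp add: complex_eq_iff)
  have "z = w * cis (\<theta> * (a + b))" by (simp add: w_def mult.assoc cis_mult)
  then have "z = u a" using \<open>w = 1\<close> True by (simp add: u_def algebra_simps)
  then show ?thesis by simp
next
  case False
  let ?h = "\<theta> * (b - a)" and ?m = "\<theta> * (a + b)"
  define w where "w = z * cis (- ?m)"
  have z: "z = w * cis ?m" by (simp add: w_def mult.assoc cis_mult)
  have re: "Re w = cos ?h" using assms(3) by (simp add: lf_def w_def)
  have "norm w \<le> 1" using assms(2) by (simp add: w_def norm_mult)
  then have "(Re w)\<^sup>2 + (Im w)\<^sup>2 \<le> 1" by (metis cmod_power2 norm_ge_zero power_le_one_iff zero_less_numeral less_numeral_extra(3) pos2)
  then have "(Im w)\<^sup>2 \<le> (sin ?h)\<^sup>2" using re by (simp add: sin_squared_eq)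
  then have le: "\<bar>Im w\<bar> \<le> \<bar>sin ?h\<bar>" by (simp add: abs_le_square_iff)
  have sne: "sin ?h \<noteq> 0" using sgn_sin[OF assms(1)] False by (auto simp: sgn_0_0)
  \<comment> \<open>After the rotation the chord is upright and its ends have imaginary parts
    \<open>sin ?h\<close> and \<open>- sin ?h\<close>; q is the position on it in these
    units.\<close>
  define q where "q = Im w / sin ?h"
  define t where "t = (1 + q) / 2"
  have t: "0 \<le> t" "t \<le> 1"
  proof -
    have "\<bar>q\<bar> \<le> 1" using le sne by (simp add: q_def abs_divide)
    then show "0 \<le> t" "t \<le> 1" by (auto simp: t_def)
  qed
  have w: "w = (1 - t) *\<^sub>R cis (- ?h) + t *\<^sub>R cis ?h"
  proof (rule complex_eqI)
    show "Re w = Re ((1 - t) *\<^sub>R cis (- ?h) + t *\<^sub>R cis ?h)" by (simp add: re left_diff_distrib)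
    have "Im ((1 - t) *\<^sub>R cis (- ?h) + t *\<^sub>R cis ?h) = (2 * t - 1) * sin ?h"
      by (simp add: left_diff_distrib)
    also have "2 * t - 1 = q" by (simp add: t_def field_simps)
    finally show "Im w = Im ((1 - t) *\<^sub>R cis (- ?h) + t *\<^sub>R cis ?h)" using sne by (simp add: q_def)
  qed
  have "z = (1 - t) *\<^sub>R (cis (- ?h) * cis ?m) + t *\<^sub>R (cis ?h * cis ?m)"
    unfolding z w by (simp only: distrib_right mult_scaleR_left)
  also have "cis (- ?h) * cis ?m = u a" by (simp add: cis_mult u_def algebra_simps)
  also have "cis ?h * cis ?m = u b" by (simp add: cis_mult u_def algebra_simps)
  finally show ?thesis using t by (auto simp: in_segment)
qed

end

text \<open>\<open>pt\<close> gives the other end of the chord at a position, and \<open>up\<close>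
  its hemisphere. Only one interleaving pattern is excluded explicitly; naming a chord by its other
  end gives the remaining ones.\<close>

locale chord_diagram = circle +
  fixes pt :: "nat \<Rightarrow> nat" and up :: "nat \<Rightarrow> bool"
  assumes pt_less: "k < N \<Longrightarrow> pt k < N"
    and pt_pt: "k < N \<Longrightarrow> pt (pt k) = k"
    and pt_ne: "k < N \<Longrightarrow> pt k \<noteq> k"
    and up_pt: "k < N \<Longrightarrow> up (pt k) = up k"
    and noncross: "i < N \<Longrightarrow> k < N \<Longrightarrow> up i = up k \<Longrightarrow> \<not> (i < k \<and> k < pt i \<and> pt i < pt k)"
begin

text \<open>The end at position \<open>k\<close> of a chord is doubled, with the end of the overstrand preceding that
  of the understrand; the doubled chords cross in one point.\<close>

definition pos :: "nat \<Rightarrow> bool \<Rightarrow> real" where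
  "pos k ov = real k + (if ov then - 1/4 else 1/4)"

definition ep :: "nat \<Rightarrow> bool \<Rightarrow> complex" where "ep k ov = u (pos k ov)"

definition l :: "nat \<Rightarrow> bool \<Rightarrow> complex \<Rightarrow> real" where "l k ov = lf (pos k ov) (pos (pt k) ov)"

text \<open>The doubled chords are the chord from k to \<open>pt k\<close> turned by
  \<open>\<theta> / 2\<close> in either direction, both at the signed distance
  \<open>cos (\<theta> * (pt k - k))\<close> from the origin. So they cross on the axis of the
  original chord, farther out by the factor \<open>1 / cos (\<theta> / 2)\<close>.\<close>

definition X :: "nat \<Rightarrow> complex" where
  "X k = complex_of_real (cos (\<theta> * (real (pt k) - real k)) / cos (\<theta> / 2)) * cis (\<theta> * (real k + real (pt k)))"

definition HS :: "nat \<Rightarrow> bool \<Rightarrow> complex set" where "HS k ov = closed_segment (X k) (ep k ov)"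

definition P :: "nat \<Rightarrow> complex \<Rightarrow> real" where "P k z = l k True z * l k False z"

text \<open>The side of the chord at k on which position m lies, read off the linear order; the
  value 1 means between the two ends.\<close>

definition st :: "nat \<Rightarrow> nat \<Rightarrow> real" where
  "st k m = sgn (real m - real k) * sgn (real (pt k) - real m)"

definition dr :: "nat \<Rightarrow> real" where "dr k = sgn (real (pt k) - real k)"

lemma l_pt: "k < N \<Longrightarrow> l (pt k) ov = l k ov"
  by (simp add: l_def pt_pt lf_sym)

lemma P_pt: "k < N \<Longrightarrow> P (pt k) = P k"
  by (simp add: P_def[abs_def] l_pt)

lemma X_pt: "k < N \<Longrightarrow> X (pt k) = X k"
proof -
  assume k: "k < N"
  have "cos (\<theta> * (real k - real (pt k))) = cos (\<theta> * (real (pt k) - real k))"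
    by (metis cos_minus minus_diff_eq mult_minus_right)
  then show ?thesis by (simp add: X_def pt_pt[OF k] add.commute)
qed

lemma cos_half_pos: "0 < cos (\<theta> / 2)"
  using \<theta>_pos \<theta>_le by (intro cos_gt_zero_pi) auto

lemma l_X: "l k ov (X k) = 0"
proof -
  have "cis (\<theta> * (real k + real (pt k))) * cis (- \<theta> * (pos k ov + pos (pt k) ov))
      = cis (if ov then \<theta> / 2 else - (\<theta> / 2))"
    by (simp add: cis_mult pos_def algebra_simps)
  then have *: "X k * cis (- \<theta> * (pos k ov + pos (pt k) ov)) =
      complex_of_real (cos (\<theta> * (real (pt k) - real k)) / cos (\<theta> / 2)) * cis (if ov then \<theta> / 2 else - (\<theta> / 2))"
    by (simp only: X_def mult.assoc)
  have "Re (cis (if ov then \<theta> / 2 else - (\<theta> / 2))) = cos (\<theta> / 2)" by simp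
  then have "Re (X k * cis (- \<theta> * (pos k ov + pos (pt k) ov))) = cos (\<theta> * (real (pt k) - real k))"
    unfolding * using cos_half_pos by simp
  moreover have "pos (pt k) ov - pos k ov = real (pt k) - real k" by (simp add: pos_def)
  ultimately show ?thesis by (simp add: l_def lf_def)
qed

text \<open>The ends of a chord are between 1 and N - 1 positions apart, so the angle is between
  \<theta> and pi - \<theta>, and its cosine is at most \<open>cos \<theta>\<close> in absolute
  value, which is less than \<open>cos (\<theta> / 2)\<close>.\<close>

lemma norm_X: "k < N \<Longrightarrow> norm (X k) < 1"
proof -
  assume k: "k < N"
  let ?d = "\<bar>real (pt k) - real k\<bar>"
  have d: "1 \<le> ?d" "?d \<le> real N - 1" using pt_ne[OF k] pt_less[OF k] k by linarith+
  have b: "\<theta> \<le> \<theta> * ?d" "\<theta> * ?d \<le> pi - \<theta>"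
  proof -
    show "\<theta> \<le> \<theta> * ?d" using d(1) \<theta>_pos by simp
    have "\<theta> * ?d \<le> \<theta> * (real N - 1)" using d(2) \<theta>_pos by (intro mult_left_mono) auto
    then show "\<theta> * ?d \<le> pi - \<theta>" using \<theta>_N by (simp add: algebra_simps)
  qed
  have "cos (\<theta> * ?d) \<le> cos \<theta>"
    using b \<theta>_pos by (intro cos_monotone_0_pi_le) auto
  moreover have "cos (pi - \<theta>) \<le> cos (\<theta> * ?d)"
    using b \<theta>_pos by (intro cos_monotone_0_pi_le) auto
  ultimately have "\<bar>cos (\<theta> * ?d)\<bar> \<le> cos \<theta>" by simp
  moreover have "cos \<theta> < cos (\<theta> / 2)" using \<theta>_pos \<theta>_le by (intro cos_monotone_0_pi) auto
  moreover have "cos (\<theta> * ?d) = cos (\<theta> * (real (pt k) - real k))"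
    by (metis abs_if cos_minus mult_minus_right)
  ultimately have "\<bar>cos (\<theta> * (real (pt k) - real k))\<bar> < cos (\<theta> / 2)" by simp
  then show ?thesis using cos_half_pos by (simp add: X_def norm_mult norm_divide)
qed

lemma pos_bounds: "k < N \<Longrightarrow> m < N \<Longrightarrow> \<bar>pos k ov - pos m ov'\<bar> < real N"
  by (auto simp: pos_def abs_if)

lemma sgn_pos_diff: "m \<noteq> k \<Longrightarrow> sgn (pos m ov' - pos k ov) = sgn (real m - real k)"
proof -
  assume "m \<noteq> k"
  then have "real m - real k \<ge> 1 \<or> real m - real k \<le> -1" by linarith
  then show ?thesis by (auto simp: pos_def sgn_if)
qed

lemma sgn_l_ep:
  assumes "k < N" "m < N" "m \<noteq> k" "m \<noteq> pt k"
  shows "sgn (l k ov (ep m ov')) = st k m" "st k m \<noteq> 0"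
proof -
  have "sgn (l k ov (ep m ov')) = sgn (pos m ov' - pos k ov) * sgn (pos (pt k) ov - pos m ov')"
    unfolding l_def ep_def using assms pos_bounds pt_less by (intro sgn_lf_u) auto
  then show "sgn (l k ov (ep m ov')) = st k m"
    using sgn_pos_diff[of m k ov' ov] sgn_pos_diff[of "pt k" m ov ov'] assms by (simp add: st_def)
  show "st k m \<noteq> 0" using assms by (auto simp: st_def sgn_0_0)
qed

text \<open>The first eight hypotheses exclude interleaving for both orders of the two chords and
  all choices of their first ends. What remains is that neither chord separates the ends of the
  other.\<close>

lemma noncrossing_inside:
  fixes a b c d :: nat
  assumes "\<not> (a < c \<and> c < b \<and> b < d)" "\<not> (c < a \<and> a < d \<and> d < b)" "\<not> (a < d \<and> d < b \<and> b < c)"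
    "\<not> (d < a \<and> a < c \<and> c < b)" "\<not> (b < c \<and> c < a \<and> a < d)" "\<not> (c < b \<and> b < d \<and> d < a)"
    "\<not> (b < d \<and> d < a \<and> a < c)" "\<not> (d < b \<and> b < c \<and> c < a)"
    and "a \<noteq> c" "a \<noteq> d" "b \<noteq> c" "b \<noteq> d"
  shows "(a < c \<and> c < b \<or> b < c \<and> c < a) \<longleftrightarrow> (a < d \<and> d < b \<or> b < d \<and> d < a)"
proof
  assume "a < c \<and> c < b \<or> b < c \<and> c < a"
  then show "a < d \<and> d < b \<or> b < d \<and> d < a"
  proof (elim disjE conjE)
    assume "a < c" "c < b"
    then have "\<not> b < d" "\<not> d < a" using assms(1,4) by simp_all
    then show ?thesis using assms(10,12) by simp
  next
    assume "b < c" "c < a"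
    then have "\<not> a < d" "\<not> d < b" using assms(5,8) by simp_all
    then show ?thesis using assms(10,12) by simp
  qed
next
  assume "a < d \<and> d < b \<or> b < d \<and> d < a"
  then show "a < c \<and> c < b \<or> b < c \<and> c < a"
  proof (elim disjE conjE)
    assume "a < d" "d < b"
    then have "\<not> b < c" "\<not> c < a" using assms(2,3) by simp_all
    then show ?thesis using assms(9,11) by simp
  next
    assume "b < d" "d < a"
    then have "\<not> a < c" "\<not> c < b" using assms(6,7) by simp_all
    then show ?thesis using assms(9,11) by simp
  qed
qed

lemma st_pt:
  assumes "k < N" "m < N" "m \<noteq> k" "m \<noteq> pt k" "up m = up k"
  shows "st k (pt m) = st k m"
proof -
  note b = pt_less[OF assms(1)] pt_less[OF assms(2)] and q = pt_pt[OF assms(1)] pt_pt[OF assms(2)]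
    and w = up_pt[OF assms(1)] up_pt[OF assms(2)]
  have ne: "pt m \<noteq> k" "pt m \<noteq> pt k" "pt m \<noteq> m" "pt k \<noteq> k"
    using assms q pt_ne by metis+
  have in_out: "(k < m \<and> m < pt k \<or> pt k < m \<and> m < k) \<longleftrightarrow> (k < pt m \<and> pt m < pt k \<or> pt k < pt m \<and> pt m < k)"
    using noncross[of k m] noncross[of m k] noncross[of k "pt m"] noncross[of "pt m" k]
      noncross[of "pt k" m] noncross[of m "pt k"] noncross[of "pt k" "pt m"] noncross[of "pt m" "pt k"]
      assms b ne unfolding q w by (intro noncrossing_inside) simp_all
  have st: "st k x = (if k < x \<and> x < pt k \<or> pt k < x \<and> x < k then 1 else - 1)"
    if "x \<noteq> k" "x \<noteq> pt k" for x
    using that by (auto simp: st_def sgn_if)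
  show ?thesis using st[of m] st[of "pt m"] assms ne in_out by simp
qed

lemma dr_ne: "k < N \<Longrightarrow> dr k \<noteq> 0"
  using pt_ne[of k] by (simp add: dr_def sgn_0_0)

lemma dr_pt: "k < N \<Longrightarrow> dr (pt k) = - dr k"
  by (simp add: dr_def pt_pt sgn_if)

text \<open>The over end precedes the under end at each position, so each lies on a definite side of
  the other strand, and the sides are exchanged at the far end of the chord, where \<open>dr\<close>
  changes sign.\<close>

lemma sgn_l_own:
  assumes "k < N"
  shows "sgn (l k (\<not> ov) (ep k ov)) = (if ov then - dr k else dr k)"
proof -
  have "sgn (l k (\<not> ov) (ep k ov)) = sgn (pos k ov - pos k (\<not> ov)) * sgn (pos (pt k) (\<not> ov) - pos k ov)"
    unfolding l_def ep_def using assms pos_bounds pt_less by (intro sgn_lf_u) auto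
  then show ?thesis
    using sgn_pos_diff[of "pt k" k "\<not> ov" ov] pt_ne[OF assms] by (auto simp: dr_def pos_def)
qed

lemma l_own_ne: "k < N \<Longrightarrow> l k (\<not> ov) (ep k ov) \<noteq> 0"
  using sgn_l_own[of k ov] dr_ne[of k] by (auto split: if_splits)

lemma l_convex: "l k ov ((1 - t) *\<^sub>R z + t *\<^sub>R w) = (1 - t) * l k ov z + t * l k ov w"
  by (simp add: l_def lf_convex)

lemma l_ends: "l k ov (ep k ov) = 0" "l k ov (ep (pt k) ov) = 0"
  by (simp_all add: l_def ep_def lf_ends)

lemma norm_ep [simp]: "norm (ep k ov) = 1"
  by (simp add: ep_def)

lemma HS_param:
  assumes "z \<in> HS k ov"
  obtains t where "0 \<le> t" "t \<le> 1" "z = (1 - t) *\<^sub>R X k + t *\<^sub>R ep k ov"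
  using assms by (auto simp: HS_def in_segment)

lemma HS_norm:
  assumes "k < N" "z \<in> HS k ov"
  shows "norm z \<le> 1" "norm z = 1 \<Longrightarrow> z = ep k ov"
proof -
  obtain t where t: "0 \<le> t" "t \<le> 1" "z = (1 - t) *\<^sub>R X k + t *\<^sub>R ep k ov"
    using HS_param[OF assms(2)] .
  have n: "norm z \<le> (1 - t) * norm (X k) + t"
    unfolding t(3) using norm_triangle_ineq[of "(1 - t) *\<^sub>R X k" "t *\<^sub>R ep k ov"] t(1,2) by simp
  have m: "(1 - t) * norm (X k) \<le> 1 - t"
    using norm_X[OF assms(1)] t by (simp add: mult_left_le)
  show "norm z \<le> 1" using n m by linarith
  assume "norm z = 1"
  then have "1 - t \<le> (1 - t) * norm (X k)" using n by linarith
  then have "(1 - t) * (1 - norm (X k)) \<le> 0" by (simp add: algebra_simps)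
  then have "t = 1" using norm_X[OF assms(1)] t by (auto simp: mult_le_0_iff)
  then show "z = ep k ov" using t by simp
qed

lemma HS_l: "z \<in> HS k ov \<Longrightarrow> l k ov z = 0"
  by (erule HS_param) (simp add: l_convex l_X l_ends)

lemma HS_other:
  assumes "z \<in> HS k ov"
  obtains t where "0 \<le> t" "t \<le> 1" "z = (1 - t) *\<^sub>R X k + t *\<^sub>R ep k ov" "l k (\<not> ov) z = t * l k (\<not> ov) (ep k ov)"
  using assms by (elim HS_param) (simp add: l_convex l_X)

lemma X_in_chord:
  assumes "k < N"
  shows "X k \<in> closed_segment (ep k ov) (ep (pt k) ov)"
  unfolding ep_def using assms norm_X[OF assms] l_X[of k ov] pos_bounds pt_less
  by (intro chord_eq) (auto simp: l_def)

lemma chord_cover: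
  assumes "k < N" "norm z \<le> 1" "l k ov z = 0"
  shows "z \<in> HS k ov \<union> HS (pt k) ov"
proof -
  have "z \<in> closed_segment (ep k ov) (ep (pt k) ov)"
    unfolding ep_def using assms pos_bounds pt_less by (intro chord_eq) (auto simp: l_def)
  then show ?thesis
    using Un_closed_segment[OF X_in_chord[OF assms(1), of ov]] X_pt[OF assms(1)]
    unfolding HS_def by (auto simp: closed_segment_commute)
qed

lemma HS_sub_chord:
  assumes "k < N"
  shows "HS k ov \<subseteq> closed_segment (ep k ov) (ep (pt k) ov)"
  unfolding HS_def using X_in_chord[OF assms] by (intro closed_segment_subset) auto

lemma convex_sum_pos:
  fixes a b t :: real
  assumes "0 < a" "0 < b" "0 \<le> t" "t \<le> 1"
  shows "0 < (1 - t) * a + t * b"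
proof (cases "t = 0")
  case False
  then have "0 < t * b" using assms by simp
  moreover have "0 \<le> (1 - t) * a" using assms by simp
  ultimately show ?thesis by linarith
qed (use assms in simp)

lemma sgn_convex:
  fixes a b t s :: real
  assumes "sgn a = s" "sgn b = s" "0 \<le> t" "t \<le> 1"
  shows "sgn ((1 - t) * a + t * b) = s"
proof (cases "s = 0")
  case True
  then show ?thesis using assms by (simp add: sgn_0_0)
next
  case False
  then have "s = 1 \<or> s = -1" using assms(1) by (auto simp: sgn_if split: if_splits)
  then show ?thesis
  proof
    assume s: "s = 1"
    then have "0 < a" "0 < b" using assms by (auto simp: sgn_1_pos)
    then have "0 < (1 - t) * a + t * b" using assms(3,4) by (intro convex_sum_pos)
    then show ?thesis using s by simp
  next
    assume s: "s = -1"
    then have "a < 0" "b < 0" using assms by (auto simp: sgn_1_neg)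
    then have "0 < (1 - t) * (- a) + t * (- b)" using assms(3,4) by (intro convex_sum_pos) auto
    then have "(1 - t) * a + t * b < 0" by simp
    then show ?thesis using s by simp
  qed
qed

lemma HS_far:
  assumes "k < N" "m < N" "m \<noteq> k" "m \<noteq> pt k" "up m = up k" "z \<in> HS m ov'"
  shows "sgn (l k ov z) = st k m" "st k m \<noteq> 0"
proof -
  have "z \<in> closed_segment (ep m ov') (ep (pt m) ov')" using HS_sub_chord[OF assms(2)] assms(6) by blast
  then obtain t where t: "0 \<le> t" "t \<le> 1" "z = (1 - t) *\<^sub>R ep m ov' + t *\<^sub>R ep (pt m) ov'"
    by (auto simp: in_segment)
  have ne: "pt m \<noteq> k" "pt m \<noteq> pt k" using assms pt_pt by metis+
  have "sgn (l k ov (ep (pt m) ov')) = st k m"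
    using sgn_l_ep(1)[OF assms(1) pt_less[OF assms(2)] ne] st_pt[OF assms(1-5)] by simp
  then show "sgn (l k ov z) = st k m"
    unfolding t(3) l_convex using sgn_l_ep(1)[OF assms(1-4)] t by (intro sgn_convex) auto
  show "st k m \<noteq> 0" by (rule sgn_l_ep(2)[OF assms(1-4)])
qed

text \<open>A different chord of the same hemisphere lies on the same side of both strands, so the
  two factors of \<open>P\<close> have equal sign.\<close>

lemma P_far:
  assumes "k < N" "m < N" "m \<noteq> k" "m \<noteq> pt k" "up m = up k" "z \<in> HS m ov'"
  shows "0 < P k z"
proof -
  have "sgn (P k z) = st k m * st k m" by (simp add: P_def sgn_mult HS_far(1)[OF assms])
  moreover have "st k m * st k m = 1" using HS_far(2)[OF assms] by (auto simp: st_def sgn_if)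
  ultimately show ?thesis by (simp add: sgn_1_pos)
qed

lemma X_in_HS: "X k \<in> HS k ov" and ep_in_HS: "ep k ov \<in> HS k ov"
  by (auto simp: HS_def)

lemma ep_inj:
  assumes "k < N" "m < N" "ep k ov = ep m ov'"
  shows "k = m \<and> ov = ov'"
proof -
  have "pos k ov = pos m ov'"
    using assms inj_u pos_bounds unfolding ep_def by blast
  then have *: "real k - real m = (if ov' then - 1/4 else 1/4) - (if ov then - 1/4 else 1/4)"
    by (simp add: pos_def)
  then have "\<bar>real k - real m\<bar> < 1" by (auto split: if_splits)
  then have "k = m" by linarith
  then show ?thesis using * by (auto split: if_splits)
qed

text \<open>On the circle the ends are distinct. Inside, different chords are kept apart by signs,
  the two strands of one chord share only \<open>X k\<close>, and the two halves of one strand lie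
  on opposite sides of the other strand.\<close>

lemma HS_meet:
  assumes "k < N" "m < N" "z \<in> HS k ov" "z \<in> HS m ov'" "(k, ov) \<noteq> (m, ov')" "up k = up m \<or> norm z = 1"
  shows "z = X k \<and> (m = k \<or> m = pt k)"
proof (cases "norm z = 1")
  case True
  then have "ep k ov = ep m ov'" using HS_norm(2) assms by metis
  then show ?thesis using ep_inj assms by blast
next
  case False
  then have up: "up m = up k" using assms by auto
  have m: "m = k \<or> m = pt k"
    using HS_far(1)[OF assms(1,2) _ _ up assms(4), where ov = ov]
      HS_far(2)[OF assms(1,2) _ _ up assms(4)] HS_l[OF assms(3)] by auto
  have zero: "z = X k" if z: "l k (\<not> ov) z = 0"
  proof -
    obtain t where t: "0 \<le> t" "z = (1 - t) *\<^sub>R X k + t *\<^sub>R ep k ov"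
      "l k (\<not> ov) z = t * l k (\<not> ov) (ep k ov)" using HS_other[OF assms(3)] .
    then have "t = 0" using l_own_ne[OF assms(1)] z by auto
    then show ?thesis using t by simp
  qed
  have lm: "l m ov' = l k ov'" using m l_pt[OF assms(1)] by auto
  show ?thesis
  proof (cases "ov' = ov")
    case False
    then have "l k (\<not> ov) z = 0" using HS_l[OF assms(4)] lm by simp
    then show ?thesis using zero m by blast
  next
    case True
    then have mk: "m = pt k" using m assms(5) by auto
    obtain t where t: "0 \<le> t" "l k (\<not> ov) z = t * l k (\<not> ov) (ep k ov)" using HS_other[OF assms(3)] .
    obtain t' where t': "0 \<le> t'" "l m (\<not> ov') z = t' * l m (\<not> ov') (ep m ov')" using HS_other[OF assms(4)] .
    have s: "sgn (l m (\<not> ov') (ep m ov')) = - sgn (l k (\<not> ov) (ep k ov))"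
      using sgn_l_own[OF assms(1)] sgn_l_own[OF assms(2)] True mk dr_pt[OF assms(1)] by simp
    have "sgn (l k (\<not> ov) z) = sgn t * sgn (l k (\<not> ov) (ep k ov))" using t by (simp add: sgn_mult)
    moreover have "sgn (l k (\<not> ov) z) = sgn t' * - sgn (l k (\<not> ov) (ep k ov))"
      using t'(2) s l_pt[OF assms(1)] True mk by (simp add: sgn_mult)
    ultimately have "(sgn t + sgn t') * sgn (l k (\<not> ov) (ep k ov)) = 0" by (simp add: distrib_right)
    moreover have "sgn (l k (\<not> ov) (ep k ov)) \<noteq> 0" using l_own_ne[OF assms(1)] by (simp add: sgn_0_0)
    ultimately have "sgn t = - sgn t'" by simp
    then have "t = 0" using t(1) t'(1) by (auto simp: sgn_if split: if_splits)
    then have "l k (\<not> ov) z = 0" using t by simp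
    then show ?thesis using zero mk by blast
  qed
qed

lemma P_X: "P k (X k) = 0"
  by (simp add: P_def l_X)

lemma sgn_band: "sgn (y + 1/4) * sgn (y - 1/4) = sgn (\<bar>y\<bar> - 1/4)" for y :: real
  by (cases "0 \<le> y") (auto simp: sgn_if)

text \<open>The range of r is one full turn starting at the first over end,
  \<open>pos 0 True\<close>; all differences of positions stay below N in absolute value, so no
  wrap-around enters the signs.\<close>

lemma sgn_P_u:
  assumes "k < N" "- 1/4 \<le> r" "r < real N - 1/4"
  shows "sgn (P k (u r)) = sgn (\<bar>r - real k\<bar> - 1/4) * sgn (\<bar>r - real (pt k)\<bar> - 1/4)"
proof -
  have b: "\<bar>r - pos m ov\<bar> < real N" "\<bar>pos m ov - r\<bar> < real N" if "m < N" for m ov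
    using that assms(2,3) by (auto simp: pos_def abs_if)
  have "sgn (l k ov (u r)) = sgn (r - pos k ov) * sgn (pos (pt k) ov - r)" for ov
    unfolding l_def using b assms(1) pt_less by (intro sgn_lf_u) auto
  then have "sgn (P k (u r)) = (sgn (r - pos k True) * sgn (r - pos k False)) *
      (sgn (pos (pt k) True - r) * sgn (pos (pt k) False - r))"
    by (simp add: P_def sgn_mult)
  also have "sgn (r - pos k True) * sgn (r - pos k False) = sgn (\<bar>r - real k\<bar> - 1/4)"
    using sgn_band[of "r - real k"] by (simp add: pos_def algebra_simps)
  also have "sgn (pos (pt k) True - r) * sgn (pos (pt k) False - r) = sgn (\<bar>r - real (pt k)\<bar> - 1/4)"
    using sgn_band[of "real (pt k) - r"] by (simp add: pos_def abs_minus_commute algebra_simps)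
  finally show ?thesis .
qed

lemma continuous_P: "continuous_on A (P k)"
  unfolding P_def[abs_def] l_def by (intro continuous_intros continuous_lf)

text \<open>One radius for the finitely many crossings. The factor 2 leaves space for the triangle
  inequality when two squares are compared, each within half the radius of its crossing.\<close>

lemma room:
  obtains d where "0 < d"
    "\<And>k z. k < N \<Longrightarrow> dist (X k) z < 2 * d \<Longrightarrow> norm z < 1"
    "\<And>k m z. k < N \<Longrightarrow> m < N \<Longrightarrow> m \<noteq> k \<Longrightarrow> m \<noteq> pt k \<Longrightarrow> up m = up k \<Longrightarrow> dist (X k) z < 2 * d \<Longrightarrow> 0 < P m z"
proof -
  define V where "V k = {z. norm z < 1} \<inter> (\<Inter>m\<in>{m. m < N \<and> m \<noteq> k \<and> m \<noteq> pt k \<and> up m = up k}. {z. 0 < P m z})" for k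
  have "open {z :: complex. norm z < 1}" by (intro open_Collect_less continuous_intros)
  moreover have "open {z. 0 < P m z}" for m
    by (intro open_Collect_less continuous_intros continuous_P)
  ultimately have op: "open (V k)" for k
    unfolding V_def by (intro open_Int open_INT) auto
  have XV: "X k \<in> V k" if k: "k < N" for k
  proof -
    have "0 < P m (X k)" if "m < N" "m \<noteq> k" "m \<noteq> pt k" "up m = up k" for m
      using that P_far[OF that(1) k _ _ _ X_in_HS] pt_pt[OF k] pt_pt[OF that(1)] by metis
    then show ?thesis using norm_X[OF k] by (simp add: V_def)
  qed
  have "\<exists>e. 0 < e \<and> (\<forall>z. dist (X k) z < e \<longrightarrow> z \<in> V k)" if "k < N" for k
    using op[of k] XV[OF that] unfolding open_contains_ball by (auto simp: subset_iff)
  then obtain e where e: "\<And>k. k < N \<Longrightarrow> 0 < e k" "\<And>k z. k < N \<Longrightarrow> dist (X k) z < e k \<Longrightarrow> z \<in> V k"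
    by metis
  define d where "d = Min (e ` {..<N}) / 2"
  have ne: "e ` {..<N} \<noteq> {}" using N2 by (auto simp: lessThan_empty_iff)
  have "0 < Min (e ` {..<N})" using e(1) ne by (subst Min_gr_iff) auto
  then have d: "0 < d" by (simp add: d_def)
  have le: "2 * d \<le> e k" if "k < N" for k using that by (simp add: d_def)
  show thesis
  proof (rule that[OF d])
    show "norm z < 1" if "k < N" "dist (X k) z < 2 * d" for k z
      using e(2)[OF that(1)] le[OF that(1)] that(2) by (auto simp: V_def)
    show "0 < P m z" if "k < N" "m < N" "m \<noteq> k" "m \<noteq> pt k" "up m = up k" "dist (X k) z < 2 * d" for k m z
      using e(2)[OF that(1), of z] le[OF that(1)] that by (auto simp: V_def)
  qed
qed

end

section \<open>Drawing the diagram on the sphere\<close>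

text \<open>For \<sigma> = 1 or -1, the hemisphere of that sign as a graph over the closed unit
  disc; on the unit circle both give the equator.\<close>

definition lift :: "real \<Rightarrow> complex \<Rightarrow> real ^ 3" where
  "lift \<sigma> z = Re z *\<^sub>R axis 1 1 + Im z *\<^sub>R axis 2 1 + (\<sigma> * sqrt (1 - (norm z)\<^sup>2)) *\<^sub>R axis 3 1"

definition proj :: "real ^ 3 \<Rightarrow> complex" where
  "proj w = Complex (w $ 1) (w $ 2)"

lemma lift_nth: "lift \<sigma> z $ 1 = Re z" "lift \<sigma> z $ 2 = Im z" "lift \<sigma> z $ 3 = \<sigma> * sqrt (1 - (norm z)\<^sup>2)"
  by (simp_all add: lift_def axis_def)

lemma proj_lift [simp]: "proj (lift \<sigma> z) = z"
  by (simp add: proj_def lift_nth)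

lemma continuous_lift: "continuous_on A (lift \<sigma>)"
  unfolding lift_def by (intro continuous_intros)

lemma norm_sq_3: "(norm w)\<^sup>2 = (w $ 1)\<^sup>2 + (w $ 2)\<^sup>2 + (w $ 3)\<^sup>2" for w :: "real ^ 3"
  unfolding power2_norm_eq_inner inner_vec_def sum_3 by (simp add: power2_eq_square)

lemma lift_in_S2:
  assumes "norm z \<le> 1" "\<sigma> = 1 \<or> \<sigma> = -1"
  shows "lift \<sigma> z \<in> S2"
proof -
  have "0 \<le> 1 - (norm z)\<^sup>2" using assms(1) by (simp add: power_le_one)
  moreover have "\<sigma>\<^sup>2 = 1" using assms(2) by auto
  ultimately have "(norm (lift \<sigma> z))\<^sup>2 = 1"
    by (simp add: norm_sq_3 lift_nth power_mult_distrib cmod_power2)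
  then have "norm (lift \<sigma> z) = 1" by (simp add: power2_eq_1_iff) (metis norm_ge_zero not_one_le_zero neg_0_le_iff_le le_minus_one_simps(3))
  then show ?thesis by simp
qed

lemma lift_unit: "norm z = 1 \<Longrightarrow> lift \<sigma> z = lift \<sigma>' z"
  by (simp add: lift_def)

lemma lift_eq:
  assumes "lift \<sigma> z = lift \<sigma>' w" "norm z \<le> 1" "\<sigma> = 1 \<or> \<sigma> = -1" "\<sigma>' = 1 \<or> \<sigma>' = -1"
  shows "z = w \<and> (\<sigma> = \<sigma>' \<or> norm z = 1)"
proof -
  have zw: "z = w" using arg_cong[OF assms(1), of proj] by simp
  have "\<sigma> * sqrt (1 - (norm z)\<^sup>2) = \<sigma>' * sqrt (1 - (norm z)\<^sup>2)"
    using arg_cong[OF assms(1), of "\<lambda>w. w $ 3"] by (simp add: lift_nth zw)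
  then have "\<sigma> = \<sigma>' \<or> 1 - (norm z)\<^sup>2 = 0" by auto
  moreover have "norm z = 1" if "1 - (norm z)\<^sup>2 = 0"
    using that by (metis eq_iff_diff_eq_0 norm_ge_zero one_power2 power2_eq_imp_eq zero_le_one)
  ultimately show ?thesis using zw by blast
qed

lemma norm_proj: "w \<in> S2 \<Longrightarrow> norm (proj w) \<le> 1"
proof -
  assume "w \<in> S2"
  then have "(w $ 1)\<^sup>2 + (w $ 2)\<^sup>2 + (w $ 3)\<^sup>2 = 1" using norm_sq_3[of w] by simp
  then have "(norm (proj w))\<^sup>2 \<le> 1" by (simp add: proj_def cmod_power2) (metis add_le_same_cancel1 le_add_same_cancel1 zero_le_power2)
  then show ?thesis by (simp add: power_le_one_iff abs_square_le_1)
qed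

lemma lift_proj:
  assumes "w \<in> S2" "0 \<le> \<sigma> * w $ 3" "\<sigma> = 1 \<or> \<sigma> = -1"
  shows "w = lift \<sigma> (proj w)"
proof -
  have "(w $ 1)\<^sup>2 + (w $ 2)\<^sup>2 + (w $ 3)\<^sup>2 = 1" using norm_sq_3[of w] assms(1) by simp
  then have "1 - (norm (proj w))\<^sup>2 = (w $ 3)\<^sup>2" by (simp add: proj_def cmod_power2)
  then have "\<sigma> * sqrt (1 - (norm (proj w))\<^sup>2) = w $ 3" using assms(2,3) by auto
  then show ?thesis by (simp add: vec_eq_iff forall_3 lift_nth) (simp add: proj_def)
qed

lemma proj_unit:
  assumes "w \<in> S2" "w $ 3 = 0"
  shows "norm (proj w) = 1"
proof -
  have "(norm (proj w))\<^sup>2 = 1" using norm_sq_3[of w] assms by (simp add: proj_def cmod_power2)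
  then show ?thesis by (metis norm_ge_zero one_power2 power2_eq_imp_eq zero_le_one)
qed

lemma continuous_proj: "continuous_on A proj"
  unfolding proj_def Complex_eq by (intro continuous_intros)

lemma arc_lift:
  assumes "arc p" "\<And>t. t \<in> {0..1} \<Longrightarrow> norm (p t) \<le> 1" "\<sigma> = 1 \<or> \<sigma> = -1"
  shows "arc (lift \<sigma> \<circ> p)"
  unfolding arc_def
proof
  show "path (lift \<sigma> \<circ> p)"
    using assms(1) by (intro path_continuous_image continuous_lift) (simp add: arc_def)
  show "inj_on (lift \<sigma> \<circ> p) {0..1}"
  proof (rule inj_onI)
    fix s t assume "s \<in> {0..1}" "t \<in> {0..1}" "(lift \<sigma> \<circ> p) s = (lift \<sigma> \<circ> p) t"
    then show "s = t" using lift_eq[of \<sigma> "p s" \<sigma> "p t"] assms by (auto simp: arc_def dest: inj_onD)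
  qed
qed

lemma joinpaths_initial:
  assumes "0 \<le> t" "t \<le> 1"
  shows "(p +++ q) ` {0..t / 2} = p ` {0..t}"
proof -
  have "(p +++ q) ` {0..t / 2} = (\<lambda>x. p (2 * x)) ` {0..t / 2}"
    using assms by (intro image_cong) (auto simp: joinpaths_def)
  also have "\<dots> = p ` ((\<lambda>x. 2 * x) ` {0..t / 2})" by (rule image_image[symmetric])
  also have "(\<lambda>x. 2 * x) ` {0..t / 2} = {0..t}" by (simp add: image_mult_atLeastAtMost)
  finally show ?thesis .
qed

section \<open>Half-strands, equator arcs and the edges built from them\<close>

context chord_diagram
begin

definition sg :: "nat \<Rightarrow> real" where "sg k = (if up k then 1 else -1)"

definition nx :: "nat \<Rightarrow> nat" where "nx i = Suc i mod N"

definition cross :: "nat \<Rightarrow> real ^ 3" where "cross k = lift (sg k) (X k)"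

definition hs :: "nat \<Rightarrow> bool \<Rightarrow> real \<Rightarrow> real ^ 3" where
  "hs k ov = lift (sg k) \<circ> linepath (X k) (ep k ov)"

definition eqt :: "nat \<Rightarrow> real \<Rightarrow> real ^ 3" where
  "eqt i = lift 1 \<circ> (\<lambda>t. u (real i + 3/4 - t / 2))"

text \<open>From the crossing at the next position along its overstrand to the over end at
  \<open>i + 3/4\<close>, back along the equator to the under end at \<open>i + 1/4\<close>, then
  along the understrand to the crossing at i. Since over ends precede under ends, every such arc
  joins an over end to an under end; this makes the diagram alternating.\<close>

definition edge :: "nat \<Rightarrow> real \<Rightarrow> real ^ 3" where
  "edge i = hs (nx i) True +++ eqt i +++ reversepath (hs i False)"

definition HSL :: "nat \<Rightarrow> bool \<Rightarrow> (real ^ 3) set" where "HSL k ov = lift (sg k) ` HS k ov"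

definition EQ :: "nat \<Rightarrow> (real ^ 3) set" where "EQ i = (\<lambda>r. lift 1 (u r)) ` {real i + 1/4..real i + 3/4}"

lemma sg_cases: "sg k = 1 \<or> sg k = -1"
  by (simp add: sg_def)

lemma sg_eq_iff: "sg k = sg m \<longleftrightarrow> up k = up m"
  by (simp add: sg_def)

lemma nx_less: "nx i < N"
  using N2 by (simp add: nx_def)

lemma ep_nx: "i < N \<Longrightarrow> ep (nx i) True = u (real i + 3/4)"
proof (cases "Suc i = N")
  case True
  then have "real i + 3/4 = - 1/4 + real N" by linarith
  then have "u (real i + 3/4) = u (- 1/4)" by (simp only: u_periodic)
  then show ?thesis using True by (simp add: nx_def ep_def pos_def)
next
  case False
  assume "i < N"
  then have "nx i = Suc i" using False by (simp add: nx_def)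
  then show ?thesis by (simp add: ep_def pos_def algebra_simps)
qed

lemma nx_surj: "k < N \<Longrightarrow> \<exists>i<N. nx i = k"
proof (cases k)
  case 0
  then show ?thesis using N2 by (intro exI[of _ "N - 1"]) (simp add: nx_def)
next
  case (Suc i)
  assume "k < N"
  then show ?thesis using Suc by (intro exI[of _ i]) (simp add: nx_def)
qed

lemma nx_inj: "i < N \<Longrightarrow> i' < N \<Longrightarrow> nx i = nx i' \<Longrightarrow> i = i'"
  unfolding nx_def by (cases "Suc i = N"; cases "Suc i' = N") auto

lemma path_image_hs: "path_image (hs k ov) = HSL k ov"
  by (simp add: hs_def HSL_def HS_def path_image_compose)

lemma path_image_eqt: "path_image (eqt i) = EQ i"
proof -
  have "(\<lambda>t::real. real i + 3/4 - t / 2) ` {0..1} = {real i + 1/4..real i + 3/4}"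
  proof
    show "{real i + 1/4..real i + 3/4} \<subseteq> (\<lambda>t::real. real i + 3/4 - t / 2) ` {0..1}"
    proof
      fix r assume r: "r \<in> {real i + 1/4..real i + 3/4}"
      then show "r \<in> (\<lambda>t::real. real i + 3/4 - t / 2) ` {0..1}"
        by (intro image_eqI[of _ _ "2 * (real i + 3/4 - r)"]) (auto simp: field_simps)
    qed
  qed auto
  then have "EQ i = (\<lambda>r. lift 1 (u r)) ` ((\<lambda>t::real. real i + 3/4 - t / 2) ` {0..1})" by (simp add: EQ_def)
  then show ?thesis by (simp add: path_image_def eqt_def image_image)
qed

lemma hs_ends: "pathstart (hs k ov) = cross k" "pathfinish (hs k ov) = lift 1 (ep k ov)"
  by (simp_all add: hs_def cross_def pathstart_compose pathfinish_compose lift_unit[of _ "sg k" 1])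

lemma eqt_ends:
  assumes "i < N"
  shows "pathstart (eqt i) = lift 1 (ep (nx i) True)" "pathfinish (eqt i) = lift 1 (ep i False)"
  using ep_nx[OF assms] by (auto simp: eqt_def pathstart_def pathfinish_def ep_def pos_def algebra_simps)

lemma HSL_S2: "k < N \<Longrightarrow> HSL k ov \<subseteq> S2"
  unfolding HSL_def using lift_in_S2 HS_norm(1) sg_cases by blast

lemma EQ_S2: "EQ i \<subseteq> S2"
  unfolding EQ_def using lift_in_S2[of "u _" 1] by auto

lemma HSL_meet:
  assumes "k < N" "m < N" "w \<in> HSL k ov" "w \<in> HSL m ov'" "(k, ov) \<noteq> (m, ov')"
  shows "w = cross k \<and> (m = k \<or> m = pt k)"
proof -
  obtain z where z: "z \<in> HS k ov" "w = lift (sg k) z" using assms(3) by (auto simp: HSL_def)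
  obtain z' where z': "z' \<in> HS m ov'" "w = lift (sg m) z'" using assms(4) by (auto simp: HSL_def)
  have "z = z' \<and> (sg k = sg m \<or> norm z = 1)"
    using z(2) z'(2) HS_norm(1)[OF assms(1) z(1)] sg_cases by (intro lift_eq) auto
  then have "z = X k \<and> (m = k \<or> m = pt k)"
    using HS_meet[OF assms(1,2) z(1) _ assms(5)] z'(1) sg_eq_iff by metis
  then show ?thesis using z by (simp add: cross_def)
qed

lemma cross_in_HSL: "cross k \<in> HSL k ov"
  using X_in_HS by (auto simp: HSL_def cross_def)

lemma cross_pt: "k < N \<Longrightarrow> cross (pt k) = cross k"
  by (simp add: cross_def X_pt sg_def up_pt)

lemma cross_HSL: "k < N \<Longrightarrow> m < N \<Longrightarrow> cross k \<in> HSL m ov \<Longrightarrow> m = k \<or> m = pt k"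
  using HSL_meet[of k m "cross k" "\<not> ov" ov] cross_in_HSL by blast

lemma cross_eq_iff: "k < N \<Longrightarrow> m < N \<Longrightarrow> cross k = cross m \<longleftrightarrow> m = k \<or> m = pt k"
  using cross_HSL[of k m True] cross_in_HSL[of m True] cross_pt[of k] by metis

lemma u_inj_cases:
  assumes "u r = u s" "- 1/4 \<le> s" "s \<le> real N - 1/4" "- 1/4 \<le> r" "r \<le> real N - 1/4"
  shows "r = s \<or> r = real N - 1/4 \<and> s = - 1/4 \<or> r = - 1/4 \<and> s = real N - 1/4"
proof (cases "\<bar>r - s\<bar> < real N")
  case True
  then show ?thesis using inj_u[OF assms(1)] by blast
next
  case False
  then show ?thesis using assms by linarith
qed

lemma HSL_EQ:
  assumes "k < N" "i < N" "w \<in> HSL k ov" "w \<in> EQ i"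
  shows "w = lift 1 (ep k ov) \<and> (if ov then k = nx i else k = i)"
proof -
  obtain z where z: "z \<in> HS k ov" "w = lift (sg k) z" using assms(3) by (auto simp: HSL_def)
  obtain r where r: "real i + 1/4 \<le> r" "r \<le> real i + 3/4" "w = lift 1 (u r)" using assms(4) by (auto simp: EQ_def)
  have zu: "z = u r" using arg_cong[OF z(2), of proj] r(3) by simp
  then have ze: "z = ep k ov" using HS_norm(2)[OF assms(1) z(1)] by simp
  then have "u r = u (pos k ov)" using zu by (simp add: ep_def)
  moreover have "- 1/4 \<le> pos k ov" "pos k ov < real N - 1/4" using assms(1) by (auto simp: pos_def)
  moreover have "- 1/4 \<le> r" "r \<le> real N - 1/4" using r assms(2) by auto
  ultimately have "r = pos k ov \<or> r = real N - 1/4 \<and> pos k ov = - 1/4"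
    using u_inj_cases[of r "pos k ov"] by auto
  then have "if ov then k = nx i else k = i"
  proof
    assume rp: "r = pos k ov"
    show ?thesis
    proof (cases ov)
      case True
      then have "real i + 1/2 \<le> real k" "real k \<le> real i + 1" using r rp by (auto simp: pos_def)
      then have "k = Suc i" by linarith
      then show ?thesis using True assms(1) by (simp add: nx_def)
    next
      case False
      then have "real i \<le> real k" "real k \<le> real i + 1/2" using r rp by (auto simp: pos_def)
      then have "k = i" by linarith
      then show ?thesis using False by simp
    qed
  next
    \<comment> \<open>The wrap-around: the last equator arc reaches the over end of position
      0.\<close>
    assume rp: "r = real N - 1/4 \<and> pos k ov = - 1/4"
    then have "Suc i = N" using r assms(2) by linarith
    moreover have "k = 0 \<and> ov" using rp by (auto simp: pos_def split: if_splits)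
    ultimately show ?thesis by (simp add: nx_def)
  qed
  moreover have "w = lift 1 (ep k ov)" using r(3) zu ze by simp
  ultimately show ?thesis by blast
qed

lemma EQ_disjoint:
  assumes "i < N" "i' < N" "i \<noteq> i'"
  shows "EQ i \<inter> EQ i' = {}"
proof -
  have False if w: "w \<in> EQ i" "w \<in> EQ i'" for w
  proof -
    obtain r where r: "real i + 1/4 \<le> r" "r \<le> real i + 3/4" "w = lift 1 (u r)" using w(1) by (auto simp: EQ_def)
    obtain s where s: "real i' + 1/4 \<le> s" "s \<le> real i' + 3/4" "w = lift 1 (u s)" using w(2) by (auto simp: EQ_def)
    have "u r = u s" using arg_cong[OF r(3), of proj] s(3) by simp
    moreover have "\<bar>r - s\<bar> < real N" using r s assms by linarith
    ultimately have "r = s" by (rule inj_u)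
    then show False using r s assms(3) by linarith
  qed
  then show ?thesis by blast
qed

lemma cross_not_EQ:
  assumes "k < N"
  shows "cross k \<notin> EQ i"
proof
  assume "cross k \<in> EQ i"
  then obtain r where "cross k = lift 1 (u r)" by (auto simp: EQ_def)
  moreover have "proj (cross k) = X k" by (simp add: cross_def)
  ultimately have "X k = u r" by simp
  then show False using norm_X[OF assms] by simp
qed

lemma arc_hs:
  assumes "k < N"
  shows "arc (hs k ov)"
  unfolding hs_def
proof (rule arc_lift)
  show "arc (linepath (X k) (ep k ov))"
    using norm_X[OF assms] by (intro arc_linepath) (metis norm_ep less_irrefl)
  fix t :: real assume "t \<in> {0..1}"
  then have "linepath (X k) (ep k ov) t \<in> HS k ov"
    by (metis HS_def image_eqI linepath_image_01)
  then show "norm (linepath (X k) (ep k ov) t) \<le> 1" using HS_norm(1)[OF assms] by blast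
qed (rule sg_cases)

lemma arc_eqt: "arc (eqt i)"
  unfolding eqt_def
proof (rule arc_lift)
  show "arc (\<lambda>t. u (real i + 3/4 - t / 2))"
    unfolding arc_def path_def
  proof
    show "continuous_on {0..1} (\<lambda>t. u (real i + 3/4 - t / 2))"
      unfolding u_def by (intro continuous_intros) auto
    show "inj_on (\<lambda>t. u (real i + 3/4 - t / 2)) {0..1}"
    proof (rule inj_onI)
      fix s t :: real assume st: "s \<in> {0..1}" "t \<in> {0..1}" "u (real i + 3/4 - s / 2) = u (real i + 3/4 - t / 2)"
      have "\<bar>real i + 3/4 - s / 2 - (real i + 3/4 - t / 2)\<bar> < real N" using st(1,2) N2 by auto
      then have "real i + 3/4 - s / 2 = real i + 3/4 - t / 2" by (rule inj_u[OF st(3)])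
      then show "s = t" by simp
    qed
  qed
qed auto

lemma path_image_edge: "i < N \<Longrightarrow> path_image (edge i) = HSL (nx i) True \<union> EQ i \<union> HSL i False"
  by (simp add: edge_def path_image_join hs_ends eqt_ends path_image_hs path_image_eqt Un_assoc)

lemma edge_ends: "pathstart (edge i) = cross (nx i)" "pathfinish (edge i) = cross i"
  by (simp_all add: edge_def hs_ends)

text \<open>The two half-strands can meet only in a crossing, which is then both the start and the
  end of the edge; loops are allowed.\<close>

lemma simple_path_edge:
  assumes i: "i < N"
  shows "simple_path (edge i)"
  unfolding edge_def
proof (rule simple_path_join3I)
  show "arc (hs (nx i) True)" "arc (eqt i)" "arc (reversepath (hs i False))"
    using arc_hs arc_eqt nx_less i by (auto simp: arc_reversepath)
  show "path_image (hs (nx i) True) \<inter> path_image (eqt i) \<subseteq> {pathstart (eqt i)}"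
    using HSL_EQ[OF nx_less i] by (auto simp: path_image_hs path_image_eqt eqt_ends[OF i])
  show "path_image (eqt i) \<inter> path_image (reversepath (hs i False)) \<subseteq> {pathstart (reversepath (hs i False))}"
    using HSL_EQ[OF i i] by (auto simp: path_image_hs path_image_eqt hs_ends)
  show "path_image (hs (nx i) True) \<inter> path_image (reversepath (hs i False))
      \<subseteq> {pathstart (hs (nx i) True)} \<inter> {pathfinish (reversepath (hs i False))}"
    using HSL_meet[OF nx_less i, of _ i True False] cross_eq_iff[OF nx_less i, of i]
    by (auto simp: path_image_hs hs_ends)
  show "pathfinish (hs (nx i) True) = pathstart (eqt i)" by (simp add: hs_ends eqt_ends[OF i])
  show "pathfinish (eqt i) = pathstart (reversepath (hs i False))" by (simp add: hs_ends eqt_ends[OF i])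
qed

lemma edge_S2: "i < N \<Longrightarrow> path_image (edge i) \<subseteq> S2"
  using path_image_edge HSL_S2 EQ_S2 nx_less by simp

lemma cross_on_edge:
  assumes "i < N" "k < N" "cross k \<in> path_image (edge i)"
  shows "cross k = cross i \<or> cross k = cross (nx i)"
  using assms cross_HSL[OF assms(2) nx_less] cross_HSL[OF assms(2,1)] cross_not_EQ[OF assms(2)]
    cross_eq_iff[OF assms(2) nx_less] cross_eq_iff[OF assms(2,1)]
  unfolding path_image_edge[OF assms(1)] by blast

lemma edge_interior:
  assumes "i < N"
  shows "edge i ` {0<..<1} = path_image (edge i) - {cross i, cross (nx i)}"
proof -
  have "edge i t \<noteq> cross i" "edge i t \<noteq> cross (nx i)" if "0 < t" "t < 1" for t
    using simple_path_interior_ne[OF simple_path_edge[OF assms] that] edge_ends[of i]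
    by (auto simp: pathstart_def pathfinish_def)
  then show ?thesis unfolding path_image_split[of "edge i"] edge_ends by auto
qed

lemma edge_interior_cross:
  assumes "i < N" "k < N"
  shows "cross k \<notin> edge i ` {0<..<1}"
  using cross_on_edge[OF assms] unfolding edge_interior[OF assms(1)] by auto

lemma edge_interior_disjoint:
  assumes "i < N" "i' < N" "i \<noteq> i'"
  shows "edge i ` {0<..<1} \<inter> edge i' ` {0<..<1} = {}"
proof -
  have no: "w \<noteq> cross k" if "w \<in> edge i ` {0<..<1}" "k < N" for w k
    using edge_interior_cross[OF assms(1) that(2)] that(1) by blast
  have False if w: "w \<in> edge i ` {0<..<1}" "w \<in> edge i' ` {0<..<1}" for w
  proof -
    have nxi: "nx i \<noteq> nx i'" using nx_inj assms by blast
    have "w \<in> HSL (nx i) True \<or> w \<in> EQ i \<or> w \<in> HSL i False"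
      "w \<in> HSL (nx i') True \<or> w \<in> EQ i' \<or> w \<in> HSL i' False"
      using w path_image_edge[OF assms(1)] path_image_edge[OF assms(2)] edge_interior assms by blast+
    moreover have hh: False if "w \<in> HSL k ov" "w \<in> HSL m ov'" "(k, ov) \<noteq> (m, ov')" "k < N" "m < N" for k m ov ov'
      using HSL_meet[OF that(4,5,1,2,3)] no[OF w(1) that(4)] by blast
    moreover have "w \<notin> EQ i'" if "w \<in> HSL (nx i) True \<or> w \<in> HSL i False"
      using that HSL_EQ[OF nx_less assms(2), of w i True] HSL_EQ[OF assms(1,2), of w False] nxi assms(3) by auto
    moreover have "w \<notin> EQ i" if "w \<in> HSL (nx i') True \<or> w \<in> HSL i' False"
      using that HSL_EQ[OF nx_less assms(1), of w i' True] HSL_EQ[OF assms(2,1), of w False] nxi assms(3) by auto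
    moreover have "w \<notin> EQ i \<or> w \<notin> EQ i'" using EQ_disjoint[OF assms] by blast
    ultimately show False using nxi assms nx_less by blast
  qed
  then show ?thesis by blast
qed

end

fun fB :: "plane \<Rightarrow> plane" where "fB (x, y) = (1 - x, y)"
fun fW :: "plane \<Rightarrow> plane" where "fW (x, y) = (x, 1 - y)"
fun fO :: "plane \<Rightarrow> plane" where "fO (x, y) = (1 - x, 1 - y)"

text \<open>In the square around the crossing of the chord at position \<open>k\<close>, the under- and overstrand leave
  towards this position through the corners \<open>cc k\<close> and \<open>dd k\<close>.\<close>

locale drawing = chord_diagram +
  fixes cc dd :: "nat \<Rightarrow> plane"
  assumes cc_pos: "k < N \<Longrightarrow> cc k \<in> positive_corners"
    and cc_pt: "k < N \<Longrightarrow> cc (pt k) = fO (cc k)"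
    and dd_eq: "k < N \<Longrightarrow> dd k = (if up k then fB (cc k) else fW (cc k))"
begin

section \<open>Squares around the crossings\<close>

definition gap :: real where
  "gap = (SOME d. 0 < d \<and> (\<forall>k z. k < N \<longrightarrow> dist (X k) z < 2 * d \<longrightarrow> norm z < 1) \<and>
     (\<forall>k m z. k < N \<longrightarrow> m < N \<longrightarrow> m \<noteq> k \<longrightarrow> m \<noteq> pt k \<longrightarrow> up m = up k \<longrightarrow> dist (X k) z < 2 * d \<longrightarrow> 0 < P m z))"

lemma gap: "0 < gap" "k < N \<Longrightarrow> dist (X k) z < 2 * gap \<Longrightarrow> norm z < 1"
  "k < N \<Longrightarrow> m < N \<Longrightarrow> m \<noteq> k \<Longrightarrow> m \<noteq> pt k \<Longrightarrow> up m = up k \<Longrightarrow> dist (X k) z < 2 * gap \<Longrightarrow> 0 < P m z"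
proof -
  have "\<exists>d>0. (\<forall>k z. k < N \<longrightarrow> dist (X k) z < 2 * d \<longrightarrow> norm z < 1) \<and>
     (\<forall>k m z. k < N \<longrightarrow> m < N \<longrightarrow> m \<noteq> k \<longrightarrow> m \<noteq> pt k \<longrightarrow> up m = up k \<longrightarrow> dist (X k) z < 2 * d \<longrightarrow> 0 < P m z)"
    by (rule room) blast
  from someI_ex[OF this, folded gap_def]
  show "0 < gap" "k < N \<Longrightarrow> dist (X k) z < 2 * gap \<Longrightarrow> norm z < 1"
    "k < N \<Longrightarrow> m < N \<Longrightarrow> m \<noteq> k \<Longrightarrow> m \<noteq> pt k \<Longrightarrow> up m = up k \<Longrightarrow> dist (X k) z < 2 * gap \<Longrightarrow> 0 < P m z"
    by blast+
qed

text \<open>Coordinate along the diagonal of the overstrand, with value 1 at the corner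
  \<open>dd k\<close>; \<open>mu\<close> is the one along the understrand, with value 1 at
  \<open>cc k\<close>.\<close>

definition lam :: "nat \<Rightarrow> plane \<Rightarrow> real" where "lam k p = dotc p (dd k) / 2"

definition mu :: "nat \<Rightarrow> plane \<Rightarrow> real" where "mu k p = dotc p (cc k) / 2"

text \<open>An affine map taking the diagonals of the square into the two strands through
  \<open>X k\<close>. Points of the unit circle are at most 2 apart, so the factor
  \<open>gap / 4\<close> keeps the image within \<open>gap / 2\<close> of the crossing.\<close>

definition A :: "nat \<Rightarrow> plane \<Rightarrow> complex" where
  "A k p = X k + (gap / 4 * lam k p) *\<^sub>R (ep k True - ep (pt k) True)
     + (gap / 4 * mu k p) *\<^sub>R (ep k False - ep (pt k) False)"

definition ck :: "nat \<Rightarrow> plane \<Rightarrow> real ^ 3" where "ck k p = lift (sg k) (A k p)"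

text \<open>The sign s records which positive corner is \<open>cc k\<close>. The extra sign for
  \<open>up k\<close> comes from \<open>dd_eq\<close>; it makes up for the colours exchanging their
  roles between the hemispheres.\<close>

lemma lam_mu:
  assumes "k < N"
  obtains s where "s = 1 \<or> s = -1" "\<And>x y. mu k (x, y) = s * (x - y)"
    "\<And>x y. lam k (x, y) = (if up k then - s else s) * (x + y - 1)"
proof -
  have "cc k = (1, 0) \<or> cc k = (0, 1)" using cc_pos[OF assms] by (auto simp: positive_corners_def)
  then show thesis
  proof
    assume "cc k = (1, 0)"
    then show thesis
      using that[of 1] dd_eq[OF assms] by (simp add: mu_def lam_def field_simps split: if_splits)
  next
    assume "cc k = (0, 1)"
    then show thesis
      using that[of "-1"] dd_eq[OF assms] by (simp add: mu_def lam_def field_simps split: if_splits)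
  qed
qed

lemma lam_mu_pt:
  assumes "k < N"
  shows "lam (pt k) p = - lam k p" "mu (pt k) p = - mu k p"
proof -
  have *: "dotc p (fO v) = - dotc p v" "fB (fO v) = fO (fB v)" "fW (fO v) = fO (fW v)" for v
    by (cases p; cases v; simp add: algebra_simps)+
  show "lam (pt k) p = - lam k p" "mu (pt k) p = - mu k p"
    using dd_eq[OF assms] dd_eq[OF pt_less[OF assms]] cc_pt[OF assms] up_pt[OF assms] *
    by (simp_all add: lam_def mu_def)
qed

lemma A_pt: "k < N \<Longrightarrow> A (pt k) p = A k p"
  by (simp add: A_def lam_mu_pt X_pt pt_pt algebra_simps)

text \<open>Both ends of a chord name the same crossing, and \<Gamma> picks one of them arbitrarily,
  so the chart must not depend on the end.\<close>

lemma ck_pt: "k < N \<Longrightarrow> ck (pt k) = ck k"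
  by (simp add: ck_def[abs_def] A_pt sg_def up_pt)

lemma lam_mu_le:
  assumes "k < N" "p \<in> unit_square"
  shows "\<bar>lam k p\<bar> + \<bar>mu k p\<bar> \<le> 1"
proof -
  obtain x y where p: "p = (x, y)" by (cases p)
  obtain s where s: "s = 1 \<or> s = -1" "\<And>x y. mu k (x, y) = s * (x - y)"
    "\<And>x y. lam k (x, y) = (if up k then - s else s) * (x + y - 1)" using lam_mu[OF assms(1)] by blast
  have "\<bar>lam k p\<bar> = \<bar>x + y - 1\<bar>" "\<bar>mu k p\<bar> = \<bar>x - y\<bar>" using s by (auto simp: p abs_mult)
  then show ?thesis using assms(2) by (auto simp: p unit_square_iff abs_if)
qed

lemma lam_mu_diagonals:
  assumes "k < N" "p \<in> unit_square"
  shows "p \<in> diagonals \<longleftrightarrow> lam k p = 0 \<or> mu k p = 0"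
proof -
  obtain x y where p: "p = (x, y)" by (cases p)
  obtain s where s: "s = 1 \<or> s = -1" "\<And>x y. mu k (x, y) = s * (x - y)"
    "\<And>x y. lam k (x, y) = (if up k then - s else s) * (x + y - 1)" using lam_mu[OF assms(1)] by blast
  have "p \<in> diagonals \<longleftrightarrow> x = y \<or> x + y = 1" using mem_diagonals_iff[OF assms(2)] by (simp add: p)
  moreover have "lam k p = 0 \<longleftrightarrow> x + y = 1" "mu k p = 0 \<longleftrightarrow> x = y" using s(1) by (auto simp: p s(2,3))
  ultimately show ?thesis by blast
qed

lemma lam_mu_inj:
  assumes "k < N" "lam k p = lam k q" "mu k p = mu k q"
  shows "p = q"
proof -
  obtain x y x' y' where pq: "p = (x, y)" "q = (x', y')" by (cases p; cases q)
  obtain s where s: "s = 1 \<or> s = -1" "\<And>x y. mu k (x, y) = s * (x - y)"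
    "\<And>x y. lam k (x, y) = (if up k then - s else s) * (x + y - 1)" using lam_mu[OF assms(1)] by blast
  have "x - y = x' - y'" "x + y - 1 = x' + y' - 1"
    using assms(2,3) s(1) unfolding pq s(2,3) by (auto split: if_splits)
  then show ?thesis unfolding pq by auto
qed

lemma dist_A:
  assumes "k < N" "p \<in> unit_square"
  shows "dist (X k) (A k p) \<le> gap / 2"
proof -
  have D: "norm (ep k ov - ep (pt k) ov) \<le> 2" for ov
    using norm_triangle_ineq4[of "ep k ov" "ep (pt k) ov"] by simp
  have "dist (A k p) (X k) = norm ((gap / 4 * lam k p) *\<^sub>R (ep k True - ep (pt k) True)
     + (gap / 4 * mu k p) *\<^sub>R (ep k False - ep (pt k) False))"
    by (simp add: dist_norm A_def add.assoc)
  also have "\<dots> \<le> \<bar>gap / 4 * lam k p\<bar> * 2 + \<bar>gap / 4 * mu k p\<bar> * 2"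
    by (rule norm_triangle_le) (use D in \<open>auto intro!: add_mono mult_left_mono\<close>)
  also have "\<dots> = gap / 2 * (\<bar>lam k p\<bar> + \<bar>mu k p\<bar>)" using gap(1) by (simp add: abs_mult field_simps)
  also have "\<dots> \<le> gap / 2 * 1" using lam_mu_le[OF assms] gap(1) by (intro mult_left_mono) auto
  finally show ?thesis by (simp add: dist_commute)
qed

lemma norm_A: "k < N \<Longrightarrow> p \<in> unit_square \<Longrightarrow> norm (A k p) < 1"
  using gap(2)[of k "A k p"] dist_A[of k p] gap(1) by auto

lemma P_A_far:
  "k < N \<Longrightarrow> m < N \<Longrightarrow> m \<noteq> k \<Longrightarrow> m \<noteq> pt k \<Longrightarrow> up m = up k \<Longrightarrow> p \<in> unit_square \<Longrightarrow> 0 < P m (A k p)"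
  using gap(3)[of k m "A k p"] dist_A[of k p] gap(1) by auto

definition slope :: "nat \<Rightarrow> bool \<Rightarrow> real" where
  "slope k ov = l k ov (ep k (\<not> ov)) - l k ov (ep (pt k) (\<not> ov))"

lemma sgn_slope:
  assumes "k < N"
  shows "sgn (slope k ov) = (if ov then dr k else - dr k)"
proof -
  have "sgn (l k ov (ep k (\<not> ov))) = (if ov then dr k else - dr k)"
    using sgn_l_own[OF assms, of "\<not> ov"] by auto
  moreover have "sgn (l k ov (ep (pt k) (\<not> ov))) = - (if ov then dr k else - dr k)"
    using sgn_l_own[OF pt_less[OF assms], of "\<not> ov"] l_pt[OF assms] dr_pt[OF assms] by auto
  moreover have "dr k = 1 \<or> dr k = -1" using dr_ne[OF assms] by (auto simp: dr_def sgn_if split: if_splits)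
  ultimately show ?thesis
    unfolding slope_def by (auto simp: sgn_1_pos sgn_1_neg split: if_splits)
qed

lemma l_add: "l k ov (z + t *\<^sub>R (w - w')) = l k ov z + t * (l k ov w - l k ov w')"
  by (simp add: l_def lf_add)

lemma l_A: "l k True (A k p) = gap / 4 * mu k p * slope k True" "l k False (A k p) = gap / 4 * lam k p * slope k False"
  unfolding A_def l_add by (simp_all add: l_X l_ends slope_def)

lemma slope_ne: "k < N \<Longrightarrow> slope k ov \<noteq> 0"
  using sgn_slope[of k ov] dr_ne[of k] by (auto split: if_splits)

text \<open>On the square, \<open>l k True\<close> depends only on the coordinate along the
  understrand and \<open>l k False\<close> only on the one along the overstrand, with slopes of
  opposite sign.\<close>

lemma sgn_P_A:
  assumes "k < N"
  shows "sgn (P k (A k p)) = - sgn (lam k p * mu k p)"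
proof -
  have "sgn (P k (A k p)) = sgn (mu k p) * sgn (lam k p) * (sgn (slope k True) * sgn (slope k False))"
    using gap(1) by (simp add: P_def l_A sgn_mult)
  also have "sgn (slope k True) * sgn (slope k False) = -1"
    using sgn_slope[OF assms] dr_ne[OF assms] by (auto simp: dr_def sgn_if split: if_splits)
  finally show ?thesis by (simp add: sgn_mult)
qed

lemma A_inj:
  assumes "k < N" "A k p = A k q"
  shows "p = q"
proof (rule lam_mu_inj[OF assms(1)])
  show "lam k p = lam k q"
    using l_A(2)[of k p] l_A(2)[of k q] assms slope_ne[OF assms(1)] gap(1) by simp
  show "mu k p = mu k q"
    using l_A(1)[of k p] l_A(1)[of k q] assms slope_ne[OF assms(1)] gap(1) by simp
qed

lemma ck_eq:
  assumes "k < N" "m < N" "p \<in> unit_square" "q \<in> unit_square" "ck k p = ck m q"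
  shows "m = k \<or> m = pt k" "p = q"
proof -
  have "A k p = A m q \<and> (sg k = sg m \<or> norm (A k p) = 1)"
    using assms(5) norm_A[OF assms(1,3)] sg_cases unfolding ck_def by (intro lift_eq) auto
  then have eq: "A k p = A m q" "up m = up k" using norm_A[OF assms(1,3)] sg_eq_iff by auto
  show mk: "m = k \<or> m = pt k"
  proof (rule ccontr)
    assume "\<not> (m = k \<or> m = pt k)"
    \<comment> \<open>If the squares of two chords of one hemisphere met, \<open>X m\<close> would
      be near enough to \<open>X k\<close> for \<open>P m\<close> to be positive at it, but
      \<open>P m\<close> vanishes there.\<close>
    moreover have "dist (X k) (X m) < 2 * gap"
      using dist_A[OF assms(1,3)] dist_A[OF assms(2,4)] eq(1) gap(1)
        dist_triangle[of "X k" "X m" "A k p"] by (simp add: dist_commute)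
    ultimately have "0 < P m (X m)" using gap(3)[OF assms(1,2) _ _ eq(2)] by blast
    then show False using P_X by simp
  qed
  then have "A k p = A k q" using eq(1) A_pt[OF assms(1), of q] by metis
  then show "p = q" by (rule A_inj[OF assms(1)])
qed

lemma A_centre: "A k square_centre = X k"
  by (cases "cc k"; cases "dd k") (simp add: A_def lam_def mu_def)

lemma ck_centre: "ck k square_centre = cross k"
  unfolding ck_def cross_def A_centre ..

lemma continuous_ck: "continuous_on S (ck k)"
proof -
  have "continuous_on S (\<lambda>p. dotc p v)" for v
  proof -
    have "(\<lambda>p. dotc p v) = (\<lambda>p. (2 * fst p - 1) * (2 * fst v - 1) + (2 * snd p - 1) * (2 * snd v - 1))"
      by (rule ext) (metis dotc.simps prod.collapse)
    then show ?thesis by (simp only:) (intro continuous_intros)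
  qed
  then have "continuous_on S (A k)"
    unfolding A_def[abs_def] lam_def mu_def by (intro continuous_intros) auto
  then show ?thesis
    unfolding ck_def by (rule continuous_on_compose2[OF continuous_lift]) auto
qed

text \<open>The overstrand is on the negative corners at every crossing, because \<open>dd k\<close>
  is negative and \<open>cc k\<close> is positive.\<close>

definition \<Gamma> :: diagram where
  "\<Gamma> = \<lparr>crossings = cross ` {..<N}, edges = edge ` {..<N},
     chart = (\<lambda>x. ck (SOME k. k < N \<and> cross k = x)), over = (\<lambda>_. negative_corners)\<rparr>"

lemma \<Gamma>_simps [simp]: "crossings \<Gamma> = cross ` {..<N}" "edges \<Gamma> = edge ` {..<N}" "over \<Gamma> x = negative_corners"
  by (simp_all add: \<Gamma>_def)

lemma chart_cross:
  assumes "k < N"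
  shows "chart \<Gamma> (cross k) = ck k"
proof -
  define m where "m = (SOME m. m < N \<and> cross m = cross k)"
  have "\<exists>m. m < N \<and> cross m = cross k" using assms by blast
  from someI_ex[OF this, folded m_def] have "m < N" "cross k = cross m" by auto
  then have "m = k \<or> m = pt k" using cross_eq_iff assms by blast
  then have "ck m = ck k" using ck_pt[OF assms] by auto
  then show ?thesis by (simp add: \<Gamma>_def m_def)
qed

lemma graph_eq: "graph \<Gamma> = (\<Union>k<N. HSL k True \<union> HSL k False) \<union> (\<Union>i<N. EQ i)"
proof
  have "path_image (edge i) \<subseteq> (\<Union>k<N. HSL k True \<union> HSL k False) \<union> (\<Union>i<N. EQ i)" if "i < N" for i
    using nx_less[of i] that unfolding path_image_edge[OF that] by blast
  moreover have "cross k \<in> HSL k True" for k by (rule cross_in_HSL)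
  ultimately show "graph \<Gamma> \<subseteq> (\<Union>k<N. HSL k True \<union> HSL k False) \<union> (\<Union>i<N. EQ i)"
    unfolding graph_def by auto
  have "HSL k True \<subseteq> graph \<Gamma>" if k: "k < N" for k
  proof -
    obtain i where i: "i < N" "nx i = k" using nx_surj[OF k] by blast
    then show ?thesis using path_image_edge[OF i(1)] by (auto simp: graph_def)
  qed
  moreover have "HSL i False \<subseteq> graph \<Gamma>" "EQ i \<subseteq> graph \<Gamma>" if "i < N" for i
    using path_image_edge[OF that] that by (auto simp: graph_def)
  ultimately show "(\<Union>k<N. HSL k True \<union> HSL k False) \<union> (\<Union>i<N. EQ i) \<subseteq> graph \<Gamma>" by blast
qed

lemma graph_cases:
  assumes "w \<in> graph \<Gamma>"
  obtains k ov where "k < N" "w \<in> HSL k ov" | i where "i < N" "w \<in> EQ i"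
  using assms unfolding graph_eq by blast

lemma HSL_graph: "k < N \<Longrightarrow> HSL k ov \<subseteq> graph \<Gamma>"
  unfolding graph_eq by (cases ov) auto

lemma ck_graph:
  assumes "k < N" "p \<in> unit_square"
  shows "ck k p \<in> graph \<Gamma> \<longleftrightarrow> p \<in> diagonals"
proof
  assume "p \<in> diagonals"
  then have "l k False (A k p) = 0 \<or> l k True (A k p) = 0"
    using lam_mu_diagonals[OF assms] l_A(1)[of k p] l_A(2)[of k p] by auto
  then obtain ov where "l k ov (A k p) = 0" by blast
  then have "A k p \<in> HS k ov \<union> HS (pt k) ov"
    using chord_cover[OF assms(1)] norm_A[OF assms] by simp
  moreover have "sg (pt k) = sg k" using up_pt[OF assms(1)] by (simp add: sg_def)
  ultimately have "ck k p \<in> HSL k ov \<union> HSL (pt k) ov" by (auto simp: HSL_def ck_def)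
  then show "ck k p \<in> graph \<Gamma>" using HSL_graph assms(1) pt_less by blast
next
  assume "ck k p \<in> graph \<Gamma>"
  then show "p \<in> diagonals"
  proof (cases rule: graph_cases)
    case (1 m ov)
    then obtain z where z: "z \<in> HS m ov" "lift (sg k) (A k p) = lift (sg m) z" by (auto simp: HSL_def ck_def)
    have "A k p = z \<and> (sg k = sg m \<or> norm (A k p) = 1)"
      using z(2) norm_A[OF assms] sg_cases by (intro lift_eq) auto
    then have eq: "A k p = z" "up m = up k" using norm_A[OF assms] sg_eq_iff by auto
    have lz: "l m ov (A k p) = 0" using HS_l[OF z(1)] eq by simp
    have "m = k \<or> m = pt k"
    proof (rule ccontr)
      assume "\<not> (m = k \<or> m = pt k)"
      then have "0 < P m (A k p)" using P_A_far[OF assms(1) 1(1) _ _ eq(2) assms(2)] by blast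
      then show False using lz by (cases ov) (auto simp: P_def)
    qed
    then have "l k ov (A k p) = 0" using lz l_pt[OF assms(1)] by auto
    then have "lam k p = 0 \<or> mu k p = 0"
      using l_A[of k p] slope_ne[OF assms(1)] gap(1) by (cases ov) auto
    then show ?thesis using lam_mu_diagonals[OF assms] by simp
  next
    case (2 i)
    then obtain r where "ck k p = lift 1 (u r)" by (auto simp: EQ_def)
    then have "proj (ck k p) = u r" by simp
    then have "A k p = u r" by (simp add: ck_def)
    then show ?thesis using norm_A[OF assms] by simp
  qed
qed

lemma link_diagram: "link_diagram \<Gamma>"
proof -
  have charts: "continuous_on unit_square (chart \<Gamma> (cross k)) \<and> inj_on (chart \<Gamma> (cross k)) unit_square \<and>
        chart \<Gamma> (cross k) ` unit_square \<subseteq> S2 \<and> chart \<Gamma> (cross k) square_centre = cross k \<and>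
        {p \<in> unit_square. chart \<Gamma> (cross k) p \<in> graph \<Gamma>} = diagonals \<and>
        over \<Gamma> (cross k) \<in> {positive_corners, negative_corners}" if k: "k < N" for k
  proof -
    have "inj_on (ck k) unit_square" using ck_eq(2)[OF k k] by (auto intro: inj_onI)
    moreover have "ck k ` unit_square \<subseteq> S2"
      using lift_in_S2[OF less_imp_le[OF norm_A[OF k]] sg_cases] by (auto simp: ck_def)
    moreover have "{p \<in> unit_square. ck k p \<in> graph \<Gamma>} = diagonals"
      using ck_graph[OF k] diagonals_sub by auto
    ultimately show ?thesis
      unfolding chart_cross[OF k] by (simp add: continuous_ck ck_centre)
  qed
  have disj: "chart \<Gamma> (cross k) ` unit_square \<inter> chart \<Gamma> (cross m) ` unit_square = {}"
    if k: "k < N" "m < N" "cross k \<noteq> cross m" for k m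
  proof -
    have False if "p \<in> unit_square" "q \<in> unit_square" "ck k p = ck m q" for p q
      using ck_eq(1)[OF k(1,2) that] k cross_eq_iff[OF k(1,2)] by blast
    then show ?thesis unfolding chart_cross[OF k(1)] chart_cross[OF k(2)] by blast
  qed
  have edges: "simple_path (edge i) \<and> path_image (edge i) \<subseteq> S2 \<and> pathstart (edge i) \<in> cross ` {..<N} \<and>
      pathfinish (edge i) \<in> cross ` {..<N} \<and> edge i ` {0<..<1} \<inter> cross ` {..<N} = {}" if i: "i < N" for i
  proof -
    have "w \<notin> edge i ` {0<..<1}" if w: "w \<in> cross ` {..<N}" for w
    proof -
      obtain k where "w = cross k" "k < N" using w by (rule imageE) simp
      then show ?thesis using edge_interior_cross[OF i, of k] by simp
    qed
    then have "edge i ` {0<..<1} \<inter> cross ` {..<N} = {}" by (meson disjoint_iff)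
    then show ?thesis using simple_path_edge[OF i] edge_S2[OF i] edge_ends[of i] nx_less[of i] i by simp
  qed
  have ed: "edge i ` {0<..<1} \<inter> edge i' ` {0<..<1} = {}" if "i < N" "i' < N" "edge i \<noteq> edge i'" for i i'
    using edge_interior_disjoint[OF that(1,2)] that(3) by blast
  have cS: "cross ` {..<N} \<subseteq> S2" using cross_in_HSL HSL_S2 by blast
  have ne: "cross ` {..<N} \<noteq> {}" using N2 by (auto simp: lessThan_empty_iff)
  show ?thesis
    unfolding link_diagram_def
  proof (intro conjI)
    show "finite (crossings \<Gamma>)" "finite (edges \<Gamma>)" by simp_all
    show "crossings \<Gamma> \<noteq> {}" "crossings \<Gamma> \<subseteq> S2" using ne cS by simp_all
    show "\<forall>g\<in>edges \<Gamma>. simple_path g \<and> path_image g \<subseteq> S2 \<and>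
        pathstart g \<in> crossings \<Gamma> \<and> pathfinish g \<in> crossings \<Gamma> \<and>
        g ` {0<..<1} \<inter> crossings \<Gamma> = {}" using edges unfolding \<Gamma>_simps by blast
    show "\<forall>g\<in>edges \<Gamma>. \<forall>g'\<in>edges \<Gamma>. g \<noteq> g' \<longrightarrow> g ` {0<..<1} \<inter> g' ` {0<..<1} = {}"
      using ed unfolding \<Gamma>_simps by blast
    show "\<forall>x\<in>crossings \<Gamma>.
        continuous_on unit_square (chart \<Gamma> x) \<and> inj_on (chart \<Gamma> x) unit_square \<and>
        chart \<Gamma> x ` unit_square \<subseteq> S2 \<and> chart \<Gamma> x square_centre = x \<and>
        {p \<in> unit_square. chart \<Gamma> x p \<in> graph \<Gamma>} = diagonals \<and>
        over \<Gamma> x \<in> {positive_corners, negative_corners}"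
      using charts unfolding \<Gamma>_simps(1) by blast
    show "\<forall>x\<in>crossings \<Gamma>. \<forall>y\<in>crossings \<Gamma>. x \<noteq> y \<longrightarrow>
        chart \<Gamma> x ` unit_square \<inter> chart \<Gamma> y ` unit_square = {}"
      using disj unfolding \<Gamma>_simps(1) by blast
  qed
qed

lemma hs_initial:
  assumes "k < N"
  obtains t where "0 < t" "t < 1" "hs k ov ` {0..t} = ck k ` closed_segment square_centre (if ov then dd k else cc k)"
proof -
  let ?v = "if ov then dd k else cc k" and ?D = "ep k ov - ep (pt k) ov"
  obtain \<kappa>' where \<kappa>': "0 \<le> \<kappa>'" "\<kappa>' \<le> 1" "X k = (1 - \<kappa>') *\<^sub>R ep k ov + \<kappa>' *\<^sub>R ep (pt k) ov"
    using X_in_chord[OF assms, of ov] by (auto simp: in_segment)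
  have eX: "ep k ov = X k + \<kappa>' *\<^sub>R ?D" unfolding \<kappa>'(3) by (simp add: algebra_simps)
  \<comment> \<open>The ball of radius \<open>2 * gap\<close> stays inside the open disc, while the
    end is on the circle.\<close>
  have far: "2 * gap \<le> dist (X k) (ep k ov)" using gap(2)[OF assms, of "ep k ov"] by (cases "dist (X k) (ep k ov) < 2 * gap") auto
  have "norm ?D \<le> 2" using norm_triangle_ineq4[of "ep k ov" "ep (pt k) ov"] by simp
  moreover have "dist (X k) (ep k ov) = \<kappa>' * norm ?D"
    using \<kappa>'(1) by (subst eX) (simp add: dist_norm norm_minus_commute)
  ultimately have "2 * gap \<le> \<kappa>' * 2" using far mult_left_mono[OF _ \<kappa>'(1), of "norm ?D" 2] by linarith
  then have gk: "gap \<le> \<kappa>'" by simp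
  \<comment> \<open>In multiples of \<open>?D\<close>, the half-diagonal has length
    \<open>gap / 4\<close> and the half-strand length \<kappa>'; t is their ratio.\<close>
  define t where "t = gap / 4 / \<kappa>'"
  have kpos: "0 < \<kappa>'" using gk gap(1) by linarith
  have t: "0 < t" "t < 1" "t * \<kappa>' = gap / 4" using gk gap(1) kpos by (auto simp: t_def field_simps)
  have Av: "A k (1/2 + s * (fst ?v - 1/2), 1/2 + s * (snd ?v - 1/2)) = X k + (s * (gap / 4)) *\<^sub>R ?D" for s
  proof -
    let ?p = "(1/2 + s * (fst ?v - 1/2), 1/2 + s * (snd ?v - 1/2))"
    have c: "cc k = (1, 0) \<or> cc k = (0, 1)" using cc_pos[OF assms] by (auto simp: positive_corners_def)
    have "dotc ?p (dd k) = (if ov then 2 * s else 0)" "dotc ?p (cc k) = (if ov then 0 else 2 * s)"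
      using c dd_eq[OF assms] by (auto simp: field_simps)
    then show ?thesis by (cases ov) (simp_all add: A_def lam_def mu_def mult.commute)
  qed
  have hsp: "hs k ov r = lift (sg k) (X k + (r * \<kappa>') *\<^sub>R ?D)" for r
  proof -
    have "linepath (X k) (ep k ov) r = X k + r *\<^sub>R (ep k ov - X k)" by (simp add: linepath_def algebra_simps)
    also have "ep k ov - X k = \<kappa>' *\<^sub>R ?D" using eX by (simp add: algebra_simps)
    finally show ?thesis by (simp add: hs_def)
  qed
  have "hs k ov ` {0..t} = (\<lambda>s. lift (sg k) (X k + (s * (gap / 4)) *\<^sub>R ?D)) ` {0..1}"
  proof -
    have "{0..t} = (\<lambda>s. t * s) ` {0..1}" using t(1) by (simp add: image_mult_atLeastAtMost)
    then have "hs k ov ` {0..t} = (\<lambda>s. hs k ov (t * s)) ` {0..1}" by (simp add: image_image)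
    also have "(\<lambda>s. hs k ov (t * s)) = (\<lambda>s. lift (sg k) (X k + (s * (gap / 4)) *\<^sub>R ?D))"
      unfolding hsp t(3)[symmetric] by (simp add: mult_ac)
    finally show ?thesis .
  qed
  also have "\<dots> = ck k ` ((\<lambda>s. (1/2 + s * (fst ?v - 1/2), 1/2 + s * (snd ?v - 1/2))) ` {0..1})"
    unfolding image_image ck_def Av ..
  also have "(\<lambda>s. (1/2 + s * (fst ?v - 1/2), 1/2 + s * (snd ?v - 1/2))) ` {0..1} = closed_segment square_centre ?v"
    using half_param[of _ ?v] by blast
  finally show thesis using that[OF t(1,2)] by blast
qed

lemma corners_cc_dd: "k < N \<Longrightarrow> cc k \<in> corners" "k < N \<Longrightarrow> dd k \<in> corners" "k < N \<Longrightarrow> dd k \<in> negative_corners"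
  "k < N \<Longrightarrow> cc k \<notin> negative_corners"
  using cc_pos[of k] dd_eq[of k] by (auto simp: corners_eq positive_corners_def negative_corners_def)

lemma leaves_edge:
  assumes i: "i < N"
  shows "leaves_at \<Gamma> (edge i) (cross (nx i)) (dd (nx i))"
    "leaves_at \<Gamma> (reversepath (edge i)) (cross i) (cc i)"
proof -
  obtain t where t: "0 < t" "t < 1" "hs (nx i) True ` {0..t} = ck (nx i) ` closed_segment square_centre (dd (nx i))"
    using hs_initial[OF nx_less, of i True] by auto
  have "edge i ` {0..t / 2} = ck (nx i) ` closed_segment square_centre (dd (nx i))"
    unfolding edge_def using t by (simp add: joinpaths_initial)
  then show "leaves_at \<Gamma> (edge i) (cross (nx i)) (dd (nx i))"
    unfolding leaves_at_def using t nx_less[of i] corners_cc_dd(2)[OF nx_less] edge_ends[of i]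
    by (auto simp: chart_cross intro!: bexI[of _ "t / 2"])
  obtain t where t: "0 < t" "t < 1" "hs i False ` {0..t} = ck i ` closed_segment square_centre (cc i)"
    using hs_initial[OF i, of False] by auto
  \<comment> \<open>Reversing regroups the joined paths: the under half-strand now takes up only the
    first quarter of the parameter interval, hence \<open>t / 2 / 2\<close> below.\<close>
  have rev: "reversepath (edge i) = (hs i False +++ reversepath (eqt i)) +++ reversepath (hs (nx i) True)"
    unfolding edge_def by (simp add: reversepath_joinpaths hs_ends eqt_ends[OF i])
  have "(hs i False +++ reversepath (eqt i)) ` {0..t / 2} = hs i False ` {0..t}"
    using t by (intro joinpaths_initial) auto
  moreover have "reversepath (edge i) ` {0..t / 2 / 2} = (hs i False +++ reversepath (eqt i)) ` {0..t / 2}"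
    unfolding rev using t by (intro joinpaths_initial) auto
  ultimately have "reversepath (edge i) ` {0..t / 2 / 2} = ck i ` closed_segment square_centre (cc i)"
    using t(3) by simp
  then show "leaves_at \<Gamma> (reversepath (edge i)) (cross i) (cc i)"
    unfolding leaves_at_def using t i corners_cc_dd(1)[OF i] edge_ends[of i]
    by (auto simp: chart_cross intro!: bexI[of _ "t / 2 / 2"])
qed

lemma joins_edge: "i < N \<Longrightarrow> joins_over_under \<Gamma> (edge i) (cross (nx i)) (dd (nx i)) (cross i) (cc i)"
  unfolding joins_over_under_def using leaves_edge corners_cc_dd nx_less by simp

lemma alternating: "alternating \<Gamma>"
  unfolding alternating_def \<Gamma>_simps(2) using joins_edge by blast

text \<open>Edges with consecutive indices share the crossing at the position between them.\<close>

lemma connected_diagram: "connected_diagram \<Gamma>"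
  unfolding connected_diagram_def
proof -
  have ce: "connected (path_image (edge i))" if "i < N" for i
    using simple_path_edge[OF that] by (rule connected_simple_path_image)
  have meet: "path_image (edge i) \<inter> path_image (edge (nx i)) \<noteq> {}" for i
    using pathstart_in_path_image[of "edge i"] pathfinish_in_path_image[of "edge (nx i)"] edge_ends by auto
  have "connected (\<Union>i\<le>n. path_image (edge i))" if "n < N" for n
    using that
  proof (induction n)
    case 0
    then show ?case using ce by simp
  next
    case (Suc n)
    then have nx: "nx n = Suc n" by (simp add: nx_def)
    have "connected ((\<Union>i\<le>n. path_image (edge i)) \<union> path_image (edge (Suc n)))"
    proof (rule connected_Un)
      show "connected (\<Union>i\<le>n. path_image (edge i))" using Suc by simp
      show "connected (path_image (edge (Suc n)))" using ce Suc by simp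
      show "(\<Union>i\<le>n. path_image (edge i)) \<inter> path_image (edge (Suc n)) \<noteq> {}" using meet[of n] nx by auto
    qed
    moreover have "(\<Union>i\<le>Suc n. path_image (edge i)) = (\<Union>i\<le>n. path_image (edge i)) \<union> path_image (edge (Suc n))"
      by (auto simp: atMost_Suc)
    ultimately show ?case by simp
  qed
  from this[of "N - 1"] have "connected (\<Union>i\<le>N - 1. path_image (edge i))" using N2 by simp
  moreover have "{..N - 1} = {..<N}" using N2 by auto
  moreover have "graph \<Gamma> = (\<Union>i<N. path_image (edge i))"
  proof -
    have "cross k \<in> path_image (edge k)" for k using edge_ends(2) pathfinish_in_path_image by metis
    then show ?thesis by (auto simp: graph_def)
  qed
  ultimately show "connected (graph \<Gamma>)" by simp
qed

end

section \<open>The checkerboard colouring and the gluing of the drawn diagram\<close>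

lemma side_flip: "side a b \<longleftrightarrow> a \<in> corners \<and> (b = fB a \<or> b = fW a)"
  by (cases a; cases b) (auto simp: side_def corners_eq dist_Pair_Pair dist_real_def)

lemma flip_midpoint: "fst (midpoint a (fB a)) = 1/2" "a \<in> corners \<Longrightarrow> fst (midpoint a (fW a)) \<noteq> 1/2"
  "a \<in> corners \<Longrightarrow> fB a \<noteq> fW a"
  by (cases a; auto simp: midpoint_def corners_eq field_simps)+

context circle
begin

lemma unit_u:
  assumes "norm z = 1"
  obtains r where "- 1/4 \<le> r" "r < real N - 1/4" "z = u r"
proof -
  define r where "r = Arg2pi z / (2 * \<theta>)"
  have z: "z = u r"
    using Arg2pi_eq[of z] assms \<theta>_pos by (simp add: u_def r_def cis_conv_exp)
  have "2 * pi = real N * (2 * \<theta>)" using \<theta>_N by (simp add: mult.commute)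
  then have r: "0 \<le> r" "r < real N"
    using Arg2pi[of z] \<theta>_pos by (simp_all add: r_def field_simps)
  show thesis
  proof (cases "r < real N - 1/4")
    case True
    then show thesis using that[of r] r z by simp
  next
    \<comment> \<open>The turn starts at -1/4 instead of 0, so its last quarter unit is moved back
      by N.\<close>
    case False
    then show thesis using that[of "r - N"] r z N2 u_periodic'[of r] by simp
  qed
qed

end

context drawing
begin

text \<open>\<open>P k\<close> is negative between the two strands that replace a chord.  The checkerboard colouring is
  black there in the upper hemisphere and white there in the lower one.\<close>

definition near :: "bool \<Rightarrow> (real ^ 3) set" where
  "near b = {w. \<exists>k\<in>{..<N}. up k = b \<and> P k (proj w) \<le> 0}"

definition far :: "bool \<Rightarrow> (real ^ 3) set" where
  "far b = {w. \<forall>k\<in>{..<N}. up k = b \<longrightarrow> 0 \<le> P k (proj w)}"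

definition black :: "(real ^ 3) set" where
  "black = {w. 0 \<le> w $ 3} \<inter> near True \<union> {w. w $ 3 \<le> 0} \<inter> far False"

definition white :: "(real ^ 3) set" where
  "white = {w. 0 \<le> w $ 3} \<inter> far True \<union> {w. w $ 3 \<le> 0} \<inter> near False"

lemma closed_near_far: "closed (near b)" "closed (far b)"
proof -
  have c: "continuous_on UNIV (\<lambda>w. P k (proj w))" for k
    by (rule continuous_on_compose2[OF continuous_P continuous_proj]) auto
  have "near b = (\<Union>k\<in>{k\<in>{..<N}. up k = b}. {w. P k (proj w) \<le> 0})" by (auto simp: near_def)
  moreover have "closed (\<Union>k\<in>{k\<in>{..<N}. up k = b}. {w. P k (proj w) \<le> 0})"
    using c by (intro closed_UN ballI closed_Collect_le continuous_intros) auto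
  ultimately show "closed (near b)" by simp
  have "far b = (\<Inter>k\<in>{k\<in>{..<N}. up k = b}. {w. 0 \<le> P k (proj w)})" by (auto simp: far_def)
  moreover have "closed (\<Inter>k\<in>{k\<in>{..<N}. up k = b}. {w. 0 \<le> P k (proj w)})"
    using c by (intro closed_INT ballI closed_Collect_le continuous_intros) auto
  ultimately show "closed (far b)" by simp
qed

lemma closed_colours: "closed black" "closed white"
proof -
  have "closed {w :: real ^ 3. 0 \<le> w $ 3}" "closed {w :: real ^ 3. w $ 3 \<le> 0}"
    by (intro closed_Collect_le continuous_intros)+
  then show "closed black" "closed white"
    unfolding black_def white_def using closed_near_far by (intro closed_Un closed_Int; simp)+
qed

lemma colours_cover: "w \<in> black \<union> white"
proof -
  have "w \<in> near b \<union> far b" for b by (auto simp: near_def far_def not_le intro: less_imp_le)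
  then show ?thesis unfolding black_def white_def using linear[of 0 "w $ 3"] by blast
qed

lemma near_far_graph:
  assumes w: "w \<in> S2" "0 \<le> (if b then 1 else -1) * w $ 3" and nf: "w \<in> near b" "w \<in> far b"
  shows "w \<in> graph \<Gamma>"
proof -
  obtain k where k: "k < N" "up k = b" "P k (proj w) \<le> 0" using nf(1) by (auto simp: near_def)
  then have "P k (proj w) = 0" using nf(2) by (auto simp: far_def intro: antisym)
  then obtain ov where "l k ov (proj w) = 0" by (auto simp: P_def)
  then have HS: "proj w \<in> HS k ov \<union> HS (pt k) ov" using chord_cover[OF k(1) norm_proj[OF w(1)]] by simp
  have sg: "sg k = (if b then 1 else -1)" "sg (pt k) = sg k" using k up_pt by (simp_all add: sg_def)
  have "w = lift (sg k) (proj w)" using w sg(1) by (intro lift_proj) auto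
  then have "w \<in> HSL k ov \<union> HSL (pt k) ov" using HS sg(2) unfolding HSL_def by (metis Un_iff imageI)
  then show ?thesis using HSL_graph k(1) pt_less by blast
qed

lemma P_u_le:
  assumes "k < N" "- 1/4 \<le> r" "r < real N - 1/4" "P k (u r) \<le> 0"
  obtains m where "m < N" "up m = up k" "\<bar>r - real m\<bar> \<le> 1/4"
proof (cases "\<bar>r - real k\<bar> \<le> 1/4 \<or> \<bar>r - real (pt k)\<bar> \<le> 1/4")
  case True
  then show thesis using that[of k] that[of "pt k"] assms(1) pt_less up_pt by blast
next
  case False
  then have "sgn (P k (u r)) = 1" unfolding sgn_P_u[OF assms(1-3)] by simp
  then show thesis using assms(4) by (simp add: sgn_1_pos)
qed

text \<open>The point would be within 1/4 of a position of each hemisphere, but different positions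
  are at least 1 apart.\<close>

lemma equator_near:
  assumes "w \<in> S2" "w $ 3 = 0" "w \<in> near True" "w \<in> near False"
  shows False
proof -
  obtain r where r: "- 1/4 \<le> r" "r < real N - 1/4" "proj w = u r" using unit_u proj_unit[OF assms(1,2)] by blast
  obtain k where k: "k < N" "up k" "P k (u r) \<le> 0" using assms(3) r(3) by (auto simp: near_def)
  obtain m where m: "m < N" "\<not> up m" "P m (u r) \<le> 0" using assms(4) r(3) by (auto simp: near_def)
  obtain k' where k': "up k'" "\<bar>r - real k'\<bar> \<le> 1/4" using P_u_le[OF k(1) r(1,2) k(3)] k(2) by auto
  obtain m' where m': "\<not> up m'" "\<bar>r - real m'\<bar> \<le> 1/4" using P_u_le[OF m(1) r(1,2) m(3)] m(2) by auto
  have "\<bar>real k' - real m'\<bar> < 1" using k'(2) m'(2) by linarith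
  then have "k' = m'" by linarith
  then show False using k'(1) m'(1) by simp
qed

text \<open>On the equator \<open>P k\<close> is negative within 1/4 of the ends of chord k, so a
  point where no \<open>P k\<close> is negative lies on one of the arcs between these
  intervals.\<close>

lemma equator_far:
  assumes "w \<in> S2" "w $ 3 = 0" "w \<in> far True" "w \<in> far False"
  shows "w \<in> graph \<Gamma>"
proof -
  obtain r where r: "- 1/4 \<le> r" "r < real N - 1/4" "proj w = u r" using unit_u proj_unit[OF assms(1,2)] by blast
  have w: "w = lift 1 (u r)" using lift_proj[OF assms(1), of 1] assms(2) r(3) by simp
  have far: "1/4 \<le> \<bar>r - real k\<bar>" if k: "k < N" for k
  proof (rule ccontr)
    assume n: "\<not> 1/4 \<le> \<bar>r - real k\<bar>"
    have "1 \<le> \<bar>real k - real (pt k)\<bar>" using pt_ne[OF k] by linarith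
    then have "1/4 < \<bar>r - real (pt k)\<bar>" using n by linarith
    then have "sgn (P k (u r)) = -1" unfolding sgn_P_u[OF k r(1,2)] using n by simp
    then have "P k (u r) < 0" by (simp add: sgn_1_neg)
    moreover have "0 \<le> P k (u r)"
      using assms(3,4) k r(3) by (cases "up k") (auto simp: far_def)
    ultimately show False by simp
  qed
  \<comment> \<open>The unit interval from \<open>i - 1/4\<close> to \<open>i + 3/4\<close> contains
    r. Only its left end, which closes the preceding arc, and the part from \<open>i + 1/4\<close>
    on have distance at least 1/4 from i.\<close>
  define i where "i = nat \<lfloor>r + 1/4\<rfloor>"
  have i: "real i \<le> r + 1/4" "r + 1/4 < real i + 1" using r(1) by (simp_all add: i_def)
  then have iN: "i < N" using r(2) by linarith
  show ?thesis
  proof (cases "r = real i - 1/4")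
    case True
    obtain j where j: "j < N" "nx j = i" using nx_surj[OF iN] by blast
    have "u r = u (real j + 3/4)" using ep_nx[OF j(1)] True j(2) by (simp add: ep_def pos_def)
    then have "w \<in> EQ j" unfolding w EQ_def by auto
    then show ?thesis using j(1) unfolding graph_eq by blast
  next
    case False
    then have "real i - 1/4 < r" using i(1) by linarith
    then have "real i + 1/4 \<le> r" using far[OF iN] by linarith
    then have "r \<in> {real i + 1/4..real i + 3/4}" using i(2) by simp
    then have "w \<in> EQ i" unfolding w EQ_def by blast
    then show ?thesis using iN unfolding graph_eq by blast
  qed
qed

lemma colours_meet:
  assumes "w \<in> S2" "w \<in> black" "w \<in> white"
  shows "w \<in> graph \<Gamma>"
proof -
  consider "0 \<le> w $ 3" "w \<in> near True" "w \<in> far True" | "w $ 3 \<le> 0" "w \<in> near False" "w \<in> far False"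
    | "w $ 3 = 0" "w \<in> near True" "w \<in> near False" | "w $ 3 = 0" "w \<in> far True" "w \<in> far False"
    using assms(2,3) unfolding black_def white_def by force
  then show ?thesis
  proof cases
    case 1
    then show ?thesis using near_far_graph[of w True] assms(1) by simp
  next
    case 2
    then show ?thesis using near_far_graph[of w False] assms(1) by simp
  next
    case 3
    then show ?thesis using equator_near[OF assms(1)] by blast
  next
    case 4
    then show ?thesis using equator_far[OF assms(1)] by blast
  qed
qed

lemma region_colour:
  assumes R: "R \<in> regions \<Gamma>" and w: "w \<in> R" "w \<in> black" "w' \<in> R" "w' \<in> white"
  shows False
proof -
  have sub: "R \<subseteq> S2 - graph \<Gamma>" using R unfolding regions_def by (rule in_components_subset)
  have "connected R" using R unfolding regions_def by (rule in_components_connected)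
  moreover have "black \<inter> white \<inter> R = {}" using colours_meet sub by blast
  moreover have "R \<subseteq> black \<union> white" using colours_cover by blast
  ultimately show False using closed_colours w unfolding connected_closed by blast
qed

text \<open>First coordinate 1/2 marks the horizontal sides, the black edges. The sign of
  \<open>P k\<close> there is opposite to that of \<open>lam k m * mu k m\<close>, which depends on
  the hemisphere just as the colouring does.\<close>

lemma ck_colour:
  assumes k: "k < N" and m: "m \<in> mids"
  shows "fst m = 1/2 \<Longrightarrow> ck k m \<in> black" "fst m \<noteq> 1/2 \<Longrightarrow> ck k m \<in> white"
proof -
  have sq: "m \<in> unit_square" using m by (auto simp: mids_def unit_square_def)
  obtain s where s: "s = 1 \<or> s = -1" "\<And>x y. mu k (x, y) = s * (x - y)"
    "\<And>x y. lam k (x, y) = (if up k then - s else s) * (x + y - 1)" using lam_mu[OF k] by blast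
  have lm: "lam k m * mu k m = (if (fst m = 1/2) = up k then 1/4 else -1/4)"
    using s(1) m by (auto simp: mids_def s(2,3))
  have sgnP: "sgn (P k (A k m)) = (if (fst m = 1/2) = up k then -1 else 1)"
    unfolding sgn_P_A[OF k] lm by simp
  have proj: "proj (ck k m) = A k m" by (simp add: ck_def)
  have h: "if up k then 0 \<le> ck k m $ 3 else ck k m $ 3 \<le> 0"
    using norm_A[OF k sq] by (simp add: ck_def lift_nth sg_def abs_square_le_1)
  have near: "ck k m \<in> near (up k)" if "(fst m = 1/2) = up k"
    using sgnP that k by (auto simp: near_def proj sgn_1_neg)
  have far: "ck k m \<in> far (up k)" if "(fst m = 1/2) \<noteq> up k"
  proof -
    have P: "0 < P k (A k m)" using sgnP that by (simp add: sgn_1_pos)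
    have "0 \<le> P i (A k m)" if i: "i < N" "up i = up k" for i
    proof (cases "i = k \<or> i = pt k")
      case True
      then show ?thesis using P P_pt[OF k] by auto
    next
      case False
      then show ?thesis using P_A_far[OF k i(1) _ _ i(2) sq] by (simp add: less_imp_le)
    qed
    then show ?thesis by (simp add: far_def proj)
  qed
  show "ck k m \<in> black" if "fst m = 1/2"
    using near far h that by (cases "up k") (auto simp: black_def)
  show "ck k m \<in> white" if "fst m \<noteq> 1/2"
    using near far h that by (cases "up k") (auto simp: white_def)
qed

sublocale D: alt_diagram \<Gamma>
  by unfold_locales (rule link_diagram alternating connected_diagram)+

lemma reg_colour:
  assumes "k < N" "k' < N" "m \<in> mids" "m' \<in> mids" "D.reg (cross k) m = D.reg (cross k') m'"
  shows "fst m = 1/2 \<longleftrightarrow> fst m' = 1/2"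
proof -
  have cr: "cross k \<in> crossings \<Gamma>" "cross k' \<in> crossings \<Gamma>" using assms(1,2) by simp_all
  have R: "D.reg (cross k) m \<in> regions \<Gamma>" using D.reg_in_regions[OF cr(1) assms(3)] .
  have "ck k m \<in> D.reg (cross k) m" "ck k' m' \<in> D.reg (cross k') m'"
    using D.sector_reg[OF cr(1) assms(3)] D.sector_reg[OF cr(2) assms(4)] mids_sector assms(3,4)
    unfolding chart_cross[OF assms(1)] chart_cross[OF assms(2)] by blast+
  then show ?thesis
    using region_colour[OF R] ck_colour[OF assms(1,3)] ck_colour[OF assms(2,4)] assms(5) by metis
qed

text \<open>Overpass ends are at negative corners, which fixes the direction of the edge and both
  corners. Each corner has one black and one white side, and sides in a common region have the same
  colour, so they match in only one way.\<close>

lemma glued_sides_edge: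
  assumes "glued_sides \<Gamma> j a b k a' b'"
  obtains i where "i < N" "j = cross (nx i)" "a = dd (nx i)" "k = cross i" "a' = cc i"
    "b = fB a \<and> b' = fB a' \<or> b = fW a \<and> b' = fW a'"
proof -
  obtain g where g: "g \<in> oriented_edges \<Gamma>" "joins_over_under \<Gamma> g j a k a'"
    using assms unfolding glued_sides_def by blast
  obtain h where "h \<in> edges \<Gamma>" "g = h \<or> g = reversepath h" using D.oedgeE[OF g(1)] by blast
  then obtain i where i: "i < N" "g = edge i \<or> g = reversepath (edge i)" by auto
  have ge: "g = edge i"
  proof (rule ccontr)
    assume "g \<noteq> edge i"
    then have "g = reversepath (edge i)" using i(2) by blast
    then have "leaves_at \<Gamma> (reversepath (edge i)) j a" "a \<in> negative_corners"
      using g(2) unfolding joins_over_under_def by simp_all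
    then show False using D.leaves_unique[OF _ leaves_edge(2)[OF i(1)]] corners_cc_dd(4)[OF i(1)] by blast
  qed
  have ja: "j = cross (nx i)" "a = dd (nx i)"
    using g(2) D.leaves_unique[OF _ leaves_edge(1)[OF i(1)], of j a] unfolding joins_over_under_def ge by simp_all
  have ka: "k = cross i" "a' = cc i"
    using g(2) D.leaves_unique[OF _ leaves_edge(2)[OF i(1)], of k a'] unfolding joins_over_under_def ge by simp_all
  note gs = D.glued_sides_reg[OF assms]
  have b: "a \<in> corners" "b = fB a \<or> b = fW a" using gs(3) unfolding side_flip by simp_all
  have b': "a' \<in> corners" "b' = fB a' \<or> b' = fW a'"
  proof -
    have "side a' b'" using gs(4) unfolding side_def by (simp add: dist_commute)
    then show "a' \<in> corners" "b' = fB a' \<or> b' = fW a'" unfolding side_flip by simp_all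
  qed
  have "midpoint a b \<in> mids" "midpoint b' a' \<in> mids" using side_cases(3) gs(3,4) by blast+
  then have "fst (midpoint a b) = 1/2 \<longleftrightarrow> fst (midpoint b' a') = 1/2"
    using reg_colour[OF nx_less i(1)] gs(5) unfolding ja(1) ka(1) by blast
  then have "fst (midpoint a b) = 1/2 \<longleftrightarrow> fst (midpoint a' b') = 1/2" by (simp add: midpoint_sym)
  then have "b = fB a \<and> b' = fB a' \<or> b = fW a \<and> b' = fW a'"
    using b b' flip_midpoint(1)[of a] flip_midpoint(1)[of a'] flip_midpoint(2)[OF b(1)] flip_midpoint(2)[OF b'(1)]
    by metis
  then show thesis using that i(1) ja ka by blast
qed

text \<open>A partner side exists by \<open>reg_eq_joins\<close>, and the colouring leaves only the
  stated one.\<close>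

lemma edge_glued_sides:
  assumes i: "i < N"
  shows "glued_sides \<Gamma> (cross (nx i)) (dd (nx i)) (fB (dd (nx i))) (cross i) (cc i) (fB (cc i))"
    "glued_sides \<Gamma> (cross (nx i)) (dd (nx i)) (fW (dd (nx i))) (cross i) (cc i) (fW (cc i))"
proof -
  let ?a = "dd (nx i)"
  have a: "?a \<in> corners" using corners_cc_dd(2)[OF nx_less] .
  have g: "edge i \<in> oriented_edges \<Gamma>" using i by (auto simp: oriented_edges_def)
  have "\<exists>b'. glued_sides \<Gamma> (cross (nx i)) ?a b (cross i) (cc i) b'" if s: "side ?a b" for b
  proof -
    obtain b0 b' where "midpoint ?a b = midpoint ?a b0" "glued_sides \<Gamma> (cross (nx i)) ?a b0 (cross i) (cc i) b'"
      using D.reg_eq_joins[OF g joins_edge[OF i] side_cases(3,4)[OF s]] by blast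
    moreover have "b0 = b" using calculation(1) by (auto simp: midpoint_def)
    ultimately show ?thesis by blast
  qed
  then obtain b1 b2 where
    b1: "glued_sides \<Gamma> (cross (nx i)) ?a (fB ?a) (cross i) (cc i) b1" and
    b2: "glued_sides \<Gamma> (cross (nx i)) ?a (fW ?a) (cross i) (cc i) b2"
    using a unfolding side_flip by metis
  from b1 have "b1 = fB (cc i)" by (rule glued_sides_edge) (use flip_midpoint(3)[OF a] in auto)
  then show "glued_sides \<Gamma> (cross (nx i)) ?a (fB ?a) (cross i) (cc i) (fB (cc i))" using b1 by simp
  from b2 have "b2 = fW (cc i)" by (rule glued_sides_edge) (use flip_midpoint(3)[OF a] in auto)
  then show "glued_sides \<Gamma> (cross (nx i)) ?a (fW ?a) (cross i) (cc i) (fW (cc i))" using b2 by simp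
qed

end

section \<open>Realising a planar gluing by a diagram\<close>

lemma map_half_cells:
  assumes "bij_betw \<kappa> I J"
  shows "bij_betw (map_half \<kappa>) (half_cells I) (half_cells J)"
proof -
  have "inj_on (map_half \<kappa>) (half_cells I)"
  proof (rule inj_onI)
    fix c d assume cd: "c \<in> half_cells I" "d \<in> half_cells I" "map_half \<kappa> c = map_half \<kappa> d"
    have "inj_on \<kappa> I" using assms by (rule bij_betw_imp_inj_on)
    then show "c = d" using cd by (cases c; cases d) (auto simp: half_cells_def dest: inj_onD)
  qed
  moreover have "map_half \<kappa> ` half_cells I = half_cells (\<kappa> ` I)"
    by (simp add: half_cells_def image_Un image_image)
  ultimately show ?thesis using assms by (simp add: bij_betw_def)
qed

text \<open>Only the cubes are renamed, their points stay. Side faces are glued from lower to upper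
  in \<open>C3\<close> and from upper to lower in \<open>Aitchison\<close>, so gluings are compared
  up to inversion.\<close>

lemma complex_iso_relabel:
  fixes K :: "'i half cubed_complex" and L :: "'j half cubed_complex"
  assumes \<kappa>: "bij_betw \<kappa> I J"
    and K: "cells K = half_cells I" "cube K = half_cube" and L: "cells L = half_cells J" "cube L = half_cube"
    and fwd: "\<And>p q. (p, q) \<in> glue K \<Longrightarrow>
      (map_prod (map_half \<kappa>) id p, map_prod (map_half \<kappa>) id q) \<in> glue L \<union> (glue L)\<inverse>"
    and bwd: "\<And>u v. (u, v) \<in> glue L \<Longrightarrow> \<exists>p q. u = map_prod (map_half \<kappa>) id p \<and>
      v = map_prod (map_half \<kappa>) id q \<and> fst p \<in> half_cells I \<and> fst q \<in> half_cells I \<and>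
      (p, q) \<in> glue K \<union> (glue K)\<inverse>"
  shows "complex_iso K L"
proof -
  let ?\<rho> = "map_prod (map_half \<kappa>) (id :: space \<Rightarrow> space)"
  let ?RK = "glue K \<union> (glue K)\<inverse>" and ?RL = "glue L \<union> (glue L)\<inverse>"
  have bij: "bij_betw (map_half \<kappa>) (half_cells I) (half_cells J)" by (rule map_half_cells[OF \<kappa>])
  have inj: "p = q" if "?\<rho> p = ?\<rho> q" "fst p \<in> half_cells I" "fst q \<in> half_cells I" for p q
    using that bij unfolding bij_betw_def inj_on_def by (cases p; cases q) auto
  have stp: "(?\<rho> p, ?\<rho> q) \<in> ?RL" if "(p, q) \<in> ?RK" for p q
    using that fwd[of p q] fwd[of q p] by auto
  have to: "(?\<rho> p, ?\<rho> q) \<in> ?RL\<^sup>*" if "(p, q) \<in> ?RK\<^sup>*" for p q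
    using that
  proof (induction rule: rtrancl_induct)
    case base
    show ?case by simp
  next
    case (step y z)
    have "(?\<rho> y, ?\<rho> z) \<in> ?RL" using \<open>(y, z) \<in> ?RK\<close> by (rule stp)
    with step.IH show "(?\<rho> p, ?\<rho> z) \<in> ?RL\<^sup>*" by (rule rtrancl.rtrancl_into_rtrancl)
  qed
  have unglue: "\<exists>p q. u = ?\<rho> p \<and> v = ?\<rho> q \<and> fst p \<in> half_cells I \<and> fst q \<in> half_cells I \<and> (p, q) \<in> ?RK"
    if "(u, v) \<in> ?RL" for u v
  proof (cases "(u, v) \<in> glue L")
    case True
    then show ?thesis by (rule bwd)
  next
    case False
    then have "(v, u) \<in> glue L" using that by simp
    from bwd[OF this] obtain p q where "v = ?\<rho> p" "u = ?\<rho> q" "fst p \<in> half_cells I" "fst q \<in> half_cells I"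
      "(p, q) \<in> ?RK" by blast
    then show ?thesis by (intro exI[of _ q] exI[of _ p]) blast
  qed
  \<comment> \<open>A chain in L is lifted link by link; injectivity on the cells identifies the end
    of one lifted link with the start of the next.\<close>
  have from_L: "\<forall>q. v = ?\<rho> q \<longrightarrow> fst q \<in> half_cells I \<longrightarrow> (p, q) \<in> ?RK\<^sup>*"
    if "(?\<rho> p, v) \<in> ?RL\<^sup>*" and p: "fst p \<in> half_cells I" for p v
    using that(1)
  proof (induction rule: rtrancl_induct)
    case base
    show ?case using inj[OF _ p] by auto
  next
    case (step y z)
    obtain p' q' where pq: "y = ?\<rho> p'" "z = ?\<rho> q'" "fst p' \<in> half_cells I" "fst q' \<in> half_cells I" "(p', q') \<in> ?RK"
      using unglue[OF step.hyps(2)] by blast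
    have "(p, p') \<in> ?RK\<^sup>*" using step.IH pq(1,3) by blast
    then have "(p, q') \<in> ?RK\<^sup>*" using pq(5) by (rule rtrancl.rtrancl_into_rtrancl)
    moreover have "q = q'" if "z = ?\<rho> q" "fst q \<in> half_cells I" for q
      by (rule inj) (use that pq in simp_all)
    ultimately show ?case by blast
  qed
  have cube: "half_cube (map_half \<kappa> c) = half_cube c" for c by (cases c) simp_all
  have iff: "((c, x), (d, y)) \<in> identified K \<longleftrightarrow> ((map_half \<kappa> c, x), (map_half \<kappa> d, y)) \<in> identified L"
    if pts: "(c, x) \<in> cube_points K" "(d, y) \<in> cube_points K" for c x d y
  proof -
    have cd: "c \<in> half_cells I" "d \<in> half_cells I" "x \<in> half_cube c" "y \<in> half_cube d"
      using pts by (simp_all add: cube_points_def K)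
    then have "(map_half \<kappa> c, x) \<in> cube_points L" "(map_half \<kappa> d, y) \<in> cube_points L"
      using bij_betwE[OF bij] by (simp_all add: cube_points_def L cube)
    moreover have "((c, x), (d, y)) \<in> ?RK\<^sup>* \<longleftrightarrow> ((map_half \<kappa> c, x), (map_half \<kappa> d, y)) \<in> ?RL\<^sup>*"
      using to[of "(c, x)" "(d, y)"] from_L[of "(c, x)" "?\<rho> (d, y)", THEN spec, of "(d, y)"] cd by auto
    ultimately show ?thesis unfolding identified_def using pts by blast
  qed
  show ?thesis
    unfolding complex_iso_def
  proof (intro exI conjI)
    show "bij_betw (map_half \<kappa>) (cells K) (cells L)" using bij K L by simp
    show "\<forall>c\<in>cells K. (\<lambda>x. x) ` cube K c = cube L (map_half \<kappa> c) \<and> (\<forall>x\<in>cube K c. \<forall>y\<in>cube K c. dist x y = dist x y)"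
      by (simp add: K L cube)
    show "\<forall>(c, x)\<in>cube_points K. \<forall>(d, y)\<in>cube_points K.
        ((c, x), (d, y)) \<in> identified K \<longleftrightarrow> ((map_half \<kappa> c, x), (map_half \<kappa> d, y)) \<in> identified L"
      using iff by blast
  qed
qed

lemma snd_flip: "snd (flipB v) = fB (snd v)" "snd (flipW v) = fW (snd v)" "snd (opposite v) = fO (snd v)"
  by (cases v; auto)+

lemma edge_point_flip: "edge_point (edgeB v) r = (1 - r) *\<^sub>R fB (snd v) + r *\<^sub>R snd v"
  "edge_point (edgeW v) r = (1 - r) *\<^sub>R fW (snd v) + r *\<^sub>R snd v"
  by (simp_all add: edgeB_def edgeW_def snd_flip)

lemma C3_glueI:
  assumes "e \<in> E_all S" "r \<in> {0..1}" "t \<in> {-1..0}"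
  shows "((Lower (fst e), (edge_point e r, t)),
    (Upper (fst (Phi S \<phi> e)), (edge_point (Phi S \<phi> e) r, - t))) \<in> glue (C3 S \<phi>)"
  unfolding C3_def cubed_complex.simps
  by (rule UnI2, rule CollectI, intro exI conjI) (use assms in simp_all)

context sbw
begin

lemma backward:
  assumes con: "complex_connected (C3 S \<phi>)" and planar: "card (edge_orbits S \<phi>) = card S + 2"
  shows "\<exists>\<Gamma>. link_diagram \<Gamma> \<and> connected_diagram \<Gamma> \<and> alternating \<Gamma> \<and> complex_iso (C3 S \<phi>) (Aitchison \<Gamma>)"
proof -
  have "S \<noteq> {}"
  proof
    assume "S = {}"
    then have "edge_orbits S \<phi> = {}" by (simp add: edge_orbits_def E_all_def E_B_def E_W_def)
    then show False using planar by simp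
  qed
  then have ne: "V_pos S \<noteq> {}" using fst_V_pos by auto
  have pl: "norb \<beta> (V_pos S) + norb (tw \<beta> (fst ` V_pos S)) (V_pos S) = card (fst ` V_pos S) + 2"
    using planar unfolding card_edge_orbits norb_Phi norb_\<omega> fst_V_pos .
  obtain T e where "T \<subseteq> fst ` V_pos S" and e: "bij_betw e {..<card (V_pos S)} (V_pos S)"
    and tw_e: "\<And>i. i < card (V_pos S) \<Longrightarrow> tw \<beta> T (e i) = e (Suc i mod card (V_pos S))"
    and nested: "\<And>i j k l. e j = opposite (e i) \<Longrightarrow> e l = opposite (e k) \<Longrightarrow>
      (fst (e i) \<in> T \<longleftrightarrow> fst (e k) \<in> T) \<Longrightarrow> i < k \<Longrightarrow> k < j \<Longrightarrow> j < l \<Longrightarrow> l < card (V_pos S) \<Longrightarrow> False"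
    by (rule planar_arrangement[OF \<beta>_image ne _ pl]) (erule (3) \<beta>_\<tau>_transitive[OF con], rule that, assumption+)
  define N where "N = card (V_pos S)"
  define ix where "ix = inv_into {..<N} e"
  define pt where "pt k = ix (opposite (e k))" for k
  \<comment> \<open>Squares in T go below the equator and all others above; within each of the two
    families no chords interleave.\<close>
  define up where "up k \<longleftrightarrow> fst (e k) \<notin> T" for k
  define cc where "cc k = snd (e k)" for k
  define dd where "dd k = (if up k then fB (cc k) else fW (cc k))" for k
  note bij = e[folded N_def]
  have eV: "e k \<in> V_pos S" if "k < N" for k using bij_betwE[OF bij] that by simp
  have e_inj: "i = k" if "i < N" "k < N" "e i = e k" for i k
    using that bij unfolding bij_betw_def inj_on_def by simp
  have e_ix: "e (ix v) = v" "ix v < N" if "v \<in> V_pos S" for v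
    using that bij_betw_inv_into_right[OF bij] bij_betwE[OF bij_betw_inv_into[OF bij]] unfolding ix_def by auto
  have e_pt: "e (pt k) = opposite (e k)" "pt k < N" if "k < N" for k
    using e_ix[OF flip_pos(3)[OF eV[OF that]]] by (simp_all add: pt_def)
  have "0 < card S" using \<open>S \<noteq> {}\<close> finite_S by (simp add: card_gt_0_iff)
  then have N2: "2 \<le> N" using card_V_pos by (simp add: N_def)
  have up_pt: "up (pt k) = up k" if "k < N" for k using e_pt(1)[OF that] by (simp add: up_def)
  interpret drawing N pt up cc dd
  proof unfold_locales
    show "2 \<le> N" by (rule N2)
    fix k assume k: "k < N"
    show "pt k < N" by (rule e_pt(2)[OF k])
    show "pt (pt k) = k" using e_pt[OF k] e_pt[OF e_pt(2)[OF k]] k by (intro e_inj) simp_all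
    show "pt k \<noteq> k" using e_pt(1)[OF k] \<tau>_neq[OF eV[OF k]] by auto
    show "up (pt k) = up k" by (rule up_pt[OF k])
    show "cc k \<in> positive_corners" using eV[OF k] by (auto simp: cc_def V_pos_def)
    show "cc (pt k) = fO (cc k)" using e_pt(1)[OF k] by (simp add: cc_def snd_flip)
    show "dd k = (if up k then fB (cc k) else fW (cc k))" by (rule dd_def)
  next
    fix i k assume ik: "i < N" "k < N" "up i = up k"
    show "\<not> (i < k \<and> k < pt i \<and> pt i < pt k)"
      using nested[OF e_pt(1)[OF ik(1)] e_pt(1)[OF ik(2)]] ik e_pt(2) by (auto simp: up_def N_def)
  qed
  \<comment> \<open>The single cycle applies \<phi> and then moves along the white edge if the
    square is in T, along the black one otherwise; \<open>dd\<close> undoes exactly this last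
    move.\<close>
  have \<phi>_e: "\<phi> (e i) = (fst (e (nx i)), dd (nx i))" if i: "i < N" for i
  proof -
    have nx: "e (nx i) = tw \<beta> T (e i)" using tw_e[folded N_def, OF i] by (simp add: nx_def)
    show ?thesis
    proof (cases "fst (\<phi> (e i)) \<in> T")
      case True
      then have "e (nx i) = flipW (\<phi> (e i))" by (simp add: nx tw_def \<beta>_def flipW_eq)
      then show ?thesis using True
        by (simp add: prod_eq_iff[of "\<phi> (e i)"] dd_def up_def cc_def flip: snd_flip(2))
    next
      case False
      then have "e (nx i) = flipB (\<phi> (e i))" by (simp add: nx tw_def \<beta>_def)
      then show ?thesis using False
        by (simp add: prod_eq_iff[of "\<phi> (e i)"] dd_def up_def cc_def flip: snd_flip(1))
    qed
  qed
  \<comment> \<open>Either positive vertex would do: the two are the ends of one chord and give the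
    same crossing.\<close>
  define \<kappa> where "\<kappa> s = cross (ix (s, (0, 1)))" for s
  have \<kappa>_e: "\<kappa> (fst (e k)) = cross k" if k: "k < N" for k
  proof -
    have V: "(fst (e k), (0, 1)) \<in> V_pos S" using eV[OF k] by (simp add: V_pos_iff)
    then have "(fst (e k), (0, 1)) = e k \<or> (fst (e k), (0, 1)) = opposite (e k)"
      using sq_eq_iff[OF eV[OF k] V] by simp
    then have "ix (fst (e k), (0, 1)) = k \<or> ix (fst (e k), (0, 1)) = pt k"
      using e_ix[OF V] e_inj k e_pt[OF k] by metis
    then show ?thesis using cross_pt[OF k] unfolding \<kappa>_def by auto
  qed
  have S_e: "\<exists>k<N. s = fst (e k)" if "s \<in> S" for s
  proof -
    have V: "(s, (0, 1)) \<in> V_pos S" using that by (simp add: V_pos_iff)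
    then show ?thesis using e_ix[OF V] by (metis fst_conv)
  qed
  have fst_e: "fst (e k) \<in> S" if "k < N" for k using eV[OF that] by (simp add: V_pos_iff)
  have \<kappa>: "bij_betw \<kappa> S (crossings \<Gamma>)"
    unfolding bij_betw_def
  proof
    show "inj_on \<kappa> S"
    proof (rule inj_onI)
      fix s s' assume s: "s \<in> S" "s' \<in> S" "\<kappa> s = \<kappa> s'"
      obtain k k' where k: "k < N" "s = fst (e k)" "k' < N" "s' = fst (e k')" using S_e s(1,2) by blast
      then have "k' = k \<or> k' = pt k" using s(3) \<kappa>_e cross_eq_iff by auto
      then show "s = s'" using k e_pt(1)[OF k(1)] by auto
    qed
    show "\<kappa> ` S = crossings \<Gamma>"
    proof
      show "\<kappa> ` S \<subseteq> crossings \<Gamma>"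
      proof
        fix x assume "x \<in> \<kappa> ` S"
        then obtain k where "k < N" "x = \<kappa> (fst (e k))" using S_e by blast
        then show "x \<in> crossings \<Gamma>" using \<kappa>_e by simp
      qed
      show "crossings \<Gamma> \<subseteq> \<kappa> ` S"
      proof
        fix x assume "x \<in> crossings \<Gamma>"
        then obtain k where "k < N" "x = cross k" by auto
        then show "x \<in> \<kappa> ` S" using \<kappa>_e fst_e by (metis imageI)
      qed
    qed
  qed
  let ?\<rho> = "map_prod (map_half \<kappa>) (id :: space \<Rightarrow> space)"
  have PhiB: "fst (Phi S \<phi> (edgeB (e i))) = fst (e (nx i))"
    "edge_point (Phi S \<phi> (edgeB (e i))) r = (1 - r) *\<^sub>R dd (nx i) + r *\<^sub>R fB (dd (nx i))"
    and PhiW: "fst (Phi S \<phi> (edgeW (e i))) = fst (e (nx i))"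
    "edge_point (Phi S \<phi> (edgeW (e i))) r = (1 - r) *\<^sub>R dd (nx i) + r *\<^sub>R fW (dd (nx i))"
    if i: "i < N" for i r
  proof -
    have inv: "fB (fB p) = p" "fW (fW p) = p" for p by (cases p; simp)+
    show "fst (Phi S \<phi> (edgeB (e i))) = fst (e (nx i))" "fst (Phi S \<phi> (edgeW (e i))) = fst (e (nx i))"
      "edge_point (Phi S \<phi> (edgeB (e i))) r = (1 - r) *\<^sub>R dd (nx i) + r *\<^sub>R fB (dd (nx i))"
      "edge_point (Phi S \<phi> (edgeW (e i))) r = (1 - r) *\<^sub>R dd (nx i) + r *\<^sub>R fW (dd (nx i))"
      unfolding Phi_edgeB[OF eV[OF i]] Phi_edgeW[OF eV[OF i]] edge_point_flip \<beta>_def \<omega>_def \<phi>_e[OF i]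
      by (simp_all add: snd_flip inv del: flipB.simps flipW.simps)
  qed
  have E_cases: "\<exists>i<N. f = edgeB (e i) \<or> f = edgeW (e i)" if "f \<in> E_all S" for f
  proof -
    obtain v where "v \<in> V_pos S" "f = edgeB v \<or> f = edgeW v" by (rule E_all_cases[OF \<open>f \<in> E_all S\<close>]) blast+
    then show ?thesis using e_ix by metis
  qed
  have "complex_iso (C3 S \<phi>) (Aitchison \<Gamma>)"
  proof (rule complex_iso_relabel[OF \<kappa> cells_C3 cube_C3 cells_Aitchison cube_Aitchison])
    fix p q assume "(p, q) \<in> glue (C3 S \<phi>)"
    then show "(?\<rho> p, ?\<rho> q) \<in> glue (Aitchison \<Gamma>) \<union> (glue (Aitchison \<Gamma>))\<inverse>"
    proof (cases rule: C3_glueE)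
      case (base s x)
      then have "\<kappa> s \<in> crossings \<Gamma>" using bij_betwE[OF \<kappa>] by blast
      then show ?thesis using base by (cases x) (simp add: Aitchison_def base_glue_def)
    next
      case (side f r t)
      obtain i where i: "i < N" "f = edgeB (e i) \<or> f = edgeW (e i)" using E_cases side(1) by blast
      \<comment> \<open>\<open>edge_point\<close> gives weight \<open>1 - r\<close> to the initial
        vertex, which is the first vertex of the side of the upper face; t is the height in the
        lower cube, so the upper one is \<open>- t\<close>.\<close>
      have rt: "0 \<le> - t" "- t \<le> 1" "0 \<le> 1 - r" "1 - r \<le> 1" using side(2,3) by auto
      have "(?\<rho> q, ?\<rho> p) \<in> aitchison_glue \<Gamma>"
        using i(2)
      proof
        assume f: "f = edgeB (e i)"
        show ?thesis
          using aitchison_glueI[OF edge_glued_sides(1)[OF i(1)] rt]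
          unfolding side(4,5) f PhiB[OF i(1)] edge_point_flip
          by (simp add: \<kappa>_e[OF i(1)] \<kappa>_e[OF nx_less] cc_def)
      next
        assume f: "f = edgeW (e i)"
        show ?thesis
          using aitchison_glueI[OF edge_glued_sides(2)[OF i(1)] rt]
          unfolding side(4,5) f PhiW[OF i(1)] edge_point_flip
          by (simp add: \<kappa>_e[OF i(1)] \<kappa>_e[OF nx_less] cc_def)
      qed
      then show ?thesis by (simp add: Aitchison_def)
    qed
  next
    fix u v assume "(u, v) \<in> glue (Aitchison \<Gamma>)"
    then show "\<exists>p q. u = ?\<rho> p \<and> v = ?\<rho> q \<and> fst p \<in> half_cells S \<and> fst q \<in> half_cells S \<and>
      (p, q) \<in> glue (C3 S \<phi>) \<union> (glue (C3 S \<phi>))\<inverse>"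
    proof (cases rule: Aitchison_glueE)
      case (base x y)
      then obtain s where "s \<in> S" "x = \<kappa> s" using \<kappa> unfolding bij_betw_def by blast
      then show ?thesis using base
        by (intro exI[of _ "(Upper s, (y, 0))"] exI[of _ "(Lower s, (y, 0))"]; cases y)
          (auto simp: C3_def base_glue_def half_cells_def)
    next
      case (side j a b k a' b' b0 t)
      obtain i where i: "i < N" "j = cross (nx i)" "a = dd (nx i)" "k = cross i" "a' = cc i"
        "b = fB a \<and> b' = fB a' \<or> b = fW a \<and> b' = fW a'" using glued_sides_edge[OF side(1)] .
      have rt: "1 - b0 \<in> {0..1}" "- t \<in> {-1..0}" using side(2-5) by auto
      have "\<exists>f\<in>E_all S. fst f = fst (e i) \<and> fst (Phi S \<phi> f) = fst (e (nx i)) \<and>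
         edge_point f (1 - b0) = b0 *\<^sub>R b' + (1 - b0) *\<^sub>R a' \<and>
         edge_point (Phi S \<phi> f) (1 - b0) = b0 *\<^sub>R a + (1 - b0) *\<^sub>R b"
        using i(6)
      proof
        assume "b = fB a \<and> b' = fB a'"
        then show ?thesis
          using PhiB[OF i(1)] edge_in_E_all(1)[OF eV[OF i(1)]] i(3,5)
          by (intro bexI[of _ "edgeB (e i)"]) (simp_all add: edge_point_flip cc_def)
      next
        assume "b = fW a \<and> b' = fW a'"
        then show ?thesis
          using PhiW[OF i(1)] edge_in_E_all(2)[OF eV[OF i(1)]] i(3,5)
          by (intro bexI[of _ "edgeW (e i)"]) (simp_all add: edge_point_flip cc_def)
      qed
      then obtain f where f: "f \<in> E_all S" "fst f = fst (e i)" "fst (Phi S \<phi> f) = fst (e (nx i))"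
         "edge_point f (1 - b0) = b0 *\<^sub>R b' + (1 - b0) *\<^sub>R a'"
         "edge_point (Phi S \<phi> f) (1 - b0) = b0 *\<^sub>R a + (1 - b0) *\<^sub>R b" by blast
      have "((Lower (fst (e i)), (b0 *\<^sub>R b' + (1 - b0) *\<^sub>R a', - t)),
         (Upper (fst (e (nx i))), (b0 *\<^sub>R a + (1 - b0) *\<^sub>R b, t))) \<in> glue (C3 S \<phi>)"
        using C3_glueI[OF f(1) rt, of \<phi>] unfolding f(2-5) by simp
      moreover have "u = ?\<rho> (Upper (fst (e (nx i))), (b0 *\<^sub>R a + (1 - b0) *\<^sub>R b, t))"
        "v = ?\<rho> (Lower (fst (e i)), (b0 *\<^sub>R b' + (1 - b0) *\<^sub>R a', - t))"
        using side(6,7) i(2,4) \<kappa>_e[OF i(1)] \<kappa>_e[OF nx_less] by simp_all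
      moreover have "Upper (fst (e (nx i))) \<in> half_cells S" "Lower (fst (e i)) \<in> half_cells S"
        using fst_e[OF i(1)] fst_e[OF nx_less] by (simp_all add: half_cells_def)
      ultimately show ?thesis by (metis (no_types, lifting) UnI2 converseI fst_conv)
    qed
  qed
  then show ?thesis using link_diagram connected_diagram alternating by blast
qed

end

theorem theorem4p1:
  fixes S :: "'a set" and \<phi> :: "'a \<times> plane \<Rightarrow> 'a \<times> plane"
  assumes "finite S"
    and "bij_betw \<phi> (V_pos S) (V_neg S)"
  shows "(\<exists>\<Gamma>. link_diagram \<Gamma> \<and> connected_diagram \<Gamma> \<and> alternating \<Gamma> \<and>
            complex_iso (C3 S \<phi>) (Aitchison \<Gamma>)) \<longleftrightarrow>
         complex_connected (C3 S \<phi>) \<and> card (edge_orbits S \<phi>) = card S + 2"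
proof -
  interpret sbw S \<phi> using assms by unfold_locales
  show ?thesis using forward backward by blast
qed

end
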